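(* Let $1<\alpha<2$ and $T>0$, and assume that $T\notin\Lambda$. For any $u_T,v_T\in H_1$, there exist $u_0,u_1\in H$ such that the solution $u$ to $$\mathrm{i}^\alpha\partial_t^\alpha u(t)+Au(t)=0,\quad t\in(0,T),\qquad u(0)=u_0,\quad\partial_tu(0)=u_1, \tag{P}$$ satisfies $$u(T)=u_T,\qquad\partial_tu(T)=v_T.$$ Moreover, there exists a constant $C>0$ such that $$\|u(0)\|+\|\partial_tu(0)\|\le C\left(\|u(T)\|_1+\|\partial_tu(T)\|_1\right)$$ for all $u_T,v_T\in H_1$.
   Context: $(H,\langle\cdot,\cdot\rangle)$ is a complex Hilbert space with norm $\|\cdot\|$; $A:D(A)\subset H\to H$ is a negative-definite self-adjoint operator with compact resolvent. The eigenvalues of $-A$ are $0<\lambda_1\le\lambda_2\le\cdots\to\infty$, with a corresponding orthonormal (Hilbert) basis of eigenvectors $\{\varphi_n\}_{n\ge1}\subset D(A)$. For $s\ge0$, $H_s=\{u\in H:\sum_n\lambda_n^{2s}|\langle u,\varphi_n\rangle|^2<\infty\}$ with $\|u\|_s^2=\sum_n\lambda_n^{2s}|\langle u,\varphi_n\rangle|^2$; $H_{-s}=H_s'$ is its dual (identifying $H=H'$) with norm $\|u\|_{-s}^2=\sum_n\lambda_n^{-2s}|\langle u,\varphi_n\rangle_{-s,s}|^2$. Powers: $\mathrm{i}^{\alpha}=e^{\mathrm{i}\pi\alpha/2}$, $\mathrm{i}^{-\alpha}=e^{-\mathrm{i}\pi\alpha/2}$. Mittag-Leffler function: $E_{\alpha,\beta}(z)=\sum_{k\ge0}z^k/\Gamma(\alpha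 k+\beta)$. Define $\psi(t)=E_{\alpha,1}(\mathrm{i}^{-\alpha}t)^2-\mathrm{i}^{-\alpha}t\,E_{\alpha,2}(\mathrm{i}^{-\alpha}t)E_{\alpha,\alpha}(\mathrm{i}^{-\alpha}t)$ for $t>0$. Its set of zeros in $(0,\infty)$ is finite (possibly empty); denote it $\{t_1<\dots<t_N\}$, $N\in\mathbb{N}\cup\{0\}$, and set $\Lambda:=\bigcup_{n=1}^\infty\{(t_1/\lambda_n)^{1/\alpha},\dots,(t_N/\lambda_n)^{1/\alpha}\}$. Thus $T\in\Lambda$ if and only if $\psi(\lambda_nT^\alpha)=0$ for some $n$. Caputo derivative for $1<\alpha<2$: $\partial_t^\alpha u(t)=\frac{1}{\Gamma(2-\alpha)}\int_0^t(t-s)^{1-\alpha}\partial_s^2u(s)\,\mathrm{d}s$. For $u(t)=\sum_nu_n(t)\varphi_n$, $\partial_tu$ and $\partial_t^\alpha u$ are understood coefficientwise, the $u_n$ being $C^1$ on $[0,T]$ with $u_n'$ absolutely continuous. (Weak) solution of (P) for $u_0\in H$, $u_1\in H_{-1/\alpha}$: a function $u$ such that (1) $u\in C([0,T];H)$; (2) $\partial_t^\alpha u(t),Au(t)\in H_{-2/\alpha}$ for almost all $t\in(0,T)$ and the equation holds in $H_{-2/\alpha}$ for almost all $t$; (3) $\lim_{t\to0^+}\|u(t)-u_0\|=0$ and $\lim_{t\to0^+}\|\partial_tu(t)-u_1\|_{-1/\alpha}=0$. It is unique and given by $u(t)=\sum_n\langle u_0,\varphi_n\rangle E_{\alpha,1}(\mathrm{i}^{-\alpha}\lambda_nt^\alpha)\varphi_n+\sum_n\langle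 u_1,\varphi_n\rangle tE_{\alpha,2}(\mathrm{i}^{-\alpha}\lambda_nt^\alpha)\varphi_n$, with $\partial_tu(t)=\sum_n\mathrm{i}^{-\alpha}\lambda_nt^{\alpha-1}\langle u_0,\varphi_n\rangle E_{\alpha,\alpha}(\mathrm{i}^{-\alpha}\lambda_nt^\alpha)\varphi_n+\sum_n\langle u_1,\varphi_n\rangle E_{\alpha,1}(\mathrm{i}^{-\alpha}\lambda_nt^\alpha)\varphi_n$. *)

theory Defs
  imports "HOL-Analysis.Analysis"
begin

section \<open>Complex Hilbert spaces\<close>

text \<open>
  The real structure (addition, real scalars, norm, completeness) is that of the library class
  \<open>banach\<close>. The inner product is linear in its first argument.
\<close>

class complex_hilbert = banach +
  fixes scaleC :: "complex \<Rightarrow> 'a \<Rightarrow> 'a" (infixr "*\<^sub>C" 75)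
    and cinner :: "'a \<Rightarrow> 'a \<Rightarrow> complex"
  assumes scaleC_add_right: "c *\<^sub>C (x + y) = c *\<^sub>C x + c *\<^sub>C y"
    and scaleC_add_left: "(c + d) *\<^sub>C x = c *\<^sub>C x + d *\<^sub>C x"
    and scaleC_scaleC: "c *\<^sub>C (d *\<^sub>C x) = (c * d) *\<^sub>C x"
    and scaleC_of_real: "complex_of_real r *\<^sub>C x = r *\<^sub>R x"
    and cinner_commute: "cinner x y = cnj (cinner y x)"
    and cinner_add_left: "cinner (x + y) z = cinner x z + cinner y z"
    and cinner_scaleC_left: "cinner (c *\<^sub>C x) y = c * cinner x y"
    and cinner_self_nonneg: "0 \<le> Re (cinner x x)"
    and norm_eq_sqrt_cinner: "norm x = sqrt (Re (cinner x x))"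

definition csubspace :: "'h::complex_hilbert set \<Rightarrow> bool" where
  "csubspace S \<longleftrightarrow>
     0 \<in> S \<and> (\<forall>x\<in>S. \<forall>y\<in>S. x + y \<in> S) \<and> (\<forall>c. \<forall>x\<in>S. c *\<^sub>C x \<in> S)"


section \<open>Unbounded operators\<close>

text \<open>
  An operator in a Hilbert space is a pair of a domain \<open>D\<close> and a total function \<open>A\<close>; the values
  of \<open>A\<close> outside \<open>D\<close> are irrelevant.
\<close>

definition linear_operator :: "'h::complex_hilbert set \<Rightarrow> ('h \<Rightarrow> 'h) \<Rightarrow> bool" where
  "linear_operator D A \<longleftrightarrow>
     csubspace D \<and>
     (\<forall>x\<in>D. \<forall>y\<in>D. A (x + y) = A x + A y) \<and>
     (\<forall>c. \<forall>x\<in>D. A (c *\<^sub>C x) = c *\<^sub>C A x)"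

text \<open>The last conjunct says that the graph of the adjoint of \<open>A\<close> is the graph of \<open>A\<close>.\<close>

definition self_adjoint :: "'h::complex_hilbert set \<Rightarrow> ('h \<Rightarrow> 'h) \<Rightarrow> bool" where
  "self_adjoint D A \<longleftrightarrow>
     linear_operator D A \<and> closure D = UNIV \<and>
     (\<forall>v w. (\<forall>u\<in>D. cinner (A u) v = cinner u w) \<longleftrightarrow> v \<in> D \<and> w = A v)"

definition negative_definite :: "'h::complex_hilbert set \<Rightarrow> ('h \<Rightarrow> 'h) \<Rightarrow> bool" where
  "negative_definite D A \<longleftrightarrow>
     (\<forall>u\<in>D. u \<noteq> 0 \<longrightarrow> cinner (A u) u \<in> \<real> \<and> Re (cinner (A u) u) < 0)"

text \<open>\<open>R\<close> is the resolvent \<open>(\<mu> - A)\<close>-inverse, a bounded everywhere defined operator.\<close>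

definition is_resolvent ::
  "'h::complex_hilbert set \<Rightarrow> ('h \<Rightarrow> 'h) \<Rightarrow> complex \<Rightarrow> ('h \<Rightarrow> 'h) \<Rightarrow> bool" where
  "is_resolvent D A \<mu> R \<longleftrightarrow>
     bounded_linear R \<and>
     (\<forall>x. R x \<in> D \<and> \<mu> *\<^sub>C R x - A (R x) = x) \<and>
     (\<forall>u\<in>D. R (\<mu> *\<^sub>C u - A u) = u)"

definition compact_resolvent :: "'h::complex_hilbert set \<Rightarrow> ('h \<Rightarrow> 'h) \<Rightarrow> bool" where
  "compact_resolvent D A \<longleftrightarrow>
     (\<exists>\<mu> R. is_resolvent D A \<mu> R \<and> compact (closure (R ` ball 0 1)))"

text \<open>
  The eigenvalues of \<open>-A\<close>, counted with multiplicity, and an orthonormal Hilbert basis of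
  eigenvectors. Indices start at \<open>0\<close>, so that \<open>lam n\<close> is the usual \<open>\<lambda>\<close> with index \<open>n + 1\<close>.
\<close>

definition eigenbasis ::
  "'h::complex_hilbert set \<Rightarrow> ('h \<Rightarrow> 'h) \<Rightarrow> (nat \<Rightarrow> real) \<Rightarrow> (nat \<Rightarrow> 'h) \<Rightarrow> bool" where
  "eigenbasis D A lam phi \<longleftrightarrow>
     (\<forall>n. 0 < lam n) \<and> mono lam \<and> filterlim lam at_top sequentially \<and>
     (\<forall>n. phi n \<in> D \<and> - A (phi n) = lam n *\<^sub>R phi n) \<and>
     (\<forall>m n. cinner (phi m) (phi n) = (if m = n then 1 else 0)) \<and>
     closure (csubspace hull range phi) = UNIV"


section \<open>The scale of spaces\<close>

definition Hs :: "(nat \<Rightarrow> real) \<Rightarrow> (nat \<Rightarrow> 'h::complex_hilbert) \<Rightarrow> real \<Rightarrow> 'h set" where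
  "Hs lam phi s = {u. summable (\<lambda>n. lam n powr (2 * s) * (cmod (cinner u (phi n)))\<^sup>2)}"

definition Hs_norm :: "(nat \<Rightarrow> real) \<Rightarrow> (nat \<Rightarrow> 'h::complex_hilbert) \<Rightarrow> real \<Rightarrow> 'h \<Rightarrow> real" where
  "Hs_norm lam phi s u = sqrt (\<Sum>n. lam n powr (2 * s) * (cmod (cinner u (phi n)))\<^sup>2)"

text \<open>
  For \<open>s \<ge> 0\<close>, \<open>Hs_dual lam phi s\<close> is the dual of \<open>Hs lam phi s\<close>, i.e. the space of order \<open>-s\<close>.
  Its elements are the bounded conjugate-linear functionals, so that the identification of \<open>u\<close>
  in the Hilbert space with the functional \<open>cinner u\<close> is linear and the duality pairing extends
  the inner product. Functionals are set to \<open>0\<close> outside \<open>Hs lam phi s\<close>, so that two elements of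
  the dual are equal iff they are equal as HOL functions.
\<close>

definition Hs_dual ::
  "(nat \<Rightarrow> real) \<Rightarrow> (nat \<Rightarrow> 'h::complex_hilbert) \<Rightarrow> real \<Rightarrow> ('h \<Rightarrow> complex) set" where
  "Hs_dual lam phi s =
     {f. (\<forall>v\<in>Hs lam phi s. \<forall>w\<in>Hs lam phi s. f (v + w) = f v + f w) \<and>
         (\<forall>c. \<forall>v\<in>Hs lam phi s. f (c *\<^sub>C v) = cnj c * f v) \<and>
         (\<exists>C. \<forall>v\<in>Hs lam phi s. cmod (f v) \<le> C * Hs_norm lam phi s v) \<and>
         (\<forall>v. v \<notin> Hs lam phi s \<longrightarrow> f v = 0)}"

definition Hs_dual_norm ::
  "(nat \<Rightarrow> real) \<Rightarrow> (nat \<Rightarrow> 'h::complex_hilbert) \<Rightarrow> real \<Rightarrow> ('h \<Rightarrow> complex) \<Rightarrow> real" where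
  "Hs_dual_norm lam phi s f = sqrt (\<Sum>n. lam n powr (- 2 * s) * (cmod (f (phi n)))\<^sup>2)"

definition dual_embed ::
  "(nat \<Rightarrow> real) \<Rightarrow> (nat \<Rightarrow> 'h::complex_hilbert) \<Rightarrow> real \<Rightarrow> 'h \<Rightarrow> 'h \<Rightarrow> complex" where
  "dual_embed lam phi s u = (\<lambda>v. if v \<in> Hs lam phi s then cinner u v else 0)"

text \<open>The functional given by the formal series of the \<open>c n *\<^sub>C phi n\<close>.\<close>

definition dual_series ::
  "(nat \<Rightarrow> real) \<Rightarrow> (nat \<Rightarrow> 'h::complex_hilbert) \<Rightarrow> real \<Rightarrow> (nat \<Rightarrow> complex) \<Rightarrow> 'h \<Rightarrow> complex" where
  "dual_series lam phi s c =
     (\<lambda>v. if v \<in> Hs lam phi s then (\<Sum>n. c n * cinner (phi n) v) else 0)"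

text \<open>
  \<open>A u\<close> for \<open>u\<close> not necessarily in the domain of \<open>A\<close>, as an element of the dual of
  \<open>Hs lam phi s\<close>, for \<open>s \<ge> 1\<close>: then \<open>Hs lam phi s\<close> is contained in \<open>Hs lam phi 1\<close>, which is the
  domain of \<open>A\<close>, and \<open>A\<close> is extended by transposition.
\<close>

definition A_ext ::
  "('h \<Rightarrow> 'h) \<Rightarrow> (nat \<Rightarrow> real) \<Rightarrow> (nat \<Rightarrow> 'h::complex_hilbert) \<Rightarrow> real \<Rightarrow> 'h \<Rightarrow> 'h \<Rightarrow> complex" where
  "A_ext A lam phi s u = (\<lambda>v. if v \<in> Hs lam phi s then cinner u (A v) else 0)"


section \<open>Mittag-Leffler functions and the exceptional set\<close>

text \<open>\<open>i_pow a\<close> is the principal power of the imaginary unit with real exponent \<open>a\<close>.\<close>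

definition i_pow :: "real \<Rightarrow> complex" where
  "i_pow a = exp (\<i> * of_real (pi * a / 2))"

definition mittag_leffler :: "real \<Rightarrow> real \<Rightarrow> complex \<Rightarrow> complex" where
  "mittag_leffler \<alpha> \<beta> z = (\<Sum>k. z ^ k / of_real (Gamma (\<alpha> * real k + \<beta>)))"

definition psi :: "real \<Rightarrow> real \<Rightarrow> complex" where
  "psi \<alpha> t =
     (mittag_leffler \<alpha> 1 (i_pow (- \<alpha>) * of_real t))\<^sup>2
     - i_pow (- \<alpha>) * of_real t * mittag_leffler \<alpha> 2 (i_pow (- \<alpha>) * of_real t)
         * mittag_leffler \<alpha> \<alpha> (i_pow (- \<alpha>) * of_real t)"

definition Lambda_set :: "(nat \<Rightarrow> real) \<Rightarrow> real \<Rightarrow> real set" where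
  "Lambda_set lam \<alpha> = (\<Union>n. (\<lambda>t. (t / lam n) powr (1 / \<alpha>)) ` {t. 0 < t \<and> psi \<alpha> t = 0})"


section \<open>Time derivatives\<close>

definition abs_continuous_on :: "real \<Rightarrow> real \<Rightarrow> (real \<Rightarrow> complex) \<Rightarrow> bool" where
  "abs_continuous_on a b f \<longleftrightarrow>
     (\<forall>\<epsilon>>0. \<exists>\<delta>>0. \<forall>(n::nat) x y.
        (\<forall>i<n. a \<le> x i \<and> x i \<le> y i \<and> y i \<le> b) \<and>
        disjoint_family_on (\<lambda>i. {x i<..<y i}) {..<n} \<and>
        (\<Sum>i<n. y i - x i) < \<delta>
        \<longrightarrow> (\<Sum>i<n. cmod (f (y i) - f (x i))) < \<epsilon>)"

text \<open>Derivatives are taken within \<open>[0,T]\<close>, hence one-sided at the endpoints.\<close>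

definition tderiv :: "real \<Rightarrow> (real \<Rightarrow> complex) \<Rightarrow> real \<Rightarrow> complex" where
  "tderiv T f t = vector_derivative f (at t within {0..T})"

text \<open>
  The second derivative of a function with absolutely continuous first derivative is defined only
  almost everywhere; the integral is over the completed Lebesgue measure and does not depend on
  the values elsewhere.
\<close>

definition caputo :: "real \<Rightarrow> real \<Rightarrow> (real \<Rightarrow> complex) \<Rightarrow> real \<Rightarrow> complex" where
  "caputo T \<alpha> f t =
     of_real (1 / Gamma (2 - \<alpha>)) *
     set_lebesgue_integral lebesgue {0..t}
       (\<lambda>s. ((t - s) powr (1 - \<alpha>)) *\<^sub>R tderiv T (tderiv T f) s)"

text \<open>
  Coefficientwise time derivatives of a curve \<open>u\<close>, as (candidate) elements of the dual of
  \<open>Hs lam phi s\<close>.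
\<close>

definition dt ::
  "(nat \<Rightarrow> real) \<Rightarrow> (nat \<Rightarrow> 'h::complex_hilbert) \<Rightarrow> real \<Rightarrow> real \<Rightarrow> (real \<Rightarrow> 'h) \<Rightarrow> real \<Rightarrow> 'h \<Rightarrow> complex"
  where
  "dt lam phi s T u t = dual_series lam phi s (\<lambda>n. tderiv T (\<lambda>r. cinner (u r) (phi n)) t)"

definition dt_caputo ::
  "(nat \<Rightarrow> real) \<Rightarrow> (nat \<Rightarrow> 'h::complex_hilbert) \<Rightarrow> real \<Rightarrow> real \<Rightarrow> real \<Rightarrow> (real \<Rightarrow> 'h) \<Rightarrow> real \<Rightarrow> 'h \<Rightarrow> complex"
  where
  "dt_caputo lam phi s T \<alpha> u t =
     dual_series lam phi s (\<lambda>n. caputo T \<alpha> (\<lambda>r. cinner (u r) (phi n)) t)"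

definition regular_coeff :: "real \<Rightarrow> (real \<Rightarrow> complex) \<Rightarrow> bool" where
  "regular_coeff T f \<longleftrightarrow>
     f differentiable_on {0..T} \<and> continuous_on {0..T} (tderiv T f) \<and>
     abs_continuous_on 0 T (tderiv T f)"


section \<open>Weak solutions of (P)\<close>

text \<open>Here \<open>u0\<close> is a vector and \<open>u1\<close> an element of the dual of the space of order \<open>1/\<alpha>\<close>.\<close>

definition weak_solution ::
  "('h \<Rightarrow> 'h) \<Rightarrow> (nat \<Rightarrow> real) \<Rightarrow> (nat \<Rightarrow> 'h::complex_hilbert) \<Rightarrow> real \<Rightarrow> real \<Rightarrow>
     'h \<Rightarrow> ('h \<Rightarrow> complex) \<Rightarrow> (real \<Rightarrow> 'h) \<Rightarrow> bool" where
  "weak_solution A lam phi \<alpha> T u0 u1 u \<longleftrightarrow>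
     u1 \<in> Hs_dual lam phi (1 / \<alpha>) \<and>
     (\<forall>n. regular_coeff T (\<lambda>t. cinner (u t) (phi n))) \<and>
     continuous_on {0..T} u \<and>
     (AE t in lebesgue. t \<in> {0<..<T} \<longrightarrow>
        dt_caputo lam phi (2 / \<alpha>) T \<alpha> u t \<in> Hs_dual lam phi (2 / \<alpha>) \<and>
        A_ext A lam phi (2 / \<alpha>) (u t) \<in> Hs_dual lam phi (2 / \<alpha>) \<and>
        (\<forall>v\<in>Hs lam phi (2 / \<alpha>).
           i_pow \<alpha> * dt_caputo lam phi (2 / \<alpha>) T \<alpha> u t v
             + A_ext A lam phi (2 / \<alpha>) (u t) v = 0)) \<and>
     ((\<lambda>t. norm (u t - u0)) \<longlongrightarrow> 0) (at_right 0) \<and>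
     (\<forall>\<^sub>F t in at_right 0. dt lam phi (1 / \<alpha>) T u t \<in> Hs_dual lam phi (1 / \<alpha>)) \<and>
     ((\<lambda>t. Hs_dual_norm lam phi (1 / \<alpha>) (\<lambda>v. dt lam phi (1 / \<alpha>) T u t v - u1 v)) \<longlongrightarrow> 0)
       (at_right 0)"

end

theory Submission
  imports Defs "HOL-Complex_Analysis.Complex_Analysis"
begin

text \<open>
  Expanding in eigenvectors decouples the problem. The coefficients of a weak solution solve a
  scalar Caputo equation; convolving it with the conjugate Abel kernel gives a Volterra equation
  with a unique solution, a combination of the Mittag-Leffler functions \<open>f\<close>, \<open>g\<close> of order
  \<open>1\<close> and \<open>2\<close>. The terminal data then determine the initial data through a two by two linear
  system with determinant \<open>f\<^sup>2 - g * f'\<close>, which is \<open>psi \<alpha> (lam n * T powr \<alpha>)\<close> and does not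
  vanish because \<open>T \<notin> Lambda_set lam \<alpha>\<close>.

  The loss of one power of the operator comes from the behaviour at infinity: in the variable
  \<open>s = lam n powr (1 / \<alpha>) * T\<close> both \<open>g\<close> and \<open>f'\<close> are a multiple of \<open>exp (- \<i> * s)\<close> plus a
  remainder, the leading oscillating terms of the determinant cancel, and the remainder of \<open>g\<close>
  leaves exactly the order \<open>s powr (1 - \<alpha>)\<close>. This expansion is obtained without complex
  inversion of the Laplace transform: the contour integral along two rays is written down, its
  Laplace transform is computed by shifting lines, and uniqueness of the Laplace transform
  identifies it.
\<close>

section \<open>Inner product geometry and expansions in an orthonormal basis\<close>

section \<open>Complex Hilbert spaces\<close>

section \<open>Orthonormal bases of complex Hilbert spaces\<close>

text \<open>The inverse of the two by two system has the entries \<open>ff\<close>,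
  \<open>gg\<close>, \<open>f'\<close> over the determinant. The largest, \<open>f'\<close>, has
  size \<open>kap n = lam n powr (1 / \<alpha>)\<close>, while the determinant is at least a
  multiple of \<open>kap n powr (1 - \<alpha>)\<close>; the quotient has size
  \<open>kap n powr \<alpha> = lam n\<close>, which is the power separating H_1 from H. For large n
  this lower bound needs a nonzero constant: in the scaled variable the leading terms of f, g and f'
  are \<open>exp (- \<i> * s) / \<alpha>\<close> times 1, \<i> and -\<i>, they cancel in the
  determinant, and the coefficient of the next term of g must be shown not to vanish. For the
  finitely many other n a nonzero determinant suffices. The contour integral converges absolutely
  only for second parameter above 1, which covers g and f' but not f; the expansion of f is
  recovered by integration. The claim concerns every weak solution, so uniqueness must come from the
  definition, where the first derivative of a coefficient is merely absolutely continuous; this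
  forces a study of such functions.\<close>

lemma scaleC_zero_left [simp]: "0 *\<^sub>C (x::'a::complex_hilbert) = 0"
  using scaleC_of_real[of 0 x] by simp

lemma cinner_zero_left [simp]: "cinner 0 (x::'a::complex_hilbert) = 0"
  using cinner_scaleC_left[of 0 x x] by simp

lemma cinner_zero_right [simp]: "cinner (x::'a::complex_hilbert) 0 = 0"
  using cinner_commute[of x 0] by simp

lemma cinner_add_right: "cinner (x::'a::complex_hilbert) (y + z) = cinner x y + cinner x z"
  by (metis cinner_commute cinner_add_left complex_cnj_add)

lemma cinner_scaleC_right: "cinner (x::'a::complex_hilbert) (c *\<^sub>C y) = cnj c * cinner x y"
  by (metis cinner_commute cinner_scaleC_left complex_cnj_mult)

lemma cinner_scaleR_left: "cinner (r *\<^sub>R (x::'a::complex_hilbert)) y = r *\<^sub>R cinner x y"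
  by (metis cinner_scaleC_left scaleC_of_real scaleR_conv_of_real)

lemma cinner_scaleR_right: "cinner (x::'a::complex_hilbert) (r *\<^sub>R y) = r *\<^sub>R cinner x y"
  by (metis cinner_scaleC_right scaleC_of_real scaleR_conv_of_real complex_cnj_complex_of_real)

lemma cinner_self: "cinner (x::'a::complex_hilbert) x = of_real ((norm x)\<^sup>2)"
proof -
  have "Im (cinner x x) = 0"
    using arg_cong[OF cinner_commute[of x x], of Im] by simp
  then show ?thesis
    by (simp add: complex_eq_iff norm_eq_sqrt_cinner cinner_self_nonneg)
qed

lemma norm_add_sq:
  "(norm ((x::'a::complex_hilbert) + y))\<^sup>2 = (norm x)\<^sup>2 + (norm y)\<^sup>2 + 2 * Re (cinner x y)"
proof -
  have "of_real ((norm (x + y))\<^sup>2) = cinner (x + y) (x + y)"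
    by (simp add: cinner_self)
  also have "\<dots> = cinner x x + cinner y y + (cinner x y + cnj (cinner x y))"
    by (simp add: cinner_add_left cinner_add_right cinner_commute[of y x])
  finally have "Re (of_real ((norm (x + y))\<^sup>2)) =
      Re (cinner x x + cinner y y + (cinner x y + cnj (cinner x y)))"
    by simp
  then show ?thesis by (simp add: cinner_self)
qed

lemma norm_scaleC: "norm (c *\<^sub>C (x::'a::complex_hilbert)) = cmod c * norm x"
proof -
  have "cinner (c *\<^sub>C x) (c *\<^sub>C x) = c * cnj c * cinner x x"
    by (simp add: cinner_scaleC_left cinner_scaleC_right)
  then have "of_real ((norm (c *\<^sub>C x))\<^sup>2) = (of_real ((cmod c * norm x)\<^sup>2) :: complex)"
    unfolding cinner_self complex_norm_square[symmetric] by (simp add: power_mult_distrib)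
  then have "(norm (c *\<^sub>C x))\<^sup>2 = (cmod c * norm x)\<^sup>2"
    by (simp only: of_real_eq_iff)
  then show ?thesis by (simp add: power2_eq_iff_nonneg)
qed

lemma cinner_Cauchy_Schwarz: "cmod (cinner (x::'a::complex_hilbert) y) \<le> norm x * norm y"
proof (cases "y = 0")
  case False
  let ?c = "cinner x y" and ?n = "norm y"
  \<comment> \<open>The vector is the component of \<open>x\<close> orthogonal to \<open>y\<close>,
    multiplied by the squared norm of \<open>y\<close> so that no division occurs.\<close>
  have "0 \<le> (norm (of_real (?n\<^sup>2) *\<^sub>C x + (- ?c) *\<^sub>C y))\<^sup>2" by simp
  also have "\<dots> = ?n^4 * (norm x)\<^sup>2 + (cmod ?c)\<^sup>2 * ?n\<^sup>2 - 2 * (?n\<^sup>2 * (cmod ?c)\<^sup>2)"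
  proof -
    have "cinner (of_real (?n\<^sup>2) *\<^sub>C x) ((- ?c) *\<^sub>C y) = - of_real (?n\<^sup>2) * (?c * cnj ?c)"
      by (simp add: cinner_scaleC_left cinner_scaleC_right)
    also have "\<dots> = of_real (- (?n\<^sup>2 * (cmod ?c)\<^sup>2))"
      by (simp add: complex_norm_square[symmetric])
    finally have e: "Re (cinner (of_real (?n\<^sup>2) *\<^sub>C x) ((- ?c) *\<^sub>C y)) = - (?n\<^sup>2 * (cmod ?c)\<^sup>2)"
      by (simp only: Re_complex_of_real)
    have n: "(norm (of_real (?n\<^sup>2) *\<^sub>C x))\<^sup>2 = ?n^4 * (norm x)\<^sup>2"
      by (simp add: norm_scaleC power_mult_distrib norm_power del: of_real_power)
    show ?thesis
      unfolding norm_add_sq e n by (simp add: norm_scaleC power_mult_distrib)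
  qed
  also have "\<dots> = ?n\<^sup>2 * ((norm x * ?n)\<^sup>2 - (cmod ?c)\<^sup>2)"
    by (simp add: algebra_simps power_mult_distrib eval_nat_numeral)
  finally have "(cmod ?c)\<^sup>2 \<le> (norm x * ?n)\<^sup>2"
    using False by (simp add: zero_le_mult_iff)
  then show ?thesis by (rule power2_le_imp_le) simp
qed simp

lemma bounded_linear_cinner_left: "bounded_linear (\<lambda>x::'a::complex_hilbert. cinner x y)"
  by (rule bounded_linear_intro[where K="norm y"])
     (auto simp: cinner_add_left cinner_scaleR_left cinner_Cauchy_Schwarz)

lemma bounded_linear_cinner_right: "bounded_linear (\<lambda>y::'a::complex_hilbert. cinner x y)"
  by (rule bounded_linear_intro[where K="norm x"])
     (auto simp: cinner_add_right cinner_scaleR_right mult.commute[of "norm x"]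
        intro: order_trans[OF cinner_Cauchy_Schwarz])

lemma cinner_diff_left: "cinner ((x::'a::complex_hilbert) - y) z = cinner x z - cinner y z"
  by (rule linear_diff[OF bounded_linear.linear[OF bounded_linear_cinner_left]])

lemma cinner_uminus_right: "cinner (z::'a::complex_hilbert) (- x) = - cinner z x"
  by (rule linear_neg[OF bounded_linear.linear[OF bounded_linear_cinner_right]])

lemma csubspace_hull_subset: "range phi \<subseteq> S \<Longrightarrow> csubspace S \<Longrightarrow> csubspace hull range phi \<subseteq> S"
  by (simp add: hull_minimal)

locale hilbert_basis =
  fixes phi :: "nat \<Rightarrow> 'h::complex_hilbert"
  assumes orthonormal: "cinner (phi m) (phi n) = (if m = n then 1 else 0)"
    and total: "closure (csubspace hull range phi) = UNIV"
begin

text \<open>The Riesz-Fischer map from square summable sequences to vectors. On other sequences the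
  infinite sum carries no information, so the facts about it ask for square summability.\<close>

definition synth :: "(nat \<Rightarrow> complex) \<Rightarrow> 'h" where
  "synth c = (\<Sum>n. c n *\<^sub>C phi n)"

lemma cinner_sum_phi:
  assumes "finite F"
  shows "cinner (\<Sum>n\<in>F. c n *\<^sub>C phi n) (phi m) = (if m \<in> F then c m else 0)"
proof -
  have "cinner (\<Sum>n\<in>F. c n *\<^sub>C phi n) (phi m) = (\<Sum>n\<in>F. c n * cinner (phi n) (phi m))"
    by (simp add: linear_sum[OF bounded_linear.linear[OF bounded_linear_cinner_left]]
        cinner_scaleC_left)
  also have "\<dots> = (\<Sum>n\<in>F. if n = m then c m else 0)"
    by (rule sum.cong) (auto simp: orthonormal)
  finally show ?thesis using assms by simp
qed

lemma norm_sum_phi: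
  assumes "finite F"
  shows "(norm (\<Sum>n\<in>F. c n *\<^sub>C phi n))\<^sup>2 = (\<Sum>n\<in>F. (cmod (c n))\<^sup>2)"
  using assms
proof (induction F)
  case (insert m F)
  have "cinner (c m *\<^sub>C phi m) (\<Sum>n\<in>F. c n *\<^sub>C phi n) = 0"
    using cinner_sum_phi[OF insert(1), of c m] insert(2)
    by (simp add: cinner_scaleC_left cinner_commute[of "phi m"])
  moreover have "norm (phi m) = 1"
    using orthonormal[of m m] unfolding cinner_self
    by (simp add: of_real_eq_1_iff[symmetric] del: of_real_power)
       (metis norm_ge_zero of_real_eq_1_iff power2_eq_1_iff neg_0_le_iff_le not_one_le_zero)
  ultimately show ?case
    using insert by (simp add: norm_add_sq norm_scaleC)
qed simp

text \<open>By Pythagoras the squared norm of a block of the vector series is the corresponding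
  block of the scalar series, so the Cauchy criterion passes from one to the other and completeness
  does the rest.\<close>

lemma summable_synth:
  assumes "summable (\<lambda>n. (cmod (c n))\<^sup>2)"
  shows "summable (\<lambda>n. c n *\<^sub>C phi n)"
  unfolding summable_Cauchy
proof (intro allI impI)
  fix e :: real assume "0 < e"
  then have "0 < e\<^sup>2" by simp
  then obtain N where N: "\<And>m n. m \<ge> N \<Longrightarrow> norm (\<Sum>k=m..<n. (cmod (c k))\<^sup>2) < e\<^sup>2"
    using assms unfolding summable_Cauchy by blast
  have "norm (\<Sum>k=m..<n. c k *\<^sub>C phi k) < e" if "m \<ge> N" for m n
  proof -
    have "(norm (\<Sum>k=m..<n. c k *\<^sub>C phi k))\<^sup>2 < e\<^sup>2"
      using N[OF that, of n] by (simp add: norm_sum_phi sum_nonneg)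
    then show ?thesis using \<open>0 < e\<close> by (simp add: power_less_imp_less_base)
  qed
  then show "\<exists>N. \<forall>m\<ge>N. \<forall>n. norm (\<Sum>k=m..<n. c k *\<^sub>C phi k) < e" by blast
qed

lemma cinner_synth:
  assumes "summable (\<lambda>n. (cmod (c n))\<^sup>2)"
  shows "cinner (synth c) (phi m) = c m"
proof -
  have "(\<lambda>n. cinner (c n *\<^sub>C phi n) (phi m)) sums cinner (synth c) (phi m)"
    unfolding synth_def
    by (rule bounded_linear.sums[OF bounded_linear_cinner_left])
       (rule summable_sums[OF summable_synth[OF assms]])
  moreover have "(\<lambda>n. cinner (c n *\<^sub>C phi n) (phi m)) = (\<lambda>n. if n = m then c m else 0)"
    by (auto simp: cinner_scaleC_left orthonormal)
  ultimately show ?thesis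
    using sums_single[of m "\<lambda>_. c m"] sums_unique2 by fastforce
qed

lemma norm_synth:
  assumes "summable (\<lambda>n. (cmod (c n))\<^sup>2)"
  shows "(norm (synth c))\<^sup>2 = (\<Sum>n. (cmod (c n))\<^sup>2)"
proof -
  have "(\<lambda>N. (norm (\<Sum>n<N. c n *\<^sub>C phi n))\<^sup>2) \<longlonglongrightarrow> (norm (synth c))\<^sup>2"
    unfolding synth_def
    by (intro tendsto_intros summable_LIMSEQ summable_synth assms)
  then have "(\<lambda>n. (cmod (c n))\<^sup>2) sums ((norm (synth c))\<^sup>2)"
    by (simp add: norm_sum_phi sums_def)
  then show ?thesis by (simp add: sums_iff)
qed

text \<open>The squared distance from \<open>x\<close> to its partial expansion \<open>?p\<close> is
  nonnegative and equals the squared norm of \<open>x\<close> minus the partial sum.\<close>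

lemma bessel: "summable (\<lambda>n. (cmod (cinner x (phi n)))\<^sup>2)"
proof (rule summableI_nonneg_bounded[where x="(norm x)\<^sup>2"])
  fix N
  let ?p = "\<Sum>n<N. cinner x (phi n) *\<^sub>C phi n"
  have "cinner ?p x = (\<Sum>n<N. cinner x (phi n) * cnj (cinner x (phi n)))"
    by (simp add: linear_sum[OF bounded_linear.linear[OF bounded_linear_cinner_left]]
        cinner_scaleC_left cinner_commute[of "phi _" x])
  also have "\<dots> = of_real (\<Sum>n<N. (cmod (cinner x (phi n)))\<^sup>2)"
    by (simp add: complex_norm_square[symmetric])
  finally have c: "Re (cinner x ?p) = (\<Sum>n<N. (cmod (cinner x (phi n)))\<^sup>2)"
    by (subst cinner_commute) simp
  have "0 \<le> (norm (x + - ?p))\<^sup>2" by simp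
  also have "\<dots> = (norm x)\<^sup>2 - (\<Sum>n<N. (cmod (cinner x (phi n)))\<^sup>2)"
    by (subst norm_add_sq) (simp add: norm_sum_phi c cinner_uminus_right)
  finally show "(\<Sum>n<N. (cmod (cinner x (phi n)))\<^sup>2) \<le> (norm x)\<^sup>2" by simp
qed simp

text \<open>The vectors orthogonal to \<open>x\<close> form a closed complex subspace containing
  every \<open>phi n\<close>; by totality it is the whole space, so \<open>x\<close> is orthogonal
  to itself.\<close>

lemma orthogonal_eq_0:
  assumes "\<And>n. cinner (x::'h) (phi n) = 0"
  shows "x = 0"
proof -
  let ?S = "{y. cinner y x = 0}"
  have "csubspace ?S"
    by (auto simp: csubspace_def cinner_add_left cinner_scaleC_left)
  moreover have "range phi \<subseteq> ?S"
    using assms by (auto simp: cinner_commute[of "phi _" x])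
  moreover have "closed ?S"
    by (intro closed_Collect_eq continuous_intros
          linear_continuous_on bounded_linear_cinner_left)
  ultimately have "closure (csubspace hull range phi) \<subseteq> ?S"
    by (intro closure_minimal csubspace_hull_subset)
  then have "cinner x x = 0" using total by auto
  then show ?thesis by (simp add: cinner_self)
qed

lemma coeff_eqI:
  assumes "\<And>n. cinner (x::'h) (phi n) = cinner y (phi n)"
  shows "x = y"
  using orthogonal_eq_0[of "x - y"] assms by (simp add: cinner_diff_left)

lemma synth_coeff: "synth (\<lambda>n. cinner x (phi n)) = x"
  by (rule coeff_eqI) (simp add: cinner_synth bessel)

lemma parseval: "(\<Sum>n. (cmod (cinner x (phi n)))\<^sup>2) = (norm x)\<^sup>2"
  using norm_synth[OF bessel, of x] by (simp add: synth_coeff)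

lemma cinner_sums: "(\<lambda>n. cinner x (phi n) * cinner (phi n) y) sums cinner x y"
proof -
  have "(\<lambda>n. cinner x (phi n) *\<^sub>C phi n) sums x"
    using summable_sums[OF summable_synth[OF bessel, of x]] synth_coeff[of x]
    by (simp add: synth_def)
  from bounded_linear.sums[OF bounded_linear_cinner_left this, of y]
  show ?thesis by (simp add: cinner_scaleC_left)
qed

lemma cinner_eq_suminf: "cinner x y = (\<Sum>n. cinner x (phi n) * cinner (phi n) y)"
  using cinner_sums[of x y] by (simp add: sums_iff)

end

text \<open>Dominated convergence for curves given by coefficients: a time independent square
  summable majorant makes the series of squares converge uniformly. It yields continuity of
  solutions in norm and of their velocities in the dual norm.\<close>

lemma tendsto_sum_sq_diff:
  fixes c :: "real \<Rightarrow> nat \<Rightarrow> complex"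
  assumes cont: "\<And>n. continuous_on S (\<lambda>t. c t n)"
    and bound: "\<And>t n. t \<in> S \<Longrightarrow> cmod (c t n) \<le> B n"
    and B: "summable (\<lambda>n. (B n)\<^sup>2)" and a: "a \<in> S"
  shows "((\<lambda>t. \<Sum>n. (cmod (c t n - c a n))\<^sup>2) \<longlongrightarrow> 0) (at a within S)"
proof -
  have "continuous_on S (\<lambda>t. \<Sum>n. (cmod (c t n - c a n))\<^sup>2)"
  proof (rule uniform_limit_theorem)
    show "\<forall>\<^sub>F N in sequentially. continuous_on S (\<lambda>t. \<Sum>n<N. (cmod (c t n - c a n))\<^sup>2)"
      by (intro always_eventually allI continuous_intros cont)
    show "uniform_limit S (\<lambda>N t. \<Sum>n<N. (cmod (c t n - c a n))\<^sup>2)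
        (\<lambda>t. \<Sum>n. (cmod (c t n - c a n))\<^sup>2) sequentially"
    proof (rule Weierstrass_m_test)
      fix n t assume "t \<in> S"
      then have "cmod (c t n - c a n) \<le> 2 * B n"
        using norm_triangle_ineq4[of "c t n" "c a n"] bound[of t n] bound[OF a, of n] by linarith
      then have "(cmod (c t n - c a n))\<^sup>2 \<le> (2 * B n)\<^sup>2"
        by (rule power_mono) simp
      then show "norm ((cmod (c t n - c a n))\<^sup>2) \<le> 4 * (B n)\<^sup>2"
        by (simp add: power_mult_distrib)
    next
      show "summable (\<lambda>n. 4 * (B n)\<^sup>2)" using B by simp
    qed
  qed simp
  then show ?thesis
    using a by (auto simp: continuous_on_def dest!: bspec[where x=a])
qed

section \<open>Absolutely continuous functions\<close>

section \<open>Absolutely continuous functions\<close>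

text \<open>
  Why an absolutely continuous function is differentiable almost everywhere: if the increment
  ratios over small intervals around the points of a nonnegligible set come arbitrarily close to
  two different values, two Vitali covers of that set give two finite families of intervals whose
  unions almost coincide although the increments of the function over them differ.
\<close>

definition incr :: "(real \<Rightarrow> 'a::real_normed_vector) \<Rightarrow> real set \<Rightarrow> 'a" where
  "incr f K = f (Sup K) - f (Inf K)"

text \<open>Absolute continuity phrased with divisions, that is finite families of closed intervals
  with disjoint interiors, because Vitali covers and gauge integrals produce such families. The
  codomain is general so that real and imaginary parts are covered.\<close>

definition ac_on :: "real \<Rightarrow> real \<Rightarrow> (real \<Rightarrow> 'a::real_normed_vector) \<Rightarrow> bool" where
  "ac_on a b f \<longleftrightarrow> (\<forall>\<epsilon>>0. \<exists>\<delta>>0. \<forall>d. d division_of \<Union>d \<longrightarrow> \<Union>d \<subseteq> {a..b} \<longrightarrow>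
     (\<Sum>K\<in>d. measure lebesgue K) < \<delta> \<longrightarrow> (\<Sum>K\<in>d. norm (incr f K)) < \<epsilon>)"

lemma incr_interval [simp]: "u \<le> v \<Longrightarrow> incr f {u..v} = f v - f u"
  by (simp add: incr_def)

lemma division_interval:
  assumes "d division_of S" "K \<in> d"
  obtains u v :: real where "u \<le> v" "K = {u..v}"
  using division_ofD(3,4)[OF assms] by (metis atLeastatMost_empty_iff box_real(2))

lemma incr_empty_interior:
  assumes "d division_of S" "K \<in> d" "interior K = {}"
  shows "incr f K = 0"
proof -
  obtain u v where uv: "u \<le> v" "K = {u..v}" using division_interval[OF assms(1,2)] .
  then have "u = v" using assms(3) by auto
  then show ?thesis using uv by (simp add: incr_def)
qed

text \<open>Enumerating a division turns it into the indexed family of the original definition;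
  disjoint interiors become disjoint open intervals.\<close>

lemma abs_continuous_imp_ac_on:
  assumes "abs_continuous_on a b f"
  shows "ac_on a b f"
  unfolding ac_on_def
proof (intro allI impI)
  fix \<epsilon> :: real assume "0 < \<epsilon>"
  obtain \<delta> where "\<delta> > 0" and \<delta>': "\<forall>(n::nat) x y.
        (\<forall>i<n. a \<le> x i \<and> x i \<le> y i \<and> y i \<le> b) \<and>
        disjoint_family_on (\<lambda>i. {x i<..<y i}) {..<n} \<and>
        (\<Sum>i<n. y i - x i) < \<delta> \<longrightarrow> (\<Sum>i<n. cmod (f (y i) - f (x i))) < \<epsilon>"
    using assms[unfolded abs_continuous_on_def, THEN spec, THEN mp, OF \<open>0 < \<epsilon>\<close>] by (elim exE conjE)
  note \<delta> = \<delta>'[THEN spec, THEN spec, THEN spec, THEN mp, OF conjI[OF _ conjI]]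
  have "(\<Sum>K\<in>d. norm (incr f K)) < \<epsilon>"
    if d: "d division_of \<Union>d" "\<Union>d \<subseteq> {a..b}" "(\<Sum>K\<in>d. measure lebesgue K) < \<delta>" for d
  proof -
    obtain e where e: "bij_betw e {..<card d} d"
      using ex_bij_betw_nat_finite[OF division_ofD(1)[OF d(1)]]
      by (auto simp: atLeast0LessThan)
    have ed: "e i \<in> d" if "i < card d" for i
      using e that by (auto simp: bij_betw_def)
    have ei: "\<exists>u v. u \<le> v \<and> e i = {u..v} \<and> Inf (e i) = u \<and> Sup (e i) = v" if "i < card d" for i
      using division_interval[OF d(1) ed[OF that]] by (metis cInf_atLeastAtMost cSup_atLeastAtMost)
    have "(\<Sum>i<card d. cmod (f (Sup (e i)) - f (Inf (e i)))) < \<epsilon>"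
    proof (rule \<delta>)
      show "\<forall>i<card d. a \<le> Inf (e i) \<and> Inf (e i) \<le> Sup (e i) \<and> Sup (e i) \<le> b"
      proof (intro allI impI)
        fix i assume i: "i < card d"
        obtain u v where uv: "u \<le> v" "e i = {u..v}" "Inf (e i) = u" "Sup (e i) = v"
          using ei[OF i] by blast
        have "u \<in> {a..b}" "v \<in> {a..b}"
          using d(2) ed[OF i] uv(1,2) by (metis Sup_upper atLeastAtMost_iff order_refl subsetD)+
        then show "a \<le> Inf (e i) \<and> Inf (e i) \<le> Sup (e i) \<and> Sup (e i) \<le> b"
          using uv by auto
      qed
      show "disjoint_family_on (\<lambda>i. {Inf (e i)<..<Sup (e i)}) {..<card d}"
        unfolding disjoint_family_on_def
      proof (intro ballI impI)
        fix i j assume ij: "i \<in> {..<card d}" "j \<in> {..<card d}" "i \<noteq> j"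
        then have "e i \<noteq> e j" using e by (auto simp: bij_betw_def inj_on_def)
        then have "interior (e i) \<inter> interior (e j) = {}"
          using division_ofD(5)[OF d(1)] ed ij by auto
        moreover have "interior (e k) = {Inf (e k)<..<Sup (e k)}" if "k < card d" for k
          using ei[OF that] by (metis interior_atLeastAtMost_real)
        ultimately show "{Inf (e i)<..<Sup (e i)} \<inter> {Inf (e j)<..<Sup (e j)} = {}"
          using ij by auto
      qed
      have "(\<Sum>i<card d. Sup (e i) - Inf (e i)) = (\<Sum>i<card d. measure lebesgue (e i))"
      proof (rule sum.cong)
        fix i assume "i \<in> {..<card d}"
        then obtain u v where "u \<le> v" "e i = {u..v}" using ei by blast
        then show "Sup (e i) - Inf (e i) = measure lebesgue (e i)" by simp
      qed simp
      also have "\<dots> = (\<Sum>K\<in>d. measure lebesgue K)"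
        by (rule sum.reindex_bij_betw[OF e])
      finally show "(\<Sum>i<card d. Sup (e i) - Inf (e i)) < \<delta>" using d(3) by simp
    qed
    also have "(\<Sum>i<card d. cmod (f (Sup (e i)) - f (Inf (e i)))) = (\<Sum>K\<in>d. norm (incr f K))"
      unfolding incr_def by (rule sum.reindex_bij_betw[OF e])
    finally show ?thesis .
  qed
  then show "\<exists>\<delta>>0. \<forall>d. d division_of \<Union>d \<longrightarrow> \<Union>d \<subseteq> {a..b} \<longrightarrow>
     (\<Sum>K\<in>d. measure lebesgue K) < \<delta> \<longrightarrow> (\<Sum>K\<in>d. norm (incr f K)) < \<epsilon>"
    using \<open>\<delta> > 0\<close> by blast
qed

lemma ac_onE:
  assumes "ac_on a b f" "0 < \<epsilon>"
  obtains \<delta> where "0 < \<delta>" "\<And>d. d division_of \<Union>d \<Longrightarrow> \<Union>d \<subseteq> {a..b} \<Longrightarrow>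
     (\<Sum>K\<in>d. measure lebesgue K) < \<delta> \<Longrightarrow> (\<Sum>K\<in>d. norm (incr f K)) < \<epsilon>"
proof -
  from assms(1)[unfolded ac_on_def, THEN spec, THEN mp, OF assms(2)]
  obtain \<delta> where "0 < \<delta> \<and> (\<forall>d. d division_of \<Union>d \<longrightarrow> \<Union>d \<subseteq> {a..b} \<longrightarrow>
     (\<Sum>K\<in>d. measure lebesgue K) < \<delta> \<longrightarrow> (\<Sum>K\<in>d. norm (incr f K)) < \<epsilon>)" ..
  then show thesis using that[of \<delta>] by simp
qed

lemma ac_onI:
  assumes "\<And>\<epsilon>. 0 < \<epsilon> \<Longrightarrow> \<exists>\<delta>>0. \<forall>d. d division_of \<Union>d \<and> \<Union>d \<subseteq> {a..b} \<and>
     (\<Sum>K\<in>d. measure lebesgue K) < \<delta> \<longrightarrow> (\<Sum>K\<in>d. norm (incr f K)) < \<epsilon>"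
  shows "ac_on a b f"
  unfolding ac_on_def
proof (intro allI impI)
  fix \<epsilon> :: real assume "0 < \<epsilon>"
  from assms[OF this] obtain \<delta> where "0 < \<delta>" and \<delta>: "\<forall>d. d division_of \<Union>d \<and> \<Union>d \<subseteq> {a..b} \<and>
     (\<Sum>K\<in>d. measure lebesgue K) < \<delta> \<longrightarrow> (\<Sum>K\<in>d. norm (incr f K)) < \<epsilon>"
    by (elim exE conjE)
  show "\<exists>\<delta>>0. \<forall>d. d division_of \<Union>d \<longrightarrow> \<Union>d \<subseteq> {a..b} \<longrightarrow>
     (\<Sum>K\<in>d. measure lebesgue K) < \<delta> \<longrightarrow> (\<Sum>K\<in>d. norm (incr f K)) < \<epsilon>"
    using \<open>0 < \<delta>\<close> \<delta> by (intro exI[of _ \<delta>] conjI allI impI) simp_all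
qed

lemma ac_on_subset:
  assumes "ac_on a b f" "a \<le> a'" "b' \<le> b"
  shows "ac_on a' b' f"
proof (rule ac_onI)
  fix e :: real assume "e > 0"
  have sub: "{a'..b'} \<subseteq> {a..b}" using assms by auto
  obtain \<delta> where \<delta>: "\<delta> > 0" "\<And>d. d division_of \<Union>d \<Longrightarrow> \<Union>d \<subseteq> {a..b} \<Longrightarrow>
     (\<Sum>K\<in>d. measure lebesgue K) < \<delta> \<Longrightarrow> (\<Sum>K\<in>d. norm (incr f K)) < e"
    using ac_onE[OF assms(1) \<open>e > 0\<close>] by blast
  show "\<exists>\<delta>>0. \<forall>d. d division_of \<Union>d \<and> \<Union>d \<subseteq> {a'..b'} \<and>
     (\<Sum>K\<in>d. measure lebesgue K) < \<delta> \<longrightarrow> (\<Sum>K\<in>d. norm (incr f K)) < e"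
    by (rule exI[of _ \<delta>]) (use \<delta> sub in \<open>simp add: subset_trans[OF _ sub]\<close>)
qed

text \<open>Meant for the real and imaginary parts of a complex function, whose increments are
  dominated by the complex ones.\<close>

lemma ac_on_mono:
  assumes "ac_on a b f" and le: "\<And>x y. norm (g y - g x) \<le> norm (f y - f x)"
  shows "ac_on a b g"
proof (rule ac_onI)
  fix e :: real assume "e > 0"
  obtain \<delta> where \<delta>: "\<delta> > 0" "\<And>d. d division_of \<Union>d \<Longrightarrow> \<Union>d \<subseteq> {a..b} \<Longrightarrow>
     (\<Sum>K\<in>d. measure lebesgue K) < \<delta> \<Longrightarrow> (\<Sum>K\<in>d. norm (incr f K)) < e"
    using ac_onE[OF assms(1) \<open>e > 0\<close>] by blast
  have "(\<Sum>K\<in>d. norm (incr g K)) \<le> (\<Sum>K\<in>d. norm (incr f K))" for d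
    unfolding incr_def by (intro sum_mono le)
  then show "\<exists>\<delta>>0. \<forall>d. d division_of \<Union>d \<and> \<Union>d \<subseteq> {a..b} \<and>
     (\<Sum>K\<in>d. measure lebesgue K) < \<delta> \<longrightarrow> (\<Sum>K\<in>d. norm (incr g K)) < e"
    using \<delta> by (intro exI[of _ \<delta>] conjI allI impI) (auto intro: le_less_trans)
qed

text \<open>Two members of a division meet in a convex set without interior, which is a null
  set.\<close>

lemma measure_division:
  fixes d :: "real set set"
  assumes d: "d division_of S"
  shows "measure lebesgue S = (\<Sum>K\<in>d. measure lebesgue K)" and "S \<in> lmeasurable"
proof -
  have m: "K \<in> lmeasurable" if "K \<in> d" for K
    using division_ofD(4)[OF d that] by auto
  have "pairwise (\<lambda>K L. negligible (K \<inter> L)) d"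
  proof (rule pairwiseI)
    fix K L assume KL: "K \<in> d" "L \<in> d" "K \<noteq> L"
    have "interior (K \<inter> L) = {}"
      using division_ofD(5)[OF d KL] by simp
    moreover have "convex (K \<inter> L)"
      using division_ofD(4)[OF d KL(1)] division_ofD(4)[OF d KL(2)]
      by (auto intro!: convex_Int)
    ultimately show "negligible (K \<inter> L)"
      by (simp add: negligible_convex_interior)
  qed
  then have "measure lebesgue (\<Union>d) = (\<Sum>K\<in>d. measure lebesgue K)"
    by (intro measure_negligible_finite_Union division_ofD(1)[OF d] m)
  then show "measure lebesgue S = (\<Sum>K\<in>d. measure lebesgue K)"
    using division_ofD(6)[OF d] by simp
  show "S \<in> lmeasurable"
    using fmeasurable.finite_Union[of d lebesgue] m division_ofD(1,6)[OF d] by auto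
qed

text \<open>Telescoping, obtained from tagged divisions by tagging each member with its left end
  point.\<close>

lemma incr_sum_interval:
  assumes d: "d division_of {a..b}" and "a \<le> b"
  shows "(\<Sum>K\<in>d. incr f K) = f b - f a"
proof -
  let ?p = "(\<lambda>K. (Inf K, K)) ` d"
  have "?p tagged_division_of {a..b}"
  proof (rule tagged_division_ofI)
    show "finite ?p" using division_ofD(1)[OF d] by simp
    show "\<Union>{K. \<exists>x. (x, K) \<in> ?p} = {a..b}"
      using division_ofD(6)[OF d] by (auto simp: image_iff)
  next
    fix x K assume "(x, K) \<in> ?p"
    then have K: "K \<in> d" "x = Inf K" by auto
    show "x \<in> K" "\<exists>a b. K = cbox a b"
      using division_interval[OF d K(1)] K(2) division_ofD(4)[OF d K(1)]
      by (metis atLeastAtMost_iff cInf_atLeastAtMost order_refl)+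
    show "K \<subseteq> {a..b}" using division_ofD(2)[OF d K(1)] .
  next
    fix x K y L assume "(x, K) \<in> ?p" "(y, L) \<in> ?p" "(x, K) \<noteq> (y, L)"
    then show "interior K \<inter> interior L = {}"
      using division_ofD(5)[OF d] by auto
  qed
  from additive_tagged_division_1[OF \<open>a \<le> b\<close> this, of f]
  show ?thesis
    by (subst (asm) sum.reindex) (auto simp: inj_on_def incr_def)
qed

text \<open>The same intervals \<open>?q\<close> complete either division of \<open>S\<close> to a
  division of \<open>{a..b}\<close>, and both completions have total increment
  \<open>f b - f a\<close>.\<close>

lemma incr_sum_eq:
  assumes d: "d division_of S" and r: "r division_of S" and S: "S \<subseteq> {a..b}" and "a \<le> b"
  shows "(\<Sum>K\<in>d. incr f K) = (\<Sum>K\<in>r. incr f K)"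
proof -
  have "{cbox a b} division_of cbox a b" using \<open>a \<le> b\<close> by (intro division_of_self) auto
  then have ab: "{{a..b}} division_of {a..b}" by simp
  obtain D where D: "d \<subseteq> D" "D division_of {a..b}"
    using partial_division_extend[OF d ab S] by blast
  let ?q = "D - d"
  have "(\<Sum>K\<in>D. incr f K) = f b - f a"
    by (rule incr_sum_interval[OF D(2) \<open>a \<le> b\<close>])
  then have 1: "(\<Sum>K\<in>d. incr f K) + (\<Sum>K\<in>?q. incr f K) = f b - f a"
    using D division_ofD(1)[OF D(2)] by (metis add.commute sum.subset_diff)
  have q: "?q division_of \<Union>?q"
    using division_of_subset[of D ?q] D(2) division_ofD(6)[OF D(2)] by auto
  have disj: "interior S \<inter> interior (\<Union>?q) = {}"
  proof (rule Int_interior_Union_intervals)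
    show "finite ?q" "\<And>T. T \<in> ?q \<Longrightarrow> \<exists>a b. T = cbox a b"
      using division_ofD(1,4)[OF q] by auto
    fix L assume L: "L \<in> ?q"
    have "interior L \<inter> interior (\<Union>d) = {}"
    proof (rule Int_interior_Union_intervals)
      show "finite d" "\<And>T. T \<in> d \<Longrightarrow> \<exists>a b. T = cbox a b"
        using division_ofD(1,4)[OF d] by auto
      show "interior L \<inter> interior T = {}" if "T \<in> d" for T
        using division_ofD(5)[OF D(2), of L T] L that D(1) by auto
    qed simp
    then show "interior S \<inter> interior L = {}"
      using division_ofD(6)[OF d] by auto
  qed simp
  have "r \<union> ?q division_of (S \<union> \<Union>?q)"
    by (rule division_disjoint_union[OF r q disj])
  moreover have "S \<union> \<Union>?q = {a..b}"
    unfolding division_ofD(6)[OF d, symmetric] division_ofD(6)[OF D(2), symmetric]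
    using D(1) by blast
  ultimately have rq: "r \<union> ?q division_of {a..b}" by simp
  \<comment> \<open>A member shared by \<open>r\<close> and \<open>?q\<close> lies in two sets with
    disjoint interiors, so it is a single point and counting it twice does no harm.\<close>
  have "(\<Sum>K\<in>r \<inter> ?q. incr f K) = 0"
  proof (rule sum.neutral, rule ballI)
    fix K assume K: "K \<in> r \<inter> ?q"
    then have "interior K \<subseteq> interior S \<inter> interior (\<Union>?q)"
      using division_ofD(2)[OF r] by (auto dest!: interior_mono[of K S] intro: subsetD[OF interior_mono])
    then show "incr f K = 0"
      using incr_empty_interior[OF r, of K f] K disj by auto
  qed
  then have "(\<Sum>K\<in>r. incr f K) + (\<Sum>K\<in>?q. incr f K) = (\<Sum>K\<in>r \<union> ?q. incr f K)"
    using sum.union_inter[of r ?q "incr f"] division_ofD(1)[OF r] division_ofD(1)[OF q] by simp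
  also have "\<dots> = f b - f a"
    by (rule incr_sum_interval[OF rq \<open>a \<le> b\<close>])
  finally show ?thesis using 1 by (metis add_right_imp_eq)
qed

text \<open>Both sums are compared with a division \<open>P\<close> of the intersection. What either
  family has outside \<open>P\<close> is small in measure, so absolute continuity makes its
  increments small.\<close>

lemma incr_sum_diff_less:
  fixes d1 d2 :: "real set set"
  assumes d1: "d1 division_of S1" and d2: "d2 division_of S2"
    and S: "S1 \<subseteq> {a..b}" "S2 \<subseteq> {a..b}" and "a \<le> b"
    and \<delta>: "\<And>d. d division_of \<Union>d \<Longrightarrow> \<Union>d \<subseteq> {a..b} \<Longrightarrow>
     (\<Sum>K\<in>d. measure lebesgue K) < \<delta> \<Longrightarrow> (\<Sum>K\<in>d. norm (incr f K)) < \<epsilon>"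
    and m: "measure lebesgue S1 - measure lebesgue (S1 \<inter> S2) < \<delta>"
      "measure lebesgue S2 - measure lebesgue (S1 \<inter> S2) < \<delta>"
  shows "norm ((\<Sum>K\<in>d1. incr f K) - (\<Sum>K\<in>d2. incr f K)) < 2 * \<epsilon>"
proof -
  obtain P where P: "P division_of (S1 \<inter> S2)"
    using division_inter[OF d1 d2] by blast
  have *: "norm ((\<Sum>K\<in>d. incr f K) - (\<Sum>K\<in>P. incr f K)) < \<epsilon>"
    if d: "d division_of S" and PS: "S1 \<inter> S2 \<subseteq> S" and Sab: "S \<subseteq> {a..b}"
      and m: "measure lebesgue S - measure lebesgue (S1 \<inter> S2) < \<delta>" for d S
  proof -
    obtain r where r: "P \<subseteq> r" "r division_of S"
      using partial_division_extend[OF P d PS] by blast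
    note fin = division_ofD(1)[OF r(2)]
    have "(\<Sum>K\<in>d. incr f K) = (\<Sum>K\<in>r. incr f K)"
      by (rule incr_sum_eq[OF d r(2) Sab \<open>a \<le> b\<close>])
    also have "\<dots> = (\<Sum>K\<in>r - P. incr f K) + (\<Sum>K\<in>P. incr f K)"
      by (rule sum.subset_diff[OF r(1) fin])
    finally have e: "(\<Sum>K\<in>d. incr f K) - (\<Sum>K\<in>P. incr f K) = (\<Sum>K\<in>r - P. incr f K)"
      by simp
    have "(\<Sum>K\<in>r - P. norm (incr f K)) < \<epsilon>"
    proof (rule \<delta>)
      show "r - P division_of \<Union>(r - P)"
        using division_of_subset[of r "r - P"] r(2) division_ofD(6)[OF r(2)] by auto
      show "\<Union>(r - P) \<subseteq> {a..b}"
        using division_ofD(2)[OF r(2)] Sab by blast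
      show "(\<Sum>K\<in>r - P. measure lebesgue K) < \<delta>"
        using m measure_division(1)[OF r(2)] measure_division(1)[OF P]
          sum.subset_diff[OF r(1) fin, of "measure lebesgue"] by simp
    qed
    then show ?thesis
      unfolding e using norm_sum[of "incr f" "r - P"] by linarith
  qed
  have "norm ((\<Sum>K\<in>d1. incr f K) - (\<Sum>K\<in>P. incr f K)) < \<epsilon>"
    "norm ((\<Sum>K\<in>d2. incr f K) - (\<Sum>K\<in>P. incr f K)) < \<epsilon>"
    using *[OF d1 _ S(1) m(1)] *[OF d2 _ S(2) m(2)] by auto
  then show ?thesis
    using norm_triangle_ineq4[of "(\<Sum>K\<in>d1. incr f K) - (\<Sum>K\<in>P. incr f K)"
        "(\<Sum>K\<in>d2. incr f K) - (\<Sum>K\<in>P. incr f K)"] by simp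
qed

section \<open>Vitali covers and differentiability almost everywhere\<close>

text \<open>Vitali's theorem gives countably many disjoint intervals covering \<open>E\<close> up to
  a null set; their union has measure at least \<open>m\<close>, and finitely many of them already
  carry \<open>m - \<epsilon>\<close>. Since \<open>E\<close> is not assumed measurable, its size
  enters only through the lower bound \<open>m\<close> on measurable supersets.\<close>

lemma vitali_finite:
  fixes E U :: "real set"
  assumes "open U" "U \<in> lmeasurable" "E \<subseteq> U"
    and m: "\<And>V. V \<in> lmeasurable \<Longrightarrow> E \<subseteq> V \<Longrightarrow> m \<le> measure lebesgue V"
    and Q: "\<And>x e. x \<in> E \<Longrightarrow> e > 0 \<Longrightarrow> \<exists>u v. u \<le> x \<and> x \<le> v \<and> u < v \<and> v - u < e \<and> Q u v"
    and "\<epsilon> > 0"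
  obtains d where "d division_of \<Union>d" "\<Union>d \<subseteq> U" "m - \<epsilon> < measure lebesgue (\<Union>d)"
    "\<And>K. K \<in> d \<Longrightarrow> \<exists>u v. u < v \<and> K = {u..v} \<and> Q u v"
proof -
  let ?K = "{(u, v). u < v \<and> {u..v} \<subseteq> U \<and> Q u v}"
  \<comment> \<open>The covering theorem speaks of balls, so an interval enters through its midpoint
    and half its length.\<close>
  let ?c = "\<lambda>(u::real, v). (u + v) / 2" and ?r = "\<lambda>(u::real, v). (v - u) / 2"
  have cb: "cball (?c i) (?r i) = {fst i..snd i}" for i
    by (cases i) (auto simp: cball_eq_atLeastAtMost field_simps)
  obtain C where C: "countable C" "C \<subseteq> ?K"
     "pairwise (\<lambda>i j. disjnt (cball (?c i) (?r i)) (cball (?c j) (?r j))) C"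
     "negligible (E - (\<Union>i\<in>C. cball (?c i) (?r i)))"
  proof (rule Vitali_covering_theorem_cballs[of ?K ?r E ?c])
    show "0 < ?r i" if "i \<in> ?K" for i using that by auto
    fix x d :: real assume x: "x \<in> E" and d: "0 < d"
    obtain e where e: "e > 0" "ball x e \<subseteq> U"
      using \<open>open U\<close> \<open>E \<subseteq> U\<close> x by (meson open_contains_ball subsetD)
    obtain u v where uv: "u \<le> x" "x \<le> v" "u < v" "v - u < min d e" "Q u v"
      using Q[OF x, of "min d e"] d e by auto
    have "{u..v} \<subseteq> ball x e" using uv by (auto simp: dist_real_def)
    then have "(u, v) \<in> ?K" using uv e by auto
    moreover have "x \<in> cball (?c (u, v)) (?r (u, v))" unfolding cb using uv by simp
    moreover have "?r (u, v) < d" using uv by simp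
    ultimately show "\<exists>i. i \<in> ?K \<and> x \<in> cball (?c i) (?r i) \<and> ?r i < d" by blast
  qed
  let ?D = "(\<lambda>i. {fst i..snd i}) ` C"
  have neg: "negligible (E - \<Union>?D)" using C(4) unfolding cb by simp
  have CK: "fst i < snd i \<and> {fst i..snd i} \<subseteq> U \<and> Q (fst i) (snd i)" if "i \<in> C" for i
    using subsetD[OF C(2) that] by (cases i) auto
  then have DU: "\<Union>?D \<subseteq> U" by blast
  have Dm: "\<Union>?D \<in> lmeasurable"
    by (rule fmeasurableI2[OF \<open>U \<in> lmeasurable\<close> DU])
       (use \<open>countable C\<close> in \<open>auto intro!: sets.countable_UN'\<close>)
  have "m \<le> measure lebesgue (\<Union>?D \<union> (E - \<Union>?D))"
    by (rule m[OF fmeasurable.Un[OF Dm negligible_imp_measurable[OF neg]]]) blast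
  also have "\<dots> = measure lebesgue (\<Union>?D)"
    using neg Dm by (intro measure_Un_null_set) (auto simp: negligible_iff_null_sets)
  finally have mD: "m \<le> measure lebesgue (\<Union>?D)" .
  obtain d where d: "d \<subseteq> ?D" "finite d" "measure lebesgue (\<Union>?D) - \<epsilon> < measure lebesgue (\<Union>d)"
  proof (rule measure_countable_Union_approachable[of ?D \<epsilon> "measure lebesgue U"])
    show "countable ?D" using C(1) by simp
    fix D' assume "D' \<subseteq> ?D" "finite D'"
    then have "\<Union>D' \<in> lmeasurable" "\<Union>D' \<subseteq> U"
      using DU by (auto intro!: fmeasurable.finite_Union)
    then show "measure lebesgue (\<Union>D') \<le> measure lebesgue U"
      by (intro measure_mono_fmeasurable fmeasurableD \<open>U \<in> lmeasurable\<close>)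
  qed (use \<open>\<epsilon> > 0\<close> in auto)
  show thesis
  proof
    show "\<Union>d \<subseteq> U" using d(1) DU by blast
    show "m - \<epsilon> < measure lebesgue (\<Union>d)" using mD d(3) by simp
    show *: "\<exists>u v. u < v \<and> K = {u..v} \<and> Q u v" if Kd: "K \<in> d" for K
    proof -
      obtain i where i: "i \<in> C" "K = {fst i..snd i}" using Kd d(1) by blast
      show ?thesis using CK[OF i(1)] i(2) by blast
    qed
    show "d division_of \<Union>d"
    proof (rule division_ofI)
      fix K assume "K \<in> d"
      moreover obtain u v where "u < v" "K = {u..v}" using *[OF \<open>K \<in> d\<close>] by blast
      ultimately show "K \<subseteq> \<Union>d" "K \<noteq> {}" "\<exists>a b. K = cbox a b"
        by (auto intro: box_real(2)[symmetric])
    next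
      fix K L assume KL: "K \<in> d" "L \<in> d" "K \<noteq> L"
      obtain i where i: "i \<in> C" "K = {fst i..snd i}" using KL(1) d(1) by blast
      obtain j where j: "j \<in> C" "L = {fst j..snd j}" using KL(2) d(1) by blast
      have "i \<noteq> j" using i j KL(3) by blast
      from pairwiseD[OF C(3) i(1) j(1) this] have "K \<inter> L = {}"
        unfolding cb disjnt_def i(2) j(2) .
      then show "interior K \<inter> interior L = {}"
        using interior_subset by blast
    qed (use d in auto)
  qed
qed

text \<open>\<open>m\<close> is the outer measure of \<open>E\<close>, taken as the infimum over
  measurable supersets; outer regularity then gives an open superset that is almost optimal.\<close>

lemma nonnegligible_outer:
  fixes E :: "real set"
  assumes "\<not> negligible E" "E \<subseteq> {a<..<b}"
  obtains m where "m > 0" "\<And>V. V \<in> lmeasurable \<Longrightarrow> E \<subseteq> V \<Longrightarrow> m \<le> measure lebesgue V"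
    "\<And>\<epsilon>. \<epsilon> > 0 \<Longrightarrow> \<exists>U. open U \<and> U \<in> lmeasurable \<and> E \<subseteq> U \<and> U \<subseteq> {a<..<b} \<and> measure lebesgue U < m + \<epsilon>"
proof -
  let ?M = "measure lebesgue ` {V. V \<in> lmeasurable \<and> E \<subseteq> V}"
  have ne: "?M \<noteq> {}" using assms(2) by (auto intro!: exI[of _ "{a<..<b}"])
  have bdd: "bdd_below ?M" by (auto intro!: bdd_belowI[of _ 0])
  obtain e where e: "e > 0" "\<And>V. E \<subseteq> V \<Longrightarrow> V \<in> lmeasurable \<Longrightarrow> e < measure lebesgue V"
    using assms(1) unfolding negligible_outer_le by (meson not_le)
  have "e \<le> Inf ?M" using e ne by (intro cInf_greatest) (auto intro: less_imp_le)
  show thesis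
  proof
    show "0 < Inf ?M" using \<open>e \<le> Inf ?M\<close> \<open>e > 0\<close> by linarith
    show "Inf ?M \<le> measure lebesgue V" if "V \<in> lmeasurable" "E \<subseteq> V" for V
      using that bdd by (intro cInf_lower) auto
    fix \<epsilon> :: real assume "\<epsilon> > 0"
    then have "Inf ?M < Inf ?M + \<epsilon> / 2" by simp
    then obtain V where V: "V \<in> lmeasurable" "E \<subseteq> V" "measure lebesgue V < Inf ?M + \<epsilon> / 2"
      using cInf_lessD[OF ne, of "Inf ?M + \<epsilon> / 2"] by blast
    obtain U where U: "open U" "V \<subseteq> U" "U - V \<in> lmeasurable" "emeasure lebesgue (U - V) < ennreal (\<epsilon> / 2)"
      using sets_lebesgue_outer_open[of V "\<epsilon> / 2"] V(1) \<open>\<epsilon> > 0\<close> by auto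
    have Um: "U \<in> lmeasurable"
      using U V(1) fmeasurable.Un[of V lebesgue "U - V"] by (simp add: Un_absorb1)
    have "measure lebesgue (U - V) < \<epsilon> / 2"
      using U(3,4) \<open>\<epsilon> > 0\<close> by (simp add: emeasure_eq_measure2 ennreal_less_iff)
    moreover have "measure lebesgue U = measure lebesgue V + measure lebesgue (U - V)"
      using U(2,3) V(1) measure_Un_AE[of V "U - V" lebesgue] by (simp add: Un_absorb1)
    ultimately have "measure lebesgue U < Inf ?M + \<epsilon>" using V(3) by linarith
    moreover have "measure lebesgue (U \<inter> {a<..<b}) \<le> measure lebesgue U"
      using Um by (intro measure_mono_fmeasurable) auto
    ultimately show "\<exists>U. open U \<and> U \<in> lmeasurable \<and> E \<subseteq> U \<and> U \<subseteq> {a<..<b} \<and> measure lebesgue U < Inf ?M + \<epsilon>"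
      using U Um V(2) assms(2)
      by (intro exI[of _ "U \<inter> {a<..<b}"]) (auto intro!: fmeasurable_Int_fmeasurable open_Int)
  qed
qed

text \<open>\<open>x\<close> may be an end point: the choices \<open>u = x\<close> and
  \<open>v = x\<close> recover the one-sided difference quotients.\<close>

definition straddles :: "real \<Rightarrow> real \<Rightarrow> real \<Rightarrow> real \<Rightarrow> bool" where
  "straddles x e u v \<longleftrightarrow> u \<le> x \<and> x \<le> v \<and> u < v \<and> v - u < e"

lemma ac_ratio_gap_negligible:
  fixes f :: "real \<Rightarrow> real"
  assumes ac: "ac_on a b f" and "a \<le> b" "p < q" and E: "E \<subseteq> {a<..<b}"
    and lo: "\<And>x e. x \<in> E \<Longrightarrow> e > 0 \<Longrightarrow>
      \<exists>u v. straddles x e u v \<and> f v - f u \<le> p * (v - u)"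
    and hi: "\<And>x e. x \<in> E \<Longrightarrow> e > 0 \<Longrightarrow>
      \<exists>u v. straddles x e u v \<and> q * (v - u) \<le> f v - f u"
  shows "negligible E"
proof (rule ccontr)
  assume "\<not> negligible E"
  then obtain m where "m > 0" and m: "\<And>V. V \<in> lmeasurable \<Longrightarrow> E \<subseteq> V \<Longrightarrow> m \<le> measure lebesgue V"
    and U: "\<And>\<epsilon>. \<epsilon> > 0 \<Longrightarrow> \<exists>U. open U \<and> U \<in> lmeasurable \<and> E \<subseteq> U \<and> U \<subseteq> {a<..<b} \<and> measure lebesgue U < m + \<epsilon>"
    using nonnegligible_outer[OF _ E] by blast
  \<comment> \<open>\<open>g\<close> is the gap between the ideal totals \<open>p * m\<close> and
    \<open>q * m\<close>. Absolute continuity at level \<open>g / 8\<close> costs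
    \<open>g / 4\<close>, and the choice of \<epsilon> makes the deviation of both measures from
    \<open>m\<close> cost at most another \<open>g / 4\<close>, so the gap cannot be closed. The
    bound \<open>2 * \<epsilon> \<le> \<delta>\<close> is what lets the two unions almost
    coincide.\<close>
  define g where "g = (q - p) * m"
  have "g > 0" using \<open>p < q\<close> \<open>m > 0\<close> by (simp add: g_def)
  then have "g / 8 > 0" by simp
  obtain \<delta> where "\<delta> > 0" and \<delta>: "\<And>d. d division_of \<Union>d \<Longrightarrow> \<Union>d \<subseteq> {a..b} \<Longrightarrow>
     (\<Sum>K\<in>d. measure lebesgue K) < \<delta> \<Longrightarrow> (\<Sum>K\<in>d. norm (incr f K)) < g / 8"
    using ac_onE[OF ac \<open>g / 8 > 0\<close>] by blast
  define \<epsilon> where "\<epsilon> = min (\<delta> / 2) (g / (4 * (\<bar>p\<bar> + \<bar>q\<bar> + 1)))"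
  have "\<epsilon> > 0" using \<open>\<delta> > 0\<close> \<open>g > 0\<close> by (simp add: \<epsilon>_def)
  have "\<epsilon> * (\<bar>p\<bar> + \<bar>q\<bar> + 1) \<le> g / (4 * (\<bar>p\<bar> + \<bar>q\<bar> + 1)) * (\<bar>p\<bar> + \<bar>q\<bar> + 1)"
    by (rule mult_right_mono) (auto simp: \<epsilon>_def)
  moreover have "g / (4 * c) * c = g / 4" if "c \<noteq> 0" for c :: real using that by simp
  ultimately have \<epsilon>1: "\<epsilon> * (\<bar>p\<bar> + \<bar>q\<bar> + 1) \<le> g / 4"
    using abs_ge_zero[of p] abs_ge_zero[of q] by (smt (verit))
  have \<epsilon>2: "2 * \<epsilon> \<le> \<delta>" by (simp add: \<epsilon>_def)
  obtain U where U: "open U" "U \<in> lmeasurable" "E \<subseteq> U" "U \<subseteq> {a<..<b}" "measure lebesgue U < m + \<epsilon>"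
    using U[OF \<open>\<epsilon> > 0\<close>] by blast
  obtain d1 where d1: "d1 division_of \<Union>d1" "\<Union>d1 \<subseteq> U" "m - \<epsilon> < measure lebesgue (\<Union>d1)"
    "\<And>K. K \<in> d1 \<Longrightarrow> \<exists>u v. u < v \<and> K = {u..v} \<and> f v - f u \<le> p * (v - u)"
    by (rule vitali_finite[OF U(1-3) m lo[unfolded straddles_def conj_assoc] \<open>\<epsilon> > 0\<close>]) blast+
  obtain d2 where d2: "d2 division_of \<Union>d2" "\<Union>d2 \<subseteq> U" "m - \<epsilon> < measure lebesgue (\<Union>d2)"
    "\<And>K. K \<in> d2 \<Longrightarrow> \<exists>u v. u < v \<and> K = {u..v} \<and> q * (v - u) \<le> f v - f u"
    by (rule vitali_finite[OF U(1-3) m hi[unfolded straddles_def conj_assoc] \<open>\<epsilon> > 0\<close>]) blast+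
  let ?m = "measure lebesgue" and ?S1 = "\<Union>d1" and ?S2 = "\<Union>d2"
  note S1 = measure_division[OF d1(1)] and S2 = measure_division[OF d2(1)]
  have le: "?m ?S1 \<le> ?m U" "?m ?S2 \<le> ?m U" "?m (?S1 \<union> ?S2) \<le> ?m U"
    using d1(2) d2(2) U(2) S1(2) S2(2)
    by (auto intro!: measure_mono_fmeasurable simp: fmeasurableD)
  have "?m (?S1 \<union> ?S2) = ?m ?S1 + ?m ?S2 - ?m (?S1 \<inter> ?S2)"
    using measure_Un3[OF S1(2) S2(2)] .
  then have sm: "?m ?S1 - ?m (?S1 \<inter> ?S2) < \<delta>" "?m ?S2 - ?m (?S1 \<inter> ?S2) < \<delta>"
    using le U(5) d1(3) d2(3) \<epsilon>2 by linarith+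
  have ab: "?S1 \<subseteq> {a..b}" "?S2 \<subseteq> {a..b}"
    using d1(2) d2(2) U(4) by fastforce+
  have "norm ((\<Sum>K\<in>d1. incr f K) - (\<Sum>K\<in>d2. incr f K)) < 2 * (g / 8)"
    by (rule incr_sum_diff_less[OF d1(1) d2(1) ab \<open>a \<le> b\<close> \<delta> sm])
  moreover have "(\<Sum>K\<in>d1. incr f K) \<le> p * ?m ?S1"
    unfolding S1(1) sum_distrib_left
  proof (rule sum_mono)
    fix K assume "K \<in> d1"
    from d1(4)[OF this] show "incr f K \<le> p * ?m K" by auto
  qed
  moreover have "q * ?m ?S2 \<le> (\<Sum>K\<in>d2. incr f K)"
    unfolding S2(1) sum_distrib_left
  proof (rule sum_mono)
    fix K assume "K \<in> d2"
    from d2(4)[OF this] show "q * ?m K \<le> incr f K" by auto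
  qed
  moreover have "p * ?m ?S1 \<le> p * m + \<bar>p\<bar> * \<epsilon>" "q * m - \<bar>q\<bar> * \<epsilon> \<le> q * ?m ?S2"
  proof -
    have *: "\<bar>r * ?m S - r * m\<bar> \<le> \<bar>r\<bar> * \<epsilon>" if "\<bar>?m S - m\<bar> \<le> \<epsilon>" for r S
    proof -
      have "\<bar>r * ?m S - r * m\<bar> = \<bar>r\<bar> * \<bar>?m S - m\<bar>"
        by (simp add: abs_mult[symmetric] algebra_simps)
      then show ?thesis using that by (simp add: mult_left_mono)
    qed
    have "\<bar>?m ?S1 - m\<bar> \<le> \<epsilon>" "\<bar>?m ?S2 - m\<bar> \<le> \<epsilon>"
      using le U(5) d1(3) d2(3) by linarith+
    then show "p * ?m ?S1 \<le> p * m + \<bar>p\<bar> * \<epsilon>" "q * m - \<bar>q\<bar> * \<epsilon> \<le> q * ?m ?S2"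
      using *[of ?S1 p] *[of ?S2 q] by linarith+
  qed
  moreover have "\<bar>p\<bar> * \<epsilon> + \<bar>q\<bar> * \<epsilon> \<le> g / 4"
    using \<epsilon>1 \<open>\<epsilon> > 0\<close> by (simp add: algebra_simps)
  moreover have "q * m - p * m = g" by (simp add: g_def algebra_simps)
  ultimately show False using \<open>g > 0\<close> unfolding real_norm_def abs_less_iff by linarith
qed

text \<open>Otherwise a Vitali family with slopes above \<open>M\<close> covers measure
  \<open>m / 2\<close> and has variation at least \<open>M * m / 2\<close>; \<open>M\<close> is
  chosen so that this equals \<open>\<bar>B\<bar> + 1\<close>.\<close>

lemma unbounded_ratio_negligible:
  fixes f :: "real \<Rightarrow> real"
  assumes bv: "\<And>d. d division_of \<Union>d \<Longrightarrow> \<Union>d \<subseteq> {a..b} \<Longrightarrow> (\<Sum>K\<in>d. norm (incr f K)) \<le> B"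
    and E: "E \<subseteq> {a<..<b}"
    and Q: "\<And>x e M. x \<in> E \<Longrightarrow> e > 0 \<Longrightarrow>
      \<exists>u v. straddles x e u v \<and> M * (v - u) \<le> \<bar>f v - f u\<bar>"
  shows "negligible E"
proof (rule ccontr)
  assume "\<not> negligible E"
  then obtain m where "m > 0" and m: "\<And>V. V \<in> lmeasurable \<Longrightarrow> E \<subseteq> V \<Longrightarrow> m \<le> measure lebesgue V"
    and "\<And>\<epsilon>. \<epsilon> > 0 \<Longrightarrow> \<exists>U. open U \<and> U \<in> lmeasurable \<and> E \<subseteq> U \<and> U \<subseteq> {a<..<b} \<and> measure lebesgue U < m + \<epsilon>"
    using nonnegligible_outer[OF _ E] by blast
  define M where "M = (\<bar>B\<bar> + 1) / (m / 2)"
  have "m / 2 > 0" using \<open>m > 0\<close> by simp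
  have o: "open {a<..<b}" "{a<..<b} \<in> lmeasurable" by auto
  obtain d where d: "d division_of \<Union>d" "\<Union>d \<subseteq> {a<..<b}" "m - m / 2 < measure lebesgue (\<Union>d)"
    "\<And>K. K \<in> d \<Longrightarrow> \<exists>u v. u < v \<and> K = {u..v} \<and> M * (v - u) \<le> \<bar>f v - f u\<bar>"
    by (rule vitali_finite[OF o E m Q[where M=M, unfolded straddles_def conj_assoc] \<open>m / 2 > 0\<close>]) blast+
  have "M > 0" using \<open>m > 0\<close> by (simp add: M_def add_nonneg_pos)
  have "\<bar>B\<bar> + 1 = M * (m / 2)" using \<open>m > 0\<close> by (simp add: M_def)
  also have "\<dots> \<le> M * measure lebesgue (\<Union>d)"
    using d(3) \<open>M > 0\<close> by (intro mult_left_mono) auto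
  also have "\<dots> \<le> (\<Sum>K\<in>d. norm (incr f K))"
    unfolding measure_division(1)[OF d(1)] sum_distrib_left
  proof (rule sum_mono)
    fix K assume "K \<in> d"
    from d(4)[OF this] show "M * measure lebesgue K \<le> norm (incr f K)" by auto
  qed
  also have "\<dots> \<le> B" using d(1,2) by (intro bv) fastforce+
  finally show False by linarith
qed

text \<open>The derivative is the supremum \<open>L\<close> of the slopes that are reached or
  exceeded on arbitrarily short intervals around \<open>x\<close>. Slopes above \<open>L\<close> are
  excluded by definition, and the gap alternative keeps all short slopes from falling below
  \<open>L\<close>.\<close>

lemma derivative_from_ratios:
  fixes f :: "real \<Rightarrow> real"
  assumes bounded: "\<exists>M. \<exists>e>0. \<forall>u v. straddles x e u v \<longrightarrow> \<bar>f v - f u\<bar> < M * (v - u)"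
    and gap: "\<And>p q. p \<in> \<rat> \<Longrightarrow> q \<in> \<rat> \<Longrightarrow> p < q \<Longrightarrow>
      (\<exists>e>0. \<forall>u v. straddles x e u v \<longrightarrow> p * (v - u) < f v - f u) \<or>
      (\<exists>e>0. \<forall>u v. straddles x e u v \<longrightarrow> f v - f u < q * (v - u))"
  shows "\<exists>L. (f has_vector_derivative L) (at x)"
proof -
  define S where "S = {r. \<forall>e>0. \<exists>u v. straddles x e u v \<and> r * (v - u) \<le> f v - f u}"
  obtain M e0 where "e0 > 0" and M: "\<And>u v. straddles x e0 u v \<Longrightarrow> \<bar>f v - f u\<bar> < M * (v - u)"
    using bounded by (elim exE conjE) (rule that, assumption, blast)
  have inS: "- M \<in> S"
    unfolding S_def
  proof (intro CollectI allI impI)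
    fix e :: real assume "e > 0"
    then obtain h where h: "0 < h" "h < e" "h < e0"
      using \<open>e0 > 0\<close> field_lbound_gt_zero[of e e0] by blast
    show "\<exists>u v. straddles x e u v \<and> - M * (v - u) \<le> f v - f u"
      using h M[of x "x + h"] by (intro exI[of _ x] exI[of _ "x + h"]) (auto simp: straddles_def)
  qed
  have ub: "r \<le> M" if "r \<in> S" for r
  proof (rule ccontr)
    assume "\<not> r \<le> M"
    obtain u v where uv: "straddles x e0 u v" "r * (v - u) \<le> f v - f u"
      using \<open>r \<in> S\<close> \<open>e0 > 0\<close> unfolding S_def by blast
    have "M * (v - u) \<le> r * (v - u)" using \<open>\<not> r \<le> M\<close> uv by (intro mult_right_mono) (auto simp: straddles_def)
    then show False using M[OF uv(1)] uv(2) by linarith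
  qed
  have bdd: "bdd_above S" using ub by (intro bdd_aboveI) auto
  define L where "L = Sup S"
  have up: "\<exists>e>0. \<forall>u v. straddles x e u v \<longrightarrow> f v - f u < q * (v - u)" if "L < q" for q
  proof -
    have "q \<notin> S" using that bdd cSup_upper[of q S] by (auto simp: L_def)
    then obtain e where "e > 0"
        "\<not> (\<exists>u v. straddles x e u v \<and> q * (v - u) \<le> f v - f u)"
      by (auto simp: S_def)
    then show ?thesis by (intro exI[of _ e]) (auto simp flip: not_le)
  qed
  have down: "\<exists>e>0. \<forall>u v. straddles x e u v \<longrightarrow> p * (v - u) < f v - f u" if pL: "p < L" for p
  proof -
    \<comment> \<open>Some \<open>s\<close> in \<open>S\<close> exceeds \<open>q\<close>, which
      refutes the second alternative of \<open>gap\<close> for the rational pair \<open>p'\<close>,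
      \<open>q\<close>; the first one remains and bounds all short slopes from below.\<close>
    obtain q where q: "q \<in> \<rat>" "p < q" "q < L" using Rats_dense_in_real[OF pL] by blast
    obtain p' where p': "p' \<in> \<rat>" "p < p'" "p' < q" using Rats_dense_in_real[OF q(2)] by blast
    obtain s where s: "s \<in> S" "q < s" using q(3) inS less_cSupD[of S q] by (auto simp: L_def)
    have "\<not> (\<exists>e>0. \<forall>u v. straddles x e u v \<longrightarrow> f v - f u < q * (v - u))"
    proof
      assume "\<exists>e>0. \<forall>u v. straddles x e u v \<longrightarrow> f v - f u < q * (v - u)"
      then obtain e where e: "e > 0" "\<And>u v. straddles x e u v \<Longrightarrow> f v - f u < q * (v - u)"
        by blast
      obtain u v where uv: "straddles x e u v" "s * (v - u) \<le> f v - f u"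
        using s(1) e(1) unfolding S_def by blast
      have "q * (v - u) \<le> s * (v - u)" using s(2) uv by (intro mult_right_mono) (auto simp: straddles_def)
      then show False using e(2)[OF uv(1)] uv(2) by linarith
    qed
    then obtain e where e: "e > 0" "\<And>u v. straddles x e u v \<Longrightarrow> p' * (v - u) < f v - f u"
      using gap[OF p'(1) q(1) p'(3)] by blast
    have "p * (v - u) < f v - f u" if "straddles x e u v" for u v
    proof -
      have "p * (v - u) \<le> p' * (v - u)"
        using p'(2) that by (intro mult_right_mono) (auto simp: straddles_def)
      then show ?thesis using e(2)[OF that] by linarith
    qed
    then show ?thesis using e(1) by blast
  qed
  have "((\<lambda>y. (f y - f x) / (y - x)) \<longlongrightarrow> L) (at x)"
  proof (rule tendstoI)
    fix \<eta> :: real assume "\<eta> > 0"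
    obtain e1 where e1: "e1 > 0" "\<And>u v. straddles x e1 u v \<Longrightarrow> f v - f u < (L + \<eta>) * (v - u)"
      using up[of "L + \<eta>"] \<open>\<eta> > 0\<close> by auto
    obtain e2 where e2: "e2 > 0" "\<And>u v. straddles x e2 u v \<Longrightarrow> (L - \<eta>) * (v - u) < f v - f u"
      using down[of "L - \<eta>"] \<open>\<eta> > 0\<close> by auto
    have "dist ((f y - f x) / (y - x)) L < \<eta>" if y: "y \<noteq> x" "dist y x < min e1 e2" for y
    proof (cases "x < y")
      case True
      then have "(L - \<eta>) * (y - x) < f y - f x" "f y - f x < (L + \<eta>) * (y - x)"
        using y by (auto intro!: e1(2) e2(2) simp: dist_real_def straddles_def)
      then have "L - \<eta> < (f y - f x) / (y - x)" "(f y - f x) / (y - x) < L + \<eta>"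
        using True by (simp_all add: pos_less_divide_eq pos_divide_less_eq)
      then show ?thesis unfolding dist_real_def abs_less_iff by linarith
    next
      case False
      then have "y < x" using y by simp
      then have "(L - \<eta>) * (x - y) < f x - f y" "f x - f y < (L + \<eta>) * (x - y)"
        using y by (auto intro!: e1(2) e2(2) simp: dist_real_def straddles_def)
      moreover have "(f y - f x) / (y - x) = (f x - f y) / (x - y)"
        by (metis minus_diff_eq minus_divide_divide)
      ultimately have "L - \<eta> < (f y - f x) / (y - x)" "(f y - f x) / (y - x) < L + \<eta>"
        using \<open>y < x\<close> by (simp_all add: pos_less_divide_eq pos_divide_less_eq)
      then show ?thesis unfolding dist_real_def abs_less_iff by linarith
    qed
    then show "\<forall>\<^sub>F y in at x. dist ((f y - f x) / (y - x)) L < \<eta>"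
      unfolding eventually_at using e1(1) e2(1) by (intro exI[of _ "min e1 e2"]) auto
  qed
  then have "(f has_field_derivative L) (at x)" by (simp add: has_field_derivative_iff)
  then show ?thesis by (auto simp: has_real_derivative_iff_has_vector_derivative)
qed

text \<open>Testing the gap on rational pairs makes the exceptional set a countable union of null
  sets, together with the points of unbounded slope.\<close>

lemma ac_on_real_differentiable:
  fixes f :: "real \<Rightarrow> real"
  assumes ac: "ac_on a b f" and "a \<le> b"
    and bv: "\<And>d. d division_of \<Union>d \<Longrightarrow> \<Union>d \<subseteq> {a..b} \<Longrightarrow> (\<Sum>K\<in>d. norm (incr f K)) \<le> B"
  obtains N where "negligible N" "\<And>x. x \<in> {a<..<b} - N \<Longrightarrow> \<exists>L. (f has_vector_derivative L) (at x)"
proof -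
  define N0 where "N0 = {x \<in> {a<..<b}. \<forall>M. \<forall>e>0. \<exists>u v. straddles x e u v \<and> M * (v - u) \<le> \<bar>f v - f u\<bar>}"
  define N1 where "N1 p q = {x \<in> {a<..<b}. (\<forall>e>0. \<exists>u v. straddles x e u v \<and> f v - f u \<le> p * (v - u)) \<and>
      (\<forall>e>0. \<exists>u v. straddles x e u v \<and> q * (v - u) \<le> f v - f u)}" for p q
  define R where "R = {(p, q). p \<in> \<rat> \<and> q \<in> \<rat> \<and> p < (q::real)}"
  define N where "N = N0 \<union> (\<Union>(p, q)\<in>R. N1 p q)"
  have "countable R"
    by (rule countable_subset[of _ "\<rat> \<times> \<rat>"]) (auto simp: R_def countable_rat)
  moreover have "negligible (N1 p q)" if "p < q" for p q
    by (rule ac_ratio_gap_negligible[OF ac \<open>a \<le> b\<close> that]) (auto simp: N1_def)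
  ultimately have "negligible (\<Union>(p, q)\<in>R. N1 p q)"
    by (intro negligible_countable_Union countable_image) (auto simp: R_def)
  moreover have "negligible N0"
    by (rule unbounded_ratio_negligible[OF bv]) (auto simp: N0_def)
  ultimately have "negligible N" by (simp add: N_def negligible_Un)
  moreover have "\<exists>L. (f has_vector_derivative L) (at x)" if x: "x \<in> {a<..<b} - N" for x
  proof (rule derivative_from_ratios)
    have "\<not> (\<forall>M. \<forall>e>0. \<exists>u v. straddles x e u v \<and> M * (v - u) \<le> \<bar>f v - f u\<bar>)"
      using x by (simp add: N_def N0_def)
    then obtain M e where "e > 0" "\<not> (\<exists>u v. straddles x e u v \<and> M * (v - u) \<le> \<bar>f v - f u\<bar>)"
      by blast
    then show "\<exists>M. \<exists>e>0. \<forall>u v. straddles x e u v \<longrightarrow> \<bar>f v - f u\<bar> < M * (v - u)"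
      by - (rule exI[of _ M], rule exI[of _ e], auto simp flip: not_le)
  next
    fix p q :: real assume pq: "p \<in> \<rat>" "q \<in> \<rat>" "p < q"
    then have "x \<notin> N1 p q" using x by (auto simp: N_def R_def)
    then consider e where "e > 0" "\<not> (\<exists>u v. straddles x e u v \<and> f v - f u \<le> p * (v - u))"
      | e where "e > 0" "\<not> (\<exists>u v. straddles x e u v \<and> q * (v - u) \<le> f v - f u)"
      using x unfolding N1_def by auto
    then show "(\<exists>e>0. \<forall>u v. straddles x e u v \<longrightarrow> p * (v - u) < f v - f u) \<or>
      (\<exists>e>0. \<forall>u v. straddles x e u v \<longrightarrow> f v - f u < q * (v - u))"
    proof cases
      case (1 e)
      then show ?thesis by (intro disjI1 exI[of _ e]) (auto simp flip: not_le)
    next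
      case (2 e)
      then show ?thesis by (intro disjI2 exI[of _ e]) (auto simp flip: not_le)
    qed
  qed
  ultimately show thesis by (rule that)
qed

section \<open>The fundamental theorem of calculus for absolutely continuous functions\<close>

text \<open>In a gauge sum, members tagged outside \<open>N\<close> are controlled by
  differentiability at the tag, with error proportional to their length. Members tagged in
  \<open>N\<close> are confined to an open set of small measure, where absolute continuity bounds
  the increments; the integrand is replaced by 0 on \<open>N\<close>.\<close>

lemma has_integral_ac_on:
  fixes f D :: "real \<Rightarrow> complex"
  assumes ac: "ac_on a b f" and "a \<le> b" and N: "negligible N"
    and D: "\<And>x. x \<in> {a..b} - N \<Longrightarrow> (f has_vector_derivative D x) (at x within {a..b})"
  shows "(D has_integral (f b - f a)) {a..b}"
proof -
  define g where "g x = (if x \<in> N then 0 else D x)" for x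
  have "(g has_integral (f b - f a)) {a..b}"
    unfolding has_integral_real
  proof (intro allI impI)
    fix e :: real assume "e > 0"
    then have "e / 2 > 0" by simp
    obtain \<delta> where "\<delta> > 0" and \<delta>: "\<And>d. d division_of \<Union>d \<Longrightarrow> \<Union>d \<subseteq> {a..b} \<Longrightarrow>
       (\<Sum>K\<in>d. measure lebesgue K) < \<delta> \<Longrightarrow> (\<Sum>K\<in>d. norm (incr f K)) < e / 2"
      using ac_onE[OF ac \<open>e / 2 > 0\<close>] by blast
    have Nn: "N \<in> null_sets lebesgue" using N by (simp add: negligible_iff_null_sets)
    obtain U where U: "open U" "N \<subseteq> U" "U - N \<in> lmeasurable" "emeasure lebesgue (U - N) < ennreal \<delta>"
      using sets_lebesgue_outer_open[of N \<delta>] Nn \<open>\<delta> > 0\<close> by auto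
    have "U = (U - N) \<union> N" using U(2) by auto
    then have eU: "emeasure lebesgue U = emeasure lebesgue (U - N)"
      using emeasure_Un_null_set[of "U - N" lebesgue N] U(3) Nn by (metis fmeasurableD)
    have "U \<in> sets lebesgue" using U(1) by simp
    moreover have "emeasure lebesgue U < \<infinity>"
      unfolding eU infinity_ennreal_def by (rule less_trans[OF U(4) ennreal_less_top])
    ultimately have Um: "U \<in> lmeasurable" by (rule fmeasurableI)
    have mU: "measure lebesgue U < \<delta>"
      using U(4) Um \<open>\<delta> > 0\<close> unfolding eU[symmetric] by (simp add: emeasure_eq_measure2 ennreal_less_iff)
    define e' where "e' = e / (2 * (b - a) + 2)"
    have "e' > 0" using \<open>e > 0\<close> \<open>a \<le> b\<close> by (simp add: e'_def)
    have e'ab: "e' * (b - a) \<le> e / 2"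
      using \<open>e > 0\<close> \<open>a \<le> b\<close> by (simp add: e'_def field_simps)
    have "\<exists>d>0. x \<in> {a..b} - N \<longrightarrow>
        (\<forall>y\<in>{a..b}. norm (y - x) < d \<longrightarrow> norm (f y - f x - (y - x) *\<^sub>R D x) \<le> e' * norm (y - x))" for x
    proof (cases "x \<in> {a..b} - N")
      case True
      from D[OF this] show ?thesis
        using \<open>e' > 0\<close> unfolding has_vector_derivative_def has_derivative_within_alt by blast
    qed (auto intro: exI[of _ 1])
    then obtain r where r: "\<And>x. r x > 0" "\<And>x y. x \<in> {a..b} - N \<Longrightarrow> y \<in> {a..b} \<Longrightarrow> norm (y - x) < r x \<Longrightarrow>
        norm (f y - f x - (y - x) *\<^sub>R D x) \<le> e' * norm (y - x)"
      by metis
    \<comment> \<open>At points of \<open>N\<close> the gauge is the whole open set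
      \<open>U\<close>, so that all intervals tagged there have total length below \<delta>.\<close>
    define \<gamma> where "\<gamma> x = (if x \<in> N then U else ball x (r x))" for x
    have "gauge \<gamma>" using U(1,2) r(1) by (auto simp: gauge_def \<gamma>_def)
    moreover have "norm ((\<Sum>(x, k)\<in>p. measure lborel k *\<^sub>R g x) - (f b - f a)) < e"
      if p: "p tagged_division_of {a..b}" and fine: "\<gamma> fine p" for p
    proof -
      note pd = tagged_division_ofD[OF p]
      have "(\<Sum>(x, k)\<in>p. measure lborel k *\<^sub>R g x) - (f b - f a) =
          (\<Sum>(x, k)\<in>p. measure lborel k *\<^sub>R g x - incr f k)"
        unfolding additive_tagged_division_1[OF \<open>a \<le> b\<close> p, of f, symmetric]
        by (simp add: sum_subtractf[symmetric] case_prod_unfold incr_def)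
      also have "norm \<dots> \<le> (\<Sum>(x, k)\<in>p. norm (measure lborel k *\<^sub>R g x - incr f k))"
        by (rule order_trans[OF norm_sum]) (simp add: case_prod_unfold)
      also have "\<dots> \<le> (\<Sum>(x, k)\<in>p. e' * measure lborel k + (if x \<in> N then norm (incr f k) else 0))"
      proof (rule sum_mono, clarify)
        fix x k assume xk: "(x, k) \<in> p"
        obtain u v where uv: "k = {u..v}" "u \<le> x" "x \<le> v"
          using pd(2)[OF xk] pd(4)[OF xk] by auto
        have ab: "{u..v} \<subseteq> {a..b}" using pd(3)[OF xk] uv by simp
        show "norm (measure lborel k *\<^sub>R g x - incr f k) \<le>
            e' * measure lborel k + (if x \<in> N then norm (incr f k) else 0)"
        proof (cases "x \<in> N")
          case True
          then show ?thesis using \<open>e' > 0\<close> by (simp add: g_def)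
        next
          case False
          have x: "x \<in> {a..b} - N" "u \<in> {a..b}" "v \<in> {a..b}" using ab uv False by auto
          have "{u..v} \<subseteq> ball x (r x)" using bspec[OF fine[unfolded fine_def] xk] False uv(1) by (simp add: \<gamma>_def)
          then have "u \<in> ball x (r x)" "v \<in> ball x (r x)"
            by (rule subsetD, use uv in simp)+
          then have "norm (u - x) < r x" "norm (v - x) < r x" by (auto simp: dist_real_def)
          then have "norm (f u - f x - (u - x) *\<^sub>R D x) \<le> e' * norm (u - x)"
            "norm (f v - f x - (v - x) *\<^sub>R D x) \<le> e' * norm (v - x)"
            using r(2)[OF x(1)] x by blast+
          then have "norm ((f u - f x - (u - x) *\<^sub>R D x) - (f v - f x - (v - x) *\<^sub>R D x)) \<le> e' * (x - u) + e' * (v - x)"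
            using uv norm_triangle_ineq4[of "f u - f x - (u - x) *\<^sub>R D x" "f v - f x - (v - x) *\<^sub>R D x"]
            by simp
          moreover have "(f u - f x - (u - x) *\<^sub>R D x) - (f v - f x - (v - x) *\<^sub>R D x) = (v - u) *\<^sub>R D x - (f v - f u)"
            by (simp add: algebra_simps)
          ultimately show ?thesis
            using False uv by (simp add: g_def algebra_simps)
        qed
      qed
      also have "\<dots> = e' * (\<Sum>(x, k)\<in>p. measure lborel k) + (\<Sum>(x, k)\<in>p. if x \<in> N then norm (incr f k) else 0)"
        by (simp add: case_prod_unfold sum.distrib sum_distrib_left)
      also have "(\<Sum>(x, k)\<in>p. measure lborel k) = b - a"
        using additive_content_tagged_division[of p a b] p \<open>a \<le> b\<close> by simp
      also have "(\<Sum>(x, k)\<in>p. if x \<in> N then norm (incr f k) else 0) = (\<Sum>(x, k)\<in>{xk\<in>p. fst xk \<in> N}. norm (incr f k))"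
        using pd(1) by (simp add: case_prod_unfold sum.inter_filter)
      also have "\<dots> < e / 2"
      proof -
        let ?q = "{xk\<in>p. fst xk \<in> N}"
        have qp: "?q tagged_partial_division_of {a..b}"
          using tagged_partial_division_subset[of p "{a..b}" ?q] p by (auto simp: tagged_division_of_def)
        then have q: "?q tagged_division_of \<Union>(snd ` ?q)"
          by (rule tagged_partial_division_of_Union_self)
        \<comment> \<open>Passing from a sum over tags to a sum over intervals requires a function
          that vanishes on degenerate intervals, the empty one included; \<open>?n\<close> corrects
          \<open>incr\<close> at the empty set.\<close>
        let ?n = "\<lambda>k. if k = {} then 0 else norm (incr f k)"
        have ne: "k \<noteq> {}" if k: "k \<in> snd ` ?q" for k
        proof -
          obtain x where "(x, k) \<in> p" using k by auto
          from pd(2)[OF this] show ?thesis by auto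
        qed
        have "(\<Sum>(x, k)\<in>?q. norm (incr f k)) = (\<Sum>(x, k)\<in>?q. ?n k)"
          by (intro sum.cong refl) (use ne[OF imageI] in \<open>simp add: case_prod_unfold\<close>)
        also have "\<dots> = (\<Sum>k\<in>snd ` ?q. ?n k)"
          by (rule sum.over_tagged_division_lemma[OF q]) (auto simp: incr_def)
        also have "\<dots> = (\<Sum>k\<in>snd ` ?q. norm (incr f k))"
          by (rule sum.cong) (use ne in auto)
        finally have "(\<Sum>(x, k)\<in>?q. norm (incr f k)) = (\<Sum>k\<in>snd ` ?q. norm (incr f k))" .
        also have "\<dots> < e / 2"
        proof (rule \<delta>)
          show d: "snd ` ?q division_of \<Union>(snd ` ?q)" by (rule division_of_tagged_division[OF q])
          have sub: "k \<subseteq> {a..b} \<and> k \<subseteq> U" if k: "k \<in> snd ` ?q" for k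
          proof -
            obtain x where x: "(x, k) \<in> p" "x \<in> N" using k by auto
            then show ?thesis
              using pd(3)[OF x(1)] bspec[OF fine[unfolded fine_def] x(1)] by (simp add: \<gamma>_def)
          qed
          then show "\<Union>(snd ` ?q) \<subseteq> {a..b}" by blast
          have "\<Union>(snd ` ?q) \<subseteq> U" using sub by blast
          then have "measure lebesgue (\<Union>(snd ` ?q)) \<le> measure lebesgue U"
            using Um measure_division(2)[OF d] by (intro measure_mono_fmeasurable) (auto simp: fmeasurableD)
          then show "(\<Sum>K\<in>snd ` ?q. measure lebesgue K) < \<delta>"
            using mU measure_division(1)[OF d] by simp
        qed
        finally show ?thesis .
      qed
      finally show ?thesis using e'ab by simp
    qed
    ultimately show "\<exists>\<gamma>. gauge \<gamma> \<and> (\<forall>\<D>. \<D> tagged_division_of {a..b} \<and> \<gamma> fine \<D> \<longrightarrow>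
        norm ((\<Sum>(x, k)\<in>\<D>. measure lborel k *\<^sub>R g x) - (f b - f a)) < e)"
      by - (rule exI[of _ \<gamma>], rule conjI, assumption, intro allI impI, elim conjE, simp)
  qed
  then show ?thesis
    by (rule has_integral_spike[OF N, rotated]) (simp add: g_def)
qed

lemma ac_on_complex_differentiable:
  fixes f :: "real \<Rightarrow> complex"
  assumes ac: "ac_on a b f" and "a \<le> b"
    and bv: "\<And>d. d division_of \<Union>d \<Longrightarrow> \<Union>d \<subseteq> {a..b} \<Longrightarrow> (\<Sum>K\<in>d. norm (incr f K)) \<le> B"
  obtains N where "negligible N" "\<And>x. x \<in> {a<..<b} - N \<Longrightarrow> \<exists>L. (f has_vector_derivative L) (at x)"
proof -
  have part: "\<exists>N. negligible N \<and> (\<forall>x\<in>{a<..<b} - N. \<exists>L. (g has_vector_derivative L) (at x))"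
    if le: "\<And>x y. norm (g y - g x) \<le> norm (f y - f x)" for g :: "real \<Rightarrow> real"
  proof -
    have "(\<Sum>K\<in>d. norm (incr g K)) \<le> B" if "d division_of \<Union>d" "\<Union>d \<subseteq> {a..b}" for d
      by (rule order_trans[OF _ bv[OF that]]) (unfold incr_def, intro sum_mono le)
    then obtain N where "negligible N" "\<And>x. x \<in> {a<..<b} - N \<Longrightarrow> \<exists>L. (g has_vector_derivative L) (at x)"
      using ac_on_real_differentiable[OF ac_on_mono[OF ac le] \<open>a \<le> b\<close>, of B] by metis
    then show ?thesis by blast
  qed
  obtain N1 where N1: "negligible N1" "\<forall>x\<in>{a<..<b} - N1. \<exists>L. ((\<lambda>x. Re (f x)) has_vector_derivative L) (at x)"
    using part[of "\<lambda>x. Re (f x)"] abs_Re_le_cmod by (metis minus_complex.simps(1) real_norm_def)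
  obtain N2 where N2: "negligible N2" "\<forall>x\<in>{a<..<b} - N2. \<exists>L. ((\<lambda>x. Im (f x)) has_vector_derivative L) (at x)"
    using part[of "\<lambda>x. Im (f x)"] abs_Im_le_cmod by (metis minus_complex.simps(2) real_norm_def)
  show thesis
  proof (rule that[of "N1 \<union> N2"])
    show "negligible (N1 \<union> N2)" using N1 N2 by (simp add: negligible_Un)
    fix x assume x: "x \<in> {a<..<b} - (N1 \<union> N2)"
    obtain L1 where L1: "((\<lambda>x. Re (f x)) has_vector_derivative L1) (at x)" using N1(2) x by blast
    obtain L2 where L2: "((\<lambda>x. Im (f x)) has_vector_derivative L2) (at x)" using N2(2) x by blast
    have "((\<lambda>x. complex_of_real (Re (f x)) + \<i> * complex_of_real (Im (f x)))
        has_vector_derivative (complex_of_real L1 + \<i> * complex_of_real L2)) (at x)"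
      by (intro has_vector_derivative_add has_vector_derivative_mult_right has_vector_derivative_of_real
          L1[folded has_real_derivative_iff_has_vector_derivative]
          L2[folded has_real_derivative_iff_has_vector_derivative])
    then show "\<exists>L. (f has_vector_derivative L) (at x)"
      by (auto simp: complex_eq[symmetric])
  qed
qed

text \<open>Differentiability almost everywhere needs bounded variation. The interval is cut into
  cells shorter than the \<delta> that belongs to increment sum 1, so that the variation on each
  cell is at most 1.\<close>

lemma abs_continuous_FTC:
  assumes ac: "abs_continuous_on 0 T f" and "0 < T"
  obtains N where "negligible N"
    "\<And>x. x \<in> {0<..<T} - N \<Longrightarrow> (f has_vector_derivative tderiv T f x) (at x)"
    "tderiv T f absolutely_integrable_on {0..T}"
    "\<And>t. t \<in> {0..T} \<Longrightarrow> (tderiv T f has_integral (f t - f 0)) {0..t}"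
proof -
  let ?D = "tderiv T f"
  note ac' = abs_continuous_imp_ac_on[OF ac]
  obtain \<delta> where "\<delta> > 0" and \<delta>: "\<And>d. d division_of \<Union>d \<Longrightarrow> \<Union>d \<subseteq> {0..T} \<Longrightarrow>
     (\<Sum>K\<in>d. measure lebesgue K) < \<delta> \<Longrightarrow> (\<Sum>K\<in>d. norm (incr f K)) < 1"
    by (rule ac_onE[OF ac' zero_less_one]) blast
  obtain n :: nat where "n > 0" and n: "T < \<delta> * n"
  proof -
    obtain n where "T / \<delta> < real n" using reals_Archimedean2 by blast
    moreover have "0 < T / \<delta>" using \<open>\<delta> > 0\<close> \<open>0 < T\<close> by simp
    ultimately show thesis
      using that[of n] \<open>\<delta> > 0\<close> \<open>0 < T\<close> by (cases "n = 0") (auto simp: field_simps)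
  qed
  define h where "h = T / n"
  have h: "0 < h" "h < \<delta>" using \<open>n > 0\<close> \<open>0 < T\<close> n by (auto simp: field_simps h_def)
  \<comment> \<open>The indices run up to \<open>n\<close> inclusive: the last cell degenerates to
    the point \<open>T\<close> and takes care of the right end.\<close>
  define a b where "a i = real i * h" and "b i = min T (real i * h + h)" for i :: nat
  have ab: "0 \<le> a i" "a i \<le> b i" "b i \<le> T" "b i - a i < \<delta>" if "i \<le> n" for i
  proof -
    have "real i * T \<le> real n * T" using that \<open>0 < T\<close> by (intro mult_right_mono) auto
    then have "real i * h \<le> T" using \<open>n > 0\<close> by (simp add: field_simps h_def)
    moreover have "0 \<le> real i * h" using h by simp
    ultimately show "0 \<le> a i" "a i \<le> b i" "b i \<le> T" "b i - a i < \<delta>"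
      using h unfolding a_def b_def by linarith+
  qed
  have bv: "(\<Sum>K\<in>d. norm (incr f K)) \<le> 1" if i: "i \<le> n" and d: "d division_of \<Union>d" "\<Union>d \<subseteq> {a i..b i}" for i d
  proof -
    have "measure lebesgue (\<Union>d) \<le> measure lebesgue {a i..b i}"
      using d measure_division(2)[OF d(1)] by (intro measure_mono_fmeasurable) (auto simp: fmeasurableD)
    then have "(\<Sum>K\<in>d. measure lebesgue K) < \<delta>"
      using ab[OF i] measure_division(1)[OF d(1)] by simp
    moreover have "{a i..b i} \<subseteq> {0..T}" using ab[OF i] by simp
    ultimately show ?thesis using \<delta>[OF d(1) subset_trans[OF d(2)]] by simp
  qed
  have cover: "\<exists>i\<le>n. a i \<le> x \<and> x \<le> b i" if x: "0 \<le> x" "x \<le> T" for x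
  proof (intro exI conjI)
    let ?i = "nat \<lfloor>x / h\<rfloor>"
    have "0 \<le> x / h" using x h by simp
    then have fl: "real ?i \<le> x / h" "x / h < real ?i + 1" by linarith+
    then have fl': "real ?i * h \<le> x" "x < (real ?i + 1) * h"
      using pos_le_divide_eq[OF h(1), of "real ?i" x] pos_divide_less_eq[OF h(1), of x "real ?i + 1"] by simp_all
    then show "a ?i \<le> x" "x \<le> b ?i" using x(2) by (simp_all add: a_def b_def algebra_simps)
    have "x / h \<le> n" using x(2) \<open>0 < T\<close> \<open>n > 0\<close> by (simp add: field_simps h_def)
    then show "?i \<le> n" using fl(1) by linarith
  qed
  have "\<exists>N. negligible N \<and> (\<forall>x\<in>{a i<..<b i} - N. \<exists>L. (f has_vector_derivative L) (at x))" if i: "i \<le> n" for i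
    by (rule ac_on_complex_differentiable[OF ac_on_subset[OF ac' ab(1,3)[OF i]] ab(2)[OF i] bv[OF i]]) blast+
  then obtain N where N: "\<And>i. i \<le> n \<Longrightarrow> negligible (N i)"
    "\<And>i x. i \<le> n \<Longrightarrow> x \<in> {a i<..<b i} - N i \<Longrightarrow> \<exists>L. (f has_vector_derivative L) (at x)"
    by metis
  \<comment> \<open>Cell end points are discarded so that every other point is interior to a cell,
    and \<open>0\<close> and \<open>T\<close> so that the derivative within \<open>{0..T}\<close> is
    the two-sided one.\<close>
  define M where "M = (\<Union>i\<le>n. N i \<union> {a i, b i}) \<union> {0, T}"
  have M: "negligible M" unfolding M_def
    by (intro negligible_Un negligible_Union) (auto simp: N(1) negligible_Un)
  have D: "(f has_vector_derivative ?D x) (at x)" if x: "x \<in> {0..T} - M" for x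
  proof -
    obtain i where i: "i \<le> n" "a i \<le> x" "x \<le> b i" using cover[of x] x by auto
    then have "x \<in> {a i<..<b i} - N i" using x by (auto simp: M_def less_le)
    then obtain L where L: "(f has_vector_derivative L) (at x)" using N(2)[OF i(1)] by blast
    have "at x within {0..T} = at x" using x by (intro at_within_interior) (auto simp: M_def less_le)
    then have "?D x = L" using L by (simp add: tderiv_def vector_derivative_at)
    then show ?thesis using L by simp
  qed
  have int: "(?D has_integral (f v - f u)) {u..v}" if "0 \<le> u" "u \<le> v" "v \<le> T" for u v
    by (rule has_integral_ac_on[OF ac_on_subset[OF ac' that(1,3)] that(2) M])
       (use that in \<open>auto intro!: has_vector_derivative_at_within D\<close>)
  \<comment> \<open>The indefinite integral of \<open>?D\<close> is \<open>f\<close> up to a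
    constant; its bounded variation upgrades gauge integrability to absolute integrability.\<close>
  have cell: "?D absolutely_integrable_on {a i..b i}" if i: "i \<le> n" for i
  proof -
    have "?D absolutely_integrable_on cbox (a i) (b i)"
    proof (rule bounded_variation_absolutely_integrable_interval)
      show "?D integrable_on cbox (a i) (b i)" using int[OF ab(1-3)[OF i]] by (auto simp: integrable_on_def)
      fix d assume d: "d division_of cbox (a i) (b i)"
      have "(\<Sum>K\<in>d. norm (integral K ?D)) = (\<Sum>K\<in>d. norm (incr f K))"
      proof (rule sum.cong)
        fix K assume K: "K \<in> d"
        obtain u v where uv: "u \<le> v" "K = {u..v}" using division_interval[OF d K] .
        then have "{u..v} \<subseteq> {a i..b i}" using division_ofD(2)[OF d K] by simp
        then have "(?D has_integral (f v - f u)) {u..v}" using ab(1-3)[OF i] uv by (intro int) auto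
        then show "norm (integral K ?D) = norm (incr f K)" using uv by (simp add: integral_unique)
      qed simp
      also have "\<dots> \<le> 1"
        using d division_ofD(6)[OF d] by (intro bv[OF i]) auto
      finally show "(\<Sum>K\<in>d. norm (integral K ?D)) \<le> 1" .
    qed
    then show ?thesis by simp
  qed
  have "set_integrable lebesgue (\<Union>i\<in>{..n}. {a i..b i}) ?D"
    by (rule set_integrable_UN) (use cell in auto)
  then have "?D absolutely_integrable_on {0..T}"
    by (rule set_integrable_subset) (use cover in \<open>auto simp: Bex_def\<close>)
  then show thesis
    by (intro that[of M] M D int) auto
qed

section \<open>Mittag-Leffler functions\<close>

section \<open>Mittag-Leffler functions\<close>

text \<open>The quotient is \<open>Beta x \<alpha> / Gamma \<alpha>\<close>, Beta decreases in its
  second argument, and \<open>Beta x 1 = 1 / x\<close>. This replaces an asymptotic formula for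
  Gamma.\<close>

lemma Gamma_ratio_bound:
  fixes x \<alpha> :: real
  assumes "0 < x" "1 \<le> \<alpha>"
  shows "Gamma x / Gamma (x + \<alpha>) \<le> 1 / (x * Gamma \<alpha>)"
proof -
  have "Beta x \<alpha> \<le> Beta x 1"
    using assms by (intro Beta_real_mono) auto
  also have "Beta x 1 = 1 / x"
  proof -
    have "x \<notin> \<int>\<^sub>\<le>\<^sub>0" using assms(1) by (auto elim!: nonpos_Ints_cases)
    then show ?thesis using assms(1) Gamma_plus1[of x] by (simp add: Beta_def Gamma_eq_zero_iff)
  qed
  finally show ?thesis
    using assms Gamma_real_pos[of \<alpha>] by (simp add: Beta_def field_simps)
qed

lemma mittag_leffler_summable:
  fixes z :: complex
  assumes "1 \<le> \<alpha>" "0 < \<beta>"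
  shows "summable (\<lambda>k. norm (z ^ k / of_real (Gamma (\<alpha> * real k + \<beta>))))"
proof -
  let ?f = "\<lambda>k. norm z ^ k / Gamma (\<alpha> * real k + \<beta>)"
  have pos: "0 < \<alpha> * real k + \<beta>" for k using assms by (intro add_nonneg_pos) auto
  have G: "0 < Gamma (\<alpha> * real k + \<beta>)" for k using pos[of k] by (rule Gamma_real_pos)
  \<comment> \<open>From \<open>N\<close> on, \<open>\<alpha> * real k + \<beta>\<close> exceeds
    \<open>2 * norm z / Gamma \<alpha>\<close>, which brings the ratio of consecutive terms below
    one half.\<close>
  obtain N :: nat where N: "2 * norm z / Gamma \<alpha> < real N" using reals_Archimedean2 by blast
  have "summable ?f"
  proof (rule summable_ratio_test[of "1/2" N])
    fix k assume k: "k \<ge> N"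
    let ?x = "\<alpha> * real k + \<beta>"
    have A: "Gamma ?x / Gamma (?x + \<alpha>) \<le> 1 / (?x * Gamma \<alpha>)"
      using pos assms by (intro Gamma_ratio_bound)
    have "real N < ?x" using k assms mult_mono[of 1 \<alpha> "real N" "real k"] by linarith
    then have "2 * norm z \<le> ?x * Gamma \<alpha>"
      using N assms pos_divide_less_eq[of "Gamma \<alpha>" "2 * norm z" ?x] Gamma_real_pos[of \<alpha>]
      by simp
    then have "norm z * (1 / (?x * Gamma \<alpha>)) \<le> 1/2"
    proof -
      have "0 < ?x * Gamma \<alpha>" using pos[of k] assms Gamma_real_pos[of \<alpha>] by simp
      then have "norm z / (?x * Gamma \<alpha>) \<le> 1/2"
        using \<open>2 * norm z \<le> ?x * Gamma \<alpha>\<close> pos_divide_le_eq[of "?x * Gamma \<alpha>" "norm z" "1/2"] by linarith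
      then show ?thesis by simp
    qed
    with mult_left_mono[OF A norm_ge_zero[of z]]
    have *: "norm z * (Gamma ?x / Gamma (?x + \<alpha>)) \<le> 1/2" by linarith
    have "?f (Suc k) = norm z * (Gamma ?x / Gamma (?x + \<alpha>)) * ?f k"
      using G[of k] by (simp add: field_simps)
    also have "\<dots> \<le> 1/2 * ?f k"
      using * G[of k] by (intro mult_right_mono) auto
    finally have "?f (Suc k) \<le> 1/2 * ?f k" .
    then show "norm (?f (Suc k)) \<le> 1/2 * norm (?f k)"
      using G[of k] G[of "Suc k"] by (simp add: abs_of_pos)
  qed simp
  then show ?thesis using G by (simp add: norm_divide norm_power abs_of_pos)
qed

lemma mittag_leffler_sums:
  assumes "1 \<le> \<alpha>" "0 < \<beta>"
  shows "(\<lambda>k. z ^ k / of_real (Gamma (\<alpha> * real k + \<beta>))) sums mittag_leffler \<alpha> \<beta> z"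
  unfolding mittag_leffler_def
  by (rule summable_sums, rule summable_norm_cancel, rule mittag_leffler_summable[OF assms])

lemma mittag_leffler_0: "mittag_leffler \<alpha> \<beta> 0 = 1 / of_real (Gamma \<beta>)"
  unfolding mittag_leffler_def
  by (subst suminf_finite[of "{0}"]) auto

definition mittag_leffler_deriv :: "real \<Rightarrow> real \<Rightarrow> complex \<Rightarrow> complex" where
  "mittag_leffler_deriv \<alpha> \<beta> z = (\<Sum>k. diffs (\<lambda>k. 1 / of_real (Gamma (\<alpha> * real k + \<beta>))) k * z ^ k)"

lemma mittag_leffler_has_field_derivative:
  assumes "1 \<le> \<alpha>" "0 < \<beta>"
  shows "(mittag_leffler \<alpha> \<beta> has_field_derivative mittag_leffler_deriv \<alpha> \<beta> z) (at z)"
proof -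
  let ?c = "\<lambda>k. 1 / of_real (Gamma (\<alpha> * real k + \<beta>)) :: complex"
  have "summable (\<lambda>k. ?c k * y ^ k)" for y
    using summable_norm_cancel[OF mittag_leffler_summable[OF assms, of y]] by simp
  from termdiffs_strong_converges_everywhere[OF this]
  show ?thesis
    by (simp add: mittag_leffler_def[abs_def] mittag_leffler_deriv_def)
qed

lemma mittag_leffler_deriv_sums:
  assumes "1 \<le> \<alpha>" "0 < \<beta>"
  shows "(\<lambda>k. of_nat (Suc k) * z ^ k / of_real (Gamma (\<alpha> * real (Suc k) + \<beta>)))
    sums mittag_leffler_deriv \<alpha> \<beta> z"
proof -
  let ?c = "\<lambda>k. 1 / of_real (Gamma (\<alpha> * real k + \<beta>)) :: complex"
  have "summable (\<lambda>k. ?c k * y ^ k)" for y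
    using summable_norm_cancel[OF mittag_leffler_summable[OF assms, of y]] by simp
  then have "summable (\<lambda>k. diffs ?c k * z ^ k)"
    by (intro termdiff_converges_all)
  from summable_sums[OF this] show ?thesis
    by (simp add: mittag_leffler_deriv_def diffs_def mult.commute)
qed

text \<open>The coefficient of \<open>z ^ k\<close> on the left carries the factor
  \<open>\<alpha> * k + \<beta> - 1\<close>, which the functional equation of Gamma absorbs. This is
  the identity behind the derivative of \<open>ml\<close>.\<close>

lemma mittag_leffler_deriv_lower:
  assumes "1 \<le> \<alpha>" "1 < \<beta>"
  shows "of_real (\<beta> - 1) * mittag_leffler \<alpha> \<beta> z + of_real \<alpha> * (z * mittag_leffler_deriv \<alpha> \<beta> z)
    = mittag_leffler \<alpha> (\<beta> - 1) z"
proof -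
  let ?G = "\<lambda>k. of_real (Gamma (\<alpha> * real k + \<beta>)) :: complex"
  have "(\<lambda>k. z * (of_nat (Suc k) * z ^ k / of_real (Gamma (\<alpha> * real (Suc k) + \<beta>)))) sums
      (z * mittag_leffler_deriv \<alpha> \<beta> z)"
    using assms by (intro sums_mult mittag_leffler_deriv_sums) auto
  then have "(\<lambda>k. of_nat (Suc k) * z ^ Suc k / ?G (Suc k)) sums (z * mittag_leffler_deriv \<alpha> \<beta> z)"
    by (simp add: mult_ac)
  then have "(\<lambda>k. of_nat k * z ^ k / ?G k) sums (z * mittag_leffler_deriv \<alpha> \<beta> z)"
    by (subst (asm) sums_Suc_iff) simp
  then have "(\<lambda>k. of_real (\<beta> - 1) * (z ^ k / ?G k) + of_real \<alpha> * (of_nat k * z ^ k / ?G k)) sums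
      (of_real (\<beta> - 1) * mittag_leffler \<alpha> \<beta> z + of_real \<alpha> * (z * mittag_leffler_deriv \<alpha> \<beta> z))"
    using assms by (intro sums_add sums_mult mittag_leffler_sums) auto
  moreover have "of_real (\<beta> - 1) * (z ^ k / ?G k) + of_real \<alpha> * (of_nat k * z ^ k / ?G k) =
      z ^ k / of_real (Gamma (\<alpha> * real k + (\<beta> - 1)))" for k
  proof -
    let ?x = "\<alpha> * real k + (\<beta> - 1)"
    have x: "0 < ?x" using assms by (intro add_nonneg_pos) auto
    have "Gamma (\<alpha> * real k + \<beta>) = ?x * Gamma ?x"
      using Gamma_plus1[of ?x] x by (simp add: nonpos_Ints_def algebra_simps)
    then have G: "?G k = of_real ?x * of_real (Gamma ?x)" by simp
    have "of_real (\<beta> - 1) * (z ^ k / ?G k) + of_real \<alpha> * (of_nat k * z ^ k / ?G k) =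
        of_real ?x * z ^ k / ?G k"
      by (simp add: add_divide_distrib[symmetric] algebra_simps)
    also have "\<dots> = z ^ k / of_real (Gamma ?x)"
      unfolding G using x by (metis mult_divide_mult_cancel_left of_real_eq_0_iff order_less_irrefl)
    finally show ?thesis .
  qed
  ultimately have "(\<lambda>k. z ^ k / of_real (Gamma (\<alpha> * real k + (\<beta> - 1)))) sums
      (of_real (\<beta> - 1) * mittag_leffler \<alpha> \<beta> z + of_real \<alpha> * (z * mittag_leffler_deriv \<alpha> \<beta> z))"
    by simp
  then show ?thesis
    using sums_unique2 mittag_leffler_sums[of \<alpha> "\<beta> - 1" z] assms by fastforce
qed

text \<open>Complements the preceding identity at \<beta> = 1, where lowering would lead to
  parameter 0; here the factor \<open>k + 1\<close> of the termwise derivative is absorbed by Gamma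
  after an index shift.\<close>

lemma mittag_leffler_deriv_1:
  assumes "1 \<le> \<alpha>"
  shows "of_real \<alpha> * mittag_leffler_deriv \<alpha> 1 z = mittag_leffler \<alpha> \<alpha> z"
proof -
  have "(\<lambda>k. of_real \<alpha> * (of_nat (Suc k) * z ^ k / of_real (Gamma (\<alpha> * real (Suc k) + 1)))) sums
      (of_real \<alpha> * mittag_leffler_deriv \<alpha> 1 z)"
    using assms by (intro sums_mult mittag_leffler_deriv_sums) auto
  moreover have "of_real \<alpha> * (of_nat (Suc k) * z ^ k / of_real (Gamma (\<alpha> * real (Suc k) + 1))) =
      z ^ k / of_real (Gamma (\<alpha> * real k + \<alpha>))" for k
  proof -
    let ?x = "\<alpha> * real (Suc k)"
    have x: "0 < ?x" using assms by simp
    have "of_real (Gamma (?x + 1)) = (of_real ?x * of_real (Gamma ?x) :: complex)"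
      using Gamma_plus1[of ?x] x by (simp add: nonpos_Ints_def del: of_nat_Suc)
    then have "of_real \<alpha> * (of_nat (Suc k) * z ^ k / of_real (Gamma (?x + 1))) =
        of_real ?x * z ^ k / (of_real ?x * of_real (Gamma ?x))"
      by simp
    also have "\<dots> = z ^ k / of_real (Gamma ?x)"
      using x by (metis mult_divide_mult_cancel_left of_real_eq_0_iff order_less_irrefl)
    finally have "of_real \<alpha> * (of_nat (Suc k) * z ^ k / of_real (Gamma (?x + 1))) =
      z ^ k / of_real (Gamma ?x)" .
    moreover have "\<alpha> * real k + \<alpha> = ?x" by (simp add: algebra_simps)
    ultimately show ?thesis by simp
  qed
  ultimately show ?thesis
    using sums_unique2 mittag_leffler_sums[of \<alpha> \<alpha> z] assms by fastforce
qed

lemma continuous_on_mittag_leffler: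
  assumes "1 \<le> \<alpha>" "0 < \<beta>"
  shows "continuous_on S (mittag_leffler \<alpha> \<beta>)"
  by (intro continuous_at_imp_continuous_on ballI
      DERIV_isCont[OF mittag_leffler_has_field_derivative[OF assms]])

section \<open>Mittag-Leffler functions of time: derivatives and fractional integrals\<close>

text \<open>With this normalisation differentiation in time lowers \<beta> by one, the fractional
  integral of order \<gamma> raises it by \<gamma>, and the Laplace transform is an elementary
  quotient of powers.\<close>

definition ml :: "real \<Rightarrow> real \<Rightarrow> complex \<Rightarrow> real \<Rightarrow> complex" where
  "ml \<alpha> \<beta> \<mu> t = (t powr (\<beta> - 1)) *\<^sub>R mittag_leffler \<alpha> \<beta> (\<mu> * of_real (t powr \<alpha>))"

lemma continuous_on_ml:
  assumes "1 \<le> \<alpha>" "1 < \<beta>"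
  shows "continuous_on {0..} (ml \<alpha> \<beta> \<mu>)"
  unfolding ml_def using assms
  by (intro continuous_intros continuous_on_powr'
      continuous_on_compose2[OF continuous_on_mittag_leffler[of \<alpha> \<beta> UNIV]]) auto

lemma ml_has_vector_derivative:
  assumes "1 \<le> \<alpha>" "1 < \<beta>" "0 < t"
  shows "(ml \<alpha> \<beta> \<mu> has_vector_derivative ml \<alpha> (\<beta> - 1) \<mu> t) (at t)"
proof -
  let ?E = "mittag_leffler \<alpha> \<beta>" and ?E' = "mittag_leffler_deriv \<alpha> \<beta>"
  let ?z = "\<mu> * of_real (t powr \<alpha>)"
  have "((\<lambda>t. t powr \<alpha>) has_real_derivative \<alpha> * t powr (\<alpha> - 1)) (at t)"
    using assms(3) by (rule has_real_derivative_powr)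
  then have "((\<lambda>t. \<mu> * of_real (t powr \<alpha>)) has_vector_derivative
      \<mu> * of_real (\<alpha> * t powr (\<alpha> - 1))) (at t)"
    by (intro has_vector_derivative_mult_right has_vector_derivative_of_real)
  then have "(?E \<circ> (\<lambda>t. \<mu> * of_real (t powr \<alpha>)) has_vector_derivative
      \<mu> * of_real (\<alpha> * t powr (\<alpha> - 1)) * ?E' ?z) (at t)"
    using assms by (intro field_vector_diff_chain_at mittag_leffler_has_field_derivative) auto
  moreover have "((\<lambda>t. t powr (\<beta> - 1)) has_real_derivative (\<beta> - 1) * t powr (\<beta> - 1 - 1)) (at t)"
    using assms(3) by (rule has_real_derivative_powr)
  ultimately have "(ml \<alpha> \<beta> \<mu> has_vector_derivative
      t powr (\<beta> - 1) *\<^sub>R (\<mu> * of_real (\<alpha> * t powr (\<alpha> - 1)) * ?E' ?z)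
      + ((\<beta> - 1) * t powr (\<beta> - 1 - 1)) *\<^sub>R ?E ?z) (at t)"
    unfolding ml_def[abs_def] comp_def by (intro has_vector_derivative_scaleR)
  moreover have "t powr (\<beta> - 1) *\<^sub>R (\<mu> * of_real (\<alpha> * t powr (\<alpha> - 1)) * ?E' ?z)
      + ((\<beta> - 1) * t powr (\<beta> - 1 - 1)) *\<^sub>R ?E ?z = ml \<alpha> (\<beta> - 1) \<mu> t"
  proof -
    have p: "t powr (\<beta> - 1) * t powr (\<alpha> - 1) = t powr (\<beta> - 1 - 1) * t powr \<alpha>"
      by (simp add: powr_add[symmetric] algebra_simps)
    have "t powr (\<beta> - 1) *\<^sub>R (\<mu> * of_real (\<alpha> * t powr (\<alpha> - 1)) * ?E' ?z) =
        of_real (t powr (\<beta> - 1) * t powr (\<alpha> - 1)) * (of_real \<alpha> * (\<mu> * ?E' ?z))"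
      by (simp add: scaleR_conv_of_real mult_ac)
    also have "\<dots> = of_real (t powr (\<beta> - 1 - 1)) * (of_real \<alpha> * (?z * ?E' ?z))"
      unfolding p by (simp add: mult_ac)
    finally show ?thesis
      unfolding ml_def mittag_leffler_deriv_lower[OF assms(1,2), symmetric]
      by (simp add: scaleR_conv_of_real algebra_simps)
  qed
  ultimately show ?thesis by simp
qed

text \<open>Kept apart from \<open>ml \<alpha> 1\<close> because \<open>0 powr 0 = 0\<close> would
  give the latter the value 0 instead of 1 at the origin.\<close>

definition mlc :: "real \<Rightarrow> complex \<Rightarrow> real \<Rightarrow> complex" where
  "mlc \<alpha> \<mu> t = mittag_leffler \<alpha> 1 (\<mu> * of_real (t powr \<alpha>))"

lemma mlc_eq_ml: "t \<noteq> 0 \<Longrightarrow> mlc \<alpha> \<mu> t = ml \<alpha> 1 \<mu> t"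
  by (simp add: ml_def mlc_def)

lemma mlc_0 [simp]: "mlc \<alpha> \<mu> 0 = 1"
  by (simp add: mlc_def mittag_leffler_0)

lemma ml_0 [simp]: "ml \<alpha> \<beta> \<mu> 0 = 0"
  by (simp add: ml_def)

lemma mlc_has_vector_derivative:
  assumes "1 < \<alpha>" "0 \<le> t" "S \<subseteq> {0..}"
  shows "(mlc \<alpha> \<mu> has_vector_derivative \<mu> * ml \<alpha> \<alpha> \<mu> t) (at t within S)"
proof -
  have p: "((\<lambda>t. t powr \<alpha>) has_real_derivative \<alpha> * t powr (\<alpha> - 1)) (at t within S)"
  proof (cases "t = 0")
    case False
    then show ?thesis using assms(2) by (intro has_field_derivative_at_within[OF has_real_derivative_powr]) auto
  next
    case True
    \<comment> \<open>At the origin the difference quotient of \<open>t powr \<alpha>\<close> is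
      \<open>y powr (\<alpha> - 1)\<close>, which tends to 0 because \<alpha> > 1.\<close>
    have "((\<lambda>y. y powr (\<alpha> - 1)) \<longlongrightarrow> 0 powr (\<alpha> - 1)) (at 0 within S)"
      using assms by (intro tendsto_powr2) (auto simp: eventually_at_filter intro!: always_eventually)
    moreover have "eventually (\<lambda>y. y powr (\<alpha> - 1) = (y powr \<alpha> - 0 powr \<alpha>) / (y - 0)) (at 0 within S)"
      unfolding eventually_at_filter
    proof (intro always_eventually allI impI)
      fix y assume "y \<noteq> 0" "y \<in> S"
      then have "0 < y" using assms by auto
      then show "y powr (\<alpha> - 1) = (y powr \<alpha> - 0 powr \<alpha>) / (y - 0)" by (simp add: powr_diff)
    qed
    ultimately have "((\<lambda>y. (y powr \<alpha> - 0 powr \<alpha>) / (y - 0)) \<longlongrightarrow> 0 powr (\<alpha> - 1)) (at 0 within S)"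
      by (rule Lim_transform_eventually)
    then show ?thesis using True by (simp add: has_field_derivative_iff)
  qed
  have "(mittag_leffler \<alpha> 1 \<circ> (\<lambda>t. \<mu> * of_real (t powr \<alpha>)) has_vector_derivative
      \<mu> * of_real (\<alpha> * t powr (\<alpha> - 1)) * mittag_leffler_deriv \<alpha> 1 (\<mu> * of_real (t powr \<alpha>))) (at t within S)"
    using assms
    by (intro field_vector_diff_chain_within has_vector_derivative_mult_right
        has_field_derivative_at_within[OF mittag_leffler_has_field_derivative]
        has_vector_derivative_of_real p) auto
  moreover have "\<mu> * of_real (\<alpha> * t powr (\<alpha> - 1)) * mittag_leffler_deriv \<alpha> 1 z =
      \<mu> * ((t powr (\<alpha> - 1)) *\<^sub>R mittag_leffler \<alpha> \<alpha> z)" for z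
    using mittag_leffler_deriv_1[of \<alpha> z, symmetric] assms
    by (simp add: scaleR_conv_of_real mult_ac)
  ultimately show ?thesis
    unfolding ml_def mlc_def[abs_def] comp_def by simp
qed

lemma continuous_on_mlc:
  assumes "1 < \<alpha>"
  shows "continuous_on {0..} (mlc \<alpha> \<mu>)"
  using mlc_has_vector_derivative[OF assms]
  by (auto simp: continuous_on_eq_continuous_within intro!: has_vector_derivative_continuous)

text \<open>At the origin the general rule for positive times does not apply; there the difference
  quotient is the Mittag-Leffler factor itself, which tends to 1.\<close>

lemma ml2_has_vector_derivative:
  assumes "1 < \<alpha>" "0 \<le> t" "S \<subseteq> {0..}"
  shows "(ml \<alpha> 2 \<mu> has_vector_derivative mlc \<alpha> \<mu> t) (at t within S)"
proof (cases "t = 0")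
  case False
  then show ?thesis
    using ml_has_vector_derivative[of \<alpha> 2 t \<mu>] assms
    by (auto simp: mlc_eq_ml intro: has_vector_derivative_at_within)
next
  case True
  have "continuous_on {0..} (\<lambda>t. mittag_leffler \<alpha> 2 (\<mu> * of_real (t powr \<alpha>)))"
    using assms
    by (intro continuous_intros continuous_on_powr'
      continuous_on_compose2[OF continuous_on_mittag_leffler[of \<alpha> 2 UNIV]]) auto
  then have "((\<lambda>t. mittag_leffler \<alpha> 2 (\<mu> * of_real (t powr \<alpha>))) \<longlongrightarrow> 1) (at 0 within {0..})"
    by (auto simp: continuous_on_def mittag_leffler_0 Gamma_numeral dest!: bspec[where x=0])
  then have "((\<lambda>t. mittag_leffler \<alpha> 2 (\<mu> * of_real (t powr \<alpha>))) \<longlongrightarrow> 1) (at 0 within S)"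
    by (rule tendsto_within_subset) (rule assms)
  then have "((\<lambda>y. mittag_leffler \<alpha> 2 (\<mu> * of_real (y powr \<alpha>)) - 1) \<longlongrightarrow> 0) (at 0 within S)"
    by (simp add: LIM_zero)
  moreover have "eventually (\<lambda>y. mittag_leffler \<alpha> 2 (\<mu> * of_real (y powr \<alpha>)) - 1 =
      (1 / norm (y - 0)) *\<^sub>R (ml \<alpha> 2 \<mu> y - (ml \<alpha> 2 \<mu> 0 + (y - 0) *\<^sub>R 1))) (at 0 within S)"
    unfolding eventually_at_filter
  proof (intro always_eventually allI impI)
    fix y assume "y \<noteq> 0" "y \<in> S"
    then have "0 < y" using assms by auto
    then show "mittag_leffler \<alpha> 2 (\<mu> * of_real (y powr \<alpha>)) - 1 =
      (1 / norm (y - 0)) *\<^sub>R (ml \<alpha> 2 \<mu> y - (ml \<alpha> 2 \<mu> 0 + (y - 0) *\<^sub>R 1))"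
      by (simp add: ml_def scaleR_diff_right)
  qed
  ultimately have "((\<lambda>y. (1 / norm (y - 0)) *\<^sub>R (ml \<alpha> 2 \<mu> y - (ml \<alpha> 2 \<mu> 0 + (y - 0) *\<^sub>R 1))) \<longlongrightarrow> 0)
      (at 0 within S)"
    by (rule Lim_transform_eventually)
  then have "(ml \<alpha> 2 \<mu> has_vector_derivative 1) (at 0 within S)"
    unfolding has_vector_derivative_def has_derivative_within
    by (intro conjI bounded_linear_scaleR_left)
  then show ?thesis using True by simp
qed

lemma has_integral_Beta_scaled:
  fixes a b t :: real
  assumes "0 < a" "0 < b" "0 < t"
  shows "((\<lambda>s. (t - s) powr (a - 1) * s powr (b - 1)) has_integral t powr (a + b - 1) * Beta a b) {0..t}"
proof -
  have "((\<lambda>x. ((1/t) * x) powr (b - 1) * (1 - (1/t) * x) powr (a - 1)) has_integral (1 / \<bar>1/t\<bar>) *\<^sub>R Beta b a)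
      ((\<lambda>x. x / (1/t)) ` {0..1})"
    using assms by (intro has_integral_stretch_real has_integral_Beta_real) auto
  moreover have "(\<lambda>x. x / (1/t)) ` {0..1} = {0..t}"
    using assms image_mult_atLeastAtMost[of t 0 1] by (simp add: mult.commute)
  ultimately have "((\<lambda>x. ((1/t) * x) powr (b - 1) * (1 - (1/t) * x) powr (a - 1)) has_integral t * Beta a b) {0..t}"
    using assms by (simp add: Beta_commute)
  then have I: "((\<lambda>x. t powr (a + b - 2) * (((1/t) * x) powr (b - 1) * (1 - (1/t) * x) powr (a - 1))) has_integral
      t powr (a + b - 2) * (t * Beta a b)) {0..t}"
    by (rule has_integral_mult_right)
  have v: "t powr (a + b - 2) * (t * Beta a b) = t powr (a + b - 1) * Beta a b"
  proof -
    have "t powr (a + b - 2) * t = t powr (a + b - 2) * t powr 1" using assms by simp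
    also have "\<dots> = t powr (a + b - 1)" by (simp only: powr_add[symmetric]) simp
    finally show ?thesis by simp
  qed
  have pw: "t powr (a + b - 2) * (((1/t) * x) powr (b - 1) * (1 - (1/t) * x) powr (a - 1)) =
      (t - x) powr (a - 1) * x powr (b - 1)" if "x \<in> {0..t}" for x
  proof -
    have "1 - (1/t) * x = (t - x) / t" using assms by (simp add: field_simps)
    then have "((1/t) * x) powr (b - 1) * (1 - (1/t) * x) powr (a - 1) =
        (x powr (b - 1) / t powr (b - 1)) * ((t - x) powr (a - 1) / t powr (a - 1))"
      using that assms by (simp add: powr_divide)
    moreover have "t powr (a + b - 2) = t powr (b - 1) * t powr (a - 1)"
      by (simp add: powr_add[symmetric] add.commute)
    ultimately show ?thesis using assms by simp
  qed
  show ?thesis using has_integral_eq[OF pw I] unfolding v .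
qed

lemma set_integrable_Beta_scaled:
  fixes a b t :: real
  assumes "0 < a" "0 < b" "0 < t"
  shows "set_integrable lebesgue {0..t} (\<lambda>s. (t - s) powr (a - 1) * s powr (b - 1))"
    and "set_lebesgue_integral lebesgue {0..t} (\<lambda>s. (t - s) powr (a - 1) * s powr (b - 1)) =
      t powr (a + b - 1) * Beta a b"
proof -
  show i: "set_integrable lebesgue {0..t} (\<lambda>s. (t - s) powr (a - 1) * s powr (b - 1))"
    using has_integral_Beta_scaled[OF assms]
    by (intro nonnegative_absolutely_integrable_1) (auto simp: integrable_on_def)
  show "set_lebesgue_integral lebesgue {0..t} (\<lambda>s. (t - s) powr (a - 1) * s powr (b - 1)) =
      t powr (a + b - 1) * Beta a b"
    using set_lebesgue_integral_eq_integral(2)[OF i] has_integral_Beta_scaled[OF assms]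
    by (simp add: integral_unique)
qed

text \<open>Termwise integration: the Beta integral trades
  \<open>Gamma (\<alpha> * k + \<beta>)\<close> for
  \<open>Gamma (\<alpha> * k + \<beta> + \<gamma>)\<close>. The integrals of the absolute values
  again form a Mittag-Leffler series, which justifies the interchange.\<close>

lemma ml_fractional_integral:
  assumes "1 \<le> \<alpha>" "0 < \<beta>" "0 < \<gamma>" "0 < t"
  shows "set_lebesgue_integral lebesgue {0..t} (\<lambda>s. ((t - s) powr (\<gamma> - 1)) *\<^sub>R ml \<alpha> \<beta> \<mu> s) =
    of_real (Gamma \<gamma>) * ml \<alpha> (\<beta> + \<gamma>) \<mu> t"
proof -
  let ?G = "\<lambda>k. Gamma (\<alpha> * real k + \<beta>)"
  let ?w = "\<lambda>k s. (t - s) powr (\<gamma> - 1) * s powr (\<alpha> * real k + \<beta> - 1)"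
  let ?c = "\<lambda>k. \<mu> ^ k / of_real (?G k)"
  let ?f = "\<lambda>k s. indicator {0..t} s *\<^sub>R (of_real (?w k s) * ?c k)"
  have pos: "0 < \<alpha> * real k + \<beta>" for k using assms by (intro add_nonneg_pos) auto
  have G: "0 < ?G k" for k using pos[of k] by (rule Gamma_real_pos)
  have wi: "set_integrable lebesgue {0..t} (?w k)" for k
    using set_integrable_Beta_scaled(1)[OF assms(3) pos assms(4)] by simp
  have wI: "set_lebesgue_integral lebesgue {0..t} (?w k) =
      t powr (\<alpha> * real k + \<beta> + \<gamma> - 1) * (Gamma \<gamma> * ?G k / Gamma (\<alpha> * real k + (\<beta> + \<gamma>)))" for k
    using set_integrable_Beta_scaled(2)[OF assms(3) pos[of k] assms(4)]
    by (simp add: Beta_def algebra_simps)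
  have fi: "integrable lebesgue (?f k)" for k
  proof -
    have "integrable lebesgue (\<lambda>s. of_real (indicator {0..t} s *\<^sub>R ?w k s) * ?c k)"
      using wi[of k] unfolding set_integrable_def by (intro integrable_mult_left integrable_of_real)
    then show ?thesis by (simp add: scaleR_conv_of_real mult.assoc)
  qed
  have tp: "t powr (\<alpha> * real k + \<beta> + \<gamma> - 1) = t powr (\<beta> + \<gamma> - 1) * (t powr \<alpha>) ^ k" for k
    using assms by (simp add: powr_power powr_add[symmetric] algebra_simps)
  have fI: "integral\<^sup>L lebesgue (?f k) = of_real (Gamma \<gamma> * t powr (\<beta> + \<gamma> - 1)) *
      ((\<mu> * of_real (t powr \<alpha>)) ^ k / of_real (Gamma (\<alpha> * real k + (\<beta> + \<gamma>))))" for k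
  proof -
    have "integral\<^sup>L lebesgue (?f k) = (LINT s:{0..t}|lebesgue. of_real (?w k s) * ?c k)"
      by (simp only: set_lebesgue_integral_def)
    also have "\<dots> = (LINT s:{0..t}|lebesgue. complex_of_real (?w k s)) * ?c k"
      by (rule set_integral_mult_left)
    also have "(LINT s:{0..t}|lebesgue. complex_of_real (?w k s)) = of_real (LINT s:{0..t}|lebesgue. ?w k s)"
      by (rule set_integral_complex_of_real)
    finally show ?thesis
      unfolding wI tp using G[of k] by (simp add: power_mult_distrib)
  qed
  have nI: "(\<integral>s. norm (?f k s) \<partial>lebesgue) = Gamma \<gamma> * t powr (\<beta> + \<gamma> - 1) *
      norm ((\<mu> * of_real (t powr \<alpha>)) ^ k / of_real (Gamma (\<alpha> * real k + (\<beta> + \<gamma>))))" for k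
  proof -
    have "(\<integral>s. norm (?f k s) \<partial>lebesgue) = (LINT s:{0..t}|lebesgue. ?w k s * norm (?c k))"
      unfolding set_lebesgue_integral_def
      by (intro Bochner_Integration.integral_cong) (auto simp: indicator_def norm_mult norm_divide norm_power abs_mult)
    also have "\<dots> = (LINT s:{0..t}|lebesgue. ?w k s) * norm (?c k)"
      by (rule set_integral_mult_left)
    finally show ?thesis
      unfolding wI tp
      using G[of k] Gamma_real_pos[of "\<alpha> * real k + (\<beta> + \<gamma>)"] pos[of k] assms
      by (simp add: norm_mult norm_divide norm_power power_mult_distrib abs_of_pos)
  qed
  have pt: "(\<lambda>k. ?f k s) sums (indicator {0..t} s *\<^sub>R (((t - s) powr (\<gamma> - 1)) *\<^sub>R ml \<alpha> \<beta> \<mu> s)) \<and>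
      summable (\<lambda>k. norm (?f k s))" for s
  proof (cases "s \<in> {0<..t}")
    case True
    have sp: "s powr (\<alpha> * real k + \<beta> - 1) = s powr (\<beta> - 1) * (s powr \<alpha>) ^ k" for k
      using True by (simp add: powr_power powr_add[symmetric] algebra_simps)
    have f: "?f k s = of_real ((t - s) powr (\<gamma> - 1) * s powr (\<beta> - 1)) *
        ((\<mu> * of_real (s powr \<alpha>)) ^ k / of_real (?G k))" for k
      using True unfolding sp by (simp add: power_mult_distrib)
    have "(\<lambda>k. ?f k s) sums (of_real ((t - s) powr (\<gamma> - 1) * s powr (\<beta> - 1)) *
        mittag_leffler \<alpha> \<beta> (\<mu> * of_real (s powr \<alpha>)))"
      unfolding f using assms by (intro sums_mult mittag_leffler_sums)
    moreover have "summable (\<lambda>k. norm (?f k s))"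
      unfolding f norm_mult[of "of_real ((t - s) powr (\<gamma> - 1) * s powr (\<beta> - 1))"]
      using assms by (intro summable_mult mittag_leffler_summable)
    ultimately show ?thesis
      using True by (simp add: ml_def scaleR_conv_of_real mult.assoc)
  next
    case False
    then have "?f k s = 0" for k
      using assms by (cases "s = 0") (auto simp: indicator_def)
    moreover have "indicator {0..t} s *\<^sub>R (((t - s) powr (\<gamma> - 1)) *\<^sub>R ml \<alpha> \<beta> \<mu> s) = 0"
      using False by (cases "s = 0") (auto simp: indicator_def)
    ultimately show ?thesis by (simp only:) simp
  qed
  have "(\<integral>s. (\<Sum>k. ?f k s) \<partial>lebesgue) = (\<Sum>k. integral\<^sup>L lebesgue (?f k))"
  proof (rule integral_suminf[OF fi])
    show "AE s in lebesgue. summable (\<lambda>k. norm (?f k s))" using pt by simp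
    show "summable (\<lambda>k. \<integral>s. norm (?f k s) \<partial>lebesgue)"
      unfolding nI using assms by (intro summable_mult mittag_leffler_summable) auto
  qed
  also have "(\<lambda>s. \<Sum>k. ?f k s) = (\<lambda>s. indicator {0..t} s *\<^sub>R (((t - s) powr (\<gamma> - 1)) *\<^sub>R ml \<alpha> \<beta> \<mu> s))"
    using pt by (auto simp: sums_iff)
  also have "(\<Sum>k. integral\<^sup>L lebesgue (?f k)) = of_real (Gamma \<gamma> * t powr (\<beta> + \<gamma> - 1)) *
      mittag_leffler \<alpha> (\<beta> + \<gamma>) (\<mu> * of_real (t powr \<alpha>))"
  proof -
    have "(\<lambda>k. integral\<^sup>L lebesgue (?f k)) sums (of_real (Gamma \<gamma> * t powr (\<beta> + \<gamma> - 1)) *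
      mittag_leffler \<alpha> (\<beta> + \<gamma>) (\<mu> * of_real (t powr \<alpha>)))"
      unfolding fI using assms by (intro sums_mult mittag_leffler_sums) auto
    then show ?thesis by (simp add: sums_iff)
  qed
  finally show ?thesis
    by (simp add: set_lebesgue_integral_def ml_def scaleR_conv_of_real)
qed

section \<open>Laplace transforms and line shifts\<close>

section \<open>Integrals over horizontal lines\<close>

text \<open>Half a hyperbolic secant, with primitive \<open>arctan (exp (c * x)) / c\<close>. It
  serves twice: as integrable majorant of \<open>exp (- c * \<bar>x\<bar>)\<close>, and as the one
  line integral that must be evaluated explicitly, in \<open>integral_TB_p\<close>.\<close>

lemma sech_integral:
  fixes c :: real
  assumes "0 < c"
  shows "integrable lborel (\<lambda>x. exp (c * x) / (1 + exp (2 * (c * x))))"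
    and "(\<integral>x. exp (c * x) / (1 + exp (2 * (c * x))) \<partial>lborel) = pi / (2 * c)"
proof -
  let ?f = "\<lambda>x. exp (c * x) / (1 + exp (2 * (c * x)))"
  let ?F = "\<lambda>x. arctan (exp (c * x)) / c"
  have pos: "0 < 1 + exp (y::real)" for y by (simp add: add_pos_pos)
  have D: "DERIV ?F x :> ?f x" for x
  proof -
    have "DERIV (\<lambda>x. exp (c * x)) x :> exp (c * x) * c"
      by (auto intro!: derivative_eq_intros)
    from DERIV_cdivide[OF DERIV_chain2[OF DERIV_arctan this], of c]
    have "DERIV ?F x :> inverse (1 + (exp (c * x))\<^sup>2) * (exp (c * x) * c) / c" .
    moreover have "inverse (1 + E\<^sup>2) * (E * c) / c = E / (1 + E\<^sup>2)" for E :: real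
      using assms by (simp add: divide_inverse)
    ultimately show ?thesis by (simp only: exp_double)
  qed
  have cont: "isCont ?f x" for x
    by (intro continuous_intros) (use pos[of "2 * (c * x)"] in linarith)
  have lim1: "((?F \<circ> real_of_ereal) \<longlongrightarrow> 0) (at_right (-\<infinity>))"
  proof -
    have "filterlim (\<lambda>x. c * x) at_bot at_bot"
      using assms by (intro filterlim_tendsto_pos_mult_at_bot[OF tendsto_const _ filterlim_ident])
    then have "((\<lambda>x. exp (c * x)) \<longlongrightarrow> 0) at_bot"
      by (rule filterlim_compose[OF exp_at_bot])
    then have "(?F \<longlongrightarrow> arctan 0 / c) at_bot"
      using assms by (intro tendsto_intros) auto
    then show ?thesis by (simp add: ereal_tendsto_simps)
  qed
  have lim2: "((?F \<circ> real_of_ereal) \<longlongrightarrow> (pi / 2) / c) (at_left \<infinity>)"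
  proof -
    have "filterlim (\<lambda>x. c * x) at_top at_top"
      using assms by (intro filterlim_tendsto_pos_mult_at_top[OF tendsto_const _ filterlim_ident])
    then have "filterlim (\<lambda>x. exp (c * x)) at_top at_top"
      by (rule filterlim_compose[OF exp_at_top])
    then have "((\<lambda>x. arctan (exp (c * x))) \<longlongrightarrow> pi / 2) at_top"
      by (rule filterlim_compose[OF tendsto_arctan_at_top])
    then have "(?F \<longlongrightarrow> (pi / 2) / c) at_top"
      using assms by (intro tendsto_intros) auto
    then show ?thesis by (simp add: ereal_tendsto_simps)
  qed
  have nn: "AE x in lborel. -\<infinity> < ereal x \<longrightarrow> ereal x < \<infinity> \<longrightarrow> 0 \<le> ?f x"
    using pos by (intro always_eventually allI impI divide_nonneg_pos) auto
  note FTC = interval_integral_FTC_nonneg[of "-\<infinity>" \<infinity> ?F ?f, OF _ D cont nn lim1 lim2]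
  show "integrable lborel ?f"
    using FTC(1) by (simp add: set_integrable_def)
  show "(\<integral>x. ?f x \<partial>lborel) = pi / (2 * c)"
    using FTC(2) by (simp add: interval_lebesgue_integral_def set_lebesgue_integral_def)
qed

lemma exp_abs_le_sech:
  fixes c x :: real
  assumes "0 < c"
  shows "exp (- c * \<bar>x\<bar>) \<le> 2 * (exp (c * x) / (1 + exp (2 * (c * x))))"
proof -
  have p: "0 < 1 + exp (2 * (c * x))" by (simp add: add_pos_pos)
  have "exp (- c * \<bar>x\<bar>) * (1 + exp (2 * (c * x))) \<le> 2 * exp (c * x)"
  proof (cases "x \<ge> 0")
    case True
    have "exp (- c * \<bar>x\<bar>) * (1 + exp (2 * (c * x))) = exp (- (c * x)) + exp (c * x)"
      using True by (simp add: distrib_left mult_exp_exp)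
    moreover have "exp (- (c * x)) \<le> exp (c * x)" using assms True by simp
    ultimately show ?thesis by simp
  next
    case False
    have "exp (- c * \<bar>x\<bar>) * (1 + exp (2 * (c * x))) = exp (c * x) + exp (3 * (c * x))"
      using False by (simp add: distrib_left mult_exp_exp)
    moreover have "c * x < 0" using assms False by (simp add: mult_pos_neg)
    then have "exp (3 * (c * x)) \<le> exp (c * x)" by simp
    ultimately show ?thesis by simp
  qed
  then show ?thesis using p by (simp add: pos_le_divide_eq)
qed

lemma integrable_exp_abs:
  fixes c :: real
  assumes "0 < c"
  shows "integrable lborel (\<lambda>x. exp (- c * \<bar>x\<bar>))"
proof (rule Bochner_Integration.integrable_bound)
  show "integrable lborel (\<lambda>x. 2 * (exp (c * x) / (1 + exp (2 * (c * x)))))"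
    using sech_integral(1)[OF assms] by (rule integrable_mult_right)
  show "AE x in lborel. norm (exp (- c * \<bar>x\<bar>)) \<le> norm (2 * (exp (c * x) / (1 + exp (2 * (c * x)))))"
    using exp_abs_le_sech[OF assms] by (intro always_eventually allI) (auto intro: order_trans)
qed measurable

text \<open>Decay is required only for large arguments; on the compact rest continuity supplies the
  bound, so this is a convenient integrability test for functions on a horizontal line.\<close>

definition exp_tails :: "(real \<Rightarrow> complex) \<Rightarrow> bool" where
  "exp_tails g \<longleftrightarrow> (\<exists>C c X. 0 < c \<and> (\<forall>x. X \<le> \<bar>x\<bar> \<longrightarrow> cmod (g x) \<le> C * exp (- c * \<bar>x\<bar>)))"

lemma exp_tails_bound:
  assumes "continuous_on UNIV g" "exp_tails g"
  obtains C c where "0 < c" "\<And>x. cmod (g x) \<le> C * exp (- c * \<bar>x\<bar>)"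
proof -
  obtain C c X where c: "0 < c" and tail: "\<And>x. X \<le> \<bar>x\<bar> \<Longrightarrow> cmod (g x) \<le> C * exp (- c * \<bar>x\<bar>)"
    using assms(2) unfolding exp_tails_def by auto
  have "compact (g ` {-\<bar>X\<bar>..\<bar>X\<bar>})"
    using assms(1) by (intro compact_continuous_image continuous_on_subset[OF assms(1)]) auto
  then obtain B where B: "\<And>x. x \<in> {-\<bar>X\<bar>..\<bar>X\<bar>} \<Longrightarrow> cmod (g x) \<le> B"
    using compact_imp_bounded[of "g ` {-\<bar>X\<bar>..\<bar>X\<bar>}"] unfolding bounded_iff by blast
  show thesis
  proof (rule that[OF c, of "\<bar>C\<bar> + \<bar>B\<bar> * exp (c * \<bar>X\<bar>)"])
    fix x
    show "cmod (g x) \<le> (\<bar>C\<bar> + \<bar>B\<bar> * exp (c * \<bar>X\<bar>)) * exp (- c * \<bar>x\<bar>)"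
    proof (cases "X \<le> \<bar>x\<bar>")
      case True
      have "cmod (g x) \<le> C * exp (- c * \<bar>x\<bar>)" using tail[OF True] .
      also have "\<dots> \<le> (\<bar>C\<bar> + \<bar>B\<bar> * exp (c * \<bar>X\<bar>)) * exp (- c * \<bar>x\<bar>)"
        by (intro mult_right_mono) (auto intro: order_trans[of _ "\<bar>C\<bar>"])
      finally show ?thesis .
    next
      case False
      then have "x \<in> {-\<bar>X\<bar>..\<bar>X\<bar>}" by auto
      then have "cmod (g x) \<le> \<bar>B\<bar>" using B by force
      also have "\<dots> \<le> \<bar>B\<bar> * (exp (c * \<bar>X\<bar>) * exp (- c * \<bar>x\<bar>))"
      proof -
        have "c * \<bar>x\<bar> \<le> c * \<bar>X\<bar>" using False c by (intro mult_left_mono) auto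
        then have "1 \<le> exp (c * \<bar>X\<bar>) * exp (- c * \<bar>x\<bar>)"
          by (simp add: mult_exp_exp)
        then show ?thesis using mult_left_mono[of 1 _ "\<bar>B\<bar>"] by fastforce
      qed
      also have "\<dots> \<le> (\<bar>C\<bar> + \<bar>B\<bar> * exp (c * \<bar>X\<bar>)) * exp (- c * \<bar>x\<bar>)"
        by (simp add: distrib_right)
      finally show ?thesis .
    qed
  qed
qed

lemma exp_tails_integrable:
  assumes "continuous_on UNIV g" "exp_tails g"
  shows "integrable lborel g"
proof -
  obtain C c where c: "0 < c" and b: "\<And>x. cmod (g x) \<le> C * exp (- c * \<bar>x\<bar>)"
    using exp_tails_bound[OF assms] by blast
  show ?thesis
  proof (rule Bochner_Integration.integrable_bound)
    show "integrable lborel (\<lambda>x. C * exp (- c * \<bar>x\<bar>))"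
      using integrable_exp_abs[OF c] by (rule integrable_mult_right)
    show "g \<in> borel_measurable lborel"
      using borel_measurable_continuous_onI[OF assms(1)] by simp
    show "AE x in lborel. norm (g x) \<le> norm (C * exp (- c * \<bar>x\<bar>))"
    proof (intro always_eventually allI)
      fix x show "norm (g x) \<le> norm (C * exp (- c * \<bar>x\<bar>))"
        using b[of x] abs_ge_self[of "C * exp (- c * \<bar>x\<bar>)"] by (simp del: abs_mult)
    qed
  qed
qed

lemma tendsto_integral_symmetric:
  fixes g :: "real \<Rightarrow> complex"
  assumes g: "integrable lborel g"
  shows "(\<lambda>n. \<integral>x. indicator {-real n..real n} x *\<^sub>R g x \<partial>lborel) \<longlonglongrightarrow> (\<integral>x. g x \<partial>lborel)"
proof (rule integral_dominated_convergence[where w="\<lambda>x. norm (g x)"])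
  show "g \<in> borel_measurable lborel" using g by (rule borel_measurable_integrable)
  then show "(\<lambda>x. indicator {-real n..real n} x *\<^sub>R g x) \<in> borel_measurable lborel" for n :: nat
    by (intro borel_measurable_scaleR) auto
  show "integrable lborel (\<lambda>x. norm (g x))" using g by (rule integrable_norm)
  show "AE x in lborel. norm (indicator {-real n..real n} x *\<^sub>R g x) \<le> norm (g x)" for n :: nat
    by (intro always_eventually allI) (simp add: indicator_def)
  show "AE x in lborel. (\<lambda>n. indicator {-real n..real n} x *\<^sub>R g x) \<longlonglongrightarrow> g x"
  proof (intro always_eventually allI)
    fix x
    obtain N where N: "\<bar>x\<bar> \<le> real N" using real_arch_simple[of "\<bar>x\<bar>"] ..
    have "indicator {-real n..real n} x *\<^sub>R g x = g x" if "N \<le> n" for n :: nat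
      using that N by (simp add: indicator_def abs_le_iff)
    then show "(\<lambda>n. indicator {-real n..real n} x *\<^sub>R g x) \<longlonglongrightarrow> g x"
      by (intro tendsto_eventually) (auto simp: eventually_sequentially)
  qed
qed

text \<open>The convex strip carries a primitive of \<open>G\<close>. Truncated integrals over the
  two lines then differ by increments of the primitive along two vertical segments, which the
  uniform tail bound sends to 0.\<close>

lemma line_shift:
  fixes G :: "complex \<Rightarrow> complex"
  assumes hol: "G holomorphic_on {w. a < Im w \<and> Im w < b}"
    and y: "a < y1" "y1 \<le> y2" "y2 < b" and c: "0 < c"
    and tail: "\<And>x y. y1 \<le> y \<Longrightarrow> y \<le> y2 \<Longrightarrow> X \<le> \<bar>x\<bar> \<Longrightarrow> cmod (G (Complex x y)) \<le> C * exp (- c * \<bar>x\<bar>)"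
  shows "(\<integral>x. G (Complex x y1) \<partial>lborel) = (\<integral>x. G (Complex x y2) \<partial>lborel)"
proof -
  let ?S = "{w. a < Im w \<and> Im w < b}"
  have S: "?S = {w. Im w > a} \<inter> {w. Im w < b}" by auto
  have "open ?S" unfolding S by (intro open_Int open_halfspace_Im_gt open_halfspace_Im_lt)
  have "convex ?S" unfolding S by (intro convex_Int convex_halfspace_Im_gt convex_halfspace_Im_lt)
  obtain \<Phi> where "\<And>w. w \<in> ?S \<Longrightarrow> (\<Phi> has_field_derivative G w) (at w within ?S)"
    using holomorphic_convex_primitive'[OF \<open>convex ?S\<close> \<open>open ?S\<close> hol] by blast
  then have \<Phi>: "(\<Phi> has_field_derivative G w) (at w)" if "w \<in> ?S" for w
    using at_within_open[OF that \<open>open ?S\<close>] that by metis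
  have cont: "continuous_on UNIV (\<lambda>x. G (Complex x y))" if "y1 \<le> y" "y \<le> y2" for y
    by (rule continuous_on_compose2[OF holomorphic_on_imp_continuous_on[OF hol]])
       (use that y in \<open>auto intro!: continuous_intros simp: Complex_eq\<close>)
  have intg: "integrable lborel (\<lambda>x. G (Complex x y))" if "y1 \<le> y" "y \<le> y2" for y
    by (rule exp_tails_integrable[OF cont[OF that]])
       (use tail[OF that] c in \<open>auto simp: exp_tails_def\<close>)
  have fin: "(\<integral>x. indicator {-real n..real n} x *\<^sub>R G (Complex x y) \<partial>lborel) =
      \<Phi> (Complex n y) - \<Phi> (Complex (- real n) y)" if yy: "y1 \<le> y" "y \<le> y2" for n y
  proof -
    have "((\<lambda>x. \<Phi> (Complex x y)) has_vector_derivative G (Complex x y)) (at x within {-real n..real n})" for x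
    proof -
      have "((\<lambda>x. Complex x y) has_vector_derivative 1) (at x within {-real n..real n})"
        unfolding Complex_eq by (auto intro!: derivative_eq_intros)
      moreover have "(\<Phi> has_field_derivative G (Complex x y)) (at (Complex x y) within (\<lambda>x. Complex x y) ` {-real n..real n})"
        by (rule has_field_derivative_at_within[OF \<Phi>]) (use yy y in auto)
      ultimately show ?thesis
        using field_vector_diff_chain_within[of "\<lambda>x. Complex x y" 1 x "{-real n..real n}" \<Phi>] by (simp add: comp_def)
    qed
    then have "((\<lambda>x. G (Complex x y)) has_integral (\<Phi> (Complex n y) - \<Phi> (Complex (- real n) y))) {-real n..real n}"
      by (intro fundamental_theorem_of_calculus) auto
    moreover have "set_integrable lborel {-real n..real n} (\<lambda>x. G (Complex x y))"
      using intg[OF yy] by (simp add: set_integrable_def integrable_mult_indicator)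
    from set_borel_integral_eq_integral(2)[OF this]
    have "(\<integral>x. indicator {-real n..real n} x *\<^sub>R G (Complex x y) \<partial>lborel) =
        integral {-real n..real n} (\<lambda>x. G (Complex x y))"
      by (simp only: set_lebesgue_integral_def)
    ultimately show ?thesis by (simp only: integral_unique)
  qed
  \<comment> \<open>\<open>\<sigma>\<close> is 1 or -1 and treats the right and the left vertical
    segment at once.\<close>
  have ends: "(\<lambda>n. \<Phi> (Complex (\<sigma> * real n) y1) - \<Phi> (Complex (\<sigma> * real n) y2)) \<longlonglongrightarrow> 0" if \<sigma>: "\<bar>\<sigma>\<bar> = 1" for \<sigma>
  proof (rule Lim_null_comparison)
    have "norm (\<Phi> (Complex (\<sigma> * real n) y1) - \<Phi> (Complex (\<sigma> * real n) y2)) \<le> C * exp (- c * real n) * (y2 - y1)"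
      if n: "X \<le> real n" for n :: nat
    proof -
      let ?A = "Complex (\<sigma> * real n) y1" and ?B = "Complex (\<sigma> * real n) y2"
      have seg: "\<exists>v. y1 \<le> v \<and> v \<le> y2 \<and> z = Complex (\<sigma> * real n) v" if "z \<in> closed_segment ?A ?B" for z
      proof -
        obtain u where u: "0 \<le> u" "u \<le> 1" "z = (1 - u) *\<^sub>R ?A + u *\<^sub>R ?B"
          using \<open>z \<in> closed_segment ?A ?B\<close> by (auto simp: in_segment)
        have "z = Complex (\<sigma> * real n) ((1 - u) * y1 + u * y2)"
          using u by (simp add: complex_eq_iff algebra_simps)
        moreover have "y1 \<le> (1 - u) * y1 + u * y2"
          using u y(2) mult_left_mono[OF y(2) u(1)] by (simp add: algebra_simps)
        moreover have "(1 - u) * y1 + u * y2 \<le> y2"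
          using u y(2) mult_left_mono[OF y(2), of "1 - u"] by (simp add: algebra_simps)
        ultimately show ?thesis by blast
      qed
      have "norm (\<Phi> ?A - \<Phi> ?B) \<le> C * exp (- c * real n) * norm (?A - ?B)"
      proof (rule field_differentiable_bound[of "closed_segment ?A ?B" \<Phi> G])
        fix z assume "z \<in> closed_segment ?A ?B"
        from seg[OF this] obtain v where v: "y1 \<le> v" "v \<le> y2" "z = Complex (\<sigma> * real n) v" by blast
        show "(\<Phi> has_field_derivative G z) (at z within closed_segment ?A ?B)"
          by (rule has_field_derivative_at_within[OF \<Phi>]) (use v y in auto)
        show "norm (G z) \<le> C * exp (- c * real n)"
          using tail[OF v(1,2), of "\<sigma> * real n"] \<sigma> n v(3) by (simp add: abs_mult)
      qed auto
      also have "norm (?A - ?B) = y2 - y1"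
        using y(2) by (simp add: cmod_def)
      finally show ?thesis .
    qed
    then show "\<forall>\<^sub>F n in sequentially. norm (\<Phi> (Complex (\<sigma> * real n) y1) - \<Phi> (Complex (\<sigma> * real n) y2)) \<le>
        C * exp (- c * real n) * (y2 - y1)"
      using eventually_ge_at_top[of "nat \<lceil>X\<rceil>"] by (elim eventually_mono) (simp add: nat_ceiling_le_eq)
    have "filterlim (\<lambda>n. - c * real n) at_bot sequentially"
      using c by (intro filterlim_tendsto_neg_mult_at_bot[OF tendsto_const _ filterlim_real_sequentially]) auto
    then have "(\<lambda>n. exp (- c * real n)) \<longlonglongrightarrow> 0"
      by (rule filterlim_compose[OF exp_at_bot])
    then show "(\<lambda>n. C * exp (- c * real n) * (y2 - y1)) \<longlonglongrightarrow> 0"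
      by (intro tendsto_mult_left_zero tendsto_mult_right_zero)
  qed
  have "(\<lambda>n. (\<integral>x. indicator {-real n..real n} x *\<^sub>R G (Complex x y1) \<partial>lborel)
      - (\<integral>x. indicator {-real n..real n} x *\<^sub>R G (Complex x y2) \<partial>lborel)) \<longlonglongrightarrow>
      (\<integral>x. G (Complex x y1) \<partial>lborel) - (\<integral>x. G (Complex x y2) \<partial>lborel)"
    using y(2) by (intro tendsto_diff tendsto_integral_symmetric intg) auto
  moreover have "(\<lambda>n. (\<integral>x. indicator {-real n..real n} x *\<^sub>R G (Complex x y1) \<partial>lborel)
      - (\<integral>x. indicator {-real n..real n} x *\<^sub>R G (Complex x y2) \<partial>lborel)) \<longlonglongrightarrow> 0 - 0"
  proof -
    have "(\<lambda>n. (\<Phi> (Complex (1 * real n) y1) - \<Phi> (Complex (1 * real n) y2))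
      - (\<Phi> (Complex ((-1) * real n) y1) - \<Phi> (Complex ((-1) * real n) y2))) \<longlonglongrightarrow> 0 - 0"
      by (intro tendsto_diff ends) auto
    moreover have "(\<Phi> (Complex (1 * real n) y1) - \<Phi> (Complex (1 * real n) y2))
      - (\<Phi> (Complex ((-1) * real n) y1) - \<Phi> (Complex ((-1) * real n) y2)) =
      (\<integral>x. indicator {-real n..real n} x *\<^sub>R G (Complex x y1) \<partial>lborel)
      - (\<integral>x. indicator {-real n..real n} x *\<^sub>R G (Complex x y2) \<partial>lborel)" for n
      using fin[of y1 n] fin[of y2 n] y(2) by simp
    ultimately show ?thesis by simp
  qed
  ultimately show ?thesis using LIMSEQ_unique by fastforce
qed

text \<open>Numerator and denominator are both divided by \<open>z - a\<close>; the two difference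
  quotients extend holomorphically, and the second does not vanish at \<open>a\<close> because the
  zero of \<open>d\<close> is simple.\<close>

lemma removable_quotient:
  fixes f d :: "complex \<Rightarrow> complex"
  assumes "f holomorphic_on S" "d holomorphic_on S" "open S" "a \<in> S"
    and "f a = 0" "d a = 0"
    and f': "(f has_field_derivative f') (at a)" and d': "(d has_field_derivative d') (at a)" "d' \<noteq> 0"
    and nz: "\<And>w. w \<in> S \<Longrightarrow> w \<noteq> a \<Longrightarrow> d w \<noteq> 0"
  shows "\<exists>h. h holomorphic_on S \<and> (\<forall>w\<in>S. w \<noteq> a \<longrightarrow> h w = f w / d w) \<and> h a = f' / d'"
proof -
  let ?f = "\<lambda>z. if z = a then deriv f a else (f z - f a) / (z - a)"
  let ?d = "\<lambda>z. if z = a then deriv d a else (d z - d a) / (z - a)"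
  have dd: "deriv d a = d'" "deriv f a = f'" using f' d'(1) by (auto intro: DERIV_imp_deriv)
  have "(\<lambda>w. ?f w / ?d w) holomorphic_on S"
  proof (rule holomorphic_on_divide)
    show "?f holomorphic_on S" by (rule pole_lemma_open[OF assms(1,3)])
    show "?d holomorphic_on S" by (rule pole_lemma_open[OF assms(2,3)])
    show "?d w \<noteq> 0" if "w \<in> S" for w using nz[OF that] d'(2) assms(6) dd by auto
  qed
  moreover have "\<forall>w\<in>S. w \<noteq> a \<longrightarrow> ?f w / ?d w = f w / d w"
    using assms(5,6) by simp
  moreover have "?f a / ?d a = f' / d'" using dd by simp
  ultimately show ?thesis by (intro exI[of _ "\<lambda>w. ?f w / ?d w"] conjI)
qed

section \<open>Lerch's theorem from Bernstein approximation\<close>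

section \<open>Uniqueness of Laplace transforms\<close>

text \<open>In the variable \<open>x = exp (- s)\<close> the hypothesis says that all power moments
  vanish. Splitting off one factor \<open>1 - x\<close> at a time carries this over to the Bernstein
  basis.\<close>

lemma laplace_moments_zero:
  fixes H :: "real \<Rightarrow> complex"
  assumes int: "set_integrable lborel {0<..} H"
    and zero: "\<And>n::nat. (LINT s:{0<..}|lborel. exp (- s) ^ n *\<^sub>R H s) = 0"
  shows "set_integrable lborel {0<..} (\<lambda>s. (exp (- s) ^ k * (1 - exp (- s)) ^ m) *\<^sub>R H s)"
    and "(LINT s:{0<..}|lborel. (exp (- s) ^ k * (1 - exp (- s)) ^ m) *\<^sub>R H s) = 0"
proof -
  have bd: "set_integrable lborel {0<..} (\<lambda>s. g s *\<^sub>R H s)"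
    if g: "continuous_on UNIV g" "\<And>s. 0 < s \<Longrightarrow> \<bar>g s\<bar> \<le> 1" for g :: "real \<Rightarrow> real"
    unfolding set_integrable_def
  proof (rule Bochner_Integration.integrable_bound)
    show "integrable lborel (\<lambda>s. indicator {0<..} s *\<^sub>R H s)"
      using int by (simp add: set_integrable_def)
    have "g \<in> borel_measurable borel" using g(1) by (rule borel_measurable_continuous_onI)
    then have "(\<lambda>s. g s *\<^sub>R (indicator {0<..} s *\<^sub>R H s)) \<in> borel_measurable lborel"
      by (intro borel_measurable_scaleR[OF _ borel_measurable_integrable[OF int[unfolded set_integrable_def]]]) simp
    then show "(\<lambda>s. indicator {0<..} s *\<^sub>R g s *\<^sub>R H s) \<in> borel_measurable lborel"
      by (simp add: mult.commute)
    show "AE s in lborel. norm (indicator {0<..} s *\<^sub>R g s *\<^sub>R H s) \<le> norm (indicator {0<..} s *\<^sub>R H s)"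
      using g(2) by (intro always_eventually allI) (auto simp: indicator_def mult_left_le_one_le)
  qed
  have I: "set_integrable lborel {0<..} (\<lambda>s. (exp (- s) ^ k * (1 - exp (- s)) ^ m) *\<^sub>R H s)" for k m
  proof (rule bd)
    show "continuous_on UNIV (\<lambda>s::real. exp (- s) ^ k * (1 - exp (- s)) ^ m)"
      by (intro continuous_intros)
    fix s :: real assume "0 < s"
    then have "\<bar>exp (- s)\<bar> \<le> 1" "\<bar>1 - exp (- s)\<bar> \<le> 1" by (auto simp: abs_if)
    then have "\<bar>exp (- s)\<bar> ^ k \<le> 1" "\<bar>1 - exp (- s)\<bar> ^ m \<le> 1" by (simp_all add: power_le_one)
    then show "\<bar>exp (- s) ^ k * (1 - exp (- s)) ^ m\<bar> \<le> 1"
      unfolding abs_mult power_abs[symmetric] by (intro mult_le_one) auto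
  qed
  show "set_integrable lborel {0<..} (\<lambda>s. (exp (- s) ^ k * (1 - exp (- s)) ^ m) *\<^sub>R H s)"
    by (rule I)
  show "(LINT s:{0<..}|lborel. (exp (- s) ^ k * (1 - exp (- s)) ^ m) *\<^sub>R H s) = 0"
  proof (induction m arbitrary: k)
    case 0
    then show ?case using zero by simp
  next
    case (Suc m)
    have eq: "(\<lambda>s. (exp (- s) ^ k * (1 - exp (- s)) ^ Suc m) *\<^sub>R H s) =
      (\<lambda>s. (exp (- s) ^ k * (1 - exp (- s)) ^ m) *\<^sub>R H s - (exp (- s) ^ Suc k * (1 - exp (- s)) ^ m) *\<^sub>R H s)"
      by (auto simp: algebra_simps)
    show ?case
      unfolding eq set_integral_diff(2)[OF I I] by (simp only: Suc diff_zero)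
  qed
qed

text \<open>Bernstein polynomials approximate every continuous function of \<open>exp (- s)\<close>
  uniformly, so all of these integrate to 0 against \<open>H\<close>. A tent concentrated near a
  point with \<open>H s0 \<noteq> 0\<close> contradicts this.\<close>

lemma laplace_unique:
  fixes H :: "real \<Rightarrow> complex"
  assumes cont: "continuous_on {0<..} H"
    and int: "set_integrable lborel {0<..} H"
    and zero: "\<And>n::nat. (LINT s:{0<..}|lborel. exp (- s) ^ n *\<^sub>R H s) = 0"
    and "0 < s0"
  shows "H s0 = 0"
proof (rule ccontr)
  assume "H s0 \<noteq> 0"
  define h where "h = H s0"
  have "h \<noteq> 0" using \<open>H s0 \<noteq> 0\<close> by (simp add: h_def)
  note mom = laplace_moments_zero[OF int zero]
  have intn: "integrable lborel (\<lambda>s. norm (indicator {0<..} s *\<^sub>R H s))"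
    using int by (intro integrable_norm) (simp add: set_integrable_def)
  have fint: "integrable lborel (\<lambda>s. indicator {0<..} s *\<^sub>R (g (exp (- s)) *\<^sub>R H s))"
    if g: "continuous_on {0..1} g" for g :: "real \<Rightarrow> real"
  proof -
    have "compact (g ` {0..1})" using g by (intro compact_continuous_image) auto
    then obtain B where "\<forall>y\<in>g ` {0..1}. norm y \<le> B"
      using compact_imp_bounded[of "g ` {0..1}"] unfolding bounded_iff by blast
    then have B: "\<bar>g x\<bar> \<le> B" if "x \<in> {0..1}" for x using that by simp
    show ?thesis
    proof (rule Bochner_Integration.integrable_bound)
      show "integrable lborel (\<lambda>s. B * norm (indicator {0<..} s *\<^sub>R H s))"
        using intn by (rule integrable_mult_right)
      have c: "continuous_on {0<..} (\<lambda>s. g (exp (- s)) *\<^sub>R H s)"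
        by (intro continuous_intros cont continuous_on_compose2[OF g]) auto
      then have "(\<lambda>s. indicator {0<..} s *\<^sub>R (g (exp (- s)) *\<^sub>R H s)) \<in> borel_measurable borel"
        by (intro borel_measurable_continuous_on_indicator) auto
      then show "(\<lambda>s. indicator {0<..} s *\<^sub>R (g (exp (- s)) *\<^sub>R H s)) \<in> borel_measurable lborel" by simp
      show "AE s in lborel. norm (indicator {0<..} s *\<^sub>R (g (exp (- s)) *\<^sub>R H s)) \<le>
          norm (B * norm (indicator {0<..} s *\<^sub>R H s))"
      proof (intro always_eventually allI)
        fix s
        show "norm (indicator {0<..} s *\<^sub>R (g (exp (- s)) *\<^sub>R H s)) \<le> norm (B * norm (indicator {0<..} s *\<^sub>R H s))"
        proof (cases "0 < s")
          case True
          then have "\<bar>g (exp (- s))\<bar> \<le> \<bar>B\<bar>" using B[of "exp (- s)"] by force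
          then show ?thesis using True by (simp add: abs_mult mult_right_mono)
        qed simp
      qed
    qed
  qed
  have key: "(\<integral>s. indicator {0<..} s *\<^sub>R (g (exp (- s)) *\<^sub>R H s) \<partial>lborel) = 0"
    if g: "continuous_on {0..1} g" for g :: "real \<Rightarrow> real"
  proof -
    let ?N = "\<integral>s. norm (indicator {0<..} s *\<^sub>R H s) \<partial>lborel"
    have "norm (\<integral>s. indicator {0<..} s *\<^sub>R (g (exp (- s)) *\<^sub>R H s) \<partial>lborel) \<le> e * ?N" if "e > 0" for e
    proof -
      obtain n where n: "\<And>x. x \<in> {0..1} \<Longrightarrow> \<bar>g x - (\<Sum>k\<le>n. g (k / n) * Bernstein n k x)\<bar> < e"
        using Bernstein_Weierstrass[OF g \<open>e > 0\<close>] by blast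
      let ?B = "\<lambda>x. \<Sum>k\<le>n. g (k / n) * Bernstein n k x"
      have Bc: "continuous_on {0..1} ?B"
        unfolding Bernstein_def by (intro continuous_intros)
      have B0: "(\<integral>s. indicator {0<..} s *\<^sub>R (?B (exp (- s)) *\<^sub>R H s) \<partial>lborel) = 0"
      proof -
        have "(\<integral>s. indicator {0<..} s *\<^sub>R (?B (exp (- s)) *\<^sub>R H s) \<partial>lborel) =
          (\<integral>s. (\<Sum>k\<le>n. (g (k / n) * (n choose k)) *\<^sub>R
            (indicator {0<..} s *\<^sub>R ((exp (- s) ^ k * (1 - exp (- s)) ^ (n - k)) *\<^sub>R H s))) \<partial>lborel)"
          by (intro Bochner_Integration.integral_cong)
             (auto simp: Bernstein_def scaleR_sum_left scaleR_sum_right mult_ac intro!: sum.cong)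
        also have "\<dots> = (\<Sum>k\<le>n. (g (k / n) * (n choose k)) *\<^sub>R
            (LINT s:{0<..}|lborel. (exp (- s) ^ k * (1 - exp (- s)) ^ (n - k)) *\<^sub>R H s))"
          unfolding set_lebesgue_integral_def
          by (subst Bochner_Integration.integral_sum, rule integrable_scaleR_right,
              rule mom(1)[unfolded set_integrable_def], simp only: integral_scaleR_right)
        finally show ?thesis using mom(2) by simp
      qed
      have "(\<integral>s. indicator {0<..} s *\<^sub>R (g (exp (- s)) *\<^sub>R H s) \<partial>lborel) =
        (\<integral>s. indicator {0<..} s *\<^sub>R (g (exp (- s)) *\<^sub>R H s) - indicator {0<..} s *\<^sub>R (?B (exp (- s)) *\<^sub>R H s) \<partial>lborel)"
        using fint[OF g] fint[OF Bc] B0 by simp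
      also have "norm \<dots> \<le> (\<integral>s. e * norm (indicator {0<..} s *\<^sub>R H s) \<partial>lborel)"
      proof (rule Bochner_Integration.integral_norm_bound_integral)
        show "integrable lborel (\<lambda>s. indicator {0<..} s *\<^sub>R (g (exp (- s)) *\<^sub>R H s) - indicator {0<..} s *\<^sub>R (?B (exp (- s)) *\<^sub>R H s))"
          using fint[OF g] fint[OF Bc] by (rule Bochner_Integration.integrable_diff)
        show "integrable lborel (\<lambda>s. e * norm (indicator {0<..} s *\<^sub>R H s))"
          using intn by (rule integrable_mult_right)
        fix s :: real
        show "norm (indicator {0<..} s *\<^sub>R (g (exp (- s)) *\<^sub>R H s) - indicator {0<..} s *\<^sub>R (?B (exp (- s)) *\<^sub>R H s))
          \<le> e * norm (indicator {0<..} s *\<^sub>R H s)"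
        proof (cases "0 < s")
          case True
          then have "\<bar>g (exp (- s)) - ?B (exp (- s))\<bar> \<le> e" using n[of "exp (- s)"] by force
          then have "\<bar>g (exp (- s)) - ?B (exp (- s))\<bar> * norm (H s) \<le> e * norm (H s)"
            by (rule mult_right_mono) simp
          then show ?thesis using True by (simp add: scaleR_diff_left[symmetric])
        qed simp
      qed
      also have "\<dots> = e * ?N" by simp
      finally show ?thesis .
    qed
    then have *: "norm (\<integral>s. indicator {0<..} s *\<^sub>R (g (exp (- s)) *\<^sub>R H s) \<partial>lborel) \<le> e * ?N" if "e > 0" for e
      using that by blast
    define N where "N = ?N"
    have N0: "0 \<le> N" unfolding N_def by (intro integral_nonneg_AE) simp
    have "norm (\<integral>s. indicator {0<..} s *\<^sub>R (g (exp (- s)) *\<^sub>R H s) \<partial>lborel) \<le> 0"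
    proof (rule field_le_epsilon)
      fix e :: real assume "0 < e"
      have "e * N \<le> e * (N + 1)" using \<open>0 < e\<close> by simp
      then have "e / (N + 1) * N \<le> e" using N0 by (simp add: pos_divide_le_eq)
      moreover have "0 < e / (N + 1)" using N0 \<open>0 < e\<close> by simp
      ultimately show "norm (\<integral>s. indicator {0<..} s *\<^sub>R (g (exp (- s)) *\<^sub>R H s) \<partial>lborel) \<le> 0 + e"
        using *[of "e / (N + 1)"] unfolding N_def[symmetric] by linarith
    qed
    then show ?thesis by simp
  qed
  define x0 where "x0 = exp (- s0)"
  have x0: "0 < x0" "x0 < 1" using \<open>0 < s0\<close> by (auto simp: x0_def)
  have "isCont H s0"
    using cont \<open>0 < s0\<close> by (simp add: continuous_on_eq_continuous_at)
  then have "isCont (\<lambda>x. H (- ln x)) x0"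
    using x0 by (intro continuous_at_compose[of x0 "\<lambda>x. - ln x" H, unfolded comp_def] continuous_intros)
       (auto simp: x0_def)
  then have "((\<lambda>x. H (- ln x)) \<longlongrightarrow> h) (at x0)"
    by (simp add: isCont_def x0_def h_def)
  then have "\<forall>\<^sub>F x in at x0. dist (H (- ln x)) h < norm h / 2"
    using \<open>h \<noteq> 0\<close> by (intro tendstoD) auto
  then obtain \<eta> where "\<eta> > 0" and \<eta>': "\<And>x. x \<noteq> x0 \<Longrightarrow> dist x x0 < \<eta> \<Longrightarrow> dist (H (- ln x)) h < norm h / 2"
    unfolding eventually_at by blast
  have \<eta>: "dist (H s) h < norm h / 2" if "dist (exp (- s)) x0 < \<eta>" for s
  proof (cases "exp (- s) = x0")
    case True
    then have "s = s0" by (simp add: x0_def)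
    then show ?thesis using \<open>h \<noteq> 0\<close> by (simp add: h_def)
  next
    case False
    then show ?thesis using \<eta>'[OF False that] by simp
  qed
  \<comment> \<open>A tent of height 1 at \<open>x0\<close>, supported where \<open>H\<close> stays
    within \<open>norm h / 2\<close> of its value \<open>h\<close> at \<open>s0\<close>.\<close>
  define g where "g x = max 0 (1 - \<bar>x - x0\<bar> / \<eta>)" for x
  have gc: "continuous_on {0..1} g" unfolding g_def using \<open>\<eta> > 0\<close> by (intro continuous_intros) auto
  \<comment> \<open>Pairing with \<open>cnj h\<close> turns closeness of \<open>H\<close> to
    \<open>h\<close> into positivity: the real part is at least the tent times half the squared norm
    of \<open>h\<close>.\<close>
  let ?K = "\<lambda>s. Re (cnj h * (indicator {0<..} s *\<^sub>R (g (exp (- s)) *\<^sub>R H s)))"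
  have Ki: "integrable lborel ?K" using fint[OF gc] by (intro integrable_Re integrable_mult_right)
  have K0: "(\<integral>s. ?K s \<partial>lborel) = 0"
    unfolding integral_Re[OF integrable_mult_right[OF fint[OF gc]]]
      Bochner_Integration.integral_mult_right_zero key[OF gc] by simp
  have Kge: "g (exp (- s)) * ((norm h)\<^sup>2 / 2) \<le> ?K s" if "0 < s" for s
  proof (cases "dist (exp (- s)) x0 < \<eta>")
    case True
    have "Re (cnj h * H s) = (norm h)\<^sup>2 + Re (cnj h * (H s - h))"
      unfolding cmod_power2 by (simp add: algebra_simps power2_eq_square)
    moreover have "\<bar>Re (cnj h * (H s - h))\<bar> \<le> norm h * norm (H s - h)"
      using abs_Re_le_cmod[of "cnj h * (H s - h)"] by (simp add: norm_mult)
    moreover have "norm h * norm (H s - h) \<le> norm h * (norm h / 2)"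
      using \<eta>[OF True] by (intro mult_left_mono) (auto simp: dist_norm)
    ultimately have "(norm h)\<^sup>2 / 2 \<le> Re (cnj h * H s)" by (simp add: power2_eq_square)
    then have "g (exp (- s)) * ((norm h)\<^sup>2 / 2) \<le> g (exp (- s)) * Re (cnj h * H s)"
      by (intro mult_left_mono) (auto simp: g_def)
    then show ?thesis using that by (simp add: algebra_simps)
  next
    case False
    then have "g (exp (- s)) = 0" using \<open>\<eta> > 0\<close> by (simp add: g_def dist_real_def field_simps)
    then show ?thesis by simp
  qed
  obtain u v where uv: "0 < u" "u < v" "\<And>s. u \<le> s \<Longrightarrow> s \<le> v \<Longrightarrow> 1/2 \<le> g (exp (- s))"
  proof -
    have "isCont (\<lambda>s. g (exp (- s))) s0"
      unfolding g_def using \<open>\<eta> > 0\<close> by (intro continuous_intros) auto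
    moreover have "g (exp (- s0)) = 1" by (simp add: g_def x0_def)
    ultimately have "\<forall>\<^sub>F s in at s0. dist (g (exp (- s))) 1 < 1/2"
      unfolding isCont_def by (intro tendstoD) auto
    then obtain \<delta> where "\<delta> > 0" and \<delta>: "\<And>s. s \<noteq> s0 \<Longrightarrow> dist s s0 < \<delta> \<Longrightarrow> dist (g (exp (- s))) 1 < 1/2"
      unfolding eventually_at by blast
    show thesis
    proof (rule that[of s0 "s0 + \<delta> / 2"])
      fix s assume "s0 \<le> s" "s \<le> s0 + \<delta> / 2"
      then show "1 / 2 \<le> g (exp (- s))"
        using \<delta>[of s] \<open>\<delta> > 0\<close> \<open>g (exp (- s0)) = 1\<close> by (cases "s = s0") (auto simp: dist_real_def abs_if split: if_splits)
    qed (use \<open>0 < s0\<close> \<open>\<delta> > 0\<close> in auto)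
  qed
  have "(\<integral>s. indicator {u..v} s * ((norm h)\<^sup>2 / 4) \<partial>lborel) \<le> (\<integral>s. ?K s \<partial>lborel)"
  proof (rule integral_mono)
    show "integrable lborel (\<lambda>s. indicator {u..v} s * ((norm h)\<^sup>2 / 4))"
      by (intro integrable_mult_left integrable_real_indicator) (simp_all add: emeasure_lborel_Icc_eq)
    show "integrable lborel ?K" by (rule Ki)
    fix s :: real
    have g0: "0 \<le> g y" for y by (simp add: g_def)
    show "indicator {u..v} s * ((norm h)\<^sup>2 / 4) \<le> ?K s"
    proof (cases "s \<in> {u..v}")
      case True
      then have "(1/2) * ((norm h)\<^sup>2 / 2) \<le> g (exp (- s)) * ((norm h)\<^sup>2 / 2)"
        using uv by (intro mult_right_mono) auto
      then show ?thesis using Kge[of s] True uv(1) by simp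
    next
      case False
      have "0 \<le> ?K s"
      proof (cases "0 < s")
        case True
        have "0 \<le> g (exp (- s)) * ((norm h)\<^sup>2 / 2)" using g0 by simp
        then show ?thesis using Kge[OF True] by linarith
      qed simp
      then show ?thesis using False by simp
    qed
  qed
  then have "(v - u) * ((norm h)\<^sup>2 / 4) \<le> 0"
    unfolding K0 Bochner_Integration.integral_mult_left_zero using uv(2) by simp
  moreover have "0 < (v - u) * ((norm h)\<^sup>2 / 4)" using uv(2) \<open>h \<noteq> 0\<close> by simp
  ultimately show False by linarith
qed

section \<open>Exponential decay along a strip, uniform in height\<close>

section \<open>Bounds on vertical tails\<close>

text \<open>The bound is uniform in \<open>Im w\<close>, as moving lines requires, and is asked only
  for large \<open>\<bar>Re w\<bar>\<close>, so that poles in a bounded range do not matter.\<close>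

definition utail :: "(complex \<Rightarrow> complex) \<Rightarrow> bool" where
  "utail F \<longleftrightarrow> (\<exists>C c X. 0 < c \<and> (\<forall>w. X \<le> \<bar>Re w\<bar> \<longrightarrow> cmod (F w) \<le> C * exp (- c * \<bar>Re w\<bar>)))"

lemma utailI:
  assumes "0 < c1" "0 < c2" "0 \<le> C1" "0 \<le> C2" "0 < X"
    and "\<And>w. X \<le> Re w \<Longrightarrow> cmod (F w) \<le> C1 * exp (- c1 * Re w)"
    and "\<And>w. Re w \<le> - X \<Longrightarrow> cmod (F w) \<le> C2 * exp (c2 * Re w)"
  shows "utail F"
  unfolding utail_def
proof (intro exI conjI allI impI)
  show "0 < min c1 c2" using assms by simp
  fix w assume w: "X \<le> \<bar>Re w\<bar>"
  have *: "C * exp (- c * \<bar>Re w\<bar>) \<le> max C1 C2 * exp (- min c1 c2 * \<bar>Re w\<bar>)"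
    if "C \<le> max C1 C2" "0 \<le> C" "min c1 c2 \<le> c" for C c
  proof -
    have "min c1 c2 * \<bar>Re w\<bar> \<le> c * \<bar>Re w\<bar>" using that(3) by (rule mult_right_mono) simp
    then have "exp (- c * \<bar>Re w\<bar>) \<le> exp (- min c1 c2 * \<bar>Re w\<bar>)" by simp
    then show ?thesis using that by (intro mult_mono) auto
  qed
  show "cmod (F w) \<le> max C1 C2 * exp (- min c1 c2 * \<bar>Re w\<bar>)"
  proof (cases "X \<le> Re w")
    case True
    then show ?thesis using assms(6)[OF True] *[of C1 c1] assms(3,5) by simp
  next
    case False
    then have "Re w \<le> - X" using w by linarith
    then show ?thesis using assms(7)[of w] *[of C2 c2] assms(4,5) by simp
  qed
qed

lemma utail_add:
  assumes "utail F" "utail G"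
  shows "utail (\<lambda>w. F w + G w)"
proof -
  obtain C c X where F: "0 < c" "\<And>w. X \<le> \<bar>Re w\<bar> \<Longrightarrow> cmod (F w) \<le> C * exp (- c * \<bar>Re w\<bar>)"
    using assms(1) unfolding utail_def by auto
  obtain D d Y where G: "0 < d" "\<And>w. Y \<le> \<bar>Re w\<bar> \<Longrightarrow> cmod (G w) \<le> D * exp (- d * \<bar>Re w\<bar>)"
    using assms(2) unfolding utail_def by auto
  have *: "C * exp (- c * \<bar>r\<bar>) \<le> \<bar>C\<bar> * exp (- min c d * \<bar>r\<bar>)" "D * exp (- d * \<bar>r\<bar>) \<le> \<bar>D\<bar> * exp (- min c d * \<bar>r\<bar>)" for r :: real
    by (intro mult_mono; simp add: mult_right_mono)+
  show ?thesis unfolding utail_def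
  proof (intro exI conjI allI impI)
    show "0 < min c d" using F G by simp
    fix w assume "max X Y \<le> \<bar>Re w\<bar>"
    then have "cmod (F w + G w) \<le> C * exp (- c * \<bar>Re w\<bar>) + D * exp (- d * \<bar>Re w\<bar>)"
      by (intro order_trans[OF norm_triangle_ineq] add_mono F G) auto
    also have "\<dots> \<le> (\<bar>C\<bar> + \<bar>D\<bar>) * exp (- min c d * \<bar>Re w\<bar>)"
      using *[of "Re w"] by (simp add: distrib_right)
    finally show "cmod (F w + G w) \<le> (\<bar>C\<bar> + \<bar>D\<bar>) * exp (- min c d * \<bar>Re w\<bar>)" .
  qed
qed

lemma utail_cmult:
  assumes "utail F"
  shows "utail (\<lambda>w. k * F w)"
proof -
  obtain C c X where F: "0 < c" "\<And>w. X \<le> \<bar>Re w\<bar> \<Longrightarrow> cmod (F w) \<le> C * exp (- c * \<bar>Re w\<bar>)"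
    using assms(1) unfolding utail_def by auto
  show ?thesis unfolding utail_def
  proof (intro exI conjI allI impI)
    show "0 < c" by fact
    fix w assume "X \<le> \<bar>Re w\<bar>"
    then show "cmod (k * F w) \<le> (cmod k * C) * exp (- c * \<bar>Re w\<bar>)"
      using mult_left_mono[OF F(2), of w "cmod k"] by (simp add: norm_mult mult.assoc)
  qed
qed

lemma utail_exp_tails: "utail F \<Longrightarrow> exp_tails (\<lambda>x. F (Complex x y))"
  unfolding utail_def exp_tails_def by (metis complex.sel(1))

lemma utail_line_shift:
  assumes hol: "F holomorphic_on {w. a < Im w \<and> Im w < b}"
    and y: "a < y1" "y1 \<le> y2" "y2 < b" and "utail F"
  shows "(\<integral>x. F (Complex x y1) \<partial>lborel) = (\<integral>x. F (Complex x y2) \<partial>lborel)"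
proof -
  obtain C c X where F: "0 < c" "\<And>w. X \<le> \<bar>Re w\<bar> \<Longrightarrow> cmod (F w) \<le> C * exp (- c * \<bar>Re w\<bar>)"
    using assms(5) unfolding utail_def by auto
  show ?thesis
    by (rule line_shift[OF hol y F(1), of X C]) (use F(2)[of "Complex _ _"] in simp)
qed

lemma exp_minus_const_bounds:
  fixes a :: real and k :: complex
  assumes "0 < a" "k \<noteq> 0"
  obtains X where "0 < X"
    "\<And>w. X \<le> Re w \<Longrightarrow> cmod (1 / (exp (of_real a * w) - k)) \<le> 2 * exp (- a * Re w)"
    "\<And>w. Re w \<le> - X \<Longrightarrow> cmod (1 / (exp (of_real a * w) - k)) \<le> 2 / cmod k"
proof -
  \<comment> \<open>Right of \<open>X\<close> the exponential has modulus at least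
    \<open>2 * cmod k\<close>, left of \<open>- X\<close> at most \<open>cmod k / 2\<close>;
    absolute values and the summand 1 keep \<open>X\<close> positive.\<close>
  define X where "X = (\<bar>ln (2 * cmod k)\<bar> + \<bar>ln (cmod k / 2)\<bar> + 1) / a"
  have "0 < X" using assms by (auto simp: X_def intro!: divide_pos_pos add_nonneg_pos)
  have aX: "a * X = \<bar>ln (2 * cmod k)\<bar> + \<bar>ln (cmod k / 2)\<bar> + 1" using assms by (simp add: X_def)
  have n: "cmod (exp (of_real a * w)) = exp (a * Re w)" for w
    by (simp add: norm_exp_eq_Re)
  show thesis
  proof (rule that[OF \<open>0 < X\<close>])
    fix w assume "X \<le> Re w"
    then have "a * X \<le> a * Re w" using assms by simp
    then have "ln (2 * cmod k) \<le> a * Re w" unfolding aX by linarith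
    then have "exp (ln (2 * cmod k)) \<le> exp (a * Re w)" by simp
    then have "2 * cmod k \<le> exp (a * Re w)" using assms by simp
    then have "exp (a * Re w) / 2 \<le> cmod (exp (of_real a * w) - k)"
      using norm_triangle_ineq2[of "exp (of_real a * w)" k] n[of w] by simp
    then have "1 / cmod (exp (of_real a * w) - k) \<le> 1 / (exp (a * Re w) / 2)"
      by (intro frac_le) auto
    then show "cmod (1 / (exp (of_real a * w) - k)) \<le> 2 * exp (- a * Re w)"
      by (simp add: norm_divide exp_minus field_simps)
  next
    fix w assume "Re w \<le> - X"
    then have "a * Re w \<le> a * (- X)" using assms by (intro mult_left_mono) auto
    then have "a * Re w \<le> ln (cmod k / 2)" using aX by simp
    then have "exp (a * Re w) \<le> exp (ln (cmod k / 2))" by simp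
    then have "exp (a * Re w) \<le> cmod k / 2" using assms by simp
    then have "cmod k / 2 \<le> cmod (exp (of_real a * w) - k)"
      using norm_triangle_ineq2[of k "exp (of_real a * w)"] n[of w] by (simp add: norm_minus_commute)
    then have "1 / cmod (exp (of_real a * w) - k) \<le> 1 / (cmod k / 2)"
      using assms by (intro frac_le) auto
    then show "cmod (1 / (exp (of_real a * w) - k)) \<le> 2 / cmod k"
      by (simp add: norm_divide)
  qed
qed

text \<open>To the left the denominator stays away from 0 and the numerator decays because
  \<open>0 < e\<close>; to the right the quotient decays at rate \<open>a + d - e\<close>.\<close>

lemma utail_frac2:
  fixes a d e :: real and k l :: complex
  assumes "0 < a" "0 < d" "k \<noteq> 0" "l \<noteq> 0" "0 < e" "e < a + d"
  shows "utail (\<lambda>w. exp (of_real e * w) / ((exp (of_real a * w) - k) * (exp (of_real d * w) - l)))"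
proof -
  obtain X where X: "0 < X"
    "\<And>w. X \<le> Re w \<Longrightarrow> cmod (1 / (exp (of_real a * w) - k)) \<le> 2 * exp (- a * Re w)"
    "\<And>w. Re w \<le> - X \<Longrightarrow> cmod (1 / (exp (of_real a * w) - k)) \<le> 2 / cmod k"
    using exp_minus_const_bounds[OF assms(1,3)] by metis
  obtain Y where Y: "0 < Y"
    "\<And>w. Y \<le> Re w \<Longrightarrow> cmod (1 / (exp (of_real d * w) - l)) \<le> 2 * exp (- d * Re w)"
    "\<And>w. Re w \<le> - Y \<Longrightarrow> cmod (1 / (exp (of_real d * w) - l)) \<le> 2 / cmod l"
    using exp_minus_const_bounds[OF assms(2,4)] by metis
  have n: "cmod (exp (of_real e * w) / ((exp (of_real a * w) - k) * (exp (of_real d * w) - l))) =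
      exp (e * Re w) * (cmod (1 / (exp (of_real a * w) - k)) * cmod (1 / (exp (of_real d * w) - l)))" for w
    by (simp add: norm_divide norm_mult norm_exp_eq_Re)
  show ?thesis
  proof (rule utailI[of "a + d - e" e 4 "(2 / cmod k) * (2 / cmod l)" "max X Y"])
    fix w assume w: "max X Y \<le> Re w"
    have "exp (e * Re w) * (cmod (1 / (exp (of_real a * w) - k)) * cmod (1 / (exp (of_real d * w) - l)))
        \<le> exp (e * Re w) * ((2 * exp (- a * Re w)) * (2 * exp (- d * Re w)))"
      using X(2)[of w] Y(2)[of w] w by (intro mult_left_mono mult_mono) auto
    also have "\<dots> = 4 * exp (- (a + d - e) * Re w)"
      by (simp add: mult_exp_exp algebra_simps)
    finally show "cmod (exp (of_real e * w) / ((exp (of_real a * w) - k) * (exp (of_real d * w) - l)))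
        \<le> 4 * exp (- (a + d - e) * Re w)" unfolding n .
  next
    fix w assume w: "Re w \<le> - max X Y"
    have "exp (e * Re w) * (cmod (1 / (exp (of_real a * w) - k)) * cmod (1 / (exp (of_real d * w) - l)))
        \<le> exp (e * Re w) * ((2 / cmod k) * (2 / cmod l))"
      using X(3)[of w] Y(3)[of w] w by (intro mult_left_mono mult_mono) auto
    then show "cmod (exp (of_real e * w) / ((exp (of_real a * w) - k) * (exp (of_real d * w) - l)))
        \<le> (2 / cmod k) * (2 / cmod l) * exp (e * Re w)" unfolding n by (simp add: mult.commute)
  qed (use assms X(1) Y(1) in auto)
qed

section \<open>Laplace transforms of exponentials, powers and Mittag-Leffler functions\<close>

section \<open>Laplace transforms\<close>

lemma exp_laplace:
  fixes z :: complex
  assumes "0 < Re z"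
  shows "set_integrable lborel {0<..} (\<lambda>s. exp (- (z * of_real s)))"
    and "(LINT s:{0<..}|lborel. exp (- (z * of_real s))) = 1 / z"
proof -
  have z: "z \<noteq> 0" using assms by auto
  show int: "set_integrable lborel {0<..} (\<lambda>s. exp (- (z * of_real s)))"
    unfolding set_integrable_def
  proof (rule Bochner_Integration.integrable_bound)
    show "integrable lborel (\<lambda>s. exp (- Re z * \<bar>s\<bar>))" using assms by (rule integrable_exp_abs)
    have "(\<lambda>s. exp (- (z * of_real s))) \<in> borel_measurable borel"
      by (intro borel_measurable_continuous_onI continuous_intros)
    then show "(\<lambda>s. indicator {0<..} s *\<^sub>R exp (- (z * of_real s))) \<in> borel_measurable lborel"
      by (intro borel_measurable_scaleR) auto
    show "AE s in lborel. norm (indicator {0<..} s *\<^sub>R exp (- (z * of_real s))) \<le> norm (exp (- Re z * \<bar>s\<bar>))"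
      by (intro always_eventually allI) (simp add: indicator_def norm_exp_eq_Re)
  qed
  let ?F = "\<lambda>s. - exp (- (z * of_real s)) / z"
  have e: "einterval 0 \<infinity> = {0::real<..}" by (auto simp: einterval_def)
  have "(LBINT s=0..\<infinity>. exp (- (z * of_real s))) = 0 - (- 1 / z)"
  proof (rule interval_integral_FTC_integrable[of _ _ ?F])
    show "(?F has_vector_derivative exp (- (z * of_real s))) (at s)" for s
    proof -
      have "((\<lambda>w. - exp (- (z * w)) / z) has_field_derivative exp (- (z * of_real s))) (at (of_real s))"
        using z by (auto intro!: derivative_eq_intros)
      from has_vector_derivative_real_field[OF this] show ?thesis by (simp add: comp_def)
    qed
    show "isCont (\<lambda>s. exp (- (z * of_real s))) s" for s by (intro continuous_intros)
    show "set_integrable lborel (einterval 0 \<infinity>) (\<lambda>s. exp (- (z * of_real s)))"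
      using int unfolding e .
    have "isCont ?F 0" by (intro continuous_intros) (use z in auto)
    then have "(?F \<longlongrightarrow> - 1 / z) (at_right 0)"
      by (auto simp: isCont_def intro: tendsto_mono[OF at_le])
    then show "((?F \<circ> real_of_ereal) \<longlongrightarrow> - 1 / z) (at_right 0)"
      unfolding zero_ereal_def ereal_tendsto_simps .
    have "filterlim (\<lambda>s. - Re z * s) at_bot at_top"
      using assms by (intro filterlim_tendsto_neg_mult_at_bot[OF tendsto_const _ filterlim_ident]) auto
    then have "((\<lambda>s. exp (- Re z * s)) \<longlongrightarrow> 0) at_top"
      by (rule filterlim_compose[OF exp_at_bot])
    then have "((\<lambda>s. norm (exp (- (z * of_real s)))) \<longlongrightarrow> 0) at_top"
      by (simp add: norm_exp_eq_Re)
    then have "((\<lambda>s. exp (- (z * complex_of_real s))) \<longlongrightarrow> 0) at_top"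
      by (rule tendsto_norm_zero_cancel)
    then have "(?F \<longlongrightarrow> - 0 / z) at_top" by (intro tendsto_intros z)
    then show "((?F \<circ> real_of_ereal) \<longlongrightarrow> 0) (at_left \<infinity>)"
      unfolding ereal_tendsto_simps by simp
  qed simp
  then show "(LINT s:{0<..}|lborel. exp (- (z * of_real s))) = 1 / z"
    by (simp add: interval_lebesgue_integral_def e)
qed

lemma powr_laplace:
  fixes a p :: real
  assumes "0 < a" "0 < p"
  shows "integrable lborel (\<lambda>s. indicator {0<..} s * (exp (- (p * s)) * s powr (a - 1)))"
    and "(\<integral>s. indicator {0<..} s * (exp (- (p * s)) * s powr (a - 1)) \<partial>lborel) = Gamma a / p powr a"
proof -
  let ?h = "\<lambda>s. indicator {0<..} s * (exp (- s) * s powr (a - 1))"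
  have HK: "((\<lambda>t. t powr (a - 1) / exp t) has_integral Gamma a) {0..}"
    by (rule Gamma_integral_real[OF assms(1)])
  then have "set_integrable lebesgue {0..} (\<lambda>t. t powr (a - 1) / exp t)"
    by (intro nonnegative_absolutely_integrable_1) (auto simp: integrable_on_def)
  moreover have "(\<lambda>t. indicator {0..} t *\<^sub>R (t powr (a - 1) / exp t)) = ?h"
    by (auto simp: indicator_def exp_minus field_simps)
  ultimately have L: "integrable lebesgue ?h" "(\<integral>s. ?h s \<partial>lebesgue) = Gamma a"
    using set_lebesgue_integral_eq_integral(2)[of "{0..}" "\<lambda>t. t powr (a - 1) / exp t"] integral_unique[OF HK]
    by (simp_all add: set_integrable_def set_lebesgue_integral_def)
  have m: "?h \<in> borel_measurable lborel" by measurable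
  have H: "integrable lborel ?h" "(\<integral>s. ?h s \<partial>lborel) = Gamma a"
    using L m by (simp_all add: integrable_completion integral_completion)
  have e: "?h (0 + p * s) = p powr (a - 1) * (indicator {0<..} s * (exp (- (p * s)) * s powr (a - 1)))" for s
    using assms by (auto simp: indicator_def powr_mult zero_less_mult_iff)
  have "integrable lborel (\<lambda>s. ?h (0 + p * s))"
    using H(1) assms by (intro lborel_integrable_real_affine) auto
  then have "integrable lborel (\<lambda>s. inverse (p powr (a - 1)) * (p powr (a - 1) * (indicator {0<..} s * (exp (- (p * s)) * s powr (a - 1)))))"
    unfolding e by (rule integrable_mult_right)
  then show "integrable lborel (\<lambda>s. indicator {0<..} s * (exp (- (p * s)) * s powr (a - 1)))"
    using assms by (simp add: mult.assoc[symmetric])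
  have "Gamma a = \<bar>p\<bar> *\<^sub>R (\<integral>s. ?h (0 + p * s) \<partial>lborel)"
    unfolding H(2)[symmetric] using assms by (intro lborel_integral_real_affine) auto
  also have "\<dots> = p * (p powr (a - 1)) * (\<integral>s. indicator {0<..} s * (exp (- (p * s)) * s powr (a - 1)) \<partial>lborel)"
    unfolding e Bochner_Integration.integral_mult_right_zero using assms by simp
  also have "p * (p powr (a - 1)) = p powr a"
    using assms powr_add[of p 1 "a - 1"] by simp
  finally show "(\<integral>s. indicator {0<..} s * (exp (- (p * s)) * s powr (a - 1)) \<partial>lborel) = Gamma a / p powr a"
    using assms by simp
qed

text \<open>Termwise, each power of \<open>s\<close> contributes a Gamma factor that cancels the one
  in the series, leaving a geometric series in \<open>\<mu> / p powr \<alpha>\<close>. It converges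
  because \<open>\<mu>\<close> has modulus 1 and \<open>1 < p\<close>.\<close>

lemma ml_laplace:
  fixes p :: real
  assumes "1 \<le> \<alpha>" "0 < \<beta>" "1 < p" "cmod \<mu> = 1"
  shows "set_integrable lborel {0<..} (\<lambda>s. exp (- (p * s)) *\<^sub>R ml \<alpha> \<beta> \<mu> s)"
    and "(LINT s:{0<..}|lborel. exp (- (p * s)) *\<^sub>R ml \<alpha> \<beta> \<mu> s) =
      of_real (p powr (\<alpha> - \<beta>)) / (of_real (p powr \<alpha>) - \<mu>)"
proof -
  let ?G = "\<lambda>k. Gamma (\<alpha> * real k + \<beta>)"
  let ?w = "\<lambda>k s. indicator {0<..} s * (exp (- (p * s)) * s powr (\<alpha> * real k + \<beta> - 1))"
  let ?c = "\<lambda>k. \<mu> ^ k / of_real (?G k)"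
  let ?f = "\<lambda>k s. of_real (?w k s) * ?c k"
  have pos: "0 < \<alpha> * real k + \<beta>" for k using assms by (intro add_nonneg_pos) auto
  have G: "0 < ?G k" for k using pos[of k] by (rule Gamma_real_pos)
  have p0: "0 < p" using assms by simp
  note W = powr_laplace[OF pos p0]
  have pk: "p powr (\<alpha> * real k + \<beta>) = (p powr \<alpha>) ^ k * p powr \<beta>" for k
    using p0 by (simp add: powr_add powr_power mult.commute)
  have fi: "integrable lborel (?f k)" for k
    using W(1)[of k] by (intro integrable_mult_left integrable_of_real)
  have fI: "integral\<^sup>L lborel (?f k) = of_real (1 / p powr \<beta>) * (\<mu> / of_real (p powr \<alpha>)) ^ k" for k
  proof -
    have "integral\<^sup>L lborel (?f k) = of_real (?G k / p powr (\<alpha> * real k + \<beta>)) * ?c k"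
      by (simp only: Bochner_Integration.integral_mult_left_zero integral_complex_of_real W(2))
    then show ?thesis unfolding pk using G[of k] by (simp add: power_divide)
  qed
  have nI: "(\<integral>s. norm (?f k s) \<partial>lborel) = (1 / p powr \<beta>) * (1 / p powr \<alpha>) ^ k" for k
  proof -
    have "norm (?f k s) = ?w k s * (1 / ?G k)" for s
      using G[of k] assms(4) by (simp add: norm_mult norm_divide norm_power abs_mult indicator_def)
    then have "(\<integral>s. norm (?f k s) \<partial>lborel) = (?G k / p powr (\<alpha> * real k + \<beta>)) * (1 / ?G k)"
      by (simp only: Bochner_Integration.integral_mult_left_zero W(2))
    then show ?thesis unfolding pk using G[of k] by (simp add: power_divide)
  qed
  have q: "1 < p powr \<alpha>" using assms by (intro gr_one_powr) auto
  have pt: "(\<lambda>k. ?f k s) sums (indicator {0<..} s *\<^sub>R (exp (- (p * s)) *\<^sub>R ml \<alpha> \<beta> \<mu> s)) \<and>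
      summable (\<lambda>k. norm (?f k s))" for s
  proof (cases "0 < s")
    case True
    have sp: "s powr (\<alpha> * real k + \<beta> - 1) = s powr (\<beta> - 1) * (s powr \<alpha>) ^ k" for k
      using True by (simp add: powr_power powr_add[symmetric] algebra_simps)
    have f: "?f k s = of_real (exp (- (p * s)) * s powr (\<beta> - 1)) *
        ((\<mu> * of_real (s powr \<alpha>)) ^ k / of_real (?G k))" for k
      using True unfolding sp by (simp add: power_mult_distrib)
    have "(\<lambda>k. ?f k s) sums (of_real (exp (- (p * s)) * s powr (\<beta> - 1)) *
        mittag_leffler \<alpha> \<beta> (\<mu> * of_real (s powr \<alpha>)))"
      unfolding f using assms by (intro sums_mult mittag_leffler_sums)
    moreover have "summable (\<lambda>k. norm (?f k s))"
      unfolding f norm_mult[of "of_real (exp (- (p * s)) * s powr (\<beta> - 1))"]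
      using assms by (intro summable_mult mittag_leffler_summable)
    ultimately show ?thesis
      using True by (simp add: ml_def scaleR_conv_of_real mult.assoc)
  next
    case False
    then show ?thesis by simp
  qed
  have ev: "(\<lambda>s. \<Sum>k. ?f k s) = (\<lambda>s. indicator {0<..} s *\<^sub>R (exp (- (p * s)) *\<^sub>R ml \<alpha> \<beta> \<mu> s))"
    using pt by (auto simp: sums_iff)
  have AE: "AE s in lborel. summable (\<lambda>k. norm (?f k s))" using pt by simp
  have S: "summable (\<lambda>k. \<integral>s. norm (?f k s) \<partial>lborel)"
    unfolding nI using q by (intro summable_mult summable_geometric) (simp add: divide_less_eq_1)
  show "set_integrable lborel {0<..} (\<lambda>s. exp (- (p * s)) *\<^sub>R ml \<alpha> \<beta> \<mu> s)"
    using integrable_suminf[OF fi AE S] unfolding ev set_integrable_def .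
  have "(LINT s:{0<..}|lborel. exp (- (p * s)) *\<^sub>R ml \<alpha> \<beta> \<mu> s) = (\<Sum>k. integral\<^sup>L lborel (?f k))"
    using integral_suminf[OF fi AE S] unfolding ev set_lebesgue_integral_def .
  also have "\<dots> = of_real (1 / p powr \<beta>) * (1 / (1 - \<mu> / of_real (p powr \<alpha>)))"
    unfolding fI using q assms(4) by (subst suminf_mult) (auto simp: norm_divide suminf_geometric divide_less_eq_1)
  also have "\<dots> = of_real (p powr (\<alpha> - \<beta>)) / (of_real (p powr \<alpha>) - \<mu>)"
  proof -
    have "p powr \<alpha> \<noteq> 0" using p0 by simp
    then show ?thesis
      by (simp add: powr_diff divide_simps)
  qed
  finally show "(LINT s:{0<..}|lborel. exp (- (p * s)) *\<^sub>R ml \<alpha> \<beta> \<mu> s) =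
      of_real (p powr (\<alpha> - \<beta>)) / (of_real (p powr \<alpha>) - \<mu>)" .
qed

section \<open>Preparations for the inversion along two rays\<close>

section \<open>Asymptotics of the Mittag-Leffler functions\<close>

text \<open>Permits changing values at the removable singularities, which lie in a bounded range of
  \<open>Re w\<close>.\<close>

lemma utail_cong:
  assumes "utail F" "\<And>w. Y < \<bar>Re w\<bar> \<Longrightarrow> G w = F w"
  shows "utail G"
proof -
  obtain C c X where F: "0 < c" "\<And>w. X \<le> \<bar>Re w\<bar> \<Longrightarrow> cmod (F w) \<le> C * exp (- c * \<bar>Re w\<bar>)"
    using assms(1) unfolding utail_def by auto
  show ?thesis unfolding utail_def
  proof (intro exI conjI allI impI)
    show "0 < c" by fact
    fix w assume "max X (Y + 1) \<le> \<bar>Re w\<bar>"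
    then show "cmod (G w) \<le> C * exp (- c * \<bar>Re w\<bar>)"
      using F(2)[of w] assms(2)[of w] by simp
  qed
qed

lemma utail_frac1:
  fixes a e :: real and k :: complex
  assumes "0 < a" "k \<noteq> 0" "0 < e" "e < a"
  shows "utail (\<lambda>w. exp (of_real e * w) / (exp (of_real a * w) - k))"
proof -
  obtain X where X: "0 < X"
    "\<And>w. X \<le> Re w \<Longrightarrow> cmod (1 / (exp (of_real a * w) - k)) \<le> 2 * exp (- a * Re w)"
    "\<And>w. Re w \<le> - X \<Longrightarrow> cmod (1 / (exp (of_real a * w) - k)) \<le> 2 / cmod k"
    using exp_minus_const_bounds[OF assms(1,2)] by metis
  have n: "cmod (exp (of_real e * w) / (exp (of_real a * w) - k)) =
      exp (e * Re w) * cmod (1 / (exp (of_real a * w) - k))" for w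
    by (simp add: norm_divide norm_exp_eq_Re)
  show ?thesis
  proof (rule utailI[of "a - e" e 2 "2 / cmod k" X])
    fix w assume w: "X \<le> Re w"
    have "exp (e * Re w) * cmod (1 / (exp (of_real a * w) - k)) \<le> exp (e * Re w) * (2 * exp (- a * Re w))"
      using X(2)[OF w] by (intro mult_left_mono) auto
    also have "\<dots> = 2 * exp (- (a - e) * Re w)"
      by (simp add: mult_exp_exp algebra_simps)
    finally show "cmod (exp (of_real e * w) / (exp (of_real a * w) - k)) \<le> 2 * exp (- (a - e) * Re w)"
      unfolding n .
  next
    fix w assume w: "Re w \<le> - X"
    have "exp (e * Re w) * cmod (1 / (exp (of_real a * w) - k)) \<le> exp (e * Re w) * (2 / cmod k)"
      using X(3)[OF w] by (intro mult_left_mono) auto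
    then show "cmod (exp (of_real e * w) / (exp (of_real a * w) - k)) \<le> 2 / cmod k * exp (e * Re w)"
      unfolding n by (simp add: mult.commute)
  qed (use assms X(1) in auto)
qed

lemma cmod_i_pow [simp]: "cmod (i_pow a) = 1"
  by (simp add: i_pow_def norm_exp_eq_Re)

lemma i_pow_nonzero [simp]: "i_pow a \<noteq> 0"
  by (simp add: i_pow_def)

lemma exp_line: "exp (Complex x y) = of_real (exp x) * cis y"
  by (simp add: exp_eq_polar)

lemma exp_of_real_mult_ln: "0 < p \<Longrightarrow> exp (of_real a * of_real (ln p)) = (of_real (p powr a) :: complex)"
  by (simp add: powr_def exp_of_real flip: of_real_mult)

section \<open>The two-ray representation of \<open>ml\<close>\<close>

text \<open>An angle \<theta> above \<open>pi / 2\<close> puts the rays into the left half plane,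
  where \<open>exp (s * q)\<close> decays. The value \<open>2 * pi / \<alpha> - pi / 2\<close> is
  the height of the next zero of \<open>den\<close> above \<open>w0\<close>. The two bounds on
  \<beta> make the integrand decay at the right and at the left end of a line.\<close>

locale ml_strip =
  fixes \<alpha> \<beta> \<theta> :: real
  assumes alpha: "1 < \<alpha>" "\<alpha> < 2" and beta: "1 < \<beta>" "\<beta> < \<alpha> + 1"
    and theta: "pi / 2 < \<theta>" "\<theta> < pi" "\<theta> < 2 * pi / \<alpha> - pi / 2"
begin

text \<open>
  With \<open>q = exp w\<close> the rays \<open>arg q = \<plusminus>\<theta>\<close> become horizontal lines, \<open>w0\<close> is the only pole of the
  Laplace transform \<open>gh\<close> in the strip \<open>S\<close>, and \<open>bb\<close> is its residue in the variable \<open>q\<close>.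
\<close>

definition z0 :: complex where "z0 = i_pow (- \<alpha>)"
definition w0 :: complex where "w0 = Complex 0 (- (pi / 2))"
definition den :: "complex \<Rightarrow> complex" where "den w = exp (of_real \<alpha> * w) - z0"
definition gh :: "complex \<Rightarrow> complex" where "gh w = exp (of_real (\<alpha> - \<beta>) * w) / den w"
definition bb :: complex where "bb = exp (of_real (1 - \<beta>) * w0) / of_real \<alpha>"
definition vt :: real where "vt = min pi (2 * pi / \<alpha> - pi / 2)"
definition S :: "complex set" where "S = {w. - vt < Im w \<and> Im w < vt}"

lemma vt: "\<theta> < vt" "vt \<le> pi" "\<alpha> * vt \<le> 2 * pi - \<alpha> * pi / 2"
proof -
  show "\<theta> < vt" "vt \<le> pi" using theta by (auto simp: vt_def)
  have "vt \<le> 2 * pi / \<alpha> - pi / 2" by (simp add: vt_def)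
  then have "\<alpha> * vt \<le> \<alpha> * (2 * pi / \<alpha> - pi / 2)" using alpha by (intro mult_left_mono) auto
  also have "\<dots> = 2 * pi - \<alpha> * pi / 2" using alpha by (simp add: field_simps)
  finally show "\<alpha> * vt \<le> 2 * pi - \<alpha> * pi / 2" .
qed

lemma theta_pos: "0 < \<theta>"
  using theta pi_gt_zero by linarith

lemma cos_theta: "cos \<theta> < 0"
  using theta cos_monotone_0_pi[of "pi / 2" \<theta>] by simp

lemma open_S: "open S"
proof -
  have "S = {w. Im w > - vt} \<inter> {w. Im w < vt}" by (auto simp: S_def)
  then show ?thesis by (simp add: open_Int open_halfspace_Im_gt open_halfspace_Im_lt)
qed

lemma exp_w0: "exp w0 = - \<i>"
  by (simp add: w0_def exp_eq_polar)

lemma z0_eq: "z0 = exp (of_real \<alpha> * w0)"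
  unfolding z0_def i_pow_def
  by (rule arg_cong[of _ _ exp]) (simp add: complex_eq_iff w0_def)

lemma z0_norm: "cmod z0 = 1" "z0 \<noteq> 0"
  by (simp_all add: z0_def)

lemma w0_S: "w0 \<in> S"
  using vt theta pi_gt_zero by (auto simp: w0_def S_def)

text \<open>The zeros of \<open>den\<close> are \<open>w0\<close> shifted by multiples of
  \<open>2 * pi / \<alpha>\<close> along the imaginary axis. Upwards the strip ends at or below the
  next one; downwards the shift exceeds \<open>pi\<close> because \<alpha> < 2, so the next one lies
  below the strip.\<close>

lemma den_zero: assumes "w \<in> S" "den w = 0" shows "w = w0"
proof -
  have "exp (of_real \<alpha> * w) = exp (of_real \<alpha> * w0)" using assms(2) by (simp add: den_def z0_eq)
  then obtain n :: int where n: "of_real \<alpha> * w = of_real \<alpha> * w0 + (of_int (2 * n) * pi) * \<i>"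
    unfolding exp_eq by auto
  have re: "\<alpha> * Re w = 0" using arg_cong[OF n, of Re] by (simp add: w0_def)
  have im: "\<alpha> * Im w = - (\<alpha> * pi / 2) + 2 * of_int n * pi" using arg_cong[OF n, of Im] by (simp add: w0_def)
  have b: "\<alpha> * Im w < \<alpha> * vt" "\<alpha> * (- vt) < \<alpha> * Im w"
    using assms(1) alpha mult_strict_left_mono[of "- vt" "Im w" \<alpha>] by (auto simp: S_def)
  have "n = 0"
  proof (rule ccontr)
    assume "n \<noteq> 0"
    then consider "1 \<le> n" | "n \<le> - 1" by linarith
    then show False
    proof cases
      case 1
      then have "1 * pi \<le> of_int n * pi" by (intro mult_right_mono) auto
      then show False using im b(1) vt(3) by linarith
    next
      case 2
      then have "of_int n \<le> (- 1 :: real)" by linarith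
      then have "of_int n * pi \<le> - 1 * pi" by (rule mult_right_mono) simp
      moreover have "\<alpha> * vt \<le> \<alpha> * pi" using vt(2) alpha by simp
      moreover have "\<alpha> * pi < 2 * pi" using alpha by simp
      ultimately show False using im b(2) pi_gt_zero by simp
    qed
  qed
  then have "\<alpha> * Im w = \<alpha> * (- (pi / 2))" using im by simp
  then have "Im w = - (pi / 2)" using alpha by (subst (asm) mult_cancel_left) simp
  then show ?thesis using re alpha by (simp add: complex_eq_iff w0_def)
qed

lemma exp_eq_strip:
  assumes "w \<in> S" "\<bar>Im v\<bar> < pi" "exp w = exp v"
  shows "w = v"
proof -
  obtain n :: int where n: "w = v + (of_int (2 * n) * pi) * \<i>"
    using assms(3) unfolding exp_eq by auto
  have "Im w = Im v + 2 * of_int n * pi" using arg_cong[OF n, of Im] by simp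
  moreover have "\<bar>Im w\<bar> < pi" using assms(1) vt(2) by (auto simp: S_def)
  ultimately have "\<bar>2 * of_int n * pi\<bar> < 2 * pi" using assms(2) by linarith
  then have "\<bar>of_int n\<bar> < (1::real)" by (simp add: abs_mult)
  then have "n = 0" by linarith
  then show ?thesis using n by simp
qed

lemma exp_w0_zero: "w \<in> S \<Longrightarrow> exp w + \<i> = 0 \<Longrightarrow> w = w0"
  using exp_eq_strip[of w w0] pi_gt_zero by (simp add: exp_w0 eq_neg_iff_add_eq_0) (simp add: w0_def)

lemma exp_p_zero: "w \<in> S \<Longrightarrow> 0 < p \<Longrightarrow> exp w - of_real p = 0 \<Longrightarrow> w = of_real (ln p)"
  using exp_eq_strip[of w "of_real (ln p)"] by (simp add: exp_of_real)

lemma exp_plus_p_nonzero: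
  assumes "w \<in> S" "0 < p" shows "exp w + of_real p \<noteq> 0"
proof
  assume "exp w + of_real p = 0"
  then have "exp w = exp (of_real (ln p) + \<i> * of_real pi)"
    using assms(2) by (simp add: exp_add exp_of_real add_eq_0_iff)
  then obtain n :: int where n: "w = of_real (ln p) + \<i> * of_real pi + (of_int (2 * n) * pi) * \<i>"
    unfolding exp_eq by auto
  have "Im w = (1 + 2 * of_int n) * pi" using arg_cong[OF n, of Im] by (simp add: algebra_simps)
  moreover have "\<bar>Im w\<bar> < pi" using assms(1) vt(2) by (auto simp: S_def)
  ultimately have "\<bar>1 + 2 * of_int n\<bar> < (1::real)" by (simp add: abs_mult)
  then have "\<bar>1 + 2 * n\<bar> < 1" by linarith
  then show False by presburger
qed

lemma line_S: "\<bar>y\<bar> = \<theta> \<Longrightarrow> Complex x y \<in> S"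
  using vt(1) by (auto simp: S_def)

lemma line_den: "\<bar>y\<bar> = \<theta> \<Longrightarrow> den (Complex x y) \<noteq> 0"
  using den_zero[OF line_S, of y x] theta pi_gt_zero by (auto simp: w0_def)

lemma line_cos: "\<bar>y\<bar> = \<theta> \<Longrightarrow> cos y = cos \<theta>"
  by (metis cos_abs_real)

lemma line_Re: "\<bar>y\<bar> = \<theta> \<Longrightarrow> Re (exp (Complex x y)) < 0"
  using cos_theta line_cos[of y] by (simp add: exp_line mult_pos_neg)

lemma line_nonzero:
  assumes "\<bar>y\<bar> = \<theta>" "0 < p"
  shows "exp (Complex x y) + \<i> \<noteq> 0" "exp (Complex x y) - of_real p \<noteq> 0" "exp (Complex x y) + of_real p \<noteq> 0"
  using line_Re[OF assms(1), of x] assms(2) exp_plus_p_nonzero[OF line_S[OF assms(1)] assms(2)]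
  by (auto simp: complex_eq_iff)

text \<open>\<open>ker\<close> divided by \<open>exp w - p\<close>: up to sign, what remains of the
  contour integrand after the Laplace transform in time has been taken under the integral.\<close>

definition TA :: "real \<Rightarrow> complex \<Rightarrow> complex" where
  "TA p w = exp (of_real (\<alpha> - \<beta> + 1) * w) / ((exp (of_real \<alpha> * w) - z0) * (exp (of_real 1 * w) - of_real p))"

text \<open>Elementary functions used to cancel the poles of \<open>TA\<close>: with
  \<open>k = - \<i>\<close> the one at \<open>w0\<close>, with \<open>k = - p\<close> the one at
  \<open>ln p\<close>. Both decay at either end of a line.\<close>

definition TB :: "complex \<Rightarrow> real \<Rightarrow> complex \<Rightarrow> complex" where
  "TB k p w = exp (of_real 1 * w) / ((exp (of_real 1 * w) - k) * (exp (of_real 1 * w) - of_real p))"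

lemma utail_TA: "0 < p \<Longrightarrow> utail (TA p)"
  unfolding TA_def using alpha beta z0_norm by (intro utail_frac2) auto

lemma utail_TB: "0 < p \<Longrightarrow> k \<noteq> 0 \<Longrightarrow> utail (TB k p)"
  unfolding TB_def by (intro utail_frac2) auto

lemma integrable_TA: "\<bar>y\<bar> = \<theta> \<Longrightarrow> 0 < p \<Longrightarrow> integrable lborel (\<lambda>x. TA p (Complex x y))"
  using line_den line_nonzero
  by (intro exp_tails_integrable utail_exp_tails[OF utail_TA])
     (auto simp: TA_def den_def intro!: continuous_intros)

lemma integrable_TB:
  "\<bar>y\<bar> = \<theta> \<Longrightarrow> 0 < p \<Longrightarrow> k = - \<i> \<or> k = - of_real p \<Longrightarrow> integrable lborel (\<lambda>x. TB k p (Complex x y))"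
  using line_nonzero
  by (intro exp_tails_integrable utail_exp_tails[OF utail_TB])
     (auto simp: TB_def intro!: continuous_intros)

text \<open>By periodicity the line at height \<open>- \<theta>\<close> is the line at
  \<open>2 * pi - \<theta>\<close>. Between \<open>\<theta>\<close> and that height
  \<open>exp w\<close> has negative real part and meets neither \<open>- \<i>\<close> nor
  \<open>p\<close>, so the line can be moved.\<close>

lemma integral_TB_i:
  assumes "0 < p"
  shows "(\<integral>x. TB (- \<i>) p (Complex x \<theta>) \<partial>lborel) = (\<integral>x. TB (- \<i>) p (Complex x (- \<theta>)) \<partial>lborel)"
proof -
  have "(\<integral>x. TB (- \<i>) p (Complex x \<theta>) \<partial>lborel) = (\<integral>x. TB (- \<i>) p (Complex x (2 * pi - \<theta>)) \<partial>lborel)"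
  proof (rule utail_line_shift[of _ "pi / 2" "3 * pi / 2"])
    show "TB (- \<i>) p holomorphic_on {w. pi / 2 < Im w \<and> Im w < 3 * pi / 2}"
      unfolding TB_def
    proof (intro holomorphic_intros)
      fix w assume w: "w \<in> {w. pi / 2 < Im w \<and> Im w < 3 * pi / 2}"
      have "cos (Im w) < 0"
        using w cos_gt_zero_pi[of "Im w - pi"] by (simp add: cos_diff)
      then have r: "Re (exp w) < 0" by (simp add: exp_eq_polar mult_pos_neg)
      have "exp w \<noteq> - \<i>" "exp w \<noteq> of_real p" using r assms by (auto dest: arg_cong[of _ _ Re])
      then show "(exp (of_real 1 * w) - - \<i>) * (exp (of_real 1 * w) - of_real p) \<noteq> 0"
        by (auto simp: eq_neg_iff_add_eq_0)
    qed
  qed (use theta utail_TB assms in auto)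
  moreover have "TB (- \<i>) p (Complex x (2 * pi - \<theta>)) = TB (- \<i>) p (Complex x (- \<theta>))" for x
  proof -
    have "cis (2 * pi - \<theta>) = cis (- \<theta>)" by (simp add: complex_eq_iff cos_diff sin_diff)
    then have "exp (Complex x (2 * pi - \<theta>)) = exp (Complex x (- \<theta>))" unfolding exp_line by simp
    then show ?thesis by (simp add: TB_def)
  qed
  ultimately show ?thesis by simp
qed

text \<open>Moved to height \<open>pi / 2\<close>, where \<open>exp w\<close> is purely imaginary,
  the integrand becomes a multiple of the hyperbolic secant. The lower line follows by
  conjugation.\<close>

lemma integral_TB_p:
  assumes "0 < p"
  shows "(\<integral>x. TB (- of_real p) p (Complex x \<theta>) \<partial>lborel) = - (\<i> * of_real (pi / (2 * p)))"
    and "(\<integral>x. TB (- of_real p) p (Complex x (- \<theta>)) \<partial>lborel) = \<i> * of_real (pi / (2 * p))"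
proof -
  have "(\<integral>x. TB (- of_real p) p (Complex x (pi / 2)) \<partial>lborel) = (\<integral>x. TB (- of_real p) p (Complex x \<theta>) \<partial>lborel)"
  proof (rule utail_line_shift[of _ 0 pi])
    show "TB (- of_real p) p holomorphic_on {w. 0 < Im w \<and> Im w < pi}"
      unfolding TB_def
    proof (intro holomorphic_intros)
      fix w assume w: "w \<in> {w. 0 < Im w \<and> Im w < pi}"
      have "0 < sin (Im w)" using w by (simp add: sin_gt_zero)
      then have r: "0 < Im (exp w)" by (simp add: exp_eq_polar)
      have "exp w \<noteq> - of_real p" "exp w \<noteq> of_real p" using r by (auto dest: arg_cong[of _ _ Im])
      then show "(exp (of_real 1 * w) - - of_real p) * (exp (of_real 1 * w) - of_real p) \<noteq> 0"
        by (auto simp: eq_neg_iff_add_eq_0)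
    qed
  qed (use theta utail_TB assms in auto)
  moreover have "(\<integral>x. TB (- of_real p) p (Complex x (pi / 2)) \<partial>lborel) = - (\<i> * of_real (pi / (2 * p)))"
  proof -
    let ?f = "\<lambda>x. exp (1 * x) / (1 + exp (2 * (1 * x)))"
    have e: "TB (- of_real p) p (Complex x (pi / 2)) = (- \<i> / of_real p) * of_real (?f (- ln p + 1 * x))" for x
    proof -
      define E where "E = exp x"
      have E1: "exp (- ln p + x) = E / p" using assms by (simp add: E_def exp_diff)
      have E: "exp (- ln p + x) = E / p" "exp (2 * (- ln p + x)) = (E / p)\<^sup>2"
        unfolding exp_double E1 by simp_all
      have d: "of_real (p\<^sup>2 + E\<^sup>2) \<noteq> (0::complex)"
        using assms by (metis add_pos_nonneg of_real_eq_0_iff order_less_irrefl zero_le_power2 zero_less_power)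
      have "(\<i> * of_real E + of_real p) * (\<i> * of_real E - of_real p) = - of_real (p\<^sup>2 + E\<^sup>2)"
        by (simp add: algebra_simps power2_eq_square)
      then have "TB (- of_real p) p (Complex x (pi / 2)) = \<i> * of_real E / - of_real (p\<^sup>2 + E\<^sup>2)"
        by (simp add: TB_def exp_line E_def mult.commute)
      also have "\<dots> = (- \<i> / of_real p) * of_real ((E / p) / (1 + (E / p)\<^sup>2))"
      proof -
        have "(E / p) / (1 + (E / p)\<^sup>2) = p * E / (p\<^sup>2 + E\<^sup>2)"
          using assms by (simp add: field_simps power2_eq_square)
        then have F1: "(E / p) / (1 + (E / p)\<^sup>2) = p * (E / (p\<^sup>2 + E\<^sup>2))" by simp
        have "\<i> * of_real E / - of_real D = (- \<i> / of_real p) * of_real (p * (E / D))" for D :: real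
          using assms by simp
        then show ?thesis unfolding F1 .
      qed
      finally show ?thesis by (simp only: mult_1 E)
    qed
    have "(\<integral>x. ?f x \<partial>lborel) = \<bar>1\<bar> *\<^sub>R (\<integral>x. ?f (- ln p + 1 * x) \<partial>lborel)"
      by (rule lborel_integral_real_affine) simp
    then have "(\<integral>x. ?f (- ln p + 1 * x) \<partial>lborel) = pi / 2"
      using sech_integral(2)[of 1] by simp
    then have I1: "(\<integral>x. complex_of_real (?f (- ln p + 1 * x)) \<partial>lborel) = of_real (pi / 2)"
      by (simp only: integral_complex_of_real)
    have "(\<integral>x. TB (- of_real p) p (Complex x (pi / 2)) \<partial>lborel) = (- \<i> / of_real p) * of_real (pi / 2)"
      unfolding e Bochner_Integration.integral_mult_right_zero I1 ..
    then show ?thesis using assms by (simp add: field_simps)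
  qed
  ultimately show th: "(\<integral>x. TB (- of_real p) p (Complex x \<theta>) \<partial>lborel) = - (\<i> * of_real (pi / (2 * p)))"
    by simp
  have "TB (- of_real p) p (Complex x (- \<theta>)) = cnj (TB (- of_real p) p (Complex x \<theta>))" for x
    by (simp add: TB_def exp_line cis_cnj)
  then have "(\<integral>x. TB (- of_real p) p (Complex x (- \<theta>)) \<partial>lborel) = cnj (\<integral>x. TB (- of_real p) p (Complex x \<theta>) \<partial>lborel)"
    by simp
  then show "(\<integral>x. TB (- of_real p) p (Complex x (- \<theta>)) \<partial>lborel) = \<i> * of_real (pi / (2 * p))"
    unfolding th by simp
qed

text \<open>A residue computation by subtraction: multiples of \<open>TB\<close> remove both poles
  of \<open>TA\<close> in the strip, so the combination \<open>F\<close> has the same integral over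
  both lines, and the explicit integrals of \<open>TB\<close> account for the difference.\<close>

lemma integral_TA:
  assumes "0 < p"
  shows "(\<integral>x. TA p (Complex x \<theta>) \<partial>lborel) - (\<integral>x. TA p (Complex x (- \<theta>)) \<partial>lborel) =
    - (2 * of_real pi * \<i>) * (gh (of_real (ln p)) - bb / (of_real p + \<i>))"
proof -
  define wp :: complex where "wp = of_real (ln p)"
  define mp where "mp = gh wp - bb / (of_real p + \<i>)"
  have wpS: "wp \<in> S" using vt theta pi_gt_zero by (auto simp: wp_def S_def)
  have ewp: "exp wp = of_real p" using assms by (simp add: wp_def exp_of_real)
  have ne: "wp \<noteq> w0" using pi_gt_zero by (auto simp: wp_def w0_def complex_eq_iff)
  have dden: "(den has_field_derivative of_real \<alpha> * z0) (at w0)"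
    unfolding den_def[abs_def] z0_eq by (auto intro!: derivative_eq_intros)
  have hden: "den holomorphic_on S" unfolding den_def[abs_def] by (intro holomorphic_intros)
  have dg: "((\<lambda>w. exp w + \<i>) has_field_derivative - \<i>) (at w0)"
    by (auto intro!: derivative_eq_intros simp: exp_w0)
  have az: "of_real \<alpha> * z0 \<noteq> 0" using alpha z0_norm by simp
  have den0: "den w0 = 0" by (simp add: den_def z0_eq)
  have g0: "exp w0 + \<i> = 0" by (simp add: exp_w0)
  have "\<exists>h. h holomorphic_on S \<and> (\<forall>w\<in>S. w \<noteq> w0 \<longrightarrow> h w = (exp w + \<i>) / den w) \<and>
      h w0 = - \<i> / (of_real \<alpha> * z0)"
    by (rule removable_quotient[OF _ hden open_S w0_S g0 den0 dg dden az])
       (use den_zero in \<open>auto intro!: holomorphic_intros\<close>)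
  then obtain h1 where h1: "h1 holomorphic_on S" "\<forall>w\<in>S. w \<noteq> w0 \<longrightarrow> h1 w = (exp w + \<i>) / den w"
    "h1 w0 = - \<i> / (of_real \<alpha> * z0)"
    by (elim exE conjE)
  \<comment> \<open>Dividing \<open>N\<close> by \<open>exp w + \<i>\<close> gives
    \<open>gh w - bb / (exp w + \<i>)\<close>; the zero of \<open>N\<close> at \<open>w0\<close>
    expresses that \<open>bb\<close> is the residue.\<close>
  define N where "N w = exp (of_real (\<alpha> - \<beta>) * w) * h1 w - bb" for w
  have hN: "N holomorphic_on S" unfolding N_def[abs_def] by (intro holomorphic_intros h1(1))
  have N0: "N w0 = 0"
  proof -
    have "exp (of_real (\<alpha> - \<beta>) * w0) * exp w0 = exp (of_real (1 - \<beta>) * w0) * z0"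
      unfolding z0_eq by (simp add: mult_exp_exp algebra_simps)
    then have "exp (of_real (\<alpha> - \<beta>) * w0) * (- \<i> / (of_real \<alpha> * z0)) = exp (of_real (1 - \<beta>) * w0) / of_real \<alpha>"
      using z0_norm(2) alpha by (simp add: exp_w0 field_simps)
    then show ?thesis by (simp add: N_def h1(3) bb_def)
  qed
  have "\<exists>h. h holomorphic_on S \<and> (\<forall>w\<in>S. w \<noteq> w0 \<longrightarrow> h w = N w / (exp w + \<i>)) \<and>
      h w0 = deriv N w0 / - \<i>"
    by (rule removable_quotient[OF hN _ open_S w0_S N0 g0 holomorphic_derivI[OF hN open_S w0_S] dg])
       (use exp_w0_zero in \<open>auto intro!: holomorphic_intros\<close>)
  then obtain h2 where h2: "h2 holomorphic_on S" "\<forall>w\<in>S. w \<noteq> w0 \<longrightarrow> h2 w = N w / (exp w + \<i>)"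
    by (elim exE conjE)
  have h2': "h2 w = gh w - bb / (exp w + \<i>)" if w: "w \<in> S" "w \<noteq> w0" for w
  proof -
    have "exp w + \<i> \<noteq> 0" "den w \<noteq> 0" using exp_w0_zero den_zero w by auto
    then show ?thesis using h1(2) h2(2) w by (simp add: N_def gh_def field_simps)
  qed
  \<comment> \<open>The factor \<open>2 * p / (exp w + p)\<close> equals 1 at \<open>wp\<close>, so
    the pole there is removed, and unlike a constant it decays to the right, which keeps the
    subtracted term integrable.\<close>
  define N3 where "N3 w = (h2 w - mp * (2 * of_real p) / (exp w + of_real p)) * exp w" for w
  have hN3: "N3 holomorphic_on S"
    unfolding N3_def[abs_def] using exp_plus_p_nonzero[OF _ assms] by (intro holomorphic_intros h2(1)) auto
  have N30: "N3 wp = 0"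
  proof -
    have "h2 wp = mp" using h2'[OF wpS ne] by (simp add: mp_def ewp)
    moreover have "of_real p + of_real p = (2 * of_real p :: complex)" by simp
    ultimately show ?thesis using assms by (simp add: N3_def ewp)
  qed
  have dp: "((\<lambda>w. exp w - of_real p) has_field_derivative of_real p) (at wp)"
    by (auto intro!: derivative_eq_intros simp: ewp)
  have "\<exists>h. h holomorphic_on S \<and> (\<forall>w\<in>S. w \<noteq> wp \<longrightarrow> h w = N3 w / (exp w - of_real p)) \<and>
      h wp = deriv N3 wp / of_real p"
    by (rule removable_quotient[OF hN3 _ open_S wpS N30 _ holomorphic_derivI[OF hN3 open_S wpS] dp])
       (use assms ewp exp_p_zero[OF _ assms] in \<open>auto intro!: holomorphic_intros simp: wp_def\<close>)
  then obtain h3 where h3: "h3 holomorphic_on S" "\<forall>w\<in>S. w \<noteq> wp \<longrightarrow> h3 w = N3 w / (exp w - of_real p)"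
    by (elim exE conjE)
  define F where "F w = TA p w + ((- bb) * TB (- \<i>) p w + (- (2 * of_real p * mp)) * TB (- of_real p) p w)" for w
  have h3': "h3 w = F w" if w: "w \<in> S" "w \<noteq> w0" "w \<noteq> wp" for w
  proof -
    have nz: "exp w + \<i> \<noteq> 0" "den w \<noteq> 0" "exp w - of_real p \<noteq> 0" "exp w + of_real p \<noteq> 0"
      using exp_w0_zero den_zero w exp_p_zero[OF _ assms] exp_plus_p_nonzero[OF _ assms] by (auto simp: wp_def)
    have ea: "exp (of_real (\<alpha> - \<beta> + 1) * w) = exp (of_real (\<alpha> - \<beta>) * w) * exp w"
      by (simp add: mult_exp_exp algebra_simps)
    have "F w = exp (of_real (\<alpha> - \<beta>) * w) * exp w / (den w * (exp w - of_real p))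
        - bb * (exp w / ((exp w + \<i>) * (exp w - of_real p)))
        - mp * (2 * of_real p) * (exp w / ((exp w + of_real p) * (exp w - of_real p)))"
      unfolding F_def TA_def TB_def ea den_def by simp
    also have "\<dots> = N3 w / (exp w - of_real p)"
    proof -
      have "X * q / (d * r) - b * (q / (u * r)) - c * (q / (v * r)) = (X / d - b / u - c / v) * q / r"
        for X q d r b u c v :: complex
        by (simp add: divide_inverse inverse_mult_distrib algebra_simps)
      then show ?thesis unfolding N3_def h2'[OF w(1,2)] gh_def .
    qed
    finally show ?thesis using h3(2) w by simp
  qed
  \<comment> \<open>\<open>F\<close> takes arbitrary values at its two removable singularities;
    \<open>G\<close> corrects them and agrees with \<open>F\<close> on both lines.\<close>
  define G where "G w = (if w = w0 \<or> w = wp then h3 w else F w)" for w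
  have "G holomorphic_on S"
    using h3(1) by (rule holomorphic_transform) (auto simp: G_def h3')
  moreover have "utail F"
    unfolding F_def using assms by (intro utail_add utail_cmult utail_TA utail_TB) auto
  then have "utail G"
    by (rule utail_cong[of _ "\<bar>ln p\<bar>"]) (auto simp: G_def w0_def wp_def)
  ultimately have "(\<integral>x. G (Complex x (- \<theta>)) \<partial>lborel) = (\<integral>x. G (Complex x \<theta>) \<partial>lborel)"
    unfolding S_def using vt theta_pos by (intro utail_line_shift) auto
  moreover have "G (Complex x y) = F (Complex x y)" if "\<bar>y\<bar> = \<theta>" for x y
    using that theta theta_pos by (auto simp: G_def w0_def wp_def complex_eq_iff)
  ultimately have eq: "(\<integral>x. F (Complex x (- \<theta>)) \<partial>lborel) = (\<integral>x. F (Complex x \<theta>) \<partial>lborel)"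
    using theta_pos by simp
  have FI: "(\<integral>x. F (Complex x y) \<partial>lborel) = (\<integral>x. TA p (Complex x y) \<partial>lborel)
      + ((- bb) * (\<integral>x. TB (- \<i>) p (Complex x y) \<partial>lborel)
      + (- (2 * of_real p * mp)) * (\<integral>x. TB (- of_real p) p (Complex x y) \<partial>lborel))" if y: "\<bar>y\<bar> = \<theta>" for y
  proof -
    have i: "integrable lborel (\<lambda>x. (- bb) * TB (- \<i>) p (Complex x y))"
      "integrable lborel (\<lambda>x. (- (2 * of_real p * mp)) * TB (- of_real p) p (Complex x y))"
      using y assms by (intro integrable_mult_right integrable_TB; simp)+
    show ?thesis
      unfolding F_def
      by (simp only: Bochner_Integration.integral_add[OF integrable_TA[OF y assms] Bochner_Integration.integrable_add[OF i]]
          Bochner_Integration.integral_add[OF i] Bochner_Integration.integral_mult_right_zero)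
  qed
  have th: "\<bar>\<theta>\<bar> = \<theta>" "\<bar>- \<theta>\<bar> = \<theta>" using theta_pos by auto
  have alg: "a - b = c * (u - v)" if "b + (x * t + (- c) * v) = a + (x * t + (- c) * u)" for a b c t u v x :: complex
    using that by (simp add: algebra_simps)
  have "(\<integral>x. TA p (Complex x \<theta>) \<partial>lborel) - (\<integral>x. TA p (Complex x (- \<theta>)) \<partial>lborel) =
    2 * of_real p * mp * (- (\<i> * of_real (pi / (2 * p))) - \<i> * of_real (pi / (2 * p)))"
    by (rule alg[OF eq[unfolded FI[OF th(1)] FI[OF th(2)] integral_TB_p[OF assms] integral_TB_i[OF assms]]])
  also have "\<dots> = - (2 * of_real pi * \<i>) * mp"
    using assms by (simp add: field_simps)
  finally show ?thesis by (simp add: mp_def wp_def)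
qed

end

lemma integrable_product_bound:
  fixes F :: "real \<times> real \<Rightarrow> complex" and f g :: "real \<Rightarrow> real"
  assumes f: "integrable lborel f" and g: "integrable lborel g"
    and m: "F \<in> borel_measurable (lborel \<Otimes>\<^sub>M lborel)"
    and b: "\<And>x y. norm (F (x, y)) \<le> f x * g y"
  shows "integrable (lborel \<Otimes>\<^sub>M lborel) F"
proof (rule Bochner_Integration.integrable_bound)
  show "integrable (lborel \<Otimes>\<^sub>M lborel) (\<lambda>z. f (fst z) * g (snd z))"
  proof (rule lborel_pair.Fubini_integrable)
    show "(\<lambda>z. f (fst z) * g (snd z)) \<in> borel_measurable (lborel \<Otimes>\<^sub>M lborel)"
      using borel_measurable_integrable[OF f] borel_measurable_integrable[OF g] by measurable
    have "(\<lambda>x. \<integral>y. norm (f (fst (x, y)) * g (snd (x, y))) \<partial>lborel) = (\<lambda>x. \<bar>f x\<bar> * (\<integral>y. \<bar>g y\<bar> \<partial>lborel))"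
      by (simp add: abs_mult)
    then show "integrable lborel (\<lambda>x. \<integral>y. norm (f (fst (x, y)) * g (snd (x, y))) \<partial>lborel)"
      using f by simp
    show "AE x in lborel. integrable lborel (\<lambda>y. f (fst (x, y)) * g (snd (x, y)))"
      using g by simp
  qed
  show "F \<in> borel_measurable (lborel \<Otimes>\<^sub>M lborel)" by (rule m)
  show "AE z in lborel \<Otimes>\<^sub>M lborel. norm (F z) \<le> norm (f (fst z) * g (snd z))"
  proof (intro always_eventually allI)
    fix z show "norm (F z) \<le> norm (f (fst z) * g (snd z))"
      using b[of "fst z" "snd z"] abs_ge_self[of "f (fst z) * g (snd z)"] by (simp del: abs_mult)
  qed
qed

text \<open>Uses \<open>exp y \<ge> (y / n) ^ n\<close>.\<close>

lemma double_exp_bound: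
  fixes \<kappa> c :: real
  assumes "0 < \<kappa>" "0 < c"
  obtains C where "0 \<le> C" "\<And>x. exp (- (\<kappa> * exp x) + c * x) \<le> C * exp (- min 1 c * \<bar>x\<bar>)"
proof -
  obtain n :: nat where n: "c + 1 < real n" using reals_Archimedean2 by blast
  then have n0: "0 < real n" using assms by linarith
  let ?C = "max 1 ((real n / \<kappa>) ^ n)"
  show thesis
  proof (rule that[of ?C])
    fix x :: real
    show "exp (- (\<kappa> * exp x) + c * x) \<le> ?C * exp (- min 1 c * \<bar>x\<bar>)"
    proof (cases "x \<le> 0")
      case True
      have "- (\<kappa> * exp x) + c * x \<le> c * x" using assms by simp
      also have "c * x \<le> min 1 c * x" using True by (intro mult_right_mono_neg) auto
      also have "\<dots> = - min 1 c * \<bar>x\<bar>" using True by simp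
      finally have "exp (- (\<kappa> * exp x) + c * x) \<le> 1 * exp (- min 1 c * \<bar>x\<bar>)" by simp
      also have "\<dots> \<le> ?C * exp (- min 1 c * \<bar>x\<bar>)" by (intro mult_right_mono) auto
      finally show ?thesis .
    next
      case False
      let ?y = "\<kappa> * exp x"
      have y: "0 < ?y" using assms by simp
      have "0 \<le> ?y / n" using y by (intro divide_nonneg_nonneg) auto
      then have "(?y / n) ^ n \<le> exp (?y / n) ^ n"
        using exp_ge_add_one_self[of "?y / n"] by (intro power_mono) linarith+
      also have "\<dots> = exp ?y" using n0 by (simp add: exp_of_nat_mult[symmetric])
      finally have "inverse (exp ?y) \<le> inverse ((?y / n) ^ n)"
        using y n0 by (intro le_imp_inverse_le) auto
      also have "\<dots> = (real n / \<kappa>) ^ n * exp (- (real n * x))"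
        using assms n0
        by (simp add: power_divide power_mult_distrib exp_of_nat_mult[symmetric] exp_minus field_simps)
      finally have "exp (- ?y) * exp (c * x) \<le> ((real n / \<kappa>) ^ n * exp (- (real n * x))) * exp (c * x)"
        by (intro mult_right_mono) (auto simp: exp_minus)
      also have "\<dots> = (real n / \<kappa>) ^ n * exp (- (real n - c) * x)"
        by (simp add: mult.assoc mult_exp_exp algebra_simps)
      also have "\<dots> \<le> ?C * exp (- min 1 c * \<bar>x\<bar>)"
      proof (rule mult_mono)
        have "min 1 c * x \<le> (real n - c) * x" using n False by (intro mult_right_mono) auto
        moreover have "\<bar>x\<bar> = x" using False by simp
        ultimately show "exp (- (real n - c) * x) \<le> exp (- min 1 c * \<bar>x\<bar>)"
          by (simp only: exp_le_cancel_iff mult_minus_left neg_le_iff_le)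
      qed auto
      finally show ?thesis by (simp add: mult_exp_exp)
    qed
  qed simp
qed

lemma double_exp_integrable:
  fixes \<kappa> c :: real
  assumes "0 < \<kappa>" "0 < c"
  shows "integrable lborel (\<lambda>x. exp (- (\<kappa> * exp x) + c * x))"
proof -
  obtain C where C: "0 \<le> C" "\<And>x. exp (- (\<kappa> * exp x) + c * x) \<le> C * exp (- min 1 c * \<bar>x\<bar>)"
    using double_exp_bound[OF assms] by blast
  have mc: "0 < min 1 c" using assms by simp
  show ?thesis
  proof (rule Bochner_Integration.integrable_bound)
    show "integrable lborel (\<lambda>x. C * exp (- min 1 c * \<bar>x\<bar>))"
      using integrable_exp_abs[OF mc] by (rule integrable_mult_right)
    show "AE x in lborel. norm (exp (- (\<kappa> * exp x) + c * x)) \<le> norm (C * exp (- min 1 c * \<bar>x\<bar>))"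
      using C by (intro always_eventually allI) simp
  qed measurable
qed

context ml_strip
begin

text \<open>The factor \<open>exp (Complex x y)\<close> is the Jacobian of the substitution
  \<open>q = exp w\<close>.\<close>

definition ker :: "real \<Rightarrow> real \<Rightarrow> complex" where
  "ker y x = gh (Complex x y) * exp (Complex x y)"

text \<open>The inversion integral over the ray \<open>arg q = y\<close>. It converges absolutely
  for all \<open>0 \<le> s\<close>, since \<open>ker\<close> is integrable and the exponential
  factor has modulus at most 1 there.\<close>

definition Rk :: "real \<Rightarrow> real \<Rightarrow> complex" where
  "Rk y s = (\<integral>x. exp (of_real s * exp (Complex x y)) * ker y x \<partial>lborel)"

lemma ker_eq: "ker y x = exp (of_real (\<alpha> - \<beta> + 1) * Complex x y) / (exp (of_real \<alpha> * Complex x y) - z0)"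
proof -
  have "exp (of_real (\<alpha> - \<beta> + 1) * Complex x y) = exp (of_real (\<alpha> - \<beta>) * Complex x y) * exp (Complex x y)"
    by (simp add: mult_exp_exp algebra_simps)
  then show ?thesis by (simp add: ker_def gh_def den_def)
qed

lemma continuous_ker: "\<bar>y\<bar> = \<theta> \<Longrightarrow> continuous_on UNIV (ker y)"
  unfolding ker_def[abs_def] gh_def den_def[abs_def] using line_den[unfolded den_def]
  by (intro continuous_intros) auto

lemma integrable_ker:
  assumes "\<bar>y\<bar> = \<theta>"
  shows "integrable lborel (ker y)"
proof -
  have "utail (\<lambda>w. exp (of_real (\<alpha> - \<beta> + 1) * w) / (exp (of_real \<alpha> * w) - z0))"
    using alpha beta z0_norm by (intro utail_frac1) auto
  from utail_exp_tails[OF this, of y] have "exp_tails (ker y)"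
    unfolding ker_eq[abs_def] .
  then show ?thesis by (rule exp_tails_integrable[OF continuous_ker[OF assms]])
qed

lemma norm_exp_line:
  assumes "\<bar>y\<bar> = \<theta>"
  shows "cmod (exp (of_real s * exp (Complex x y))) = exp (s * (exp x * cos \<theta>))"
  using line_cos[OF assms] by (simp add: norm_exp_eq_Re exp_line)

lemma norm_exp_line_le_1:
  assumes "\<bar>y\<bar> = \<theta>" "0 \<le> s"
  shows "cmod (exp (of_real s * exp (Complex x y))) \<le> 1"
  using cos_theta assms(2) unfolding norm_exp_line[OF assms(1)]
  by (simp add: mult_nonneg_nonpos)

lemma integrable_Rk:
  assumes "\<bar>y\<bar> = \<theta>" "0 \<le> s"
  shows "integrable lborel (\<lambda>x. exp (of_real s * exp (Complex x y)) * ker y x)"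
proof (rule Bochner_Integration.integrable_bound[OF integrable_ker[OF assms(1)]])
  have "continuous_on UNIV (\<lambda>x. exp (of_real s * exp (Complex x y)) * ker y x)"
    by (intro continuous_intros continuous_ker[OF assms(1)])
  then show "(\<lambda>x. exp (of_real s * exp (Complex x y)) * ker y x) \<in> borel_measurable lborel"
    using borel_measurable_continuous_onI by simp
  show "AE x in lborel. norm (exp (of_real s * exp (Complex x y)) * ker y x) \<le> norm (ker y x)"
    using norm_exp_line_le_1[OF assms] by (intro always_eventually allI) (simp add: norm_mult mult_left_le_one_le)
qed

lemma Rk_bounded:
  assumes "\<bar>y\<bar> = \<theta>" "0 \<le> s"
  shows "cmod (Rk y s) \<le> (\<integral>x. norm (ker y x) \<partial>lborel)"
  unfolding Rk_def
proof (rule Bochner_Integration.integral_norm_bound_integral[OF integrable_Rk[OF assms]])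
  show "integrable lborel (\<lambda>x. norm (ker y x))" using integrable_ker[OF assms(1)] by (rule integrable_norm)
  show "norm (exp (of_real s * exp (Complex x y)) * ker y x) \<le> norm (ker y x)" for x
    using norm_exp_line_le_1[OF assms] by (simp add: norm_mult mult_left_le_one_le)
qed

lemma continuous_Rk:
  assumes "\<bar>y\<bar> = \<theta>"
  shows "continuous_on {0..} (Rk y)"
  unfolding continuous_on_sequentially
proof (intro allI ballI impI, elim conjE)
  fix f :: "nat \<Rightarrow> real" and a assume a: "a \<in> {0..}" and f: "\<forall>n. f n \<in> {0..}" "f \<longlonglongrightarrow> a"
  show "(Rk y \<circ> f) \<longlonglongrightarrow> Rk y a"
    unfolding Rk_def comp_def
  proof (rule integral_dominated_convergence[where w="\<lambda>x. norm (ker y x)"])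
    show "integrable lborel (\<lambda>x. norm (ker y x))" using integrable_ker[OF assms] by (rule integrable_norm)
    show "(\<lambda>x. exp (of_real a * exp (Complex x y)) * ker y x) \<in> borel_measurable lborel"
      using a by (intro borel_measurable_integrable integrable_Rk[OF assms]) auto
    show "(\<lambda>x. exp (of_real (f n) * exp (Complex x y)) * ker y x) \<in> borel_measurable lborel" for n
      using f(1) by (intro borel_measurable_integrable integrable_Rk[OF assms]) auto
    show "AE x in lborel. (\<lambda>n. exp (of_real (f n) * exp (Complex x y)) * ker y x) \<longlonglongrightarrow>
        exp (of_real a * exp (Complex x y)) * ker y x"
      by (intro always_eventually allI tendsto_intros f(2))
    show "AE x in lborel. norm (exp (of_real (f n) * exp (Complex x y)) * ker y x) \<le> norm (ker y x)" for n
      using norm_exp_line_le_1[OF assms, of "f n"] f(1)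
      by (intro always_eventually allI) (simp add: norm_mult mult_left_le_one_le)
  qed
qed

text \<open>Fubini with a product majorant. The inner integral over time is
  \<open>1 / (p - q)\<close>, which is available because \<open>q\<close> lies in the left half
  plane and \<open>p\<close> is positive.\<close>

lemma Rk_laplace:
  assumes y: "\<bar>y\<bar> = \<theta>" and p: "0 < p"
  shows "set_integrable lborel {0<..} (\<lambda>s. exp (- (p * s)) *\<^sub>R Rk y s)"
    and "(LINT s:{0<..}|lborel. exp (- (p * s)) *\<^sub>R Rk y s) = - (\<integral>x. TA p (Complex x y) \<partial>lborel)"
proof -
  let ?e = "\<lambda>s. indicator {0<..} s * exp (- (p * s))"
  let ?F = "\<lambda>s x. ?e s *\<^sub>R (exp (of_real s * exp (Complex x y)) * ker y x)"
  have "?e = (\<lambda>s. indicator {0<..} s * (exp (- (p * s)) * s powr (1 - 1)))"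
    by (auto simp: indicator_def fun_eq_iff)
  then have ei: "integrable lborel ?e"
    using powr_laplace(1)[of 1 p] p by simp
  have k[measurable]: "ker y \<in> borel_measurable borel"
    using borel_measurable_integrable[OF integrable_ker[OF y]] by simp
  have c[measurable]: "(\<lambda>x. exp (Complex x y)) \<in> borel_measurable borel"
    by (intro borel_measurable_continuous_onI continuous_intros)
  have "integrable (lborel \<Otimes>\<^sub>M lborel) (\<lambda>z. ?F (fst z) (snd z))"
  proof (rule integrable_product_bound[OF ei integrable_norm[OF integrable_ker[OF y]]])
    show "(\<lambda>z. ?F (fst z) (snd z)) \<in> borel_measurable (lborel \<Otimes>\<^sub>M lborel)" by measurable
    fix s x
    show "norm (?F (fst (s, x)) (snd (s, x))) \<le> ?e s * norm (ker y x)"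
    proof (cases "0 < s")
      case True
      then have "cmod (exp (of_real s * exp (Complex x y))) * norm (ker y x) \<le> 1 * norm (ker y x)"
        using norm_exp_line_le_1[OF y, of s x] by (intro mult_right_mono) auto
      then show ?thesis using True by (simp add: norm_mult)
    qed simp
  qed
  then have Fi: "integrable (lborel \<Otimes>\<^sub>M lborel) (case_prod ?F)" by (simp add: case_prod_unfold)
  have in1: "(\<integral>x. ?F s x \<partial>lborel) = indicator {0<..} s *\<^sub>R (exp (- (p * s)) *\<^sub>R Rk y s)" for s
    unfolding Rk_def by (simp only: integral_scaleR_right scaleR_scaleR)
  show "set_integrable lborel {0<..} (\<lambda>s. exp (- (p * s)) *\<^sub>R Rk y s)"
    using lborel_pair.integrable_fst[OF Fi] unfolding in1 set_integrable_def .
  have in2: "(\<integral>s. ?F s x \<partial>lborel) = - TA p (Complex x y)" for x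
  proof -
    define q where "q = exp (Complex x y)"
    have r: "0 < Re (of_real p - q)" using line_Re[OF y, of x] p by (simp add: q_def)
    have "(\<integral>s. ?F s x \<partial>lborel) = (\<integral>s. indicator {0<..} s *\<^sub>R exp (- ((of_real p - q) * of_real s)) * ker y x \<partial>lborel)"
    proof (intro Bochner_Integration.integral_cong refl)
      fix s
      have "exp (- ((of_real p - q) * of_real s)) = of_real (exp (- (p * s))) * exp (of_real s * q)"
        by (simp add: exp_of_real[symmetric] mult_exp_exp algebra_simps)
      then show "?F s x = indicator {0<..} s *\<^sub>R exp (- ((of_real p - q) * of_real s)) * ker y x"
        by (simp add: q_def scaleR_conv_of_real mult.assoc)
    qed
    also have "\<dots> = 1 / (of_real p - q) * ker y x"
      using exp_laplace(2)[OF r] by (simp only: Bochner_Integration.integral_mult_left_zero set_lebesgue_integral_def)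
    also have "\<dots> = - TA p (Complex x y)"
    proof -
      have "- (X / (d * (q - P))) = 1 / (P - q) * (X / d)" for X d P
        by (metis (no_types, lifting) divide_divide_eq_left' minus_diff_eq minus_divide_right times_divide_eq_left mult_1 mult.commute)
      then show ?thesis unfolding ker_eq TA_def q_def by simp
    qed
    finally show ?thesis .
  qed
  have "(LINT s:{0<..}|lborel. exp (- (p * s)) *\<^sub>R Rk y s) = (\<integral>s. (\<integral>x. ?F s x \<partial>lborel) \<partial>lborel)"
    unfolding in1 set_lebesgue_integral_def ..
  also have "\<dots> = (\<integral>x. (\<integral>s. ?F s x \<partial>lborel) \<partial>lborel)"
    by (rule lborel_pair.Fubini_integral[OF Fi, symmetric])
  finally show "(LINT s:{0<..}|lborel. exp (- (p * s)) *\<^sub>R Rk y s) = - (\<integral>x. TA p (Complex x y) \<partial>lborel)"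
    unfolding in2 by simp
qed

text \<open>What the two rays contribute to the deformed inversion contour; the residue at
  \<open>w0\<close> contributes the oscillating term.\<close>

definition RR :: "real \<Rightarrow> complex" where
  "RR s = (Rk \<theta> s - Rk (- \<theta>) s) / (2 * of_real pi * \<i>)"

lemma abs_theta: "\<bar>\<theta>\<bar> = \<theta>" "\<bar>- \<theta>\<bar> = \<theta>"
  using theta_pos by auto

lemma RR_laplace:
  assumes p: "0 < p"
  shows "set_integrable lborel {0<..} (\<lambda>s. exp (- (p * s)) *\<^sub>R RR s)"
    and "(LINT s:{0<..}|lborel. exp (- (p * s)) *\<^sub>R RR s) = gh (of_real (ln p)) - bb / (of_real p + \<i>)"
proof -
  note L1 = Rk_laplace[OF abs_theta(1) p] and L2 = Rk_laplace[OF abs_theta(2) p]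
  have e: "(\<lambda>s. exp (- (p * s)) *\<^sub>R RR s) =
      (\<lambda>s. (exp (- (p * s)) *\<^sub>R Rk \<theta> s - exp (- (p * s)) *\<^sub>R Rk (- \<theta>) s) / (2 * of_real pi * \<i>))"
    by (auto simp: RR_def scaleR_conv_of_real algebra_simps diff_divide_distrib)
  note D = set_integral_diff[OF L1(1) L2(1)]
  show "set_integrable lborel {0<..} (\<lambda>s. exp (- (p * s)) *\<^sub>R RR s)"
    unfolding e using D(1) by (rule set_integrable_divide)
  have "(LINT s:{0<..}|lborel. exp (- (p * s)) *\<^sub>R RR s) =
    (- (\<integral>x. TA p (Complex x \<theta>) \<partial>lborel) - - (\<integral>x. TA p (Complex x (- \<theta>)) \<partial>lborel)) / (2 * of_real pi * \<i>)"
    unfolding e set_integral_divide_zero D(2) L1(2) L2(2) ..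
  also have "\<dots> = - ((\<integral>x. TA p (Complex x \<theta>) \<partial>lborel) - (\<integral>x. TA p (Complex x (- \<theta>)) \<partial>lborel)) / (2 * of_real pi * \<i>)"
    by simp
  also have "\<dots> = gh (of_real (ln p)) - bb / (of_real p + \<i>)"
    unfolding integral_TA[OF p] by simp
  finally show "(LINT s:{0<..}|lborel. exp (- (p * s)) *\<^sub>R RR s) = gh (of_real (ln p)) - bb / (of_real p + \<i>)" .
qed

lemma gh_ln: "0 < p \<Longrightarrow> gh (of_real (ln p)) = of_real (p powr (\<alpha> - \<beta>)) / (of_real (p powr \<alpha>) - z0)"
  unfolding gh_def den_def by (simp only: exp_of_real_mult_ln)

lemma continuous_RR: "continuous_on {0..} RR"
  unfolding RR_def[abs_def] by (intro continuous_intros continuous_Rk abs_theta) auto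

theorem ml_representation:
  assumes "0 < s"
  shows "ml \<alpha> \<beta> z0 s = bb * exp (- (\<i> * of_real s)) + RR s"
proof -
  define V where "V s = ml \<alpha> \<beta> z0 s - (bb * exp (- (\<i> * of_real s)) + RR s)" for s
  have Vi: "set_integrable lborel {0<..} (\<lambda>s. exp (- (p * s)) *\<^sub>R V s)"
    and V0: "(LINT s:{0<..}|lborel. exp (- (p * s)) *\<^sub>R V s) = 0" if p: "1 < p" for p
  proof -
    have p0: "0 < p" using p by simp
    have r: "0 < Re (of_real p + \<i>)" using p by simp
    note A = ml_laplace[of \<alpha> \<beta> p z0, OF _ _ p z0_norm(1)]
    have ab: "1 \<le> \<alpha>" "0 < \<beta>" using alpha beta by auto
    note B = exp_laplace[OF r] and C = RR_laplace[OF p0]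
    have Bi: "set_integrable lborel {0<..} (\<lambda>s. bb * exp (- ((of_real p + \<i>) * of_real s)))"
      using B(1) by (intro set_integrable_mult_right) auto
    note BC = set_integral_add[OF Bi C(1)]
    note ABC = set_integral_diff[OF A(1)[OF ab] BC(1)]
    have e: "(\<lambda>s. exp (- (p * s)) *\<^sub>R V s) = (\<lambda>s. exp (- (p * s)) *\<^sub>R ml \<alpha> \<beta> z0 s -
        (bb * exp (- ((of_real p + \<i>) * of_real s)) + exp (- (p * s)) *\<^sub>R RR s))"
    proof
      fix s
      have "exp (- ((of_real p + \<i>) * of_real s)) = of_real (exp (- (p * s))) * exp (- (\<i> * of_real s))"
        by (simp add: exp_of_real[symmetric] mult_exp_exp algebra_simps)
      then show "exp (- (p * s)) *\<^sub>R V s = exp (- (p * s)) *\<^sub>R ml \<alpha> \<beta> z0 s -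
        (bb * exp (- ((of_real p + \<i>) * of_real s)) + exp (- (p * s)) *\<^sub>R RR s)"
        by (simp add: V_def scaleR_conv_of_real algebra_simps)
    qed
    show "set_integrable lborel {0<..} (\<lambda>s. exp (- (p * s)) *\<^sub>R V s)"
      unfolding e by (rule ABC(1))
    show "(LINT s:{0<..}|lborel. exp (- (p * s)) *\<^sub>R V s) = 0"
      unfolding e ABC(2) BC(2) A(2)[OF ab] C(2) set_integral_mult_right B(2) gh_ln[OF p0] by simp
  qed
  \<comment> \<open>The factor \<open>exp (- 2 * s)\<close> makes the difference integrable and
    turns its moments into transforms at \<open>2 + n\<close>, inside the range \<open>1 < p\<close>
    where the transforms are known.\<close>
  let ?H = "\<lambda>s. exp (- (2 * s)) *\<^sub>R V s"
  have "?H s = 0"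
  proof (rule laplace_unique[OF _ _ _ assms])
    have "continuous_on {0<..} (ml \<alpha> \<beta> z0)"
      using alpha beta by (intro continuous_on_subset[OF continuous_on_ml]) auto
    moreover have "continuous_on {0<..} RR"
      by (rule continuous_on_subset[OF continuous_RR]) auto
    ultimately show "continuous_on {0<..} ?H"
      unfolding V_def[abs_def] by (intro continuous_intros)
    show "set_integrable lborel {0<..} ?H" by (rule Vi) simp
    fix n :: nat
    have "exp (- s) ^ n *\<^sub>R ?H s = exp (- ((2 + real n) * s)) *\<^sub>R V s" for s
    proof -
      have "exp (- s) ^ n = exp (real n * (- s))" by (rule exp_of_nat_mult[symmetric])
      then have "exp (- s) ^ n * exp (- (2 * s)) = exp (- ((2 + real n) * s))"
        by (simp only: mult_exp_exp) (simp add: algebra_simps)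
      then show ?thesis by (simp only: scaleR_scaleR)
    qed
    then have "(\<lambda>s. exp (- s) ^ n *\<^sub>R ?H s) = (\<lambda>s. exp (- ((2 + real n) * s)) *\<^sub>R V s)"
      by (rule ext)
    then show "(LINT s:{0<..}|lborel. exp (- s) ^ n *\<^sub>R ?H s) = 0"
      by (simp only:) (rule V0, simp)
  qed
  then show ?thesis by (simp add: V_def)
qed

end

section \<open>Decay of the remainder and its leading coefficient\<close>

lemma powr_tail_integrable:
  fixes e :: real
  assumes "e < - 1"
  shows "integrable lborel (\<lambda>s. indicator {1..} s * s powr e)"
proof -
  have "((\<lambda>s. s powr e) has_integral - (1 powr (e + 1)) / (e + 1)) {1..}"
    by (rule has_integral_powr_to_inf[OF assms]) simp
  then have "set_integrable lebesgue {1..} (\<lambda>s. s powr e)"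
    by (intro nonnegative_absolutely_integrable_1) (auto simp: integrable_on_def)
  then have "integrable lebesgue (\<lambda>s. indicator {1..} s * s powr e)"
    by (simp add: set_integrable_def)
  moreover have "(\<lambda>s. indicator {1..} s * s powr e) \<in> borel_measurable lborel" by measurable
  ultimately show ?thesis by (simp add: integrable_completion)
qed

context ml_strip
begin

text \<open>The integral of \<open>exp q\<close> times the power \<open>c - 1\<close> of
  \<open>q\<close> along the ray \<open>arg q = y\<close>, the building block of Hankel's formula
  for the reciprocal Gamma function.\<close>

definition MM :: "real \<Rightarrow> real \<Rightarrow> complex" where
  "MM c y = (\<integral>x. exp (exp (Complex x y)) * exp (of_real c * Complex x y) \<partial>lborel)"

lemma norm_kernel:
  assumes "\<bar>y\<bar> = \<theta>"
  shows "cmod (exp (of_real s * exp (Complex x y)) * exp (of_real c * Complex x y)) =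
    exp (- (s * - cos \<theta> * exp x) + c * x)"
  unfolding norm_mult norm_exp_line[OF assms] by (simp add: norm_exp_eq_Re mult_exp_exp mult_ac)

lemma integrable_kernel:
  assumes "\<bar>y\<bar> = \<theta>" "0 < s" "0 < c"
  shows "integrable lborel (\<lambda>x. exp (of_real s * exp (Complex x y)) * exp (of_real c * Complex x y))"
proof (rule Bochner_Integration.integrable_bound)
  show "integrable lborel (\<lambda>x. exp (- (s * - cos \<theta> * exp x) + c * x))"
    using cos_theta assms by (intro double_exp_integrable) (auto simp: mult_pos_neg)
  have "continuous_on UNIV (\<lambda>x. exp (of_real s * exp (Complex x y)) * exp (of_real c * Complex x y))"
    by (intro continuous_intros)
  then show "(\<lambda>x. exp (of_real s * exp (Complex x y)) * exp (of_real c * Complex x y)) \<in> borel_measurable lborel"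
    using borel_measurable_continuous_onI by simp
  show "AE x in lborel. norm (exp (of_real s * exp (Complex x y)) * exp (of_real c * Complex x y)) \<le>
      norm (exp (- (s * - cos \<theta> * exp x) + c * x))"
    unfolding norm_kernel[OF assms(1)] by simp
qed

text \<open>Translating \<open>x\<close> by \<open>ln s\<close> moves the whole dependence on
  \<open>s\<close> into the factor \<open>s powr (- c)\<close>.\<close>

lemma kernel_scale:
  assumes "0 < s"
  shows "(\<integral>x. exp (of_real s * exp (Complex x y)) * exp (of_real c * Complex x y) \<partial>lborel) =
    of_real (s powr (- c)) * MM c y"
proof -
  let ?f = "\<lambda>x. exp (of_real s * exp (Complex x y)) * exp (of_real c * Complex x y)"
  have "(\<integral>x. ?f x \<partial>lborel) = \<bar>1\<bar> *\<^sub>R (\<integral>x. ?f (- ln s + 1 * x) \<partial>lborel)"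
    by (rule lborel_integral_real_affine[where f="?f" and c=1 and t="- ln s"]) simp
  moreover have "?f (- ln s + 1 * x) = of_real (s powr (- c)) * (exp (exp (Complex x y)) * exp (of_real c * Complex x y))" for x
  proof -
    have "of_real s * exp (Complex (- ln s + 1 * x) y) = exp (Complex x y)"
      using assms by (simp add: exp_line exp_diff)
    moreover have "of_real c * Complex (- ln s + 1 * x) y = of_real (- c) * of_real (ln s) + of_real c * Complex x y"
      by (simp add: complex_eq_iff algebra_simps)
    then have "exp (of_real c * Complex (- ln s + 1 * x) y) = of_real (s powr (- c)) * exp (of_real c * Complex x y)"
      by (simp only: exp_add exp_of_real_mult_ln[OF assms])
    ultimately show ?thesis by (simp only: mult_ac)
  qed
  ultimately show ?thesis
    by (simp only: Bochner_Integration.integral_mult_right_zero MM_def) simp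
qed

lemma double_exp_scale:
  fixes s \<kappa> c :: real
  assumes "0 < s"
  shows "(\<integral>x. exp (- (s * \<kappa> * exp x) + c * x) \<partial>lborel) = s powr (- c) * (\<integral>x. exp (- (\<kappa> * exp x) + c * x) \<partial>lborel)"
proof -
  let ?f = "\<lambda>x. exp (- (s * \<kappa> * exp x) + c * x)"
  have "(\<integral>x. ?f x \<partial>lborel) = \<bar>1\<bar> *\<^sub>R (\<integral>x. ?f (- ln s + 1 * x) \<partial>lborel)"
    by (rule lborel_integral_real_affine[where f="?f" and c=1 and t="- ln s"]) simp
  moreover have "?f (- ln s + 1 * x) = s powr (- c) * exp (- (\<kappa> * exp x) + c * x)" for x
  proof -
    have "s * exp (- ln s + 1 * x) = exp x" using assms by (simp add: exp_diff)
    then have "s * \<kappa> * exp (- ln s + 1 * x) = \<kappa> * exp x" by (metis mult.assoc mult.commute)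
    moreover have "exp (c * (- ln s + 1 * x)) = s powr (- c) * exp (c * x)"
      using assms by (simp add: powr_def mult_exp_exp algebra_simps)
    ultimately show ?thesis by (simp only: exp_add minus_mult_left mult.assoc) simp
  qed
  ultimately show ?thesis
    by (simp only: Bochner_Integration.integral_mult_right_zero) simp
qed

text \<open>On the line \<open>den\<close> is \<open>r * u - z0\<close> with \<open>r > 0\<close>
  and \<open>u\<close>, \<open>z0\<close> of modulus 1. Its modulus is at least
  \<open>\<bar>r - 1\<bar>\<close>, and moving \<open>r * u\<close> to \<open>u\<close> costs
  \<open>\<bar>r - 1\<bar>\<close>, so it is at least half the distance from \<open>u\<close> to
  \<open>z0\<close>.\<close>

lemma den_lower:
  assumes "\<bar>y\<bar> = \<theta>"
  obtains D where "0 < D" "\<And>x. cmod (1 / den (Complex x y)) \<le> D"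
proof -
  define u where "u = cis (\<alpha> * y)"
  have e: "den (Complex x y) = of_real (exp (\<alpha> * x)) * u - z0" for x
    by (simp add: den_def u_def exp_eq_polar)
  have "u \<noteq> z0" using line_den[OF assms, of 0] e[of 0] by simp
  then have pos: "0 < cmod (u - z0)" by simp
  show thesis
  proof (rule that[of "2 / cmod (u - z0)"])
    show "0 < 2 / cmod (u - z0)" using pos by simp
    fix x
    let ?r = "exp (\<alpha> * x)"
    let ?d = "cmod (of_real ?r * u - z0)"
    have "cmod (u - z0) \<le> cmod (u - of_real ?r * u) + ?d"
      using norm_triangle_ineq[of "u - of_real ?r * u" "of_real ?r * u - z0"] by simp
    moreover have "cmod (u - of_real ?r * u) = \<bar>1 - ?r\<bar>"
    proof -
      have "u - of_real ?r * u = of_real (1 - ?r) * u" by (simp add: algebra_simps)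
      then show ?thesis by (simp only: norm_mult norm_of_real) (simp add: u_def)
    qed
    moreover have "\<bar>?r - 1\<bar> \<le> ?d"
      using norm_triangle_ineq3[of "of_real ?r * u" z0] z0_norm by (simp add: norm_mult u_def)
    ultimately have "cmod (u - z0) / 2 \<le> ?d" by linarith
    then have "1 / ?d \<le> 1 / (cmod (u - z0) / 2)" using pos by (intro frac_le) auto
    then show "cmod (1 / den (Complex x y)) \<le> 2 / cmod (u - z0)"
      by (simp add: e norm_divide)
  qed
qed

text \<open>The identity \<open>1 / den = - 1 / z0 + exp (\<alpha> * w) / (z0 * den)\<close> splits
  off the behaviour at small \<open>q\<close>. By scaling, the first part gives the leading power;
  the extra factor \<open>exp (\<alpha> * w)\<close> improves the order of the second by
  \<alpha>.\<close>

lemma Rk_asymp: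
  assumes y: "\<bar>y\<bar> = \<theta>"
  obtains K where "\<And>s. 0 < s \<Longrightarrow>
    cmod (Rk y s - (- MM (\<alpha> - \<beta> + 1) y / z0) * of_real (s powr (- (\<alpha> - \<beta> + 1)))) \<le> K * s powr (- (2 * \<alpha> - \<beta> + 1))"
proof -
  obtain D where D: "0 < D" "\<And>x. cmod (1 / den (Complex x y)) \<le> D"
    using den_lower[OF y] by blast
  let ?c = "\<alpha> - \<beta> + 1" and ?d = "2 * \<alpha> - \<beta> + 1"
  let ?I = "\<integral>x. exp (- (- cos \<theta> * exp x) + ?d * x) \<partial>lborel"
  have c: "0 < ?c" "0 < ?d" using alpha beta by auto
  have "cmod (Rk y s - (- MM ?c y / z0) * of_real (s powr (- ?c))) \<le> D * ?I * s powr (- ?d)" if s: "0 < s" for s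
  proof -
    let ?E = "\<lambda>x. exp (of_real s * exp (Complex x y))"
    let ?e = "\<lambda>c x. exp (of_real c * Complex x y)"
    have pw: "?E x * ker y x - (- 1 / z0) * (?E x * ?e ?c x) = (1 / z0) * ((?E x * ?e ?d x) * (1 / den (Complex x y)))" for x
    proof -
      have nz: "den (Complex x y) \<noteq> 0" by (rule line_den[OF y])
      have k: "ker y x = ?e ?c x / den (Complex x y)" unfolding ker_eq den_def ..
      have ed: "?e ?d x = ?e ?c x * (den (Complex x y) + z0)"
      proof -
        have "?e ?d x = ?e ?c x * ?e \<alpha> x" by (simp add: mult_exp_exp algebra_simps)
        then show ?thesis by (simp add: den_def)
      qed
      show ?thesis unfolding k ed using nz z0_norm(2) by (simp add: field_simps)
    qed
    have i1: "integrable lborel (\<lambda>x. ?E x * ker y x)" using integrable_Rk[OF y] s by simp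
    have i2: "integrable lborel (\<lambda>x. (- 1 / z0) * (?E x * ?e ?c x))"
      using integrable_kernel[OF y s c(1)] by (rule integrable_mult_right)
    have "Rk y s - (- 1 / z0) * (of_real (s powr (- ?c)) * MM ?c y) =
        (\<integral>x. ?E x * ker y x - (- 1 / z0) * (?E x * ?e ?c x) \<partial>lborel)"
      unfolding Bochner_Integration.integral_diff[OF i1 i2] Bochner_Integration.integral_mult_right_zero
        kernel_scale[OF s] Rk_def ..
    then have eq: "Rk y s - (- MM ?c y / z0) * of_real (s powr (- ?c)) =
        (\<integral>x. (1 / z0) * ((?E x * ?e ?d x) * (1 / den (Complex x y))) \<partial>lborel)"
      unfolding pw by (simp add: mult_ac)
    have "cmod (\<integral>x. (1 / z0) * ((?E x * ?e ?d x) * (1 / den (Complex x y))) \<partial>lborel) \<le>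
        (\<integral>x. D * exp (- (s * - cos \<theta> * exp x) + ?d * x) \<partial>lborel)"
    proof (rule Bochner_Integration.integral_norm_bound_integral)
      show "integrable lborel (\<lambda>x. (1 / z0) * ((?E x * ?e ?d x) * (1 / den (Complex x y))))"
        unfolding pw[symmetric] using i1 i2 by (rule Bochner_Integration.integrable_diff)
      have "0 < s * - cos \<theta>" using s cos_theta by (simp add: mult_pos_neg)
      then show "integrable lborel (\<lambda>x. D * exp (- (s * - cos \<theta> * exp x) + ?d * x))"
        using c(2) by (intro integrable_mult_right double_exp_integrable)
      fix x
      have "cmod ((1 / z0) * ((?E x * ?e ?d x) * (1 / den (Complex x y)))) =
          exp (- (s * - cos \<theta> * exp x) + ?d * x) * cmod (1 / den (Complex x y))"
        unfolding norm_mult[of "1 / z0"] norm_mult[of "?E x * ?e ?d x"] norm_kernel[OF y]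
        using z0_norm by (simp add: norm_divide)
      also have "\<dots> \<le> exp (- (s * - cos \<theta> * exp x) + ?d * x) * D"
        using D(2)[of x] by (intro mult_left_mono) auto
      finally show "cmod ((1 / z0) * ((?E x * ?e ?d x) * (1 / den (Complex x y)))) \<le>
          D * exp (- (s * - cos \<theta> * exp x) + ?d * x)" by (simp only: mult.commute)
    qed
    also have "\<dots> = D * (s powr (- ?d) * ?I)"
      unfolding Bochner_Integration.integral_mult_right_zero double_exp_scale[OF s] ..
    finally show ?thesis unfolding eq by (simp only: mult_ac)
  qed
  then show thesis by (rule that)
qed

text \<open>By Hankel's formula this is minus the reciprocal of
  \<open>z0 * Gamma (\<beta> - \<alpha>)\<close>, read as 0 at a pole of Gamma. What matters below
  is only whether it vanishes.\<close>

definition CC :: complex where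
  "CC = (- MM (\<alpha> - \<beta> + 1) \<theta> / z0 - - MM (\<alpha> - \<beta> + 1) (- \<theta>) / z0) / (2 * of_real pi * \<i>)"

lemma RR_asymp:
  obtains K where "0 \<le> K" "\<And>s. 0 < s \<Longrightarrow>
    cmod (RR s - CC * of_real (s powr (- (\<alpha> - \<beta> + 1)))) \<le> K * s powr (- (2 * \<alpha> - \<beta> + 1))"
proof -
  let ?c = "\<alpha> - \<beta> + 1" and ?d = "2 * \<alpha> - \<beta> + 1"
  obtain K1 where K1: "\<And>s. 0 < s \<Longrightarrow>
    cmod (Rk \<theta> s - (- MM ?c \<theta> / z0) * of_real (s powr (- ?c))) \<le> K1 * s powr (- ?d)"
    by (rule Rk_asymp[OF abs_theta(1)]) blast
  obtain K2 where K2: "\<And>s. 0 < s \<Longrightarrow>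
    cmod (Rk (- \<theta>) s - (- MM ?c (- \<theta>) / z0) * of_real (s powr (- ?c))) \<le> K2 * s powr (- ?d)"
    by (rule Rk_asymp[OF abs_theta(2)]) blast
  have npi: "cmod (2 * of_real pi * \<i>) = 2 * pi" by (simp add: norm_mult)
  show thesis
  proof (rule that[of "(\<bar>K1\<bar> + \<bar>K2\<bar>) / (2 * pi)"])
    fix s :: real assume s: "0 < s"
    let ?p = "of_real (s powr (- ?c)) :: complex"
    have "RR s - CC * ?p = ((Rk \<theta> s - (- MM ?c \<theta> / z0) * ?p) - (Rk (- \<theta>) s - (- MM ?c (- \<theta>) / z0) * ?p)) / (2 * of_real pi * \<i>)"
    proof -
      have "(A - B) / k - ((a - b) / k) * q = ((A - a * q) - (B - b * q)) / k" for A B a b k q :: complex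
        by (simp add: divide_inverse algebra_simps)
      then show ?thesis unfolding RR_def CC_def .
    qed
    then have "cmod (RR s - CC * ?p) = cmod ((Rk \<theta> s - (- MM ?c \<theta> / z0) * ?p) - (Rk (- \<theta>) s - (- MM ?c (- \<theta>) / z0) * ?p)) / (2 * pi)"
      by (simp only: norm_divide npi)
    also have "\<dots> \<le> ((\<bar>K1\<bar> + \<bar>K2\<bar>) * s powr (- ?d)) / (2 * pi)"
    proof (rule divide_right_mono)
      have "K1 * s powr (- ?d) \<le> \<bar>K1\<bar> * s powr (- ?d)" "K2 * s powr (- ?d) \<le> \<bar>K2\<bar> * s powr (- ?d)"
        by (intro mult_right_mono; simp)+
      then show "cmod ((Rk \<theta> s - (- MM ?c \<theta> / z0) * ?p) - (Rk (- \<theta>) s - (- MM ?c (- \<theta>) / z0) * ?p)) \<le>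
          (\<bar>K1\<bar> + \<bar>K2\<bar>) * s powr (- ?d)"
        using K1[OF s] K2[OF s] norm_triangle_ineq4[of "Rk \<theta> s - (- MM ?c \<theta> / z0) * ?p" "Rk (- \<theta>) s - (- MM ?c (- \<theta>) / z0) * ?p"]
        unfolding distrib_right by linarith
    qed simp
    finally show "cmod (RR s - CC * ?p) \<le> (\<bar>K1\<bar> + \<bar>K2\<bar>) / (2 * pi) * s powr (- ?d)" by simp
  qed simp
qed

lemma RR_bounded:
  obtains B where "0 \<le> B" "\<And>s. 0 \<le> s \<Longrightarrow> cmod (RR s) \<le> B"
proof -
  let ?N = "\<lambda>y. \<integral>x. norm (ker y x) \<partial>lborel"
  show thesis
  proof (rule that[of "(?N \<theta> + ?N (- \<theta>)) / (2 * pi)"])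
    show "0 \<le> (?N \<theta> + ?N (- \<theta>)) / (2 * pi)"
      by (intro divide_nonneg_nonneg add_nonneg_nonneg integral_nonneg_AE) auto
    fix s :: real assume s: "0 \<le> s"
    have "cmod (RR s) = cmod (Rk \<theta> s - Rk (- \<theta>) s) / (2 * pi)"
      unfolding RR_def by (simp add: norm_divide norm_mult)
    also have "\<dots> \<le> (?N \<theta> + ?N (- \<theta>)) / (2 * pi)"
      using Rk_bounded[OF abs_theta(1) s] Rk_bounded[OF abs_theta(2) s]
      by (intro divide_right_mono order_trans[OF norm_triangle_ineq4] add_mono) auto
    finally show "cmod (RR s) \<le> (?N \<theta> + ?N (- \<theta>)) / (2 * pi)" .
  qed
qed

text \<open>For \<open>c = 1\<close> the integrand is entire and periodic. Between the heights
  \<open>\<theta>\<close> and \<open>2 * pi - \<theta>\<close> the cosine is at most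
  \<open>cos \<theta> < 0\<close>, so the upper line can be moved to a copy of the lower
  one.\<close>

lemma MM_1: "MM 1 \<theta> = MM 1 (- \<theta>)"
proof -
  let ?G = "\<lambda>w. exp (exp w) * exp w :: complex"
  have kp: "0 < - cos \<theta>" using cos_theta by simp
  obtain C where C: "0 \<le> C" "\<And>x. exp (- (- cos \<theta> * exp x) + 1 * x) \<le> C * exp (- min 1 1 * \<bar>x\<bar>)"
    using double_exp_bound[OF kp zero_less_one] by blast
  have "(\<integral>x. ?G (Complex x \<theta>) \<partial>lborel) = (\<integral>x. ?G (Complex x (2 * pi - \<theta>)) \<partial>lborel)"
  proof (rule line_shift[of ?G 0 "2 * pi" _ _ 1 0 C])
    show "?G holomorphic_on {w. 0 < Im w \<and> Im w < 2 * pi}" by (intro holomorphic_intros)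
    fix x y assume y: "\<theta> \<le> y" "y \<le> 2 * pi - \<theta>"
    have "cos y \<le> cos \<theta>"
    proof (cases "y \<le> pi")
      case True
      then show ?thesis using y theta_pos by (intro cos_monotone_0_pi_le) auto
    next
      case False
      then have "cos (2 * pi - y) \<le> cos \<theta>" using y theta_pos by (intro cos_monotone_0_pi_le) auto
      then show ?thesis by (simp add: cos_diff)
    qed
    then have "exp x * cos y \<le> exp x * cos \<theta>" by (intro mult_left_mono) auto
    then have "exp (exp x * cos y + x) \<le> exp (- (- cos \<theta> * exp x) + 1 * x)" by (simp add: mult.commute)
    also have "\<dots> \<le> C * exp (- 1 * \<bar>x\<bar>)" using C(2)[of x] by simp
    finally show "cmod (?G (Complex x y)) \<le> C * exp (- 1 * \<bar>x\<bar>)"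
      by (simp add: norm_mult norm_exp_eq_Re exp_line mult_exp_exp)
  qed (use theta theta_pos in auto)
  moreover have "exp (Complex x (2 * pi - \<theta>)) = exp (Complex x (- \<theta>))" for x
  proof -
    have "cis (2 * pi - \<theta>) = cis (- \<theta>)" by (simp add: complex_eq_iff cos_diff sin_diff)
    then show ?thesis unfolding exp_line by simp
  qed
  ultimately show ?thesis by (simp add: MM_def)
qed

text \<open>The leading exponent is then 1, where the two rays cancel. The remainder of f' therefore
  decays like \<open>s powr (- \<alpha> - 1)\<close> and not like \<open>1 / s\<close>.\<close>

lemma CC_eq_0: "\<beta> = \<alpha> \<Longrightarrow> CC = 0"
  unfolding CC_def using MM_1 by simp

text \<open>
  If the leading coefficient vanished, the remainder would be integrable and its Laplace transform
  would stay bounded at \<open>0\<close>, unlike \<open>p powr (\<alpha> - 2)\<close>.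
\<close>

lemma CC_nonzero:
  assumes "\<beta> = 2"
  shows "CC \<noteq> 0"
proof
  assume "CC = 0"
  obtain B where B: "0 \<le> B" "\<And>s. 0 \<le> s \<Longrightarrow> cmod (RR s) \<le> B" using RR_bounded by blast
  obtain K where K: "0 \<le> K" "\<And>s. 0 < s \<Longrightarrow> cmod (RR s) \<le> K * s powr (- (2 * \<alpha> - 1))"
  proof (rule RR_asymp)
    fix K assume K: "0 \<le> K" "\<And>s. 0 < s \<Longrightarrow>
      cmod (RR s - CC * of_real (s powr (- (\<alpha> - \<beta> + 1)))) \<le> K * s powr (- (2 * \<alpha> - \<beta> + 1))"
    have e: "2 * \<alpha> - \<beta> + 1 = 2 * \<alpha> - 1" using assms by simp
    show thesis
      by (rule that[OF K(1)]) (use K(2) in \<open>simp only: \<open>CC = 0\<close> e mult_zero_left diff_zero\<close>)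
  qed
  \<comment> \<open>A majorant of \<open>RR\<close> independent of \<open>p\<close>: bounded up to
    1, and integrable beyond because \<open>2 * \<alpha> - 1 > 1\<close>.\<close>
  define g where "g s = B * indicator {0..1} s + K * (indicator {1..} s * s powr (- (2 * \<alpha> - 1)))" for s :: real
  have gi: "integrable lborel g"
    unfolding g_def using alpha
    by (intro Bochner_Integration.integrable_add integrable_mult_right powr_tail_integrable integrable_real_indicator) auto
  define I where "I = (\<integral>s. g s \<partial>lborel)"
  have main: "cmod (gh (of_real (ln p)) - bb / (of_real p + \<i>)) \<le> I" if p: "0 < p" for p
  proof -
    have "cmod (\<integral>s. indicator {0<..} s *\<^sub>R (exp (- (p * s)) *\<^sub>R RR s) \<partial>lborel) \<le> (\<integral>s. g s \<partial>lborel)"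
    proof (rule Bochner_Integration.integral_norm_bound_integral[OF _ gi])
      show "integrable lborel (\<lambda>s. indicator {0<..} s *\<^sub>R (exp (- (p * s)) *\<^sub>R RR s))"
        using RR_laplace(1)[OF p] by (simp add: set_integrable_def)
      fix s :: real
      show "norm (indicator {0<..} s *\<^sub>R (exp (- (p * s)) *\<^sub>R RR s)) \<le> g s"
      proof (cases "0 < s")
        case True
        then have "exp (- (p * s)) * cmod (RR s) \<le> 1 * cmod (RR s)"
          using p by (intro mult_right_mono) auto
        also have "1 * cmod (RR s) \<le> g s"
          using B(2)[of s] K(2)[OF True] B(1) K(1) True by (auto simp: g_def indicator_def)
        finally show ?thesis using True by simp
      next
        case False
        have "0 \<le> g s" using B(1) K(1) by (simp add: g_def)
        then show ?thesis using False by simp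
      qed
    qed
    then show ?thesis using RR_laplace(2)[OF p] by (simp add: set_lebesgue_integral_def I_def)
  qed
  have I0: "0 \<le> I" by (rule order_trans[OF norm_ge_zero main[OF zero_less_one]])
  \<comment> \<open>\<open>Y / 2\<close> exceeds \<open>I + cmod bb\<close>, the bound that the
    vanishing of \<open>CC\<close> would impose. The choice of \<open>p\<close> makes
    \<open>p powr (\<alpha> - 2)\<close> equal to \<open>Y\<close>, and \<open>1 \<le> Y\<close>
    gives \<open>p \<le> 1\<close>, hence a denominator of modulus at most 2.\<close>
  define Y where "Y = 2 * (I + cmod bb) + 3"
  have Y: "1 \<le> Y" using I0 by (simp add: Y_def)
  define p where "p = Y powr (1 / (\<alpha> - 2))"
  have p: "0 < p" "p \<le> 1"
  proof -
    show "0 < p" using Y by (simp add: p_def)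
    have "Y powr (1 / (\<alpha> - 2)) \<le> Y powr 0" using Y alpha by (intro powr_mono) (auto simp: divide_nonneg_neg)
    then show "p \<le> 1" using Y by (simp add: p_def)
  qed
  have pY: "p powr (\<alpha> - 2) = Y" using Y alpha by (simp add: p_def powr_powr)
  have "p powr \<alpha> \<le> 1" using p alpha by (simp add: powr_le_one_le powr_le1)
  then have d: "cmod (of_real (p powr \<alpha>) - z0) \<le> 2"
    using norm_triangle_ineq4[of "of_real (p powr \<alpha>)" z0] z0_norm by simp
  have d0: "0 < cmod (of_real (p powr \<alpha>) - z0)"
  proof -
    have "den (of_real (ln p)) \<noteq> 0"
      using den_zero[of "of_real (ln p)"] vt theta pi_gt_zero by (auto simp: w0_def S_def complex_eq_iff)
    then show ?thesis unfolding den_def exp_of_real_mult_ln[OF p(1)] by simp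
  qed
  have "Y / 2 \<le> Y / cmod (of_real (p powr \<alpha>) - z0)"
    using d d0 Y by (intro divide_left_mono) auto
  also have "\<dots> = cmod (gh (of_real (ln p)))"
    unfolding gh_ln[OF p(1)] using pY Y assms by (simp add: norm_divide)
  also have "\<dots> \<le> cmod (gh (of_real (ln p)) - bb / (of_real p + \<i>)) + cmod (bb / (of_real p + \<i>))"
    using norm_triangle_ineq[of "gh (of_real (ln p)) - bb / (of_real p + \<i>)" "bb / (of_real p + \<i>)"] by simp
  also have "\<dots> \<le> I + cmod bb"
  proof (rule add_mono[OF main[OF p(1)]])
    have "1 \<le> cmod (of_real p + \<i>)"
      using abs_Im_le_cmod[of "of_real p + \<i>"] by simp
    then have "cmod bb / cmod (of_real p + \<i>) \<le> cmod bb / 1" by (intro divide_left_mono) auto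
    then show "cmod (bb / (of_real p + \<i>)) \<le> cmod bb" by (simp add: norm_divide)
  qed
  finally show False by (simp add: Y_def)
qed

end

section \<open>Bounds on f, g, f' and the lower bound on the determinant\<close>

text \<open>Two instances of the strip, \<beta> = 2 for g and \<beta> = \<alpha> for f', share the
  angle and the pole; evaluating the residues with \<open>exp w0 = - \<i>\<close> gives the opposite
  amplitudes.\<close>

lemma ml_asymptotics:
  assumes \<alpha>: "1 < \<alpha>" "\<alpha> < 2"
  defines "z \<equiv> i_pow (- \<alpha>)"
  obtains B C K R Q where
    "0 \<le> B" "0 \<le> K" "C \<noteq> (0::complex)"
    "\<And>s. 0 < s \<Longrightarrow> ml \<alpha> 2 z s = (\<i> / of_real \<alpha>) * exp (- (\<i> * of_real s)) + R s"
    "\<And>s. 0 < s \<Longrightarrow> z * ml \<alpha> \<alpha> z s = - (\<i> / of_real \<alpha>) * exp (- (\<i> * of_real s)) + Q s"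
    "\<And>s. 0 < s \<Longrightarrow> cmod (R s) \<le> B" "\<And>s. 0 < s \<Longrightarrow> cmod (Q s) \<le> B"
    "\<And>s. 0 < s \<Longrightarrow> cmod (R s - C * of_real (s powr (1 - \<alpha>))) \<le> K * s powr (1 - 2 * \<alpha>)"
    "\<And>s. 0 < s \<Longrightarrow> cmod (Q s) \<le> K * s powr (- \<alpha> - 1)"
proof -
  define M where "M = min pi (2 * pi / \<alpha> - pi / 2)"
  have "pi < 2 * pi / \<alpha>" using \<alpha> by (simp add: field_simps)
  then have M: "pi / 2 < M" "M \<le> pi" "M \<le> 2 * pi / \<alpha> - pi / 2"
    using pi_gt_zero by (auto simp: M_def)
  \<comment> \<open>The midpoint of the admissible range of angles, which is nonempty because
    \<alpha> < 2.\<close>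
  define \<theta> where "\<theta> = (pi / 2 + M) / 2"
  have \<theta>: "pi / 2 < \<theta>" "\<theta> < pi" "\<theta> < 2 * pi / \<alpha> - pi / 2"
    using M by (auto simp: \<theta>_def)
  interpret A: ml_strip \<alpha> 2 \<theta> using \<alpha> \<theta> by unfold_locales auto
  interpret B: ml_strip \<alpha> \<alpha> \<theta> using \<alpha> \<theta> by unfold_locales auto
  have z: "A.z0 = z" "B.z0 = z" by (simp_all add: A.z0_def B.z0_def z_def)
  have w: "B.w0 = A.w0" by (simp add: A.w0_def B.w0_def)
  have bA: "A.bb = \<i> / of_real \<alpha>"
  proof -
    have "exp (of_real (1 - 2) * A.w0) = inverse (exp A.w0)" by (simp add: exp_minus)
    then show ?thesis by (simp add: A.bb_def A.exp_w0)
  qed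
  have bB: "z * B.bb = - (\<i> / of_real \<alpha>)"
  proof -
    have "z * exp (of_real (1 - \<alpha>) * B.w0) = exp B.w0"
      unfolding z(2)[symmetric] B.z0_eq by (simp add: mult_exp_exp algebra_simps)
    then show ?thesis by (simp add: B.bb_def B.exp_w0)
  qed
  obtain B1 where B1: "0 \<le> B1" "\<And>s. 0 \<le> s \<Longrightarrow> cmod (A.RR s) \<le> B1" using A.RR_bounded by blast
  obtain B2 where B2: "0 \<le> B2" "\<And>s. 0 \<le> s \<Longrightarrow> cmod (B.RR s) \<le> B2" using B.RR_bounded by blast
  obtain K1 where K1: "0 \<le> K1" "\<And>s. 0 < s \<Longrightarrow>
    cmod (A.RR s - A.CC * of_real (s powr (- (\<alpha> - 2 + 1)))) \<le> K1 * s powr (- (2 * \<alpha> - 2 + 1))"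
    using A.RR_asymp by blast
  obtain K2 where K2: "0 \<le> K2" "\<And>s. 0 < s \<Longrightarrow>
    cmod (B.RR s - B.CC * of_real (s powr (- (\<alpha> - \<alpha> + 1)))) \<le> K2 * s powr (- (2 * \<alpha> - \<alpha> + 1))"
    using B.RR_asymp by blast
  have nz: "cmod z = 1" by (simp add: z_def)
  show thesis
  proof (rule that[of "max B1 B2" "max K1 K2" A.CC A.RR "\<lambda>s. z * B.RR s"])
    show "0 \<le> max B1 B2" "0 \<le> max K1 K2" using B1(1) K1(1) by auto
    show "A.CC \<noteq> 0" by (rule A.CC_nonzero) simp
    fix s :: real assume s: "0 < s"
    show "ml \<alpha> 2 z s = (\<i> / of_real \<alpha>) * exp (- (\<i> * of_real s)) + A.RR s"
      using A.ml_representation[OF s] by (simp add: z bA)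
    have "z * ml \<alpha> \<alpha> z s = z * (B.bb * exp (- (\<i> * of_real s)) + B.RR s)"
      using B.ml_representation[OF s] by (simp only: z)
    also have "\<dots> = (z * B.bb) * exp (- (\<i> * of_real s)) + z * B.RR s" by (simp add: algebra_simps)
    finally show "z * ml \<alpha> \<alpha> z s = - (\<i> / of_real \<alpha>) * exp (- (\<i> * of_real s)) + z * B.RR s"
      by (simp only: bB)
    show "cmod (A.RR s) \<le> max B1 B2" "cmod (z * B.RR s) \<le> max B1 B2"
      using B1(2)[of s] B2(2)[of s] s nz by (auto simp: norm_mult)
    have "cmod (A.RR s - A.CC * of_real (s powr (1 - \<alpha>))) \<le> K1 * s powr (1 - 2 * \<alpha>)"
      using K1(2)[OF s] by (simp add: algebra_simps)
    also have "\<dots> \<le> max K1 K2 * s powr (1 - 2 * \<alpha>)" by (intro mult_right_mono) auto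
    finally show "cmod (A.RR s - A.CC * of_real (s powr (1 - \<alpha>))) \<le> max K1 K2 * s powr (1 - 2 * \<alpha>)" .
    have "cmod (z * B.RR s) \<le> K2 * s powr (- \<alpha> - 1)"
    proof -
      have "- (2 * \<alpha> - \<alpha> + 1) = - \<alpha> - 1" by simp
      then have "cmod (B.RR s) \<le> K2 * s powr (- \<alpha> - 1)"
        using K2(2)[OF s] by (simp only: B.CC_eq_0[OF refl] mult_zero_left diff_zero)
      then show ?thesis by (simp add: norm_mult nz)
    qed
    also have "\<dots> \<le> max K1 K2 * s powr (- \<alpha> - 1)" by (intro mult_right_mono) auto
    finally show "cmod (z * B.RR s) \<le> max K1 K2 * s powr (- \<alpha> - 1)" .
  qed
qed

text \<open>
  Integrating the derivative bound gives the decay of \<open>F\<close> up to a constant; the constant vanishes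
  because the primitive \<open>R\<close> of \<open>F\<close> stays bounded.
\<close>

lemma decay_from_derivative:
  fixes F R Q :: "real \<Rightarrow> complex"
  assumes a: "0 < a" and "0 \<le> K"
    and F: "\<And>s. 0 < s \<Longrightarrow> (F has_vector_derivative Q s) (at s)"
    and R: "\<And>s. 0 < s \<Longrightarrow> (R has_vector_derivative F s) (at s)"
    and Q: "\<And>s. 0 < s \<Longrightarrow> cmod (Q s) \<le> K * s powr (- a - 1)"
    and B: "\<And>s. 0 < s \<Longrightarrow> cmod (R s) \<le> B"
    and s: "0 < s"
  shows "cmod (F s) \<le> K / a * s powr (- a)"
proof -
  have FF: "cmod (F t - F r) \<le> K / a * r powr (- a)" if "0 < r" "r \<le> t" for r t
  proof (cases "r = t")
    case False
    then have "r < t" using that by simp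
    let ?\<phi> = "\<lambda>x. - (K / a) * x powr (- a)"
    have "norm (F t - F r) \<le> ?\<phi> t - ?\<phi> r"
    proof (rule differentiable_bound_general[OF \<open>r < t\<close>])
      have "(F has_vector_derivative Q x) (at x)" if "x \<in> {r..t}" for x
        using F that \<open>0 < r\<close> by auto
      then show "continuous_on {r..t} F"
        by (intro continuous_at_imp_continuous_on ballI has_vector_derivative_continuous) auto
      show "continuous_on {r..t} ?\<phi>" using \<open>0 < r\<close> by (intro continuous_intros) auto
      fix x assume x: "r < x" "x < t"
      then have x0: "0 < x" using \<open>0 < r\<close> by simp
      show "(F has_vector_derivative Q x) (at x)" by (rule F[OF x0])
      have "(?\<phi> has_real_derivative - (K / a) * (- a * x powr (- a - 1))) (at x)"
        using has_real_derivative_powr[OF x0, of "- a"] by (rule DERIV_cmult)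
      then show "(?\<phi> has_vector_derivative K * x powr (- a - 1)) (at x)"
        using a by (simp add: has_real_derivative_iff_has_vector_derivative[symmetric])
      show "norm (Q x) \<le> K * x powr (- a - 1)" by (rule Q[OF x0])
    qed
    also have "\<dots> \<le> K / a * r powr (- a)" using a \<open>0 \<le> K\<close> by simp
    finally show ?thesis .
  qed (use a \<open>0 \<le> K\<close> in simp)
  let ?D = "K / a * s powr (- a)"
  have "(t - s) * cmod (F s) \<le> (t - s) * ?D + 2 * B" if t: "s < t" for t
  proof -
    let ?G = "\<lambda>x. R x - x *\<^sub>R F s"
    have "norm (?G t - ?G s) \<le> ?D * t - ?D * s"
    proof (rule differentiable_bound_general[OF t, of ?G "\<lambda>x. ?D * x" "\<lambda>x. F x - F s" "\<lambda>_. ?D"])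
      have G: "(?G has_vector_derivative (F x - F s)) (at x)" if "s \<le> x" for x
        using that s by (auto intro!: derivative_eq_intros R)
      then show "continuous_on {s..t} ?G"
        by (intro continuous_at_imp_continuous_on ballI has_vector_derivative_continuous) auto
      show "continuous_on {s..t} (\<lambda>x. ?D * x)" by (intro continuous_intros)
      fix x assume x: "s < x" "x < t"
      show "(?G has_vector_derivative (F x - F s)) (at x)" using G x by simp
      show "((\<lambda>x. ?D * x) has_vector_derivative ?D) (at x)"
        unfolding has_real_derivative_iff_has_vector_derivative[symmetric]
        by (rule DERIV_cmult_Id)
      show "norm (F x - F s) \<le> ?D" using FF[OF s, of x] x by simp
    qed
    moreover have "?G t - ?G s = (R t - R s) - (t - s) *\<^sub>R F s" by (simp add: algebra_simps)
    ultimately have "norm ((R t - R s) - (t - s) *\<^sub>R F s) \<le> ?D * (t - s)"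
      by (simp only: right_diff_distrib)
    moreover have "norm (R t - R s) \<le> 2 * B"
      using norm_triangle_ineq4[of "R t" "R s"] B[of t] B[of s] s t by simp
    moreover have "norm ((t - s) *\<^sub>R F s) \<le> norm (R t - R s) + norm ((R t - R s) - (t - s) *\<^sub>R F s)"
      using norm_triangle_ineq4[of "R t - R s" "(R t - R s) - (t - s) *\<^sub>R F s"] by simp
    ultimately show ?thesis using t by (simp add: mult.commute)
  qed
  then have lin: "x * cmod (F s) \<le> x * ?D + 2 * B" if "0 < x" for x
    using that by (metis add_diff_cancel_left' less_add_same_cancel1)
  show ?thesis
  proof (rule ccontr)
    assume "\<not> ?thesis"
    then have d: "0 < cmod (F s) - ?D" by simp
    define x where "x = (2 * \<bar>B\<bar> + 1) / (cmod (F s) - ?D)"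
    have "0 < x" using d by (simp add: x_def add_nonneg_pos)
    have "x * (cmod (F s) - ?D) = 2 * \<bar>B\<bar> + 1" using d by (simp add: x_def)
    then show False using lin[OF \<open>0 < x\<close>] by (simp add: right_diff_distrib)
  qed
qed

text \<open>After cancellation the determinant is
  \<open>\<i> / \<alpha> * exp (- \<i> * s) * R s\<close> up to terms of order
  \<open>s powr (- \<alpha>)\<close>, and \<open>R s\<close> is
  \<open>C * s powr (1 - \<alpha>)\<close> up to terms no larger than these.\<close>

theorem ml_bounds:
  assumes \<alpha>: "1 < \<alpha>" "\<alpha> < 2"
  defines "z \<equiv> i_pow (- \<alpha>)"
  obtains b c X where "0 < c" "0 < X"
    "\<And>s. 0 \<le> s \<Longrightarrow> cmod (mlc \<alpha> z s) \<le> b" "\<And>s. 0 \<le> s \<Longrightarrow> cmod (ml \<alpha> 2 z s) \<le> b"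
    "\<And>s. 0 \<le> s \<Longrightarrow> cmod (z * ml \<alpha> \<alpha> z s) \<le> b"
    "\<And>s. X \<le> s \<Longrightarrow> c * s powr (1 - \<alpha>) \<le> cmod ((mlc \<alpha> z s)\<^sup>2 - ml \<alpha> 2 z s * (z * ml \<alpha> \<alpha> z s))"
proof -
  obtain B C K R Q where BK: "0 \<le> B" "0 \<le> K" and C: "C \<noteq> (0::complex)"
    and g: "\<And>s. 0 < s \<Longrightarrow> ml \<alpha> 2 z s = (\<i> / of_real \<alpha>) * exp (- (\<i> * of_real s)) + R s"
    and h: "\<And>s. 0 < s \<Longrightarrow> z * ml \<alpha> \<alpha> z s = - (\<i> / of_real \<alpha>) * exp (- (\<i> * of_real s)) + Q s"
    and R: "\<And>s. 0 < s \<Longrightarrow> cmod (R s) \<le> B" and QB: "\<And>s. 0 < s \<Longrightarrow> cmod (Q s) \<le> B"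
    and RC: "\<And>s. 0 < s \<Longrightarrow> cmod (R s - C * of_real (s powr (1 - \<alpha>))) \<le> K * s powr (1 - 2 * \<alpha>)"
    and Q: "\<And>s. 0 < s \<Longrightarrow> cmod (Q s) \<le> K * s powr (- \<alpha> - 1)"
    unfolding z_def by (rule ml_asymptotics[OF \<alpha>]) blast
  let ?e = "\<lambda>s::real. exp (- (\<i> * of_real s))"
  \<comment> \<open>The amplitude \<open>1 / \<alpha>\<close> is the one for which \<open>F\<close>
    is a primitive of \<open>Q\<close> and \<open>R\<close> a primitive of \<open>F\<close>.\<close>
  define F where "F s = mlc \<alpha> z s - ?e s / of_real \<alpha>" for s
  have e: "(?e has_vector_derivative - \<i> * ?e s) (at s)" for s
  proof -
    have "((\<lambda>w. exp (- (\<i> * w))) has_field_derivative - \<i> * ?e s) (at (of_real s))"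
      by (auto intro!: derivative_eq_intros)
    from has_vector_derivative_real_field[OF this] show ?thesis by (simp add: comp_def)
  qed
  have ne: "cmod (?e s) = 1" for s by (simp add: norm_exp_eq_Re)
  have at: "at s within {0..} = at s" if "0 < s" for s :: real
    using that by (intro at_within_interior) (simp add: interior_real_atLeast)
  have F': "(F has_vector_derivative Q s) (at s)" if s: "0 < s" for s
  proof -
    have "(mlc \<alpha> z has_vector_derivative z * ml \<alpha> \<alpha> z s) (at s)"
      using mlc_has_vector_derivative[OF \<alpha>(1), of s "{0..}" z] s by (simp add: at)
    then have "(F has_vector_derivative (z * ml \<alpha> \<alpha> z s - (- \<i> * ?e s) / of_real \<alpha>)) (at s)"
      unfolding F_def[abs_def] by (intro has_vector_derivative_diff has_vector_derivative_divide e)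
    then show ?thesis unfolding h[OF s] by simp
  qed
  have R': "(R has_vector_derivative F s) (at s)" if s: "0 < s" for s
  proof -
    have "(ml \<alpha> 2 z has_vector_derivative mlc \<alpha> z s) (at s)"
      using ml2_has_vector_derivative[OF \<alpha>(1), of s "{0..}" z] s by (simp add: at)
    then have "((\<lambda>s. ml \<alpha> 2 z s - (\<i> / of_real \<alpha>) * ?e s) has_vector_derivative
        (mlc \<alpha> z s - (\<i> / of_real \<alpha>) * (- \<i> * ?e s))) (at s)"
      by (intro has_vector_derivative_diff has_vector_derivative_mult_right e)
    then have "((\<lambda>s. ml \<alpha> 2 z s - (\<i> / of_real \<alpha>) * ?e s) has_vector_derivative F s) (at s)"
      by (simp add: F_def)
    then show ?thesis
    proof (rule has_vector_derivative_transform_within_open[where S="{0<..}"])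
      show "ml \<alpha> 2 z x - (\<i> / of_real \<alpha>) * ?e x = R x" if "x \<in> {0<..}" for x
        using g[of x] that by simp
    qed (use s in auto)
  qed
  have FK: "cmod (F s) \<le> K / \<alpha> * s powr (- \<alpha>)" if "0 < s" for s
    by (rule decay_from_derivative[OF _ BK(2) F' R' Q R that]) (use \<alpha> in auto)
  have Kn: "K / \<alpha> \<le> K" using \<alpha> BK by (simp add: divide_le_eq mult_le_cancel_left1)
  have FK': "cmod (F s) \<le> K * s powr (- \<alpha>)" if "0 < s" for s
    using FK[OF that] mult_right_mono[OF Kn, of "s powr (- \<alpha>)"] by simp
  \<comment> \<open>The decay bound on \<open>F\<close> blows up at 0, so f is bounded on
    \<open>{0..1}\<close> by compactness.\<close>
  have "compact (mlc \<alpha> z ` {0..1})"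
    by (intro compact_continuous_image continuous_on_subset[OF continuous_on_mlc[OF \<alpha>(1)]]) auto
  then obtain b0 where "\<forall>y\<in>mlc \<alpha> z ` {0..1}. norm y \<le> b0"
    using compact_imp_bounded[of "mlc \<alpha> z ` {0..1}"] unfolding bounded_iff by blast
  then have b0: "cmod (mlc \<alpha> z s) \<le> b0" if "0 \<le> s" "s \<le> 1" for s using that by simp
  have ia: "cmod (\<i> / of_real \<alpha>) \<le> 1" "cmod (1 / of_real \<alpha>) \<le> 1" using \<alpha> by (auto simp: norm_divide)
  define b where "b = max (max b0 (1 + K)) (1 + B)"
  \<comment> \<open>\<open>q\<close> adds the coefficients of all errors of size
    \<open>s powr (- \<alpha>)\<close>: those of \<open>rest\<close>, and one more \<open>K\<close>
    from the lower bound of \<open>R\<close>. With \<open>c\<close> half of the limiting constant,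
    \<open>X\<close> is the point from which these errors use up at most the other half.\<close>
  define q where "q = 4 * K + K\<^sup>2 + B * K"
  have q0: "0 \<le> q" using BK by (simp add: q_def)
  define c where "c = cmod C / (2 * \<alpha>)"
  define X where "X = max 1 (2 * q * \<alpha> / cmod C)"
  show thesis
  proof (rule that[of c X b])
    show "0 < c" using C \<alpha> by (simp add: c_def)
    show "0 < X" by (simp add: X_def)
    show "cmod (mlc \<alpha> z s) \<le> b" if s: "0 \<le> s" for s
    proof (cases "s \<le> 1")
      case True
      then show ?thesis using b0[OF s True] by (simp add: b_def)
    next
      case False
      then have "s powr (- \<alpha>) \<le> 1 powr (- \<alpha>)" using \<alpha> by (intro powr_mono2') auto
      then have "K * s powr (- \<alpha>) \<le> K" using BK by (simp add: mult_left_le)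
      then have "cmod (F s) \<le> K" using FK'[of s] False by simp
      moreover have "mlc \<alpha> z s = ?e s / of_real \<alpha> + F s" by (simp add: F_def)
      moreover have "cmod (?e s / of_real \<alpha>) \<le> 1" using ia(2) ne[of s] by (simp add: norm_divide)
      ultimately have "cmod (mlc \<alpha> z s) \<le> 1 + K" using norm_triangle_ineq[of "?e s / of_real \<alpha>" "F s"] by simp
      then show ?thesis by (simp add: b_def)
    qed
    have b1: "1 + B \<le> b" "0 \<le> b" using BK by (auto simp: b_def)
    show "cmod (ml \<alpha> 2 z s) \<le> b" if s: "0 \<le> s" for s
    proof (cases "s = 0")
      case False
      then have s': "0 < s" using s by simp
      have "cmod (ml \<alpha> 2 z s) \<le> cmod ((\<i> / of_real \<alpha>) * ?e s) + cmod (R s)"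
        unfolding g[OF s'] by (rule norm_triangle_ineq)
      also have "cmod ((\<i> / of_real \<alpha>) * ?e s) = cmod (\<i> / of_real \<alpha>)"
        unfolding norm_mult ne by simp
      also have "cmod (\<i> / of_real \<alpha>) + cmod (R s) \<le> 1 + B" using ia(1) R[OF s'] by linarith
      finally show ?thesis using b1 by simp
    qed (use b1 in simp)
    show "cmod (z * ml \<alpha> \<alpha> z s) \<le> b" if s: "0 \<le> s" for s
    proof (cases "s = 0")
      case False
      then have s': "0 < s" using s by simp
      have "cmod (z * ml \<alpha> \<alpha> z s) \<le> cmod (- (\<i> / of_real \<alpha>) * ?e s) + cmod (Q s)"
        unfolding h[OF s'] by (rule norm_triangle_ineq)
      also have "cmod (- (\<i> / of_real \<alpha>) * ?e s) = cmod (\<i> / of_real \<alpha>)"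
        unfolding norm_mult ne by simp
      also have "cmod (\<i> / of_real \<alpha>) + cmod (Q s) \<le> 1 + B" using ia(1) QB[OF s'] by linarith
      finally show ?thesis using b1 by simp
    qed (use b1 in simp)
    fix s assume s: "X \<le> s"
    then have s1: "1 \<le> s" "0 < s" "2 * q * \<alpha> / cmod C \<le> s" by (auto simp: X_def)
    let ?W = "(mlc \<alpha> z s)\<^sup>2 - ml \<alpha> 2 z s * (z * ml \<alpha> \<alpha> z s)"
    let ?k = "1 / of_real \<alpha> :: complex" and ?p = "s powr (- \<alpha>)"
    have f: "mlc \<alpha> z s = ?k * ?e s + F s" by (simp add: F_def)
    define rest where "rest = 2 * (?k * ?e s) * F s + F s * F s - \<i> * ?k * ?e s * Q s - R s * Q s"
    \<comment> \<open>The oscillating terms of f squared and of g times f' coincide, because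
      \<open>\<i> * (- \<i>) = 1\<close>. Among the rest only the product of the amplitude of f'
      with \<open>R s\<close> fails to be of order \<open>s powr (- \<alpha>)\<close>.\<close>
    have W: "?W = \<i> * ?k * ?e s * R s + rest"
    proof -
      have "(k * E + f)\<^sup>2 - (\<i> * k * E + r) * (- (\<i> * k) * E + q) =
          \<i> * k * E * r + (2 * (k * E) * f + f * f - \<i> * k * E * q - r * q)" for k E f r q :: complex
        by (simp add: power2_eq_square algebra_simps)
      from this[of ?k "?e s" "F s" "R s" "Q s"] show ?thesis
        unfolding f g[OF s1(2)] h[OF s1(2)] rest_def by simp
    qed
    have p1: "?p \<le> 1" using s1 \<alpha> powr_mono2'[of "- \<alpha>" 1 s] by simp
    have p2: "s powr (- \<alpha> - 1) \<le> ?p" "s powr (1 - 2 * \<alpha>) \<le> ?p"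
      using s1 \<alpha> by (auto intro!: powr_mono)
    have Fp: "cmod (F s) \<le> K * ?p" by (rule FK'[OF s1(2)])
    have F1: "cmod (F s) \<le> K" using Fp p1 BK mult_left_mono[of ?p 1 K] by simp
    have Qp: "cmod (Q s) \<le> K * ?p" using Q[OF s1(2)] mult_left_mono[OF p2(1) BK(2)] by simp
    have k1: "cmod ?k \<le> 1" by (rule ia(2))
    have n1: "cmod (2 * (?k * ?e s) * F s) \<le> 2 * (K * ?p)"
    proof -
      have "cmod (2 * (?k * ?e s) * F s) = 2 * (cmod ?k * cmod (F s))" unfolding norm_mult ne by simp
      then show ?thesis using mult_mono[OF k1 Fp] by simp
    qed
    have n2: "cmod (F s * F s) \<le> K * (K * ?p)"
      unfolding norm_mult using F1 Fp BK by (intro mult_mono) auto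
    have n3: "cmod (\<i> * ?k * ?e s * Q s) \<le> K * ?p"
    proof -
      have "cmod (\<i> * ?k * ?e s * Q s) = cmod ?k * cmod (Q s)" unfolding norm_mult ne by simp
      then show ?thesis using mult_mono[OF k1 Qp] by simp
    qed
    have n4: "cmod (R s * Q s) \<le> B * (K * ?p)"
      unfolding norm_mult using R[OF s1(2)] Qp BK by (intro mult_mono) auto
    have "cmod rest \<le> cmod (2 * (?k * ?e s) * F s) + cmod (F s * F s) + cmod (\<i> * ?k * ?e s * Q s) + cmod (R s * Q s)"
      unfolding rest_def
      by (intro order_trans[OF norm_triangle_ineq4] add_mono order_trans[OF norm_triangle_ineq] order_refl)
    also have "\<dots> \<le> 2 * (K * ?p) + K * (K * ?p) + K * ?p + B * (K * ?p)"
      using n1 n2 n3 n4 by linarith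
    finally have rest: "cmod rest \<le> (3 * K + K\<^sup>2 + B * K) * ?p" by (simp add: algebra_simps power2_eq_square)
    have Rl: "cmod C * s powr (1 - \<alpha>) - K * ?p \<le> cmod (R s)"
    proof -
      have "cmod (C * of_real (s powr (1 - \<alpha>))) \<le> cmod (R s) + cmod (R s - C * of_real (s powr (1 - \<alpha>)))"
        using norm_triangle_ineq4[of "R s" "R s - C * of_real (s powr (1 - \<alpha>))"] by simp
      moreover have "cmod (R s - C * of_real (s powr (1 - \<alpha>))) \<le> K * ?p"
        using RC[OF s1(2)] mult_left_mono[OF p2(2) BK(2)] by simp
      ultimately show ?thesis by (simp add: norm_mult)
    qed
    have "cmod (\<i> * ?k * ?e s * R s) = cmod (R s) / \<alpha>" using \<alpha> by (simp add: norm_mult norm_divide ne)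
    moreover have "(cmod C * s powr (1 - \<alpha>) - K * ?p) / \<alpha> \<le> cmod (R s) / \<alpha>"
      using Rl \<alpha> by (intro divide_right_mono) auto
    moreover have "(K * ?p) / \<alpha> \<le> K * ?p"
    proof -
      have "(K / \<alpha>) * ?p \<le> K * ?p" using Kn by (rule mult_right_mono) simp
      then show ?thesis by simp
    qed
    moreover have "cmod (\<i> * ?k * ?e s * R s) - cmod rest \<le> cmod ?W"
      unfolding W using norm_diff_ineq[of "\<i> * ?k * ?e s * R s" rest] by simp
    ultimately have "cmod C * s powr (1 - \<alpha>) / \<alpha> - (K * ?p + (3 * K + K\<^sup>2 + B * K) * ?p) \<le> cmod ?W"
      using rest by (simp add: diff_divide_distrib)
    then have "cmod C * s powr (1 - \<alpha>) / \<alpha> - q * ?p \<le> cmod ?W"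
      by (simp add: q_def algebra_simps)
    moreover have "q * ?p \<le> c * s powr (1 - \<alpha>)"
    proof -
      have "q \<le> c * s" using s1(3) C \<alpha> by (simp add: c_def field_simps)
      then have "q * ?p \<le> c * s * ?p" by (rule mult_right_mono) simp
      also have "c * s * ?p = c * s powr (1 - \<alpha>)"
        using s1(2) by (simp add: powr_diff powr_minus divide_inverse)
      finally show ?thesis .
    qed
    moreover have "cmod C * s powr (1 - \<alpha>) / \<alpha> = 2 * (c * s powr (1 - \<alpha>))"
      using \<alpha> by (simp add: c_def)
    ultimately show "c * s powr (1 - \<alpha>) \<le> cmod ?W" by linarith
  qed
qed

section \<open>Uniqueness for the scalar Caputo equation\<close>

section \<open>The scalar Caputo equation\<close>

text \<open>A second derivative is only Lebesgue measurable, whereas Fubini is applied to the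
  product of \<open>lborel\<close> with itself; a Borel representative bridges the two.\<close>

lemma integrable_lebesgue_Borel:
  fixes f :: "real \<Rightarrow> complex"
  assumes f: "integrable lebesgue f"
  obtains g where "integrable lborel g" "AE x in lborel. f x = g x"
proof -
  have r: "integrable lebesgue (\<lambda>x. Re (f x))" and i: "integrable lebesgue (\<lambda>x. Im (f x))"
    using f by auto
  obtain p where p: "p \<in> borel_measurable lborel" "AE x in lborel. Re (f x) = p x"
    using completion_ex_borel_measurable_real[OF borel_measurable_integrable[OF r]] by auto
  obtain q where q: "q \<in> borel_measurable lborel" "AE x in lborel. Im (f x) = q x"
    using completion_ex_borel_measurable_real[OF borel_measurable_integrable[OF i]] by auto
  let ?g = "\<lambda>x. Complex (p x) (q x)"
  have m: "?g \<in> borel_measurable lborel"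
  proof -
    have "(\<lambda>x. of_real (p x) + \<i> * of_real (q x)) \<in> borel_measurable lborel" using p(1) q(1) by measurable
    then show ?thesis by (simp add: complex_eq[symmetric] Complex_eq)
  qed
  have e: "AE x in lborel. f x = ?g x"
    using p(2) q(2) by eventually_elim (simp add: complex_eq_iff)
  have "integrable lebesgue ?g"
    by (rule integrable_cong_AE_imp[OF f])
      (use m e in \<open>auto intro: measurable_completion AE_completion elim!: eventually_mono\<close>)
  then have "integrable lborel ?g" using m by (simp add: integrable_completion)
  then show thesis using e by (rule that)
qed

text \<open>The Beta parameters \<open>\<alpha> - 1\<close> and \<open>2 - \<alpha>\<close> add up
  to 1, so the integral does not depend on the length of the interval and the denominator of the
  Beta function is \<open>Gamma 1 = 1\<close>.\<close>

lemma has_bochner_integral_Abel_kernel: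
  fixes \<alpha> s \<tau> :: real
  assumes \<alpha>: "1 < \<alpha>" "\<alpha> < 2" and s: "s < \<tau>"
  shows "has_bochner_integral lborel
    (\<lambda>t. indicator {s<..<\<tau>} t * ((\<tau> - t) powr (\<alpha> - 2) * (t - s) powr (1 - \<alpha>)))
    (Gamma (\<alpha> - 1) * Gamma (2 - \<alpha>))"
proof -
  let ?k = "\<lambda>t. indicator {s<..<\<tau>} t * ((\<tau> - t) powr (\<alpha> - 2) * (t - s) powr (1 - \<alpha>))"
  let ?b = "\<lambda>r. (\<tau> - s - r) powr (\<alpha> - 1 - 1) * r powr (2 - \<alpha> - 1)"
  have pos: "0 < \<alpha> - 1" "0 < 2 - \<alpha>" "0 < \<tau> - s" using \<alpha> s by auto
  have eq: "indicator {0..\<tau> - s} r *\<^sub>R ?b r = ?k (s + 1 * r)" for r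
    by (cases "r = 0"; cases "r = \<tau> - s") (auto simp: indicator_def diff_diff_eq)
  have m: "(\<lambda>r. ?k (s + 1 * r)) \<in> borel_measurable borel" by measurable
  have "has_bochner_integral lebesgue (\<lambda>r. ?k (s + 1 * r)) (Beta (\<alpha> - 1) (2 - \<alpha>))"
    using set_integrable_Beta_scaled[OF pos] pos
    unfolding set_integrable_def set_lebesgue_integral_def eq
    by (simp add: has_bochner_integral_iff)
  then have "has_bochner_integral lborel (\<lambda>r. ?k (s + 1 * r)) (Beta (\<alpha> - 1) (2 - \<alpha>))"
    using m unfolding has_bochner_integral_iff
    by (simp add: integrable_completion integral_completion)
  moreover have "Beta (\<alpha> - 1) (2 - \<alpha>) = Gamma (\<alpha> - 1) * Gamma (2 - \<alpha>)" by (simp add: Beta_def)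
  ultimately show ?thesis
    using lborel_has_bochner_integral_real_affine_iff[of 1 ?k "Gamma (\<alpha> - 1) * Gamma (2 - \<alpha>)" s] by simp
qed

text \<open>
  Convolving the Abel integral equation with the conjugate kernel turns it, by Fubini and the Beta
  integral, into an ordinary primitive.
\<close>

lemma Abel_inversion:
  fixes h y :: "real \<Rightarrow> complex"
  assumes \<alpha>: "1 < \<alpha>" "\<alpha> < 2" and \<tau>: "0 < \<tau>" "\<tau> \<le> T"
    and h: "set_integrable lebesgue {0..T} h" and y: "continuous_on {0..T} y"
    and eq: "AE t in lebesgue. t \<in> {0<..<T} \<longrightarrow>
      of_real (1 / Gamma (2 - \<alpha>)) * set_lebesgue_integral lebesgue {0..t} (\<lambda>s. ((t - s) powr (1 - \<alpha>)) *\<^sub>R h s) = y t"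
  shows "of_real (Gamma (\<alpha> - 1)) * set_lebesgue_integral lebesgue {0..\<tau>} h =
    (\<integral>t. indicator {0<..<\<tau>} t *\<^sub>R ((\<tau> - t) powr (\<alpha> - 2)) *\<^sub>R y t \<partial>lborel)"
proof -
  let ?G = "Gamma (\<alpha> - 1) * Gamma (2 - \<alpha>)"
  have G0: "0 < Gamma (2 - \<alpha>)" "0 < Gamma (\<alpha> - 1)" using \<alpha> by (auto intro: Gamma_real_pos)
  obtain g where g: "integrable lborel g" and hg: "AE x in lborel. indicator {0..T} x *\<^sub>R h x = g x"
    using h unfolding set_integrable_def by (elim integrable_lebesgue_Borel)
  have gm: "g \<in> borel_measurable borel" using borel_measurable_integrable[OF g] by simp
  have hm: "(\<lambda>x. indicator {0..T} x *\<^sub>R h x) \<in> borel_measurable lebesgue"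
    using h unfolding set_integrable_def by (rule borel_measurable_integrable)
  have hg': "AE x in lebesgue. indicator {0..T} x *\<^sub>R h x = g x" using hg by (rule AE_completion)
  \<comment> \<open>Replaces Lebesgue integrals of \<open>h\<close> over \<open>{0..t}\<close> by
    \<open>lborel\<close> integrals of its representative \<open>g\<close> over the open interval;
    the end points are null.\<close>
  have conv: "(\<integral>s. (indicator {0..t} s * p s) *\<^sub>R h s \<partial>lebesgue) =
      (\<integral>s. (indicator {0<..<t} s * p s) *\<^sub>R g s \<partial>lborel)"
    if t: "t \<le> T" and p: "p \<in> borel_measurable borel" for t :: real and p :: "real \<Rightarrow> real"
  proof -
    have m: "(\<lambda>s. (indicator {0<..<t} s * p s) *\<^sub>R g s) \<in> borel_measurable lborel"
      using gm p by measurable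
    have e: "(indicator {0..t} s * p s) *\<^sub>R h s = (indicator {0..t} s * p s) *\<^sub>R (indicator {0..T} s *\<^sub>R h s)" for s
      using t by (auto simp: indicator_def)
    have "(\<integral>s. (indicator {0..t} s * p s) *\<^sub>R h s \<partial>lebesgue) =
        (\<integral>s. (indicator {0<..<t} s * p s) *\<^sub>R g s \<partial>lebesgue)"
    proof (rule integral_cong_AE)
      show "(\<lambda>s. (indicator {0..t} s * p s) *\<^sub>R h s) \<in> borel_measurable lebesgue"
        unfolding e by (intro borel_measurable_scaleR hm measurable_completion) (use p in measurable)
      show "(\<lambda>s. (indicator {0<..<t} s * p s) *\<^sub>R g s) \<in> borel_measurable lebesgue"
        using m by (rule measurable_completion)
      have "AE s in lebesgue. s \<noteq> 0 \<and> s \<noteq> t"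
        using AE_completion[OF AE_lborel_singleton[of 0]] AE_completion[OF AE_lborel_singleton[of t]] by eventually_elim simp
      then show "AE s in lebesgue. (indicator {0..t} s * p s) *\<^sub>R h s = (indicator {0<..<t} s * p s) *\<^sub>R g s"
        using hg'
      proof eventually_elim
        case (elim s)
        then show ?case unfolding e elim(2)[symmetric] by (auto simp: indicator_def)
      qed
    qed
    also have "\<dots> = (\<integral>s. (indicator {0<..<t} s * p s) *\<^sub>R g s \<partial>lborel)"
      using m by (rule integral_completion)
    finally show ?thesis .
  qed
  let ?k = "\<lambda>s t. indicator {s<..<\<tau>} t * ((\<tau> - t) powr (\<alpha> - 2) * (t - s) powr (1 - \<alpha>))"
  let ?F = "\<lambda>s t. (indicator {0<..<\<tau>} s * ?k s t) *\<^sub>R g s"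
  have ind: "indicator {s<..<\<tau>} t = (if s < t \<and> t < \<tau> then 1 else 0 :: real)" for s t :: real
    by (simp add: indicator_def)
  have Fm: "case_prod ?F \<in> borel_measurable (lborel \<Otimes>\<^sub>M lborel)"
    unfolding ind using gm by measurable
  have kB: "has_bochner_integral lborel (\<lambda>t. indicator {0<..<\<tau>} s * ?k s t) (indicator {0<..<\<tau>} s * ?G)" for s
    using has_bochner_integral_mult_right[OF has_bochner_integral_Abel_kernel[OF \<alpha>, of s \<tau>], of "indicator {0<..<\<tau>} s"]
    by (cases "s < \<tau>") (auto simp: indicator_def)
  have FI: "(\<integral>t. ?F s t \<partial>lborel) = (indicator {0<..<\<tau>} s * ?G) *\<^sub>R g s" for s
    using has_bochner_integral_integral_eq[OF has_bochner_integral_scaleR_left[of "g s", OF kB[of s]]] by auto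
  have F: "integrable (lborel \<Otimes>\<^sub>M lborel) (case_prod ?F)"
  proof (rule lborel_pair.Fubini_integrable[OF Fm])
    have nI: "(\<integral>t. norm (case_prod ?F (s, t)) \<partial>lborel) = indicator {0<..<\<tau>} s *\<^sub>R (?G * norm (g s))" for s
    proof -
      have "norm (case_prod ?F (s, t)) = (indicator {0<..<\<tau>} s * ?k s t) * norm (g s)" for t
        by (simp add: abs_mult)
      then show ?thesis
        using has_bochner_integral_integral_eq[OF kB[of s]] by auto
    qed
    show "integrable lborel (\<lambda>s. \<integral>t. norm (case_prod ?F (s, t)) \<partial>lborel)"
      unfolding nI using g by (intro integrable_mult_indicator integrable_mult_right integrable_norm) auto
    show "AE s in lborel. integrable lborel (\<lambda>t. case_prod ?F (s, t))"
      using kB by (auto simp: has_bochner_integral_iff intro!: integrable_scaleR_left)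
  qed
  have "(\<integral>t. (\<integral>s. ?F s t \<partial>lborel) \<partial>lborel) = (\<integral>s. (\<integral>t. ?F s t \<partial>lborel) \<partial>lborel)"
    by (rule lborel_pair.Fubini_integral[OF F])
  also have "\<dots> = of_real ?G * (\<integral>s. (indicator {0<..<\<tau>} s * 1) *\<^sub>R g s \<partial>lborel)"
    unfolding FI by (simp add: scaleR_conv_of_real mult_ac del: integral_mult_right_zero integral_mult_left_zero
      flip: Bochner_Integration.integral_mult_right_zero)
  also have "(\<integral>s. (indicator {0<..<\<tau>} s * 1) *\<^sub>R g s \<partial>lborel) = set_lebesgue_integral lebesgue {0..\<tau>} h"
    using conv[OF \<tau>(2), of "\<lambda>_. 1"] by (simp add: set_lebesgue_integral_def)
  also have "(\<integral>t. (\<integral>s. ?F s t \<partial>lborel) \<partial>lborel) =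
      (\<integral>t. of_real (Gamma (2 - \<alpha>)) * (indicator {0<..<\<tau>} t *\<^sub>R ((\<tau> - t) powr (\<alpha> - 2)) *\<^sub>R y t) \<partial>lborel)"
  proof -
    let ?Y = "\<lambda>t. of_real (Gamma (2 - \<alpha>)) * (indicator {0<..<\<tau>} t *\<^sub>R ((\<tau> - t) powr (\<alpha> - 2)) *\<^sub>R y t)"
    have m1: "(\<lambda>t. \<integral>s. ?F s t \<partial>lborel) \<in> borel_measurable lborel"
      using lborel_pair.integrable_snd[OF F] by (rule borel_measurable_integrable)
    have "(\<lambda>t. indicator {0..T} t *\<^sub>R y t) \<in> borel_measurable borel"
      by (rule borel_measurable_continuous_on_indicator[OF _ y]) simp
    then have "(\<lambda>t. of_real (Gamma (2 - \<alpha>)) * (indicator {0<..<\<tau>} t *\<^sub>R ((\<tau> - t) powr (\<alpha> - 2)) *\<^sub>R (indicator {0..T} t *\<^sub>R y t))) \<in> borel_measurable borel"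
      by measurable
    also have "(\<lambda>t. of_real (Gamma (2 - \<alpha>)) * (indicator {0<..<\<tau>} t *\<^sub>R ((\<tau> - t) powr (\<alpha> - 2)) *\<^sub>R (indicator {0..T} t *\<^sub>R y t))) = ?Y"
      using \<tau> by (auto simp: indicator_def)
    finally have m2: "?Y \<in> borel_measurable lborel" by simp
    \<comment> \<open>The equation identifies the inner integral only for almost every
      \<open>t\<close>, which suffices after integration over \<open>t\<close>.\<close>
    have "AE t in lebesgue. (\<integral>s. ?F s t \<partial>lborel) = ?Y t"
      using eq
    proof eventually_elim
      case (elim t)
      show ?case
      proof (cases "t \<in> {0<..<\<tau>}")
        case False
        then have z: "?F s t = 0" for s by (auto simp: indicator_def)
        have "(\<integral>s. ?F s t \<partial>lborel) = 0" unfolding z by simp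
        then show ?thesis using False by simp
      next
        case True
        have z: "?F s t = ((\<tau> - t) powr (\<alpha> - 2)) *\<^sub>R ((indicator {0<..<t} s * (t - s) powr (1 - \<alpha>)) *\<^sub>R g s)" for s
          using True by (auto simp: indicator_def)
        have "(\<integral>s. ?F s t \<partial>lborel) = ((\<tau> - t) powr (\<alpha> - 2)) *\<^sub>R
            (\<integral>s. (indicator {0<..<t} s * (t - s) powr (1 - \<alpha>)) *\<^sub>R g s \<partial>lborel)"
          unfolding z by (simp del: scaleR_scaleR)
        also have "(\<integral>s. (indicator {0<..<t} s * (t - s) powr (1 - \<alpha>)) *\<^sub>R g s \<partial>lborel) =
            set_lebesgue_integral lebesgue {0..t} (\<lambda>s. ((t - s) powr (1 - \<alpha>)) *\<^sub>R h s)"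
          using conv[of t "\<lambda>s. (t - s) powr (1 - \<alpha>)"] True \<tau> by (simp add: set_lebesgue_integral_def)
        also have "\<dots> = of_real (Gamma (2 - \<alpha>)) * y t"
          using elim True \<tau> G0 by (auto simp: field_simps)
        finally show ?thesis using True by (simp add: scaleR_conv_of_real mult_ac)
      qed
    qed
    then have "(\<integral>t. (\<integral>s. ?F s t \<partial>lborel) \<partial>lebesgue) = (\<integral>t. ?Y t \<partial>lebesgue)"
      by (intro integral_cong_AE measurable_completion m1 m2)
    then show ?thesis using m1 m2 by (simp add: integral_completion)
  qed
  finally have "of_real (Gamma (2 - \<alpha>)) * (\<integral>t. indicator {0<..<\<tau>} t *\<^sub>R ((\<tau> - t) powr (\<alpha> - 2)) *\<^sub>R y t \<partial>lborel) =
      of_real ?G * set_lebesgue_integral lebesgue {0..\<tau>} h"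
    unfolding Bochner_Integration.integral_mult_right_zero .
  then show ?thesis using G0 by (simp del: scaleR_scaleR)
qed

lemma tderiv_eq:
  assumes "0 < T" "t \<in> {0..T}" "(f has_vector_derivative v) (at t within {0..T})"
  shows "tderiv T f t = v"
  unfolding tderiv_def using assms by (intro vector_derivative_within_closed_interval) auto

lemma regular_coeffD:
  assumes c: "regular_coeff T c" and "0 < T" and t: "t \<in> {0..T}"
  shows "(c has_vector_derivative tderiv T c t) (at t within {0..T})"
proof -
  have "c differentiable (at t within {0..T})"
    using c t by (simp add: regular_coeff_def differentiable_on_def)
  then show ?thesis unfolding tderiv_def by (simp add: vector_derivative_works)
qed

text \<open>The kernel has mass \<open>\<tau> powr a * Beta a 1\<close>, at most its value at
  \<open>T\<close>. This uniformity in \<tau> gives the Volterra operator a single constant.\<close>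

lemma integrable_Abel:
  fixes y :: "real \<Rightarrow> complex"
  assumes a: "0 < a" and \<tau>: "0 < \<tau>" "\<tau> \<le> T" and y: "continuous_on {0..T} y"
    and M: "\<And>t. t \<in> {0..\<tau>} \<Longrightarrow> cmod (y t) \<le> M"
  shows "integrable lborel (\<lambda>t. indicator {0<..<\<tau>} t *\<^sub>R ((\<tau> - t) powr (a - 1)) *\<^sub>R y t)"
    and "cmod (\<integral>t. indicator {0<..<\<tau>} t *\<^sub>R ((\<tau> - t) powr (a - 1)) *\<^sub>R y t \<partial>lborel) \<le> T powr a * Beta a 1 * M"
proof -
  let ?k = "\<lambda>t. indicator {0<..<\<tau>} t * (\<tau> - t) powr (a - 1)"
  let ?f = "\<lambda>t. indicator {0<..<\<tau>} t *\<^sub>R ((\<tau> - t) powr (a - 1)) *\<^sub>R y t"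
  \<comment> \<open>A Beta integral with second parameter 1. The exponents \<open>1 - 1\<close> and
    \<open>a - 1\<close> give the value 0 at the two end points, since \<open>0 powr x = 0\<close>,
    so the closed interval may be replaced by the open one.\<close>
  let ?j = "\<lambda>t. indicator {0..\<tau>} t *\<^sub>R ((\<tau> - t) powr (a - 1) * t powr (1 - 1))"
  have M0: "0 \<le> M" using M[of 0] \<tau> norm_ge_zero[of "y 0"] by (simp del: norm_ge_zero)
  have jk: "?j t = ?k t" for t
    by (cases "t = \<tau>"; cases "t = 0") (auto simp: indicator_def)
  have km: "?k \<in> borel_measurable borel" by measurable
  have k1: "integrable lborel ?k" and k2: "(\<integral>t. ?k t \<partial>lborel) = \<tau> powr a * Beta a 1"
    using set_integrable_Beta_scaled[of a 1 \<tau>] a \<tau> km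
    unfolding set_integrable_def set_lebesgue_integral_def jk
    by (simp_all add: integrable_completion integral_completion)
  have "(\<lambda>t. indicator {0..T} t *\<^sub>R y t) \<in> borel_measurable borel"
    by (rule borel_measurable_continuous_on_indicator[OF _ y]) simp
  then have "(\<lambda>t. indicator {0<..<\<tau>} t *\<^sub>R ((\<tau> - t) powr (a - 1)) *\<^sub>R (indicator {0..T} t *\<^sub>R y t)) \<in> borel_measurable borel"
    by measurable
  also have "(\<lambda>t. indicator {0<..<\<tau>} t *\<^sub>R ((\<tau> - t) powr (a - 1)) *\<^sub>R (indicator {0..T} t *\<^sub>R y t)) = ?f"
    using \<tau> by (auto simp: indicator_def)
  finally have fm: "?f \<in> borel_measurable lborel" by simp
  have b: "norm (?f t) \<le> ?k t * M" for t
    using M[of t] by (auto simp: indicator_def intro!: mult_left_mono)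
  have kM: "integrable lborel (\<lambda>t. ?k t * M)" using k1 by (rule integrable_mult_left)
  show fi: "integrable lborel ?f"
    by (rule Bochner_Integration.integrable_bound[OF kM fm]) (use b M0 in \<open>auto simp: indicator_def\<close>)
  have "cmod (\<integral>t. ?f t \<partial>lborel) \<le> (\<integral>t. ?k t * M \<partial>lborel)"
    by (rule Bochner_Integration.integral_norm_bound_integral[OF fi kM]) (use b in simp)
  also have "\<dots> = \<tau> powr a * Beta a 1 * M" using k2 by simp
  also have "\<dots> \<le> T powr a * Beta a 1 * M"
    using \<tau> a M0 by (intro mult_right_mono powr_mono2) (auto simp: Beta_def intro!: divide_nonneg_nonneg mult_nonneg_nonneg less_imp_le Gamma_real_pos)
  finally show "cmod (\<integral>t. ?f t \<partial>lborel) \<le> T powr a * Beta a 1 * M" .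
qed

text \<open>Picard iteration: a bound \<open>B * (L * t) ^ n / fact n\<close> on \<open>d\<close>
  bounds \<open>w\<close> by \<open>L\<close> times the same expression, and integration produces
  the bound for \<open>n + 1\<close>. The factorial wins in the limit.\<close>

lemma Volterra_bound_imp_0:
  fixes d w :: "real \<Rightarrow> complex"
  assumes d': "\<And>t. t \<in> {0..T} \<Longrightarrow> (d has_vector_derivative w t) (at t within {0..T})"
    and d0: "d 0 = 0" and L: "0 \<le> L"
    and w: "\<And>\<tau> M. \<lbrakk>0 < \<tau>; \<tau> \<le> T; \<And>t. t \<in> {0..\<tau>} \<Longrightarrow> cmod (d t) \<le> M\<rbrakk> \<Longrightarrow> cmod (w \<tau>) \<le> L * M"
    and t: "t \<in> {0..T}"
  shows "d t = 0"
proof -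
  have dc: "continuous_on {0..T} d"
    unfolding continuous_on_eq_continuous_within using has_vector_derivative_continuous[OF d'] by blast
  then have "compact (d ` {0..T})" by (intro compact_continuous_image) auto
  then obtain B where "\<forall>y\<in>d ` {0..T}. norm y \<le> B"
    using compact_imp_bounded[of "d ` {0..T}"] unfolding bounded_iff by blast
  then have B: "cmod (d t) \<le> B" if "t \<in> {0..T}" for t using that by simp
  have B0: "0 \<le> B" using B[OF t] norm_ge_zero[of "d t"] by linarith
  have main: "\<forall>t\<in>{0..T}. cmod (d t) \<le> B * ((L * t) ^ n / fact n)" for n
  proof (induction n)
    case 0
    then show ?case using B by simp
  next
    case (Suc n)
    show ?case
    proof
      fix t assume t: "t \<in> {0..T}"
      let ?\<phi> = "\<lambda>x. B * ((L * x) ^ Suc n / fact (Suc n))"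
      show "cmod (d t) \<le> ?\<phi> t"
      proof (cases "t = 0")
        case True
        then show ?thesis using d0 by simp
      next
        case False
        then have t0: "0 < t" using t by simp
        have "norm (d t - d 0) \<le> ?\<phi> t - ?\<phi> 0"
        proof (rule differentiable_bound_general[OF t0])
          show "continuous_on {0..t} d" using dc t by (auto intro: continuous_on_subset)
          show "continuous_on {0..t} ?\<phi>" by (intro continuous_intros) auto
          fix x assume x: "0 < x" "x < t"
          have "at x within {0..T} = at x" using x t by (intro at_within_interior) auto
          then show "(d has_vector_derivative w x) (at x)" using d'[of x] x t by simp
          have "((\<lambda>x. B * (L * x) ^ Suc n / fact (Suc n)) has_real_derivative
              B * (real (Suc n) * (L * x) ^ n * L) / fact (Suc n)) (at x)"
            by (auto intro!: derivative_eq_intros simp del: power_Suc)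
          moreover have "B * (real (Suc n) * (L * x) ^ n * L) / fact (Suc n) = L * (B * ((L * x) ^ n / fact n))"
            by (simp add: field_simps del: of_nat_Suc)
          ultimately show "(?\<phi> has_vector_derivative L * (B * ((L * x) ^ n / fact n))) (at x)"
            by (simp only: has_real_derivative_iff_has_vector_derivative times_divide_eq_right)
          show "norm (w x) \<le> L * (B * ((L * x) ^ n / fact n))"
          proof (rule w)
            fix r assume r: "r \<in> {0..x}"
            then have "cmod (d r) \<le> B * ((L * r) ^ n / fact n)" using Suc x t by auto
            also have "\<dots> \<le> B * ((L * x) ^ n / fact n)"
              using r L B0 by (intro mult_left_mono divide_right_mono power_mono) auto
            finally show "cmod (d r) \<le> B * ((L * x) ^ n / fact n)" .
          qed (use x t in auto)
        qed
        then show ?thesis using d0 by simp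
      qed
    qed
  qed
  have "(\<lambda>n. B * (inverse (fact n) * (L * t) ^ n)) \<longlonglongrightarrow> B * 0"
    by (intro tendsto_mult_left summable_LIMSEQ_zero summable_exp)
  then have "cmod (d t) \<le> B * 0"
    by (rule LIMSEQ_le_const) (use main t in \<open>auto simp: divide_inverse_commute\<close>)
  then show ?thesis by simp
qed

text \<open>The Caputo derivative is the Abel integral of the second derivative, so
  \<open>Abel_inversion\<close> applies; the resulting primitive of the second derivative is an
  increment of the first by the fundamental theorem for absolutely continuous functions.\<close>

lemma caputo_Volterra:
  assumes \<alpha>: "1 < \<alpha>" "\<alpha> < 2" and c: "regular_coeff T c" and \<tau>: "0 < \<tau>" "\<tau> \<le> T"
    and eq: "AE t in lebesgue. t \<in> {0<..<T} \<longrightarrow> caputo T \<alpha> c t = \<mu> * c t"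
  shows "of_real (Gamma (\<alpha> - 1)) * (tderiv T c \<tau> - tderiv T c 0) =
    (\<integral>t. indicator {0<..<\<tau>} t *\<^sub>R ((\<tau> - t) powr (\<alpha> - 2)) *\<^sub>R (\<mu> * c t) \<partial>lborel)"
proof -
  let ?h = "tderiv T (tderiv T c)"
  have T: "0 < T" using \<tau> by simp
  have "abs_continuous_on 0 T (tderiv T c)" using c by (simp add: regular_coeff_def)
  then obtain N where h: "?h absolutely_integrable_on {0..T}"
    and i: "\<forall>t\<in>{0..T}. (?h has_integral (tderiv T c t - tderiv T c 0)) {0..t}"
    using abs_continuous_FTC[OF _ T] by metis
  have "set_integrable lebesgue {0..\<tau>} ?h"
    using h by (rule set_integrable_subset) (use \<tau> in auto)
  then have I: "set_lebesgue_integral lebesgue {0..\<tau>} ?h = tderiv T c \<tau> - tderiv T c 0"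
    using i \<tau> by (subst set_lebesgue_integral_eq_integral(2)) (auto intro: integral_unique)
  have "continuous_on {0..T} c" using c
    by (auto simp: regular_coeff_def differentiable_imp_continuous_on)
  then have y: "continuous_on {0..T} (\<lambda>t. \<mu> * c t)" by (intro continuous_intros)
  show ?thesis
    using Abel_inversion[OF \<alpha> \<tau> h y] eq unfolding I caputo_def by simp
qed

theorem caputo_unique:
  assumes \<alpha>: "1 < \<alpha>" "\<alpha> < 2" and T: "0 < T"
    and c: "regular_coeff T c" and d: "regular_coeff T d"
    and ceq: "AE t in lebesgue. t \<in> {0<..<T} \<longrightarrow> caputo T \<alpha> c t = \<mu> * c t"
    and deq: "AE t in lebesgue. t \<in> {0<..<T} \<longrightarrow> caputo T \<alpha> d t = \<mu> * d t"
    and init: "c 0 = d 0" "tderiv T c 0 = tderiv T d 0" and t: "t \<in> {0..T}"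
  shows "c t = d t"
proof -
  let ?K = "\<lambda>\<tau> y. \<integral>t. indicator {0<..<\<tau>} t *\<^sub>R ((\<tau> - t) powr (\<alpha> - 1 - 1)) *\<^sub>R y t \<partial>lborel"
  have G: "0 < Gamma (\<alpha> - 1)" using \<alpha> by (intro Gamma_real_pos) simp
  have cc: "continuous_on {0..T} c" "continuous_on {0..T} d"
    using c d by (auto simp: regular_coeff_def differentiable_imp_continuous_on)
  \<comment> \<open>The kernel mass from \<open>integrable_Abel\<close>, times the size of \<mu>,
    divided by the Gamma factor on the left of the Volterra equation.\<close>
  define L where "L = T powr (\<alpha> - 1) * Beta (\<alpha> - 1) 1 * cmod \<mu> / Gamma (\<alpha> - 1)"
  have L0: "0 \<le> L" using \<alpha> G
    by (auto simp: L_def Beta_def intro!: divide_nonneg_nonneg mult_nonneg_nonneg less_imp_le[OF Gamma_real_pos])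
  have "c t - d t = 0"
  proof (rule Volterra_bound_imp_0[where d = "\<lambda>t. c t - d t" and L = L and T = T
      and w = "\<lambda>t. tderiv T c t - tderiv T d t"])
    show "((\<lambda>t. c t - d t) has_vector_derivative tderiv T c t - tderiv T d t) (at t within {0..T})"
      if "t \<in> {0..T}" for t
      by (intro has_vector_derivative_diff regular_coeffD c d T that)
    show "c 0 - d 0 = 0" using init by simp
    fix \<tau> M assume \<tau>: "0 < \<tau>" "\<tau> \<le> T" and M: "\<And>t. t \<in> {0..\<tau>} \<Longrightarrow> cmod (c t - d t) \<le> M"
    have y: "continuous_on {0..T} (\<lambda>t. \<mu> * c t)" "continuous_on {0..T} (\<lambda>t. \<mu> * d t)"
      "continuous_on {0..T} (\<lambda>t. \<mu> * (c t - d t))"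
      using cc by (auto intro!: continuous_intros)
    have bd: "\<exists>B. \<forall>t\<in>{0..\<tau>}. cmod (y t) \<le> B" if "continuous_on {0..T} y" for y :: "real \<Rightarrow> complex"
    proof -
      have "compact (y ` {0..\<tau>})" using that \<tau>
        by (intro compact_continuous_image) (auto intro: continuous_on_subset)
      then show ?thesis using compact_imp_bounded[of "y ` {0..\<tau>}"] unfolding bounded_iff by auto
    qed
    have a1: "0 < \<alpha> - 1" using \<alpha> by simp
    obtain B1 where B1: "\<forall>t\<in>{0..\<tau>}. cmod (\<mu> * c t) \<le> B1" using bd[OF y(1)] ..
    obtain B2 where B2: "\<forall>t\<in>{0..\<tau>}. cmod (\<mu> * d t) \<le> B2" using bd[OF y(2)] ..
    have i: "integrable lborel (\<lambda>t. indicator {0<..<\<tau>} t *\<^sub>R ((\<tau> - t) powr (\<alpha> - 1 - 1)) *\<^sub>R (\<mu> * c t))"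
      "integrable lborel (\<lambda>t. indicator {0<..<\<tau>} t *\<^sub>R ((\<tau> - t) powr (\<alpha> - 1 - 1)) *\<^sub>R (\<mu> * d t))"
      using integrable_Abel(1)[OF a1 \<tau> y(1), of B1] integrable_Abel(1)[OF a1 \<tau> y(2), of B2] B1 B2 by auto
    have "of_real (Gamma (\<alpha> - 1)) * (tderiv T c \<tau> - tderiv T c 0) = ?K \<tau> (\<lambda>t. \<mu> * c t)"
      "of_real (Gamma (\<alpha> - 1)) * (tderiv T d \<tau> - tderiv T d 0) = ?K \<tau> (\<lambda>t. \<mu> * d t)"
      using caputo_Volterra[OF \<alpha> c \<tau> ceq] caputo_Volterra[OF \<alpha> d \<tau> deq] by simp_all
    then have "of_real (Gamma (\<alpha> - 1)) * (tderiv T c \<tau> - tderiv T d \<tau>) = ?K \<tau> (\<lambda>t. \<mu> * c t) - ?K \<tau> (\<lambda>t. \<mu> * d t)"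
      using init by (simp add: algebra_simps)
    also have "\<dots> = ?K \<tau> (\<lambda>t. \<mu> * (c t - d t))"
      by (subst Bochner_Integration.integral_diff[OF i, symmetric]) (simp add: algebra_simps)
    finally have e: "of_real (Gamma (\<alpha> - 1)) * (tderiv T c \<tau> - tderiv T d \<tau>) = ?K \<tau> (\<lambda>t. \<mu> * (c t - d t))" .
    have "cmod (?K \<tau> (\<lambda>t. \<mu> * (c t - d t))) \<le> T powr (\<alpha> - 1) * Beta (\<alpha> - 1) 1 * (cmod \<mu> * M)"
      using M by (intro integrable_Abel(2) a1 \<tau> y) (auto simp: norm_mult intro!: mult_left_mono)
    then have "Gamma (\<alpha> - 1) * cmod (tderiv T c \<tau> - tderiv T d \<tau>) \<le> T powr (\<alpha> - 1) * Beta (\<alpha> - 1) 1 * (cmod \<mu> * M)"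
      using G unfolding e[symmetric] norm_mult by simp
    then show "cmod (tderiv T c \<tau> - tderiv T d \<tau>) \<le> L * M"
      using G by (simp add: L_def field_simps)
  qed (use L0 t in auto)
  then show ?thesis by simp
qed

section \<open>Regularity of the explicit scalar solution\<close>

text \<open>A monotone function sends disjoint intervals to disjoint, possibly empty, intervals
  between \<open>F a\<close> and \<open>F b\<close>; additivity of the measure sums their
  lengths.\<close>

lemma sum_increments_le:
  fixes F :: "real \<Rightarrow> real"
  assumes F: "\<And>x y. \<lbrakk>a \<le> x; x \<le> y; y \<le> b\<rbrakk> \<Longrightarrow> F x \<le> F y"
    and ab: "\<And>i. i < n \<Longrightarrow> a \<le> x i \<and> x i \<le> y i \<and> y i \<le> b"
    and disj: "disjoint_family_on (\<lambda>i. {x i<..<y i}) {..<n::nat}"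
  shows "(\<Sum>i<n. F (y i) - F (x i)) \<le> \<bar>F b - F a\<bar>"
proof (cases "n = 0")
  case False
  let ?I = "\<lambda>i. {F (x i)<..<F (y i)}"
  have ab': "a \<le> b" using ab[of 0] False by auto
  have Fi: "F (x i) \<le> F (y i)" if "i < n" for i using F ab that by simp
  have "disjoint_family_on ?I {..<n}"
    unfolding disjoint_family_on_def
  proof (intro ballI impI)
    fix i j assume ij: "i \<in> {..<n}" "j \<in> {..<n}" "i \<noteq> j"
    have xi: "a \<le> x i" "x i \<le> y i" "y i \<le> b" "a \<le> x j" "x j \<le> y j" "y j \<le> b"
      using ab ij by auto
    have "{x i<..<y i} \<inter> {x j<..<y j} = {}" using disj ij by (simp add: disjoint_family_on_def)
    then have "x i = y i \<or> x j = y j \<or> y i \<le> x j \<or> y j \<le> x i"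
    proof -
      assume e: "{x i<..<y i} \<inter> {x j<..<y j} = {}"
      \<comment> \<open>If all four alternatives failed, this midpoint would lie in the
        intersection.\<close>
      have "(max (x i) (x j) + min (y i) (y j)) / 2 \<notin> {x i<..<y i} \<inter> {x j<..<y j}" unfolding e by simp
      then show ?thesis using xi by (auto simp: max_def min_def split: if_splits)
    qed
    then have "F (x i) = F (y i) \<or> F (x j) = F (y j) \<or> F (y i) \<le> F (x j) \<or> F (y j) \<le> F (x i)"
      using F[of "y i" "x j"] F[of "y j" "x i"] xi by auto
    then show "?I i \<inter> ?I j = {}" by auto
  qed
  then have "(\<Sum>i<n. measure lborel (?I i)) = measure lborel (\<Union>i<n. ?I i)"
    using Fi by (intro measure_finite_Union[symmetric]) auto
  also have "\<dots> \<le> measure lborel {F a..F b}"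
  proof (rule measure_mono_fmeasurable)
    show "(\<Union>i<n. ?I i) \<subseteq> {F a..F b}"
    proof
      fix z assume "z \<in> (\<Union>i<n. ?I i)"
      then obtain i where i: "i < n" "F (x i) < z" "z < F (y i)" by auto
      have "F a \<le> F (x i)" "F (y i) \<le> F b" using F ab[OF i(1)] by auto
      then show "z \<in> {F a..F b}" using i by simp
    qed
  qed (auto simp: fmeasurable_def emeasure_lborel_Icc_eq)
  also have "\<dots> \<le> \<bar>F b - F a\<bar>" using F[of a b] ab' by simp
  also have "(\<Sum>i<n. measure lborel (?I i)) = (\<Sum>i<n. F (y i) - F (x i))"
    using F ab by (intro sum.cong) auto
  finally show ?thesis .
qed simp

lemma abs_continuous_on_cong:
  assumes eq: "\<And>t. t \<in> {a..b} \<Longrightarrow> f t = g t" and f: "abs_continuous_on a b f"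
  shows "abs_continuous_on a b g"
  unfolding abs_continuous_on_def
proof (intro allI impI)
  fix \<epsilon> :: real assume "0 < \<epsilon>"
  then obtain \<delta> where \<delta>: "0 < \<delta>" "\<forall>(n::nat) x y. (\<forall>i<n. a \<le> x i \<and> x i \<le> y i \<and> y i \<le> b) \<and>
        disjoint_family_on (\<lambda>i. {x i<..<y i}) {..<n} \<and> (\<Sum>i<n. y i - x i) < \<delta>
        \<longrightarrow> (\<Sum>i<n. cmod (f (y i) - f (x i))) < \<epsilon>"
    using f unfolding abs_continuous_on_def by blast
  show "\<exists>\<delta>>0. \<forall>(n::nat) x y. (\<forall>i<n. a \<le> x i \<and> x i \<le> y i \<and> y i \<le> b) \<and>
        disjoint_family_on (\<lambda>i. {x i<..<y i}) {..<n} \<and> (\<Sum>i<n. y i - x i) < \<delta>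
        \<longrightarrow> (\<Sum>i<n. cmod (g (y i) - g (x i))) < \<epsilon>"
  proof (intro exI[of _ \<delta>] conjI allI impI)
    fix n :: nat and x y :: "nat \<Rightarrow> real"
    assume A: "(\<forall>i<n. a \<le> x i \<and> x i \<le> y i \<and> y i \<le> b) \<and>
        disjoint_family_on (\<lambda>i. {x i<..<y i}) {..<n} \<and> (\<Sum>i<n. y i - x i) < \<delta>"
    have "g (y i) - g (x i) = f (y i) - f (x i)" if "i < n" for i
    proof -
      have "x i \<in> {a..b}" "y i \<in> {a..b}" using A that by (auto intro: order_trans)
      then show ?thesis using eq by simp
    qed
    then have "(\<Sum>i<n. cmod (g (y i) - g (x i))) = (\<Sum>i<n. cmod (f (y i) - f (x i)))" by simp
    then show "(\<Sum>i<n. cmod (g (y i) - g (x i))) < \<epsilon>" using A \<delta>(2) by simp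
  qed (rule \<delta>(1))
qed

text \<open>The derivative may blow up at 0 like \<open>s powr (p - 1)\<close>. Below a cutoff
  \<open>e\<close> increments are dominated by those of the monotone function
  \<open>K / p * s powr p\<close>, whose total is small; above \<open>e\<close> the function is
  Lipschitz.\<close>

lemma abs_continuous_on_power_singularity:
  fixes v v' :: "real \<Rightarrow> complex"
  assumes p: "0 < p" "p \<le> 1" and K: "0 \<le> K" and T: "0 < T"
    and v: "continuous_on {0..T} v"
    and v': "\<And>s. \<lbrakk>0 < s; s < T\<rbrakk> \<Longrightarrow> (v has_vector_derivative v' s) (at s)"
    and b: "\<And>s. \<lbrakk>0 < s; s < T\<rbrakk> \<Longrightarrow> cmod (v' s) \<le> K * s powr (p - 1)"
  shows "abs_continuous_on 0 T v"
proof -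
  have inc: "cmod (v y - v x) \<le> K / p * (min y e powr p - min x e powr p) + K * e powr (p - 1) * (y - x)"
    if xy: "0 \<le> x" "x \<le> y" "y \<le> T" and e: "0 < e" for x y e
  proof -
    have one: "cmod (v y - v x) \<le> K / p * (y powr p - x powr p)" if "0 \<le> x" "x \<le> y" "y \<le> T" for x y
    proof (cases "x = y")
      case False
      then have "x < y" using that by simp
      have "norm (v y - v x) \<le> (\<lambda>s. K / p * s powr p) y - (\<lambda>s. K / p * s powr p) x"
      proof (rule differentiable_bound_general[OF \<open>x < y\<close>])
        show "continuous_on {x..y} v" using v that by (auto intro: continuous_on_subset)
        show "continuous_on {x..y} (\<lambda>s. K / p * s powr p)"
          using that p by (intro continuous_intros continuous_on_powr') auto
        fix s assume s: "x < s" "s < y"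
        then have s0: "0 < s" "s < T" using that by auto
        show "(v has_vector_derivative v' s) (at s)" by (rule v'[OF s0])
        have "((\<lambda>s. K / p * s powr p) has_real_derivative K / p * (p * s powr (p - 1))) (at s)"
          using has_real_derivative_powr[OF s0(1), of p] by (rule DERIV_cmult)
        then show "((\<lambda>s. K / p * s powr p) has_vector_derivative K * s powr (p - 1)) (at s)"
          using p by (simp add: has_real_derivative_iff_has_vector_derivative[symmetric])
        show "norm (v' s) \<le> K * s powr (p - 1)" by (rule b[OF s0])
      qed
      then show ?thesis by (simp add: right_diff_distrib)
    qed simp
    have two: "cmod (v y - v x) \<le> K * e powr (p - 1) * (y - x)" if "e \<le> x" "x \<le> y" "y \<le> T" for x y
    proof (cases "x = y")
      case False
      then have "x < y" using that by simp
      have "norm (v y - v x) \<le> (\<lambda>s. K * e powr (p - 1) * s) y - (\<lambda>s. K * e powr (p - 1) * s) x"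
      proof (rule differentiable_bound_general[OF \<open>x < y\<close>])
        show "continuous_on {x..y} v" using v that e by (auto intro: continuous_on_subset)
        show "continuous_on {x..y} (\<lambda>s. K * e powr (p - 1) * s)" by (intro continuous_intros)
        fix s assume s: "x < s" "s < y"
        then have s0: "0 < s" "s < T" "e \<le> s" using that e by auto
        show "(v has_vector_derivative v' s) (at s)" by (rule v'[OF s0(1,2)])
        show "((\<lambda>s. K * e powr (p - 1) * s) has_vector_derivative K * e powr (p - 1)) (at s)"
          unfolding has_real_derivative_iff_has_vector_derivative[symmetric] by (rule DERIV_cmult_Id)
        have "s powr (p - 1) \<le> e powr (p - 1)" using s0 e p by (intro powr_mono2') auto
        then show "norm (v' s) \<le> K * e powr (p - 1)"
          using b[OF s0(1,2)] K mult_left_mono[of "s powr (p - 1)" "e powr (p - 1)" K] by simp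
      qed
      then show ?thesis by (simp add: right_diff_distrib)
    qed simp
    have pos: "0 \<le> K * e powr (p - 1)" using K by simp
    consider "y \<le> e" | "x < e" "e < y" | "e \<le> x" by linarith
    then show ?thesis
    proof cases
      case 1
      then have m: "min y e = y" "min x e = x" using xy by auto
      show ?thesis unfolding m using one[of x y] xy mult_nonneg_nonneg[OF pos, of "y - x"] by linarith
    next
      case 2
      have "cmod (v y - v x) \<le> cmod (v e - v x) + cmod (v y - v e)"
        using norm_triangle_ineq[of "v e - v x" "v y - v e"] by simp
      also have "cmod (v e - v x) \<le> K / p * (e powr p - x powr p)" using one[of x e] 2 xy by simp
      also have "cmod (v y - v e) \<le> K * e powr (p - 1) * (y - e)" using two[of e y] 2 xy by simp
      also have "K * e powr (p - 1) * (y - e) \<le> K * e powr (p - 1) * (y - x)"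
        using 2 pos by (intro mult_left_mono) auto
      finally show ?thesis using 2 by (simp add: min_def)
    next
      case 3
      then have m: "min y e = e" "min x e = e" using xy by auto
      show ?thesis unfolding m using two[of x y] xy 3 by simp
    qed
  qed
  show ?thesis unfolding abs_continuous_on_def
  proof (intro allI impI)
    fix \<epsilon> :: real assume \<epsilon>: "0 < \<epsilon>"
    \<comment> \<open>Chosen so that the singular part contributes at most half of \<epsilon>;
      \<open>K + 1\<close> guards against \<open>K = 0\<close>, and the minimum keeps the cutoff
      inside the interval.\<close>
    define e where "e = min T ((\<epsilon> * p / (2 * (K + 1))) powr (1 / p))"
    have e: "0 < e" "e \<le> T" using T \<epsilon> p K by (auto simp: e_def)
    have "e powr p \<le> ((\<epsilon> * p / (2 * (K + 1))) powr (1 / p)) powr p"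
      using e p by (intro powr_mono2) (auto simp: e_def)
    also have "\<dots> = \<epsilon> * p / (2 * (K + 1))" using \<epsilon> p K by (simp add: powr_powr)
    finally have "K / p * e powr p \<le> K / p * (\<epsilon> * p / (2 * (K + 1)))" using K p by (intro mult_left_mono) auto
    also have "\<dots> = \<epsilon> / 2 * (K / (K + 1))" using p by simp
    also have "\<dots> \<le> \<epsilon> / 2 * 1" using K \<epsilon> by (intro mult_left_mono) auto
    finally have e1: "K / p * e powr p \<le> \<epsilon> / 2" by simp
    define k where "k = K * e powr (p - 1) + 1"
    have k0: "0 < k" using K by (auto simp: k_def intro!: add_nonneg_pos)
    show "\<exists>\<delta>>0. \<forall>(n::nat) x y. (\<forall>i<n. 0 \<le> x i \<and> x i \<le> y i \<and> y i \<le> T) \<and>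
        disjoint_family_on (\<lambda>i. {x i<..<y i}) {..<n} \<and> (\<Sum>i<n. y i - x i) < \<delta> \<longrightarrow>
        (\<Sum>i<n. cmod (v (y i) - v (x i))) < \<epsilon>"
    proof (intro exI[of _ "\<epsilon> / (2 * k)"] conjI allI impI)
      show "0 < \<epsilon> / (2 * k)" using \<epsilon> k0 by simp
      fix n :: nat and x y :: "nat \<Rightarrow> real"
      assume A: "(\<forall>i<n. 0 \<le> x i \<and> x i \<le> y i \<and> y i \<le> T) \<and>
        disjoint_family_on (\<lambda>i. {x i<..<y i}) {..<n} \<and> (\<Sum>i<n. y i - x i) < \<epsilon> / (2 * k)"
      let ?F = "\<lambda>x. min x e powr p"
      have F: "(\<Sum>i<n. ?F (y i) - ?F (x i)) \<le> \<bar>?F T - ?F 0\<bar>"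
        using A p e by (intro sum_increments_le) (auto intro!: powr_mono2)
      have FT: "\<bar>?F T - ?F 0\<bar> = e powr p" using e by (simp add: min_def)
      have s0: "0 \<le> (\<Sum>i<n. y i - x i)" using A by (intro sum_nonneg) auto
      have "(\<Sum>i<n. cmod (v (y i) - v (x i))) \<le>
          (\<Sum>i<n. K / p * (?F (y i) - ?F (x i)) + K * e powr (p - 1) * (y i - x i))"
        using A e by (intro sum_mono inc) auto
      also have "\<dots> = K / p * (\<Sum>i<n. ?F (y i) - ?F (x i)) + K * e powr (p - 1) * (\<Sum>i<n. y i - x i)"
        by (simp add: sum.distrib sum_distrib_left)
      also have "\<dots> \<le> K / p * e powr p + k * (\<Sum>i<n. y i - x i)"
        using F K p s0 unfolding FT k_def by (intro add_mono mult_left_mono mult_right_mono) auto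
      also have "\<dots> < \<epsilon> / 2 + k * (\<epsilon> / (2 * k))"
        using e1 A k0 by (intro add_le_less_mono mult_strict_left_mono) auto
      also have "\<dots> = \<epsilon>" using k0 by (simp add: field_simps)
      finally show "(\<Sum>i<n. cmod (v (y i) - v (x i))) < \<epsilon>" .
    qed
  qed
qed

lemma ml_bound:
  assumes "1 \<le> \<alpha>" "0 < \<beta>"
  obtains K where "0 \<le> K" "\<And>s. s \<in> {0..T} \<Longrightarrow> cmod (ml \<alpha> \<beta> \<mu> s) \<le> K * s powr (\<beta> - 1)"
proof -
  let ?E = "\<lambda>s. mittag_leffler \<alpha> \<beta> (\<mu> * of_real (s powr \<alpha>))"
  have "continuous_on {0..T} ?E" using assms
    by (intro continuous_intros continuous_on_powr'
      continuous_on_compose2[OF continuous_on_mittag_leffler[of \<alpha> \<beta> UNIV]]) auto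
  then have "compact (?E ` {0..T})" by (intro compact_continuous_image) auto
  then obtain K where K: "\<forall>y\<in>?E ` {0..T}. norm y \<le> K"
    using compact_imp_bounded[of "?E ` {0..T}"] unfolding bounded_iff by blast
  show thesis
  proof (rule that[of "\<bar>K\<bar>"])
    fix s assume "s \<in> {0..T}"
    then have "cmod (?E s) \<le> \<bar>K\<bar>" using K by force
    then have "s powr (\<beta> - 1) * cmod (?E s) \<le> s powr (\<beta> - 1) * \<bar>K\<bar>" by (rule mult_left_mono) simp
    then show "cmod (ml \<alpha> \<beta> \<mu> s) \<le> \<bar>K\<bar> * s powr (\<beta> - 1)"
      by (simp add: ml_def mult.commute[of "\<bar>K\<bar>"])
  qed simp
qed

lemma ml_set_integrable:
  assumes "1 \<le> \<alpha>" "0 < \<beta>" "0 < \<gamma>" "0 < t"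
  shows "set_integrable lebesgue {0..t} (\<lambda>s. ((t - s) powr (\<gamma> - 1)) *\<^sub>R ml \<alpha> \<beta> \<mu> s)"
  unfolding set_integrable_def
proof -
  obtain K where K: "0 \<le> K" "\<And>s. s \<in> {0..t} \<Longrightarrow> cmod (ml \<alpha> \<beta> \<mu> s) \<le> K * s powr (\<beta> - 1)"
    by (rule ml_bound[OF assms(1,2), of t \<mu>]) blast
  have E: "mittag_leffler \<alpha> \<beta> \<in> borel_measurable borel"
    using continuous_on_mittag_leffler[OF assms(1,2), of UNIV] by (rule borel_measurable_continuous_onI)
  have m: "(\<lambda>s. indicator {0..t} s *\<^sub>R ((t - s) powr (\<gamma> - 1)) *\<^sub>R ml \<alpha> \<beta> \<mu> s) \<in> borel_measurable lborel"
    unfolding ml_def using E by measurable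
  let ?j = "\<lambda>s. indicator {0..t} s *\<^sub>R ((t - s) powr (\<gamma> - 1) * s powr (\<beta> - 1)) * K"
  show "integrable lebesgue (\<lambda>s. indicator {0..t} s *\<^sub>R ((t - s) powr (\<gamma> - 1)) *\<^sub>R ml \<alpha> \<beta> \<mu> s)"
  proof (rule Bochner_Integration.integrable_bound)
    show "integrable lebesgue ?j"
      using set_integrable_Beta_scaled(1)[OF assms(3,2,4)] unfolding set_integrable_def
      by (rule integrable_mult_left)
    show "AE s in lebesgue. norm (indicator {0..t} s *\<^sub>R ((t - s) powr (\<gamma> - 1)) *\<^sub>R ml \<alpha> \<beta> \<mu> s) \<le> norm (?j s)"
    proof (rule AE_I2)
      fix s
      show "norm (indicator {0..t} s *\<^sub>R ((t - s) powr (\<gamma> - 1)) *\<^sub>R ml \<alpha> \<beta> \<mu> s) \<le> norm (?j s)"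
      proof (cases "s \<in> {0..t}")
        case True
        then have "(t - s) powr (\<gamma> - 1) * cmod (ml \<alpha> \<beta> \<mu> s) \<le> (t - s) powr (\<gamma> - 1) * (K * s powr (\<beta> - 1))"
          using K(2) by (intro mult_left_mono) auto
        then show ?thesis using True K(1) by (simp add: abs_mult mult_ac)
      qed simp
    qed
  qed (rule measurable_completion[OF m])
qed

text \<open>Differentiating twice leads to \<open>ml\<close> with parameters
  \<open>\<alpha> - 1\<close> and \<alpha>, singular at 0 only like
  \<open>s powr (\<alpha> - 2)\<close>. The fractional integral of order \<open>2 - \<alpha>\<close>
  in the Caputo derivative raises them to 1 and 2, which reproduces \<mu> times the
  function.\<close>

lemma ml_coeff:
  fixes a b \<mu> :: complex
  assumes \<alpha>: "1 < \<alpha>" "\<alpha> < 2" and T: "0 < T"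
  defines "c \<equiv> \<lambda>t. a * mlc \<alpha> \<mu> t + b * ml \<alpha> 2 \<mu> t"
  defines "w \<equiv> \<lambda>t. a * (\<mu> * ml \<alpha> \<alpha> \<mu> t) + b * mlc \<alpha> \<mu> t"
  shows "\<And>t. t \<in> {0..T} \<Longrightarrow> tderiv T c t = w t" and "regular_coeff T c"
    and "\<And>t. \<lbrakk>0 < t; t \<le> T\<rbrakk> \<Longrightarrow> caputo T \<alpha> c t = \<mu> * c t"
proof -
  define h where "h = (\<lambda>t. a * (\<mu> * ml \<alpha> (\<alpha> - 1) \<mu> t) + b * (\<mu> * ml \<alpha> \<alpha> \<mu> t))"
  have c': "(c has_vector_derivative w t) (at t within {0..T})" if "t \<in> {0..T}" for t
    unfolding c_def w_def
    by (intro has_vector_derivative_add has_vector_derivative_mult_right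
      mlc_has_vector_derivative ml2_has_vector_derivative \<alpha>) (use that in auto)
  show tc: "tderiv T c t = w t" if "t \<in> {0..T}" for t by (rule tderiv_eq[OF T that c'[OF that]])
  have w': "(w has_vector_derivative h s) (at s)" if s: "0 < s" for s
  proof -
    have at: "at s within {0..} = at s" using s by (intro at_within_interior) (simp add: interior_real_atLeast)
    show ?thesis unfolding w_def h_def
      using mlc_has_vector_derivative[OF \<alpha>(1), of s "{0..}" \<mu>] ml_has_vector_derivative[of \<alpha> \<alpha> s \<mu>] s \<alpha> unfolding at
      by (intro has_vector_derivative_add has_vector_derivative_mult_right) auto
  qed
  have th: "tderiv T (tderiv T c) s = h s" if s: "0 < s" "s \<le> T" for s
  proof (rule tderiv_eq[OF T])
    show "(tderiv T c has_vector_derivative h s) (at s within {0..T})"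
      by (rule has_vector_derivative_transform[OF _ _ has_vector_derivative_at_within[OF w'[OF s(1)]]])
        (use s tc in auto)
  qed (use s in auto)
  have wc: "continuous_on {0..T} w" unfolding w_def using \<alpha>
    by (intro continuous_intros continuous_on_subset[OF continuous_on_ml] continuous_on_subset[OF continuous_on_mlc]) auto
  obtain K1 where K1: "0 \<le> K1" "\<And>s. s \<in> {0..T} \<Longrightarrow> cmod (ml \<alpha> (\<alpha> - 1) \<mu> s) \<le> K1 * s powr (\<alpha> - 1 - 1)"
    by (rule ml_bound[of \<alpha> "\<alpha> - 1" T \<mu>]) (use \<alpha> in auto)
  obtain K2 where K2: "0 \<le> K2" "\<And>s. s \<in> {0..T} \<Longrightarrow> cmod (ml \<alpha> \<alpha> \<mu> s) \<le> K2 * s powr (\<alpha> - 1)"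
    by (rule ml_bound[of \<alpha> \<alpha> T \<mu>]) (use \<alpha> in auto)
  have "abs_continuous_on 0 T w"
  proof (rule abs_continuous_on_power_singularity[OF _ _ _ T wc w'])
    fix s assume s: "0 < s" "s < T"
    have "s powr (\<alpha> - 1) = s * s powr (\<alpha> - 1 - 1)" using s by (simp add: powr_mult_base)
    also have "\<dots> \<le> T * s powr (\<alpha> - 1 - 1)" using s by (intro mult_right_mono) auto
    finally have "K2 * s powr (\<alpha> - 1) \<le> K2 * (T * s powr (\<alpha> - 1 - 1))" using K2(1) by (rule mult_left_mono)
    then have m2: "cmod (ml \<alpha> \<alpha> \<mu> s) \<le> K2 * (T * s powr (\<alpha> - 1 - 1))" using K2(2)[of s] s by simp
    have "cmod (h s) \<le> cmod a * (cmod \<mu> * cmod (ml \<alpha> (\<alpha> - 1) \<mu> s)) + cmod b * (cmod \<mu> * cmod (ml \<alpha> \<alpha> \<mu> s))"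
      unfolding h_def norm_mult[symmetric] by (rule norm_triangle_ineq)
    also have "\<dots> \<le> cmod a * (cmod \<mu> * (K1 * s powr (\<alpha> - 1 - 1))) + cmod b * (cmod \<mu> * (K2 * (T * s powr (\<alpha> - 1 - 1))))"
      using K1(2)[of s] m2 s by (intro add_mono mult_left_mono) auto
    also have "\<dots> = (cmod a * cmod \<mu> * K1 + cmod b * cmod \<mu> * K2 * T) * s powr (\<alpha> - 1 - 1)"
      by (simp add: algebra_simps)
    finally show "cmod (h s) \<le> (cmod a * cmod \<mu> * K1 + cmod b * cmod \<mu> * K2 * T) * s powr (\<alpha> - 1 - 1)" .
  qed (use \<alpha> K1 K2 T in auto)
  then have "abs_continuous_on 0 T (tderiv T c)"
    by (rule abs_continuous_on_cong[rotated]) (use tc in simp)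
  moreover have "continuous_on {0..T} (tderiv T c)"
    using wc by (simp only: continuous_on_cong[OF refl tc])
  moreover have "c differentiable_on {0..T}"
    unfolding differentiable_on_def using differentiableI_vector[OF c'] by blast
  ultimately show "regular_coeff T c" by (simp add: regular_coeff_def)
  show "caputo T \<alpha> c t = \<mu> * c t" if t: "0 < t" "t \<le> T" for t
  proof -
    let ?k = "\<lambda>s. (t - s) powr (2 - \<alpha> - 1)"
    have pos: "1 \<le> \<alpha>" "0 < \<alpha> - 1" "0 < \<alpha>" "0 < 2 - \<alpha>" using \<alpha> by auto
    note i1 = ml_set_integrable[OF pos(1,2,4) t(1), of \<mu>] and i2 = ml_set_integrable[OF pos(1,3,4) t(1), of \<mu>]
    note I1 = ml_fractional_integral[OF pos(1,2,4) t(1), of \<mu>] and I2 = ml_fractional_integral[OF pos(1,3,4) t(1), of \<mu>]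
    have eqh: "?k s *\<^sub>R h s = (a * \<mu>) * (?k s *\<^sub>R ml \<alpha> (\<alpha> - 1) \<mu> s) + (b * \<mu>) * (?k s *\<^sub>R ml \<alpha> \<alpha> \<mu> s)" for s
      by (simp add: h_def scaleR_conv_of_real algebra_simps)
    have hi: "set_integrable lebesgue {0..t} (\<lambda>s. ?k s *\<^sub>R h s)"
      unfolding eqh by (intro set_integral_add(1) set_integrable_mult_right i1 i2)
    have "set_lebesgue_integral lebesgue {0..t} (\<lambda>s. ?k s *\<^sub>R h s) =
        (a * \<mu>) * (of_real (Gamma (2 - \<alpha>)) * ml \<alpha> 1 \<mu> t) + (b * \<mu>) * (of_real (Gamma (2 - \<alpha>)) * ml \<alpha> 2 \<mu> t)"
      unfolding eqh set_integral_add(2)[OF set_integrable_mult_right[OF i1] set_integrable_mult_right[OF i2]]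
        set_integral_mult_right I1 I2 by simp
    also have "\<dots> = of_real (Gamma (2 - \<alpha>)) * (\<mu> * c t)"
      using t by (simp add: c_def mlc_eq_ml algebra_simps)
    finally have hI: "set_lebesgue_integral lebesgue {0..t} (\<lambda>s. ?k s *\<^sub>R h s) = of_real (Gamma (2 - \<alpha>)) * (\<mu> * c t)" .
    let ?g = "\<lambda>s. indicator {0..t} s *\<^sub>R (?k s *\<^sub>R tderiv T (tderiv T c) s)"
    \<comment> \<open>The formula for the second derivative is established for positive
      \<open>s\<close> only; the origin is a null set.\<close>
    have "AE s in lebesgue. s \<noteq> 0" by (rule AE_completion[OF AE_lborel_singleton])
    then have ae: "AE s in lebesgue. indicator {0..t} s *\<^sub>R (?k s *\<^sub>R h s) = ?g s"
    proof eventually_elim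
      case (elim s)
      then show ?case using th[of s] t by (auto simp: indicator_def)
    qed
    have hm: "(\<lambda>s. indicator {0..t} s *\<^sub>R (?k s *\<^sub>R h s)) \<in> borel_measurable lebesgue"
      using hi unfolding set_integrable_def by (rule borel_measurable_integrable)
    have "integral\<^sup>L lebesgue (\<lambda>s. indicator {0..t} s *\<^sub>R (?k s *\<^sub>R h s)) = integral\<^sup>L lebesgue ?g"
      by (rule integral_cong_AE[OF hm borel_measurable_AE[OF hm ae] ae])
    then have "set_lebesgue_integral lebesgue {0..t} (\<lambda>s. ?k s *\<^sub>R tderiv T (tderiv T c) s) = of_real (Gamma (2 - \<alpha>)) * (\<mu> * c t)"
      using hI unfolding set_lebesgue_integral_def by simp
    moreover have "Gamma (2 - \<alpha>) \<noteq> 0" using Gamma_real_pos[OF pos(4)] by simp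
    moreover have "2 - \<alpha> - 1 = 1 - \<alpha>" by simp
    ultimately show ?thesis unfolding caputo_def by simp
  qed
qed

section \<open>Spectral powers, dual spaces and the extension of the operator\<close>

section \<open>The scale of spaces\<close>

lemma Hs_dualI:
  assumes "\<And>v w. \<lbrakk>v \<in> Hs lam phi s; w \<in> Hs lam phi s\<rbrakk> \<Longrightarrow> v + w \<in> Hs lam phi s \<and> h (v + w) = h v + h w"
    and "\<And>c v. v \<in> Hs lam phi s \<Longrightarrow> c *\<^sub>C v \<in> Hs lam phi s \<and> h (c *\<^sub>C v) = cnj c * h v"
    and "\<And>v. v \<in> Hs lam phi s \<Longrightarrow> cmod (h v) \<le> C * Hs_norm lam phi s v"
  shows "(\<lambda>v. if v \<in> Hs lam phi s then h v else 0) \<in> Hs_dual lam phi s"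
  unfolding Hs_dual_def
proof (intro CollectI conjI ballI allI impI)
  show "\<exists>C. \<forall>v\<in>Hs lam phi s. cmod (if v \<in> Hs lam phi s then h v else 0) \<le> C * Hs_norm lam phi s v"
    using assms(3) by (intro exI[of _ C]) simp
qed (simp_all add: assms(1,2))

locale spectral_scale = hilbert_basis phi
  for phi :: "nat \<Rightarrow> 'h::complex_hilbert" +
  fixes D :: "'h set" and A :: "'h \<Rightarrow> 'h" and lam :: "nat \<Rightarrow> real"
  assumes lam_pos: "0 < lam n" and lam_mono: "mono lam"
    and self_adjoint: "self_adjoint D A"
    and phi_D: "phi n \<in> D" and A_phi: "A (phi n) = - (lam n *\<^sub>R phi n)"
begin

lemma lam_powr_le: "0 \<le> p \<Longrightarrow> lam 0 powr p \<le> lam n powr p"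
  using lam_pos[of 0] lam_mono by (intro powr_mono2) (auto simp: mono_def)

lemma weight_sq: "lam n powr (2 * s) * (cmod x)\<^sup>2 = (cmod (of_real (lam n powr s) * x))\<^sup>2"
  by (simp add: norm_mult power_mult_distrib power2_eq_square powr_add[symmetric])

text \<open>The power of order \<open>s\<close> of \<open>-A\<close>, acting on coefficients. It is
  an isometry from the space of order \<open>s\<close> into the Hilbert space and carries questions
  on the scale back there.\<close>

definition J :: "real \<Rightarrow> 'h \<Rightarrow> 'h" where
  "J s v = synth (\<lambda>n. of_real (lam n powr s) * cinner v (phi n))"

lemma Hs_iff: "v \<in> Hs lam phi s \<longleftrightarrow> summable (\<lambda>n. (cmod (of_real (lam n powr s) * cinner v (phi n)))\<^sup>2)"
  by (simp add: Hs_def weight_sq)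

lemma J_coeff: "v \<in> Hs lam phi s \<Longrightarrow> cinner (J s v) (phi n) = of_real (lam n powr s) * cinner v (phi n)"
  unfolding J_def Hs_iff by (rule cinner_synth)

lemma norm_J: "v \<in> Hs lam phi s \<Longrightarrow> norm (J s v) = Hs_norm lam phi s v"
  unfolding Hs_norm_def weight_sq J_def Hs_iff by (simp add: norm_synth[symmetric])

text \<open>Exhibiting a vector with the weighted coefficients certifies membership and computes
  \<open>J\<close> in one stroke; Bessel's inequality supplies the summability.\<close>

lemma Hs_by_coeff:
  assumes "\<And>n. cinner x (phi n) = of_real (lam n powr s) * cinner v (phi n)"
  shows "v \<in> Hs lam phi s" "J s v = x"
proof -
  show "v \<in> Hs lam phi s" unfolding Hs_iff assms[symmetric] by (rule bessel)
  show "J s v = x" unfolding J_def assms[symmetric] by (rule synth_coeff)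
qed

lemma Hs_add:
  assumes "v \<in> Hs lam phi s" "w \<in> Hs lam phi s"
  shows "v + w \<in> Hs lam phi s" "J s (v + w) = J s v + J s w"
  by (rule Hs_by_coeff[of "J s v + J s w"], simp add: cinner_add_left J_coeff assms algebra_simps)+

lemma Hs_scaleC:
  assumes "v \<in> Hs lam phi s"
  shows "c *\<^sub>C v \<in> Hs lam phi s" "J s (c *\<^sub>C v) = c *\<^sub>C J s v"
  by (rule Hs_by_coeff[of "c *\<^sub>C J s v"], simp add: cinner_scaleC_left J_coeff assms algebra_simps)+

lemma cmod_J_coeff: "v \<in> Hs lam phi s \<Longrightarrow> cmod (cinner v (phi n)) = lam n powr (- s) * cmod (cinner (J s v) (phi n))"
  using lam_pos[of n] by (simp add: J_coeff norm_mult powr_minus)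

lemma phi_Hs: "phi m \<in> Hs lam phi s"
  by (rule Hs_by_coeff[of "of_real (lam m powr s) *\<^sub>C phi m"]) (simp add: cinner_scaleC_left orthonormal)

lemma norm_le_Hs_norm:
  assumes "0 \<le> s" "v \<in> Hs lam phi s"
  shows "norm v \<le> lam 0 powr (- s) * Hs_norm lam phi s v"
proof -
  have le: "(cmod (cinner v (phi n)))\<^sup>2 \<le> (lam 0 powr (- s))\<^sup>2 * (cmod (cinner (J s v) (phi n)))\<^sup>2" for n
  proof -
    have "lam n powr (- s) \<le> lam 0 powr (- s)"
      using lam_powr_le[OF assms(1), of n] lam_pos[of 0] by (simp add: powr_minus le_imp_inverse_le)
    then have "cmod (cinner v (phi n)) \<le> lam 0 powr (- s) * cmod (cinner (J s v) (phi n))"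
      unfolding cmod_J_coeff[OF assms(2)] by (intro mult_right_mono) auto
    then show ?thesis unfolding power_mult_distrib[symmetric] by (rule power_mono) simp
  qed
  have "(norm v)\<^sup>2 \<le> (lam 0 powr (- s))\<^sup>2 * (norm (J s v))\<^sup>2"
    unfolding parseval[symmetric] suminf_mult[OF bessel, symmetric]
    by (rule suminf_le[OF le bessel summable_mult[OF bessel]])
  then have "(norm v)\<^sup>2 \<le> (lam 0 powr (- s) * norm (J s v))\<^sup>2" by (simp add: power_mult_distrib)
  then show ?thesis using norm_J[OF assms(2)] by (metis norm_ge_zero power2_le_imp_le powr_ge_zero mult_nonneg_nonneg)
qed

lemma dual_embed_in_dual: "0 \<le> s \<Longrightarrow> dual_embed lam phi s u \<in> Hs_dual lam phi s"
  unfolding dual_embed_def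
proof (rule Hs_dualI[where C = "norm u * lam 0 powr (- s)"])
  fix v assume s: "0 \<le> s" and v: "v \<in> Hs lam phi s"
  have "cmod (cinner u v) \<le> norm u * norm v" by (rule cinner_Cauchy_Schwarz)
  also have "\<dots> \<le> norm u * (lam 0 powr (- s) * Hs_norm lam phi s v)"
    by (intro mult_left_mono norm_le_Hs_norm s v) simp
  finally show "cmod (cinner u v) \<le> norm u * lam 0 powr (- s) * Hs_norm lam phi s v" by simp
qed (simp_all add: Hs_add Hs_scaleC cinner_add_right cinner_scaleC_right)

lemma dual_series_phi: "dual_series lam phi s d (phi m) = d m"
proof -
  have "(\<lambda>n. d n * cinner (phi n) (phi m)) = (\<lambda>n. if n = m then d m else 0)"
    by (auto simp: orthonormal)
  moreover have "(\<lambda>n. if n = m then d m else 0) sums d m" by (rule sums_single[of m "\<lambda>_. d m"])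
  ultimately show ?thesis by (simp add: dual_series_def phi_Hs sums_iff)
qed

text \<open>The weights turn \<open>d\<close> into the coefficients of a genuine vector, and the
  functional is the inner product of that vector with \<open>J s v\<close>.\<close>

lemma dual_series_in_dual:
  assumes d: "summable (\<lambda>n. (lam n powr (- s) * cmod (d n))\<^sup>2)"
  shows "dual_series lam phi s d \<in> Hs_dual lam phi s"
proof -
  let ?e = "\<lambda>n. of_real (lam n powr (- s)) * d n"
  have e: "cinner (synth ?e) (phi n) = ?e n" for n
    by (rule cinner_synth) (use d in \<open>simp add: norm_mult\<close>)
  have eq: "(\<Sum>n. d n * cinner (phi n) v) = cinner (synth ?e) (J s v)" if v: "v \<in> Hs lam phi s" for v
  proof -
    have "?e n * cinner (phi n) (J s v) = d n * cinner (phi n) v" for n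
      using lam_pos[of n] by (simp add: cinner_commute[of "phi n"] J_coeff[OF v] powr_minus)
    then show ?thesis by (simp only: cinner_eq_suminf[of "synth ?e" "J s v"] e)
  qed
  have "dual_series lam phi s d = (\<lambda>v. if v \<in> Hs lam phi s then cinner (synth ?e) (J s v) else 0)"
    by (auto simp: dual_series_def eq)
  moreover have "\<dots> \<in> Hs_dual lam phi s"
    by (rule Hs_dualI[where C = "norm (synth ?e)"])
      (simp_all add: Hs_add Hs_scaleC cinner_add_right cinner_scaleC_right norm_J[symmetric] cinner_Cauchy_Schwarz)
  ultimately show ?thesis by simp
qed

lemma dual_series_coeff: "dual_series lam phi s (\<lambda>n. cinner v (phi n)) = dual_embed lam phi s v"
  by (rule ext) (simp add: dual_series_def dual_embed_def cinner_eq_suminf[symmetric])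

text \<open>The functional is tested on truncations \<open>?v N\<close> of its Riesz representative:
  there its value is the squared \<open>Hs_norm\<close> of \<open>?v N\<close>, so boundedness of
  the functional bounds that norm uniformly in \<open>N\<close>.\<close>

lemma Hs_dual_coeff_summable:
  assumes f: "f \<in> Hs_dual lam phi s"
  shows "summable (\<lambda>n. lam n powr (- 2 * s) * (cmod (f (phi n)))\<^sup>2)"
proof -
  let ?a = "\<lambda>n. lam n powr (- 2 * s) * (cmod (f (phi n)))\<^sup>2"
  let ?c = "\<lambda>n. of_real (lam n powr (- 2 * s)) * f (phi n)"
  let ?v = "\<lambda>N. \<Sum>n<N. ?c n *\<^sub>C phi n"
  have add: "f (v + w) = f v + f w" if "v \<in> Hs lam phi s" "w \<in> Hs lam phi s" for v w
    using f that by (simp add: Hs_dual_def)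
  have sc: "f (c *\<^sub>C v) = cnj c * f v" if "v \<in> Hs lam phi s" for c v
    using f that by (simp add: Hs_dual_def)
  have "\<exists>C. \<forall>v\<in>Hs lam phi s. cmod (f v) \<le> C * Hs_norm lam phi s v" using f by (simp add: Hs_dual_def)
  then obtain C where C: "\<forall>v\<in>Hs lam phi s. cmod (f v) \<le> C * Hs_norm lam phi s v" ..
  have z: "0 \<in> Hs lam phi s" by (simp add: Hs_def)
  have f0: "f 0 = 0" using sc[OF z, of 0] by simp
  have fv: "?v N \<in> Hs lam phi s \<and> f (?v N) = of_real (\<Sum>n<N. ?a n)" for N
  proof (induction N)
    case (Suc N)
    have "f (?c N *\<^sub>C phi N) = of_real (?a N)"
      unfolding sc[OF phi_Hs] by (simp add: complex_norm_square mult_ac del: of_real_power)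
    then show ?case using Suc by (simp add: Hs_add Hs_scaleC phi_Hs add)
  qed (simp add: z f0)
  have Hn: "(Hs_norm lam phi s (?v N))\<^sup>2 = (\<Sum>n<N. ?a n)" for N
  proof -
    have "(\<lambda>n. lam n powr (2 * s) * (cmod (cinner (?v N) (phi n)))\<^sup>2) = (\<lambda>n. if n < N then ?a n else 0)"
    proof
      fix n
      have "lam n powr (2 * s) * (lam n powr (- 2 * s) * lam n powr (- 2 * s)) = lam n powr (- 2 * s)"
        by (simp add: powr_add[symmetric])
      then have "lam n powr (2 * s) * (cmod (?c n))\<^sup>2 = ?a n"
        by (auto simp: norm_mult power_mult_distrib power2_eq_square mult.assoc[symmetric])
      then show "lam n powr (2 * s) * (cmod (cinner (?v N) (phi n)))\<^sup>2 = (if n < N then ?a n else 0)"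
        by (simp add: cinner_sum_phi)
    qed
    moreover have "(\<lambda>n. if n < N then ?a n else 0) sums (\<Sum>n<N. ?a n)"
      using sums_If_finite_set[of "{..<N}" ?a] by simp
    moreover have "0 \<le> (\<Sum>n<N. ?a n)" by (intro sum_nonneg) auto
    ultimately show ?thesis unfolding Hs_norm_def by (simp add: sums_iff)
  qed
  show ?thesis
  proof (rule summableI_nonneg_bounded[where x = "C\<^sup>2"])
    fix N
    let ?S = "\<Sum>n<N. ?a n" and ?h = "Hs_norm lam phi s (?v N)"
    have S0: "0 \<le> ?S" by (intro sum_nonneg) auto
    have "cmod (f (?v N)) \<le> C * ?h" by (rule bspec[OF C conjunct1[OF fv]])
    moreover have "cmod (f (?v N)) = ?S"
      unfolding conjunct2[OF fv[of N]] using S0 by (simp only: norm_of_real abs_of_nonneg)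
    ultimately have "?h\<^sup>2 \<le> C * ?h" unfolding Hn by simp
    moreover have h0: "0 \<le> ?h" by (simp only: norm_J[OF conjunct1[OF fv[of N]], symmetric] norm_ge_zero)
    ultimately have "?h \<le> \<bar>C\<bar>"
      by (cases "?h = 0") (auto simp: power2_eq_square)
    then have "?h\<^sup>2 \<le> C\<^sup>2" using h0 by (metis abs_le_square_iff abs_of_nonneg)
    then show "?S \<le> C\<^sup>2" unfolding Hn .
  qed simp
qed

lemma Hs_dual_diff:
  assumes "f \<in> Hs_dual lam phi s" "g \<in> Hs_dual lam phi s"
  shows "(\<lambda>v. f v - g v) \<in> Hs_dual lam phi s"
proof -
  have "\<exists>C. \<forall>v\<in>Hs lam phi s. cmod (f v) \<le> C * Hs_norm lam phi s v"
    "\<exists>C. \<forall>v\<in>Hs lam phi s. cmod (g v) \<le> C * Hs_norm lam phi s v"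
    using assms by (simp_all add: Hs_dual_def)
  then obtain B C where B: "\<forall>v\<in>Hs lam phi s. cmod (f v) \<le> B * Hs_norm lam phi s v"
    and C: "\<forall>v\<in>Hs lam phi s. cmod (g v) \<le> C * Hs_norm lam phi s v" by (elim exE)
  have "cmod (f v - g v) \<le> (B + C) * Hs_norm lam phi s v" if "v \<in> Hs lam phi s" for v
    using norm_triangle_ineq4[of "f v" "g v"] bspec[OF B that] bspec[OF C that] by (simp add: distrib_right)
  then have "\<exists>C. \<forall>v\<in>Hs lam phi s. cmod (f v - g v) \<le> C * Hs_norm lam phi s v" by blast
  then show ?thesis using assms by (simp add: Hs_dual_def right_diff_distrib)
qed

lemma A_coeff: "u \<in> D \<Longrightarrow> cinner (A u) (phi n) = - of_real (lam n) * cinner u (phi n)"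
proof -
  assume "u \<in> D"
  then have "cinner (A u) (phi n) = cinner u (A (phi n))"
    using self_adjoint phi_D[of n] unfolding self_adjoint_def by metis
  then show ?thesis by (simp add: A_phi cinner_uminus_right cinner_scaleR_right scaleR_conv_of_real)
qed

text \<open>\<open>- J 1 v\<close> satisfies the adjoint relation against every \<open>u\<close> in
  \<open>D\<close>; self-adjointness in graph form then puts \<open>v\<close> into the domain and
  identifies the image.\<close>

lemma A_Hs1:
  assumes v: "v \<in> Hs lam phi 1"
  shows "v \<in> D" "A v = - J 1 v"
proof -
  have "cinner (A u) v = cinner u (- J 1 v)" if u: "u \<in> D" for u
  proof -
    have "cinner (A u) (phi n) * cinner (phi n) v = cinner u (phi n) * cinner (phi n) (- J 1 v)" for n
      using lam_pos[of n]
      by (simp add: A_coeff[OF u] cinner_uminus_right cinner_commute[of "phi n"] J_coeff[OF v])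
    then show ?thesis by (simp only: cinner_eq_suminf[of "A u" v] cinner_eq_suminf[of u "- J 1 v"])
  qed
  then have "v \<in> D \<and> - J 1 v = A v"
    using self_adjoint unfolding self_adjoint_def by blast
  then show "v \<in> D" "A v = - J 1 v" by auto
qed

lemma Hs_mono:
  assumes rs: "r \<le> s" and v: "v \<in> Hs lam phi s"
  shows "v \<in> Hs lam phi r" "Hs_norm lam phi r v \<le> lam 0 powr (r - s) * Hs_norm lam phi s v"
proof -
  have c: "of_real (lam n powr (s - r)) * (of_real (lam n powr r) * x) = of_real (lam n powr s) * (x::complex)" for n x
    using lam_pos[of n] by (simp add: powr_diff)
  have "summable (\<lambda>n. lam 0 powr (2 * (r - s)) * (cmod (of_real (lam n powr s) * cinner v (phi n)))\<^sup>2)"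
    using v unfolding Hs_iff by (rule summable_mult)
  then show r: "v \<in> Hs lam phi r" unfolding Hs_iff
  proof (rule summable_comparison_test'[where N = 0])
    fix n
    have "lam n powr (r - s) \<le> lam 0 powr (r - s)"
      using lam_powr_le[of "s - r" n] rs lam_pos[of 0] le_imp_inverse_le[of "lam 0 powr (s - r)" "lam n powr (s - r)"]
      by (simp add: powr_minus[symmetric])
    then have "lam n powr (r - s) * (lam n powr s * cmod (cinner v (phi n))) \<le>
        lam 0 powr (r - s) * (lam n powr s * cmod (cinner v (phi n)))"
      by (intro mult_right_mono) auto
    moreover have "lam n powr (r - s) * lam n powr s = lam n powr r" by (simp add: powr_add[symmetric])
    ultimately have "cmod (of_real (lam n powr r) * cinner v (phi n)) \<le> lam 0 powr (r - s) * cmod (of_real (lam n powr s) * cinner v (phi n))"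
      by (simp add: norm_mult mult.assoc[symmetric])
    then have "(cmod (of_real (lam n powr r) * cinner v (phi n)))\<^sup>2 \<le> (lam 0 powr (r - s) * cmod (of_real (lam n powr s) * cinner v (phi n)))\<^sup>2"
      by (rule power_mono) simp
    moreover have "(lam 0 powr (r - s))\<^sup>2 = lam 0 powr (2 * (r - s))"
      by (simp add: power2_eq_square powr_add[symmetric])
    ultimately show "norm ((cmod (of_real (lam n powr r) * cinner v (phi n)))\<^sup>2) \<le>
        lam 0 powr (2 * (r - s)) * (cmod (of_real (lam n powr s) * cinner v (phi n)))\<^sup>2"
      by (simp add: power_mult_distrib)
  qed
  \<comment> \<open>Factoring \<open>J s\<close> through \<open>J r\<close> reduces the comparison
    of two norms to the comparison with the norm of the Hilbert space.\<close>
  have J: "J s v = J (s - r) (J r v)" and Jr: "J r v \<in> Hs lam phi (s - r)"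
    using Hs_by_coeff[of "J s v" "s - r" "J r v"] by (simp_all add: J_coeff r v c)
  show "Hs_norm lam phi r v \<le> lam 0 powr (r - s) * Hs_norm lam phi s v"
    using norm_le_Hs_norm[OF _ Jr] rs by (simp add: norm_J[symmetric] r v J Jr)
qed

lemma A_ext_in_dual:
  assumes s: "1 \<le> s"
  shows "A_ext A lam phi s u \<in> Hs_dual lam phi s"
  unfolding A_ext_def
proof (rule Hs_dualI[where C = "norm u * lam 0 powr (1 - s)"])
  fix v assume v: "v \<in> Hs lam phi s"
  note v1 = Hs_mono[OF s v]
  have "cmod (cinner u (A v)) \<le> norm u * norm (A v)" by (rule cinner_Cauchy_Schwarz)
  also have "norm (A v) \<le> lam 0 powr (1 - s) * Hs_norm lam phi s v"
    using v1(2) by (simp add: A_Hs1(2)[OF v1(1)] norm_J[OF v1(1)])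
  finally show "cmod (cinner u (A v)) \<le> norm u * lam 0 powr (1 - s) * Hs_norm lam phi s v"
    by (simp add: mult_left_mono)
  fix c
  show "c *\<^sub>C v \<in> Hs lam phi s \<and> cinner u (A (c *\<^sub>C v)) = cnj c * cinner u (A v)"
    using Hs_scaleC[OF v, of c] Hs_scaleC[OF v1(1), of c] v1(1)
    by (simp add: A_Hs1(2) cinner_uminus_right cinner_scaleC_right)
next
  fix v w assume v: "v \<in> Hs lam phi s" and w: "w \<in> Hs lam phi s"
  show "v + w \<in> Hs lam phi s \<and> cinner u (A (v + w)) = cinner u (A v) + cinner u (A w)"
    using Hs_add[OF v w] Hs_add[OF Hs_mono(1)[OF s v] Hs_mono(1)[OF s w]] Hs_mono(1)[OF s v] Hs_mono(1)[OF s w]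
    by (simp add: A_Hs1(2) cinner_uminus_right cinner_add_right del: minus_add_distrib)
qed

text \<open>The eigenvalues, which could spoil convergence, are transposed onto the test vector,
  where they become coefficients of \<open>A v\<close>.\<close>

lemma dual_series_A:
  assumes s: "1 \<le> s"
  shows "dual_series lam phi s (\<lambda>n. z * of_real (lam n) * cinner u (phi n)) = (\<lambda>v. - z * A_ext A lam phi s u v)"
proof
  fix v
  show "dual_series lam phi s (\<lambda>n. z * of_real (lam n) * cinner u (phi n)) v = - z * A_ext A lam phi s u v"
  proof (cases "v \<in> Hs lam phi s")
    case True
    note v1 = Hs_mono(1)[OF s True]
    have "z * of_real (lam n) * cinner u (phi n) * cinner (phi n) v = - z * (cinner u (phi n) * cinner (phi n) (A v))" for n
      by (simp add: cinner_commute[of "phi n"] A_coeff[OF A_Hs1(1)[OF v1]])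
    moreover have "(\<lambda>n. - z * (cinner u (phi n) * cinner (phi n) (A v))) sums (- z * cinner u (A v))"
      by (rule sums_mult[OF cinner_sums])
    ultimately show ?thesis using True by (simp add: dual_series_def A_ext_def sums_iff)
  qed (simp add: dual_series_def A_ext_def)
qed

lemma A_ext_phi: "A_ext A lam phi s u (phi n) = - of_real (lam n) * cinner u (phi n)"
  by (simp add: A_ext_def phi_Hs A_phi cinner_uminus_right cinner_scaleR_right scaleR_conv_of_real)

end

section \<open>Scaling, two-parameter families of solutions and elementary sums\<close>

section \<open>Solutions and their terminal values\<close>

text \<open>Note that \<open>powr\<close> is even in its base, because \<open>ln x\<close> is \<open>ln \<bar>x\<bar>\<close> for negative \<open>x\<close>.\<close>

lemma mlc_abs: "mlc \<alpha> \<mu> \<bar>t\<bar> = mlc \<alpha> \<mu> t"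
  by (cases "0 \<le> t") (simp_all add: mlc_def powr_def ln_minus)

lemma ml_abs: "ml \<alpha> \<beta> \<mu> \<bar>t\<bar> = ml \<alpha> \<beta> \<mu> t"
  by (cases "0 \<le> t") (simp_all add: ml_def powr_def ln_minus)

text \<open>Together with \<open>ml_scale\<close>, reduces all eigenvalues to a single function
  evaluated at the time rescaled by \<open>kap\<close>.\<close>

lemma mlc_scale:
  assumes "\<alpha> \<noteq> 0" "0 < l" "0 \<le> t"
  shows "mlc \<alpha> (\<mu> * of_real l) t = mlc \<alpha> \<mu> (l powr (1 / \<alpha>) * t)"
  using assms by (simp add: mlc_def powr_mult powr_powr mult.assoc)

lemma ml_scale:
  assumes "\<alpha> \<noteq> 0" "0 < l" "0 \<le> t"
  shows "ml \<alpha> \<beta> \<mu> (l powr (1 / \<alpha>) * t) = (l powr (1 / \<alpha>)) powr (\<beta> - 1) *\<^sub>R ml \<alpha> \<beta> (\<mu> * of_real l) t"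
proof -
  have "(l powr (1 / \<alpha>) * t) powr \<alpha> = l * t powr \<alpha>"
    using assms by (simp add: powr_mult powr_powr)
  moreover have "(l powr (1 / \<alpha>) * t) powr (\<beta> - 1) = (l powr (1 / \<alpha>)) powr (\<beta> - 1) * t powr (\<beta> - 1)"
    using assms by (simp add: powr_mult)
  ultimately show ?thesis by (simp add: ml_def mult.assoc)
qed

lemma i_pow_mult_inverse: "i_pow \<alpha> * i_pow (- \<alpha>) = 1"
  by (simp add: i_pow_def mult_exp_exp)

lemma tderiv_cong:
  assumes "\<And>t. t \<in> {0..T} \<Longrightarrow> f t = g t" "t \<in> {0..T}"
  shows "tderiv T f t = tderiv T g t"
proof -
  have "(f has_vector_derivative v) (at t within {0..T}) \<longleftrightarrow> (g has_vector_derivative v) (at t within {0..T})" for v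
    using assms by (auto intro: has_vector_derivative_transform[rotated 2])
  then show ?thesis by (simp add: tderiv_def vector_derivative_def)
qed

lemma summable_sq_add:
  fixes x y :: "nat \<Rightarrow> real"
  assumes x: "summable (\<lambda>n. (x n)\<^sup>2)" and y: "summable (\<lambda>n. (y n)\<^sup>2)"
  shows "summable (\<lambda>n. (k * (x n + y n))\<^sup>2)"
    and "(\<Sum>n. (k * (x n + y n))\<^sup>2) \<le> 2 * k\<^sup>2 * ((\<Sum>n. (x n)\<^sup>2) + (\<Sum>n. (y n)\<^sup>2))"
proof -
  have le: "(k * (x n + y n))\<^sup>2 \<le> 2 * k\<^sup>2 * ((x n)\<^sup>2 + (y n)\<^sup>2)" for n
  proof -
    have "(x n + y n)\<^sup>2 \<le> 2 * ((x n)\<^sup>2 + (y n)\<^sup>2)"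
      using zero_le_power2[of "x n - y n"] by (simp add: power2_eq_square algebra_simps)
    then have "k\<^sup>2 * (x n + y n)\<^sup>2 \<le> k\<^sup>2 * (2 * ((x n)\<^sup>2 + (y n)\<^sup>2))" by (rule mult_left_mono) simp
    moreover have "k\<^sup>2 * (2 * ((x n)\<^sup>2 + (y n)\<^sup>2)) = 2 * k\<^sup>2 * ((x n)\<^sup>2 + (y n)\<^sup>2)"
      by (simp only: mult_ac)
    ultimately show ?thesis by (simp only: power_mult_distrib)
  qed
  have s: "summable (\<lambda>n. 2 * k\<^sup>2 * ((x n)\<^sup>2 + (y n)\<^sup>2))" by (intro summable_mult summable_add x y)
  show 1: "summable (\<lambda>n. (k * (x n + y n))\<^sup>2)"
    by (rule summable_comparison_test'[OF s, of 0]) (use le in simp)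
  have "(\<Sum>n. (k * (x n + y n))\<^sup>2) \<le> (\<Sum>n. 2 * k\<^sup>2 * ((x n)\<^sup>2 + (y n)\<^sup>2))" by (rule suminf_le[OF le 1 s])
  also have "\<dots> = 2 * k\<^sup>2 * ((\<Sum>n. (x n)\<^sup>2) + (\<Sum>n. (y n)\<^sup>2))"
    using suminf_add[OF x y] suminf_mult[OF summable_add[OF x y], of "2 * k\<^sup>2"] by simp
  finally show "(\<Sum>n. (k * (x n + y n))\<^sup>2) \<le> 2 * k\<^sup>2 * ((\<Sum>n. (x n)\<^sup>2) + (\<Sum>n. (y n)\<^sup>2))" .
qed

section \<open>Coefficient estimates uniform in the eigenvalue\<close>

locale evolution = spectral_scale phi D A lam
  for phi :: "nat \<Rightarrow> 'h::complex_hilbert" and D A lam +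
  fixes \<alpha> T :: real
  assumes lam_infinity: "filterlim lam at_top sequentially"
    and \<alpha>: "1 < \<alpha>" "\<alpha> < 2" and T: "0 < T" and T_Lambda: "T \<notin> Lambda_set lam \<alpha>"
begin

definition mu :: "nat \<Rightarrow> complex" where "mu n = i_pow (- \<alpha>) * of_real (lam n)"
definition kap :: "nat \<Rightarrow> real" where "kap n = lam n powr (1 / \<alpha>)"
text \<open>\<open>ff\<close> and \<open>gg\<close> solve the scalar equation with initial value and
  velocity (1, 0) and (0, 1). As the derivative of \<open>gg\<close> is \<open>ff\<close>, the
  transition matrix at time \<open>T\<close> has rows (\<open>ff\<close>, \<open>gg\<close>) and
  (\<open>f'\<close>, \<open>ff\<close>), with determinant \<open>WW\<close>.\<close>

definition ff :: "nat \<Rightarrow> real \<Rightarrow> complex" where "ff n = mlc \<alpha> (mu n)"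
definition gg :: "nat \<Rightarrow> real \<Rightarrow> complex" where "gg n = ml \<alpha> 2 (mu n)"
definition f' :: "nat \<Rightarrow> real \<Rightarrow> complex" where "f' n t = mu n * ml \<alpha> \<alpha> (mu n) t"
definition WW :: "nat \<Rightarrow> complex" where "WW n = (ff n T)\<^sup>2 - gg n T * f' n T"

lemma kap_pos: "0 < kap n"
  using lam_pos[of n] by (simp add: kap_def)

lemma kap_powr: "kap n powr \<alpha> = lam n"
  using \<alpha> lam_pos[of n] by (simp add: kap_def powr_powr)

lemma kap_ge: "kap 0 \<le> kap n"
  unfolding kap_def using \<alpha> by (intro lam_powr_le) auto

lemma ff_scaled: "0 \<le> t \<Longrightarrow> ff n t = mlc \<alpha> (i_pow (- \<alpha>)) (kap n * t)"
  unfolding ff_def mu_def kap_def using \<alpha> lam_pos by (intro mlc_scale) auto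

lemma gg_scaled: "0 \<le> t \<Longrightarrow> ml \<alpha> 2 (i_pow (- \<alpha>)) (kap n * t) = of_real (kap n) * gg n t"
  unfolding gg_def mu_def kap_def using \<alpha> lam_pos[of n]
  by (simp add: ml_scale scaleR_conv_of_real)

lemma f'_scaled:
  assumes "0 \<le> t"
  shows "f' n t = of_real (kap n) * (i_pow (- \<alpha>) * ml \<alpha> \<alpha> (i_pow (- \<alpha>)) (kap n * t))"
proof -
  have "kap n * kap n powr (\<alpha> - 1) = lam n"
    using kap_pos[of n] by (simp add: powr_mult_base kap_powr)
  then have l: "of_real (lam n) = (of_real (kap n) * of_real (kap n powr (\<alpha> - 1)) :: complex)"
    by (simp flip: of_real_mult)
  have "ml \<alpha> \<alpha> (i_pow (- \<alpha>)) (kap n * t) = of_real (kap n powr (\<alpha> - 1)) * ml \<alpha> \<alpha> (mu n) t"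
    unfolding kap_def mu_def using \<alpha> lam_pos[of n] assms by (simp add: ml_scale scaleR_conv_of_real)
  then have "of_real (kap n) * (i_pow (- \<alpha>) * ml \<alpha> \<alpha> (i_pow (- \<alpha>)) (kap n * t)) =
      i_pow (- \<alpha>) * (of_real (kap n) * of_real (kap n powr (\<alpha> - 1))) * ml \<alpha> \<alpha> (mu n) t"
    by (simp only: mult_ac)
  then show ?thesis by (simp only: f'_def mu_def l)
qed

lemma WW_psi: "WW n = psi \<alpha> (lam n * T powr \<alpha>)"
proof -
  have "T powr \<alpha> = T * T powr (\<alpha> - 1)" using T by (simp add: powr_mult_base)
  then have "of_real (T powr \<alpha>) = (of_real T * of_real (T powr (\<alpha> - 1)) :: complex)" by (simp only: of_real_mult)
  then show ?thesis using T
    by (simp add: WW_def psi_def ff_def gg_def f'_def mlc_def ml_def mu_def scaleR_conv_of_real mult_ac)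
qed

lemma WW_nonzero: "WW n \<noteq> 0"
proof
  assume "WW n = 0"
  then have "lam n * T powr \<alpha> \<in> {t. 0 < t \<and> psi \<alpha> t = 0}" using WW_psi lam_pos[of n] T by simp
  moreover have "T = (lam n * T powr \<alpha> / lam n) powr (1 / \<alpha>)"
    using lam_pos[of n] T \<alpha> by (simp add: powr_powr)
  ultimately show False using T_Lambda unfolding Lambda_set_def by blast
qed

text \<open>In the rescaled time all three functions are bounded; undoing the scaling distributes
  the powers of \<open>kap n\<close>. The product of \<open>gg\<close> and \<open>f'\<close> is free
  of such powers, so the lower bound on the determinant transfers unchanged.\<close>

lemma coeff_bounds:
  obtains b c X where "0 \<le> b" "0 < c" "0 < X"
    "\<And>n t. cmod (ff n t) \<le> b" "\<And>n t. cmod (gg n t) \<le> b / kap n" "\<And>n t. cmod (f' n t) \<le> b * kap n"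
    "\<And>n. X \<le> kap n * T \<Longrightarrow> c * (kap n * T) powr (1 - \<alpha>) \<le> cmod (WW n)"
proof -
  let ?z = "i_pow (- \<alpha>)"
  obtain b c X where cX: "0 < c" "0 < X"
    and b1: "\<And>s. 0 \<le> s \<Longrightarrow> cmod (mlc \<alpha> ?z s) \<le> b" and b2: "\<And>s. 0 \<le> s \<Longrightarrow> cmod (ml \<alpha> 2 ?z s) \<le> b"
    and b3: "\<And>s. 0 \<le> s \<Longrightarrow> cmod (?z * ml \<alpha> \<alpha> ?z s) \<le> b"
    and W: "\<And>s. X \<le> s \<Longrightarrow> c * s powr (1 - \<alpha>) \<le> cmod ((mlc \<alpha> ?z s)\<^sup>2 - ml \<alpha> 2 ?z s * (?z * ml \<alpha> \<alpha> ?z s))"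
    by (rule ml_bounds[OF \<alpha>]) blast
  have k: "0 \<le> kap n * \<bar>t\<bar>" for n t using kap_pos[of n] by simp
  show thesis
  proof (rule that[of b c X])
    show "0 \<le> b" using b1[of 0] norm_ge_zero[of "mlc \<alpha> ?z 0"] by (simp del: norm_ge_zero)
    show "0 < c" "0 < X" by (rule cX)+
    show "cmod (ff n t) \<le> b" for n t
      using b1[OF k[of n t]] ff_scaled[of "\<bar>t\<bar>" n] by (simp add: ff_def mlc_abs)
    show "cmod (gg n t) \<le> b / kap n" for n t
    proof -
      have "kap n * cmod (gg n \<bar>t\<bar>) \<le> b"
        using b2[OF k[of n t]] gg_scaled[of "\<bar>t\<bar>" n] kap_pos[of n] by (simp add: norm_mult)
      then show ?thesis using kap_pos[of n] by (simp add: gg_def ml_abs field_simps)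
    qed
    show "cmod (f' n t) \<le> b * kap n" for n t
    proof -
      have "f' n t = f' n \<bar>t\<bar>" by (simp add: f'_def ml_abs)
      then have "cmod (f' n t) = kap n * cmod (?z * ml \<alpha> \<alpha> ?z (kap n * \<bar>t\<bar>))"
        using f'_scaled[of "\<bar>t\<bar>" n] kap_pos[of n] by (simp add: norm_mult)
      then show ?thesis using mult_left_mono[OF b3[OF k[of n t]], of "kap n"] kap_pos[of n] by (simp add: mult.commute)
    qed
    show "c * (kap n * T) powr (1 - \<alpha>) \<le> cmod (WW n)" if "X \<le> kap n * T" for n
    proof -
      have "ml \<alpha> 2 ?z (kap n * T) * (?z * ml \<alpha> \<alpha> ?z (kap n * T)) = gg n T * f' n T"
        using gg_scaled[of T n] f'_scaled[of T n] T by (simp add: mult_ac)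
      then show ?thesis using W[OF that] ff_scaled[of T n] T by (simp add: WW_def)
    qed
  qed
qed

text \<open>For large \<open>n\<close> the lower bound on \<open>WW\<close> applies, and
  \<open>lam n * kap n powr (1 - \<alpha>) = kap n\<close> matches the size of the entries. Each of
  the remaining finitely many \<open>n\<close> has a finite ratio because
  \<open>WW n \<noteq> 0\<close>.\<close>

lemma inverse_bounds:
  obtains K where "0 < K"
    "\<And>n. cmod (ff n T) + cmod (gg n T) + cmod (f' n T) \<le> K * lam n * cmod (WW n)"
proof -
  obtain b c X where bcX: "0 \<le> b" "0 < c" "0 < X"
    and b: "\<And>n t. cmod (ff n t) \<le> b" "\<And>n t. cmod (gg n t) \<le> b / kap n" "\<And>n t. cmod (f' n t) \<le> b * kap n"
    and W: "\<And>n. X \<le> kap n * T \<Longrightarrow> c * (kap n * T) powr (1 - \<alpha>) \<le> cmod (WW n)"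
    by (rule coeff_bounds) blast
  let ?m = "\<lambda>n. (cmod (ff n T) + cmod (gg n T) + cmod (f' n T)) / (lam n * cmod (WW n))"
  have m0: "0 \<le> ?m n" for n using lam_pos[of n] by simp
  have "eventually (\<lambda>n. (X / T) powr \<alpha> \<le> lam n) sequentially"
    using lam_infinity by (simp add: filterlim_at_top)
  then obtain N where N: "\<forall>n\<ge>N. (X / T) powr \<alpha> \<le> lam n" unfolding eventually_sequentially ..
  \<comment> \<open>Absorbs the sizes \<open>1\<close> and \<open>1 / kap n\<close> of the smaller
    entries into multiples of \<open>kap n\<close>, using \<open>kap 0 \<le> kap n\<close>.\<close>
  define q where "q = 1 / kap 0 + 1 / (kap 0 * kap 0) + 1"
  define K1 where "K1 = b * q / (c * T powr (1 - \<alpha>))"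
  have K1: "cmod (ff n T) + cmod (gg n T) + cmod (f' n T) \<le> K1 * (lam n * cmod (WW n))" if n: "N \<le> n" for n
  proof -
    note k = kap_pos[of n] and k0 = kap_pos[of 0]
    have "((X / T) powr \<alpha>) powr (1 / \<alpha>) \<le> lam n powr (1 / \<alpha>)"
      using N n \<alpha> by (intro powr_mono2) auto
    then have "X / T \<le> kap n" using bcX T \<alpha> by (simp add: powr_powr kap_def)
    then have "X \<le> kap n * T" using T by (simp add: field_simps)
    from W[OF this] have W': "c * (kap n powr (1 - \<alpha>) * T powr (1 - \<alpha>)) \<le> cmod (WW n)"
      using k T by (simp add: powr_mult)
    have l: "lam n * kap n powr (1 - \<alpha>) = kap n"
      using k by (simp add: kap_powr[symmetric] powr_add[symmetric])
    have "1 \<le> kap n * (1 / kap 0)" using kap_ge[of n] k0 by simp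
    moreover have "1 / kap n \<le> kap n * (1 / (kap 0 * kap 0))"
    proof -
      have "kap 0 * kap 0 \<le> kap n * kap n" using kap_ge[of n] k0 by (intro mult_mono) auto
      then show ?thesis using k k0 by (simp add: field_simps)
    qed
    ultimately have "1 + 1 / kap n + kap n \<le> kap n * q" by (simp add: q_def distrib_left)
    then have "b * (1 + 1 / kap n + kap n) \<le> b * (kap n * q)" using bcX by (intro mult_left_mono) auto
    moreover have "cmod (ff n T) + cmod (gg n T) + cmod (f' n T) \<le> b * (1 + 1 / kap n + kap n)"
      using b(1)[of n T] b(2)[of n T] b(3)[of n T] by (simp add: distrib_left)
    ultimately have "cmod (ff n T) + cmod (gg n T) + cmod (f' n T) \<le> b * q * kap n" by (simp add: mult_ac)
    also have "b * q * kap n = K1 * (lam n * (c * (kap n powr (1 - \<alpha>) * T powr (1 - \<alpha>))))"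
    proof -
      have "K1 * (lam n * (c * (kap n powr (1 - \<alpha>) * T powr (1 - \<alpha>)))) =
          (K1 * (c * T powr (1 - \<alpha>))) * (lam n * kap n powr (1 - \<alpha>))" by (simp add: mult_ac)
      also have "K1 * (c * T powr (1 - \<alpha>)) = b * q" using bcX T by (simp add: K1_def)
      finally show ?thesis by (simp only: l)
    qed
    also have "\<dots> \<le> K1 * (lam n * cmod (WW n))"
      using W' lam_pos[of n] bcX k0 T unfolding K1_def q_def
      by (intro mult_left_mono) (auto intro!: divide_nonneg_nonneg mult_nonneg_nonneg add_nonneg_nonneg less_imp_le)
    finally show ?thesis .
  qed
  \<comment> \<open>Dominates both regimes; the sum over the exceptional indices stands in for a
    maximum, and the summand 1 makes it positive.\<close>
  define K where "K = 1 + \<bar>K1\<bar> + (\<Sum>n<N. ?m n)"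
  have s0: "0 \<le> (\<Sum>n<N. ?m n)" by (intro sum_nonneg m0)
  show thesis
  proof (rule that[of K])
    show "0 < K" using s0 by (simp add: K_def)
    fix n
    have lW: "0 < lam n * cmod (WW n)" using lam_pos[of n] WW_nonzero[of n] by simp
    show "cmod (ff n T) + cmod (gg n T) + cmod (f' n T) \<le> K * lam n * cmod (WW n)"
    proof (cases "N \<le> n")
      case True
      have "K1 \<le> K" using s0 by (simp add: K_def)
      then show ?thesis using K1[OF True] mult_right_mono[OF _ less_imp_le[OF lW], of K1 K] by (simp add: mult.assoc)
    next
      case False
      then have "?m n \<le> (\<Sum>n<N. ?m n)" using m0 by (intro member_le_sum) auto
      then have "?m n \<le> K" by (simp add: K_def)
      then have "cmod (ff n T) + cmod (gg n T) + cmod (f' n T) \<le> K * (lam n * cmod (WW n))" using lW by (simp only: pos_divide_le_eq)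
      then show ?thesis by (simp add: mult.assoc)
    qed
  qed
qed

end

context evolution
begin

lemma coeff_facts:
  fixes a b :: complex
  shows "\<And>t. t \<in> {0..T} \<Longrightarrow> tderiv T (\<lambda>t. a * ff n t + b * gg n t) t = a * f' n t + b * ff n t"
    and "regular_coeff T (\<lambda>t. a * ff n t + b * gg n t)"
    and "\<And>t. \<lbrakk>0 < t; t \<le> T\<rbrakk> \<Longrightarrow> caputo T \<alpha> (\<lambda>t. a * ff n t + b * gg n t) t = mu n * (a * ff n t + b * gg n t)"
  using ml_coeff[OF \<alpha> T, where a = a and b = b and \<mu> = "mu n"] by (simp_all add: ff_def gg_def f'_def)

lemma coeff_at_0: "ff n 0 = 1" "gg n 0 = 0" "f' n 0 = 0"
  by (simp_all add: ff_def gg_def f'_def)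

lemma continuous_ff: "continuous_on {0..} (ff n)"
  and continuous_gg: "continuous_on {0..} (gg n)"
  and continuous_f': "continuous_on {0..} (f' n)"
  unfolding ff_def gg_def f'_def using \<alpha>
  by (auto intro!: continuous_intros continuous_on_mlc continuous_on_ml)

definition sol :: "'h \<Rightarrow> 'h \<Rightarrow> real \<Rightarrow> 'h" where
  "sol u0 u1 t = synth (\<lambda>n. cinner u0 (phi n) * ff n t + cinner u1 (phi n) * gg n t)"

text \<open>A majorant independent of time. The extra factor \<open>kap n\<close> for velocities is
  exactly the weight removed by the dual norm of order \<open>1 / \<alpha>\<close>.\<close>

lemma sol_bounds:
  obtains B where "summable (\<lambda>n. (B n)\<^sup>2)"
    "\<And>n t. cmod (cinner u0 (phi n) * ff n t + cinner u1 (phi n) * gg n t) \<le> B n"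
    "\<And>n t. cmod (cinner u0 (phi n) * f' n t + cinner u1 (phi n) * ff n t) \<le> kap n * B n"
proof -
  obtain b where b0: "0 \<le> b"
    and b: "\<And>n t. cmod (ff n t) \<le> b" "\<And>n t. cmod (gg n t) \<le> b / kap n" "\<And>n t. cmod (f' n t) \<le> b * kap n"
    by (rule coeff_bounds) blast
  define Q where "Q = b * (1 + 1 / kap 0)"
  let ?a = "\<lambda>n. cmod (cinner u0 (phi n))" and ?b = "\<lambda>n. cmod (cinner u1 (phi n))"
  have k: "b / kap n \<le> Q" for n
  proof -
    have "b / kap n \<le> b / kap 0" using kap_ge[of n] kap_pos[of 0] b0 by (intro divide_left_mono) (auto simp: kap_pos)
    then show ?thesis using b0 by (simp add: Q_def distrib_left)
  qed
  have bQ: "b \<le> Q" using b0 kap_pos[of 0] by (simp add: Q_def distrib_left)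
  show thesis
  proof (rule that[of "\<lambda>n. Q * (?a n + ?b n)"])
    show "summable (\<lambda>n. (Q * (?a n + ?b n))\<^sup>2)" by (intro summable_sq_add bessel)
    fix n t
    have "cmod (cinner u0 (phi n) * ff n t + cinner u1 (phi n) * gg n t) \<le> ?a n * cmod (ff n t) + ?b n * cmod (gg n t)"
      unfolding norm_mult[symmetric] by (rule norm_triangle_ineq)
    also have "\<dots> \<le> ?a n * Q + ?b n * Q"
      using order_trans[OF b(1) bQ] order_trans[OF b(2) k] by (intro add_mono mult_left_mono) auto
    finally show "cmod (cinner u0 (phi n) * ff n t + cinner u1 (phi n) * gg n t) \<le> Q * (?a n + ?b n)"
      by (simp add: algebra_simps)
    have f: "cmod (f' n t) \<le> kap n * Q"
      using b(3)[of n t] mult_right_mono[OF bQ less_imp_le[OF kap_pos[of n]]] by (simp add: mult.commute)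
    have "b \<le> kap n * Q" using k[of n] kap_pos[of n] by (simp add: field_simps)
    then have g: "cmod (ff n t) \<le> kap n * Q" using b(1)[of n t] by simp
    have "cmod (cinner u0 (phi n) * f' n t + cinner u1 (phi n) * ff n t) \<le> ?a n * cmod (f' n t) + ?b n * cmod (ff n t)"
      unfolding norm_mult[symmetric] by (rule norm_triangle_ineq)
    also have "\<dots> \<le> ?a n * (kap n * Q) + ?b n * (kap n * Q)"
      using f g by (intro add_mono mult_left_mono) auto
    finally show "cmod (cinner u0 (phi n) * f' n t + cinner u1 (phi n) * ff n t) \<le> kap n * (Q * (?a n + ?b n))"
      by (simp add: algebra_simps)
  qed
qed

lemma sol_coeff: "cinner (sol u0 u1 t) (phi n) = cinner u0 (phi n) * ff n t + cinner u1 (phi n) * gg n t"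
proof -
  obtain B where B: "summable (\<lambda>n. (B n)\<^sup>2)"
    "\<And>n t. cmod (cinner u0 (phi n) * ff n t + cinner u1 (phi n) * gg n t) \<le> B n"
    by (rule sol_bounds[of u0 u1]) blast
  show ?thesis unfolding sol_def
  proof (rule cinner_synth, rule summable_comparison_test'[OF B(1), of 0])
    fix n
    show "norm ((cmod (cinner u0 (phi n) * ff n t + cinner u1 (phi n) * gg n t))\<^sup>2) \<le> (B n)\<^sup>2"
      using power_mono[OF B(2) norm_ge_zero, of n t 2] by simp
  qed
qed

lemma continuous_sol: "continuous_on {0..} (sol u0 u1)"
  unfolding continuous_on_def
proof
  fix a :: real assume a: "a \<in> {0..}"
  obtain B where B: "summable (\<lambda>n. (B n)\<^sup>2)"
    "\<And>n t. cmod (cinner u0 (phi n) * ff n t + cinner u1 (phi n) * gg n t) \<le> B n"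
    by (rule sol_bounds[of u0 u1]) blast
  have "((\<lambda>t. \<Sum>n. (cmod ((cinner u0 (phi n) * ff n t + cinner u1 (phi n) * gg n t)
      - (cinner u0 (phi n) * ff n a + cinner u1 (phi n) * gg n a)))\<^sup>2) \<longlongrightarrow> 0) (at a within {0..})"
    by (rule tendsto_sum_sq_diff[OF _ B(2) B(1) a]) (intro continuous_intros continuous_ff continuous_gg)
  then have "((\<lambda>t. (norm (sol u0 u1 t - sol u0 u1 a))\<^sup>2) \<longlongrightarrow> 0) (at a within {0..})"
    unfolding parseval[symmetric] cinner_diff_left sol_coeff .
  then have "((\<lambda>t. sqrt ((norm (sol u0 u1 t - sol u0 u1 a))\<^sup>2)) \<longlongrightarrow> sqrt 0) (at a within {0..})"
    by (rule tendsto_real_sqrt)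
  then have n: "((\<lambda>t. norm (sol u0 u1 t - sol u0 u1 a)) \<longlongrightarrow> 0) (at a within {0..})" by simp
  show "(sol u0 u1 \<longlongrightarrow> sol u0 u1 a) (at a within {0..})"
    by (rule LIM_zero_cancel[OF tendsto_norm_zero_cancel[OF n]])
qed

lemma alpha_le: "1 \<le> 2 / \<alpha>" "0 \<le> 1 / \<alpha>"
  using \<alpha> by auto

lemma kap_weight: "lam n powr (- (1 / \<alpha>)) = 1 / kap n"
  by (simp add: kap_def powr_minus divide_inverse)

text \<open>Supplies the existence part, without which a statement about all weak solutions could be
  vacuous. The equation reduces to \<open>dual_series_A\<close>, and both initial conditions to
  convergence under the majorant.\<close>

lemma sol_weak_solution:
  "weak_solution A lam phi \<alpha> T u0 (dual_embed lam phi (1 / \<alpha>) u1) (sol u0 u1)"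
proof -
  let ?u = "sol u0 u1" and ?a = "\<lambda>n. cinner u0 (phi n)" and ?b = "\<lambda>n. cinner u1 (phi n)"
  obtain B where B: "summable (\<lambda>n. (B n)\<^sup>2)"
    and B': "\<And>n t. cmod (?a n * f' n t + ?b n * ff n t) \<le> kap n * B n"
    by (rule sol_bounds[of u0 u1]) blast
  have kB: "cmod ((?a n * f' n t + ?b n * ff n t) / of_real (kap n)) \<le> B n" for n t
    using B'[of n t] kap_pos[of n] by (simp add: norm_divide pos_divide_le_eq mult.commute)
  have cap: "dt_caputo lam phi (2 / \<alpha>) T \<alpha> ?u t = (\<lambda>v. - i_pow (- \<alpha>) * A_ext A lam phi (2 / \<alpha>) (?u t) v)"
    if t: "t \<in> {0<..<T}" for t
  proof -
    have "dt_caputo lam phi (2 / \<alpha>) T \<alpha> ?u t =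
        dual_series lam phi (2 / \<alpha>) (\<lambda>n. i_pow (- \<alpha>) * of_real (lam n) * cinner (?u t) (phi n))"
      unfolding dt_caputo_def sol_coeff using coeff_facts(3) t by (simp add: mu_def)
    then show ?thesis unfolding dual_series_A[OF alpha_le(1)] .
  qed
  have eq: "dt_caputo lam phi (2 / \<alpha>) T \<alpha> ?u t \<in> Hs_dual lam phi (2 / \<alpha>) \<and>
        A_ext A lam phi (2 / \<alpha>) (?u t) \<in> Hs_dual lam phi (2 / \<alpha>) \<and>
        (\<forall>v\<in>Hs lam phi (2 / \<alpha>).
           i_pow \<alpha> * dt_caputo lam phi (2 / \<alpha>) T \<alpha> ?u t v
             + A_ext A lam phi (2 / \<alpha>) (?u t) v = 0)" if t: "t \<in> {0<..<T}" for t
  proof -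
    have "(\<lambda>v. - i_pow (- \<alpha>) * A_ext A lam phi (2 / \<alpha>) (?u t) v) = A_ext A lam phi (2 / \<alpha>) (cnj (cnj (- i_pow (- \<alpha>))) *\<^sub>C ?u t)"
      by (rule ext) (simp add: A_ext_def cinner_scaleC_left)
    then have "dt_caputo lam phi (2 / \<alpha>) T \<alpha> ?u t \<in> Hs_dual lam phi (2 / \<alpha>)"
      unfolding cap[OF t] using A_ext_in_dual[OF alpha_le(1)] by simp
    moreover have "i_pow \<alpha> * (- i_pow (- \<alpha>) * x) + x = 0" for x
      using i_pow_mult_inverse[of \<alpha>] by (simp add: mult.assoc[symmetric])
    ultimately show ?thesis unfolding cap[OF t] using A_ext_in_dual[OF alpha_le(1)] by simp
  qed
  have td: "tderiv T (\<lambda>r. cinner (?u r) (phi n)) t = ?a n * f' n t + ?b n * ff n t" if "t \<in> {0..T}" for n t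
    unfolding sol_coeff by (rule coeff_facts(1)[OF that])
  have ev: "\<forall>\<^sub>F t in at_right 0. t \<in> {0<..<T}"
    using T eventually_at_right_less[of 0] eventually_at_right_real[of 0 T] by (auto elim: eventually_mono)
  have "sol u0 u1 0 = u0" by (rule coeff_eqI) (simp add: sol_coeff coeff_at_0)
  then have init: "((\<lambda>t. norm (?u t - u0)) \<longlongrightarrow> 0) (at_right 0)"
  proof -
    have "(?u \<longlongrightarrow> ?u 0) (at 0 within {0..})" using continuous_sol by (simp add: continuous_on_def)
    then have "(?u \<longlongrightarrow> ?u 0) (at_right 0)" by (rule tendsto_within_subset) auto
    then show ?thesis using \<open>sol u0 u1 0 = u0\<close> by (simp add: LIM_zero tendsto_norm_zero)
  qed
  have dtv: "dt lam phi (1 / \<alpha>) T ?u t (phi n) = ?a n * f' n t + ?b n * ff n t" if "t \<in> {0..T}" for t n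
    unfolding dt_def dual_series_phi by (rule td[OF that])
  have dt_dual: "dt lam phi (1 / \<alpha>) T ?u t \<in> Hs_dual lam phi (1 / \<alpha>)" if t: "t \<in> {0<..<T}" for t
    unfolding dt_def
  proof (rule dual_series_in_dual, rule summable_comparison_test'[OF B, of 0])
    fix n
    have "lam n powr (- (1 / \<alpha>)) * cmod (tderiv T (\<lambda>r. cinner (?u r) (phi n)) t) =
        cmod ((?a n * f' n t + ?b n * ff n t) / of_real (kap n))"
      using td[of t n] t kap_pos[of n] by (simp add: kap_weight norm_divide)
    then show "norm ((lam n powr (- (1 / \<alpha>)) * cmod (tderiv T (\<lambda>r. cinner (?u r) (phi n)) t))\<^sup>2) \<le> (B n)\<^sup>2"
      using power_mono[OF kB norm_ge_zero, of n t 2] by simp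
  qed
  \<comment> \<open>At time 0 the velocity coefficient is \<open>?b n\<close>, since
    \<open>f' n 0 = 0\<close> and \<open>ff n 0 = 1\<close>; the division by \<open>kap n\<close> is
    the weight of the dual norm.\<close>
  have "((\<lambda>t. \<Sum>n. (cmod ((?a n * f' n t + ?b n * ff n t) / of_real (kap n)
      - (?a n * f' n 0 + ?b n * ff n 0) / of_real (kap n)))\<^sup>2) \<longlongrightarrow> 0) (at 0 within {0..})"
    using kap_pos
    by (intro tendsto_sum_sq_diff[OF _ kB B] continuous_intros continuous_f' continuous_ff) (auto simp: less_imp_neq[symmetric])
  then have "((\<lambda>t. sqrt (\<Sum>n. (cmod ((?a n * f' n t + ?b n * ff n t) / of_real (kap n)
      - (?a n * f' n 0 + ?b n * ff n 0) / of_real (kap n)))\<^sup>2)) \<longlongrightarrow> sqrt 0) (at_right 0)"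
    by (intro tendsto_real_sqrt) (auto elim: tendsto_within_subset)
  moreover have "Hs_dual_norm lam phi (1 / \<alpha>) (\<lambda>v. dt lam phi (1 / \<alpha>) T ?u t v - dual_embed lam phi (1 / \<alpha>) u1 v) =
      sqrt (\<Sum>n. (cmod ((?a n * f' n t + ?b n * ff n t) / of_real (kap n)
      - (?a n * f' n 0 + ?b n * ff n 0) / of_real (kap n)))\<^sup>2)" if t: "t \<in> {0<..<T}" for t
  proof -
    have "lam n powr (- 2 * (1 / \<alpha>)) * (cmod (dt lam phi (1 / \<alpha>) T ?u t (phi n) - dual_embed lam phi (1 / \<alpha>) u1 (phi n)))\<^sup>2 =
      (cmod ((?a n * f' n t + ?b n * ff n t) / of_real (kap n) - (?a n * f' n 0 + ?b n * ff n 0) / of_real (kap n)))\<^sup>2" for n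
    proof -
      have "lam n powr (- 2 * (1 / \<alpha>)) = (1 / kap n)\<^sup>2"
        unfolding kap_weight[symmetric] by (simp add: power2_eq_square powr_add[symmetric])
      moreover have "dt lam phi (1 / \<alpha>) T ?u t (phi n) - dual_embed lam phi (1 / \<alpha>) u1 (phi n) =
          ?a n * f' n t + ?b n * ff n t - ?b n"
        using dtv[of t n] t by (simp add: dual_embed_def phi_Hs)
      ultimately show ?thesis using kap_pos[of n]
        by (simp add: coeff_at_0 diff_divide_distrib[symmetric] norm_divide power_divide)
    qed
    then show ?thesis unfolding Hs_dual_norm_def by simp
  qed
  ultimately have lim: "((\<lambda>t. Hs_dual_norm lam phi (1 / \<alpha>) (\<lambda>v. dt lam phi (1 / \<alpha>) T ?u t v - dual_embed lam phi (1 / \<alpha>) u1 v)) \<longlongrightarrow> 0) (at_right 0)"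
    by (subst tendsto_cong[OF eventually_mono[OF ev]]) auto
  show ?thesis unfolding weak_solution_def
  proof (intro conjI allI)
    show "dual_embed lam phi (1 / \<alpha>) u1 \<in> Hs_dual lam phi (1 / \<alpha>)" by (rule dual_embed_in_dual[OF alpha_le(2)])
    show "regular_coeff T (\<lambda>t. cinner (?u t) (phi n))" for n unfolding sol_coeff by (rule coeff_facts(2))
    show "continuous_on {0..T} ?u" using continuous_sol by (rule continuous_on_subset) auto
    show "\<forall>\<^sub>F t in at_right 0. dt lam phi (1 / \<alpha>) T ?u t \<in> Hs_dual lam phi (1 / \<alpha>)"
      using ev dt_dual by (auto elim: eventually_mono)
  qed (use eq init lim in auto)
qed

text \<open>Testing the equation with \<open>phi n\<close> isolates one coefficient. Its initial
  value and velocity are read off from the limits at 0, and uniqueness for the scalar equation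
  identifies it.\<close>

lemma weak_solution_coeff:
  assumes w: "weak_solution A lam phi \<alpha> T u0 (dual_embed lam phi (1 / \<alpha>) u1) u" and t: "t \<in> {0..T}"
  shows "cinner (u t) (phi n) = cinner u0 (phi n) * ff n t + cinner u1 (phi n) * gg n t"
    and "tderiv T (\<lambda>r. cinner (u r) (phi n)) t = cinner u0 (phi n) * f' n t + cinner u1 (phi n) * ff n t"
proof -
  let ?c = "\<lambda>t. cinner (u t) (phi n)" and ?a = "cinner u0 (phi n)" and ?b = "cinner u1 (phi n)"
  have reg: "regular_coeff T ?c" and uc: "continuous_on {0..T} u"
    and ae: "AE t in lebesgue. t \<in> {0<..<T} \<longrightarrow> (\<forall>v\<in>Hs lam phi (2 / \<alpha>).
           i_pow \<alpha> * dt_caputo lam phi (2 / \<alpha>) T \<alpha> u t v + A_ext A lam phi (2 / \<alpha>) (u t) v = 0)"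
    and u0: "((\<lambda>t. norm (u t - u0)) \<longlongrightarrow> 0) (at_right 0)"
    and ev: "\<forall>\<^sub>F t in at_right 0. dt lam phi (1 / \<alpha>) T u t \<in> Hs_dual lam phi (1 / \<alpha>)"
    and u1: "((\<lambda>t. Hs_dual_norm lam phi (1 / \<alpha>) (\<lambda>v. dt lam phi (1 / \<alpha>) T u t v - dual_embed lam phi (1 / \<alpha>) u1 v)) \<longlongrightarrow> 0) (at_right 0)"
    using w unfolding weak_solution_def by (auto elim: eventually_mono)
  have right: "at_right 0 \<le> at 0 within {0..T}" using T by (simp add: at_within_Icc_at_right)
  have nz: "at_right (0::real) \<noteq> bot" by simp
  have "AE t in lebesgue. t \<in> {0<..<T} \<longrightarrow> caputo T \<alpha> ?c t = mu n * ?c t"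
    using ae
  proof eventually_elim
    case (elim t)
    show ?case
    proof
      assume "t \<in> {0<..<T}"
      then have "i_pow \<alpha> * caputo T \<alpha> ?c t = of_real (lam n) * ?c t"
        using elim phi_Hs[of n "2 / \<alpha>"] by (auto simp: dt_caputo_def dual_series_phi A_ext_phi)
      then have "i_pow (- \<alpha>) * (i_pow \<alpha> * caputo T \<alpha> ?c t) = mu n * ?c t" by (simp add: mu_def)
      then show "caputo T \<alpha> ?c t = mu n * ?c t"
        using i_pow_mult_inverse[of \<alpha>] by (simp add: mult.assoc[symmetric] mult.commute[of "i_pow (- \<alpha>)"])
    qed
  qed
  moreover have "AE t in lebesgue. t \<in> {0<..<T} \<longrightarrow> caputo T \<alpha> (\<lambda>t. ?a * ff n t + ?b * gg n t) t = mu n * (?a * ff n t + ?b * gg n t)"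
    using coeff_facts(3) by (intro AE_I2) auto
  moreover have "?c 0 = ?a * ff n 0 + ?b * gg n 0"
  proof -
    have r: "(u \<longlongrightarrow> u0) (at_right 0)" by (rule LIM_zero_cancel[OF tendsto_norm_zero_cancel[OF u0]])
    have "(u \<longlongrightarrow> u 0) (at_right 0)"
      using uc T by (intro tendsto_mono[OF right]) (simp add: continuous_on_def)
    then have "u 0 = u0" using r by (rule tendsto_unique[OF nz])
    then show ?thesis by (simp add: coeff_at_0)
  qed
  moreover have "tderiv T ?c 0 = tderiv T (\<lambda>t. ?a * ff n t + ?b * gg n t) 0"
  proof -
    have l: "((\<lambda>t. tderiv T ?c t) \<longlongrightarrow> tderiv T ?c 0) (at_right 0)"
      using reg T by (intro tendsto_mono[OF right]) (simp add: regular_coeff_def continuous_on_def)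
    have "((\<lambda>t. tderiv T ?c t - ?b) \<longlongrightarrow> 0) (at_right 0)"
    proof (rule Lim_null_comparison)
      show "((\<lambda>t. kap n * Hs_dual_norm lam phi (1 / \<alpha>) (\<lambda>v. dt lam phi (1 / \<alpha>) T u t v - dual_embed lam phi (1 / \<alpha>) u1 v)) \<longlongrightarrow> 0) (at_right 0)"
        using tendsto_mult_left[OF u1, of "kap n"] by simp
      show "\<forall>\<^sub>F t in at_right 0. norm (tderiv T ?c t - ?b) \<le> kap n * Hs_dual_norm lam phi (1 / \<alpha>) (\<lambda>v. dt lam phi (1 / \<alpha>) T u t v - dual_embed lam phi (1 / \<alpha>) u1 v)"
        using ev
      proof eventually_elim
        case (elim t)
        let ?f = "\<lambda>v. dt lam phi (1 / \<alpha>) T u t v - dual_embed lam phi (1 / \<alpha>) u1 v"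
        have "?f \<in> Hs_dual lam phi (1 / \<alpha>)" by (rule Hs_dual_diff[OF elim dual_embed_in_dual[OF alpha_le(2)]])
        \<comment> \<open>A single term is bounded by the dual norm only if the defining series
          converges; this is where membership of the velocity in the dual near time 0
          enters.\<close>
        then have S: "summable (\<lambda>m. lam m powr (- 2 * (1 / \<alpha>)) * (cmod (?f (phi m)))\<^sup>2)" by (rule Hs_dual_coeff_summable)
        have fn: "?f (phi n) = tderiv T ?c t - ?b"
          by (simp add: dt_def dual_series_phi dual_embed_def phi_Hs)
        have "lam n powr (- 2 * (1 / \<alpha>)) = (1 / kap n)\<^sup>2"
          unfolding kap_weight[symmetric] by (simp add: power2_eq_square powr_add[symmetric])
        then have "(cmod (tderiv T ?c t - ?b) / kap n)\<^sup>2 = lam n powr (- 2 * (1 / \<alpha>)) * (cmod (?f (phi n)))\<^sup>2"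
          unfolding fn by (simp add: power_divide)
        also have "\<dots> = sum (\<lambda>m. lam m powr (- 2 * (1 / \<alpha>)) * (cmod (?f (phi m)))\<^sup>2) {n}" by simp
        also have "\<dots> \<le> (\<Sum>m. lam m powr (- 2 * (1 / \<alpha>)) * (cmod (?f (phi m)))\<^sup>2)"
          using S by (intro sum_le_suminf) auto
        finally have "cmod (tderiv T ?c t - ?b) / kap n \<le> Hs_dual_norm lam phi (1 / \<alpha>) ?f"
          unfolding Hs_dual_norm_def by (rule real_le_rsqrt)
        then show ?case using kap_pos[of n] by (simp add: field_simps)
      qed
    qed
    then have "((\<lambda>t. tderiv T ?c t) \<longlongrightarrow> ?b) (at_right 0)" by (rule LIM_zero_cancel)
    with l have "tderiv T ?c 0 = ?b" by (rule tendsto_unique[OF nz])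
    then show ?thesis using coeff_facts(1)[of 0] T by (simp add: coeff_at_0)
  qed
  ultimately have eq: "?c t = ?a * ff n t + ?b * gg n t" if "t \<in> {0..T}" for t
    using caputo_unique[OF \<alpha> T reg coeff_facts(2), where t = t] that by simp
  show "?c t = ?a * ff n t + ?b * gg n t" by (rule eq[OF t])
  show "tderiv T ?c t = ?a * f' n t + ?b * ff n t"
    using tderiv_cong[OF eq t] coeff_facts(1)[OF t] by simp
qed

end

section \<open>The terminal value problem\<close>

text \<open>Cramer's rule for the matrix with rows (f, g) and (f', f).\<close>

lemma wronskian_solve:
  fixes f g f' u v W :: complex
  assumes "W \<noteq> 0" "W = f\<^sup>2 - g * f'"
  shows "(f * u - g * v) / W * f + (f * v - f' * u) / W * g = u"
    and "(f * u - g * v) / W * f' + (f * v - f' * u) / W * f = v"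
proof -
  have "(f * u - g * v) * f + (f * v - f' * u) * g = u * W" "(f * u - g * v) * f' + (f * v - f' * u) * f = v * W"
    unfolding assms(2) by (simp_all add: power2_eq_square algebra_simps)
  then show "(f * u - g * v) / W * f + (f * v - f' * u) / W * g = u"
    "(f * u - g * v) / W * f' + (f * v - f' * u) / W * f = v"
    using assms(1) by (simp_all add: add_divide_distrib[symmetric])
qed

text \<open>By Cramer's rule each unknown times \<open>W\<close> is a combination of
  \<open>u\<close> and \<open>v\<close> with matrix entries as coefficients, and every entry is at
  most \<open>K * cmod W\<close>.\<close>

lemma wronskian_bound:
  fixes a b f g f' u v W :: complex
  assumes u: "u = a * f + b * g" and v: "v = a * f' + b * f" and W: "W = f\<^sup>2 - g * f'" "W \<noteq> 0"
    and K: "cmod f + cmod g + cmod f' \<le> K * cmod W"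
  shows "cmod a \<le> K * (cmod u + cmod v)" "cmod b \<le> K * (cmod u + cmod v)"
proof -
  have main: "cmod c \<le> K * (cmod u + cmod v)"
    if c: "c * W = p * u - q * v" and p: "cmod p \<le> cmod f + cmod g + cmod f'" and q: "cmod q \<le> cmod f + cmod g + cmod f'"
    for c p q
  proof -
    have "cmod c * cmod W \<le> cmod p * cmod u + cmod q * cmod v"
      using norm_triangle_ineq4[of "p * u" "q * v"] by (simp add: norm_mult[symmetric] c)
    also have "\<dots> \<le> (K * cmod W) * cmod u + (K * cmod W) * cmod v"
      using order_trans[OF p K] order_trans[OF q K] by (intro add_mono mult_right_mono) auto
    also have "\<dots> = (K * (cmod u + cmod v)) * cmod W" by (simp add: algebra_simps)
    finally show ?thesis using W(2) by simp
  qed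
  show "cmod a \<le> K * (cmod u + cmod v)"
    by (rule main[of a f g]) (auto simp: u v W(1) power2_eq_square algebra_simps)
  show "cmod b \<le> K * (cmod u + cmod v)"
    by (rule main[of b "- f'" "- f"]) (auto simp: u v W(1) power2_eq_square algebra_simps)
qed

context evolution
begin

lemma Hs1_weight: "lam n powr (2 * 1) * (cmod x)\<^sup>2 = (lam n * cmod x)\<^sup>2"
  using weight_sq[of n 1 x] lam_pos[of n] by (simp add: norm_mult)

text \<open>The factor \<open>lam n\<close> lost in the inversion is charged to the terminal data,
  where it builds the norm of order 1. The summability serves the construction of initial data, the
  inequality serves the estimate.\<close>

lemma terminal_data_estimate:
  obtains K where "0 < K"
    "\<And>a b uT vT. \<lbrakk>uT \<in> Hs lam phi 1; vT \<in> Hs lam phi 1;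
        \<And>n. cinner uT (phi n) = a n * ff n T + b n * gg n T; \<And>n. cinner vT (phi n) = a n * f' n T + b n * ff n T\<rbrakk>
      \<Longrightarrow> summable (\<lambda>n. (cmod (a n))\<^sup>2) \<and> summable (\<lambda>n. (cmod (b n))\<^sup>2) \<and>
         (\<Sum>n. (cmod (a n))\<^sup>2) \<le> (K * (Hs_norm lam phi 1 uT + Hs_norm lam phi 1 vT))\<^sup>2 \<and>
         (\<Sum>n. (cmod (b n))\<^sup>2) \<le> (K * (Hs_norm lam phi 1 uT + Hs_norm lam phi 1 vT))\<^sup>2"
proof -
  obtain K where K0: "0 < K" and K: "\<And>n. cmod (ff n T) + cmod (gg n T) + cmod (f' n T) \<le> K * lam n * cmod (WW n)"
    by (rule inverse_bounds) blast
  show thesis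
  proof (rule that[of "2 * K"])
    show "0 < 2 * K" using K0 by simp
    fix a b uT vT
    assume uT: "uT \<in> Hs lam phi 1" and vT: "vT \<in> Hs lam phi 1"
      and u: "\<And>n. cinner uT (phi n) = a n * ff n T + b n * gg n T"
      and v: "\<And>n. cinner vT (phi n) = a n * f' n T + b n * ff n T"
    let ?x = "\<lambda>n. lam n * cmod (cinner uT (phi n))" and ?y = "\<lambda>n. lam n * cmod (cinner vT (phi n))"
    let ?U = "Hs_norm lam phi 1 uT" and ?V = "Hs_norm lam phi 1 vT"
    have x: "summable (\<lambda>n. (?x n)\<^sup>2)" and y: "summable (\<lambda>n. (?y n)\<^sup>2)"
      using uT vT by (simp_all only: Hs_def Hs1_weight mem_Collect_eq)
    have U: "?U\<^sup>2 = (\<Sum>n. (?x n)\<^sup>2)" and V: "?V\<^sup>2 = (\<Sum>n. (?y n)\<^sup>2)"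
      using suminf_nonneg[OF x] suminf_nonneg[OF y] unfolding Hs_norm_def Hs1_weight by simp_all
    have UV: "0 \<le> ?U" "0 \<le> ?V" using norm_J[OF uT] norm_J[OF vT] by (metis norm_ge_zero)+
    have conc: "summable (\<lambda>n. (cmod (d n))\<^sup>2) \<and> (\<Sum>n. (cmod (d n))\<^sup>2) \<le> (2 * K * (?U + ?V))\<^sup>2"
      if d: "\<And>n. cmod (d n) \<le> K * (?x n + ?y n)" for d
    proof -
      have le: "(cmod (d n))\<^sup>2 \<le> (K * (?x n + ?y n))\<^sup>2" for n using d by (rule power_mono) simp
      have s: "summable (\<lambda>n. (cmod (d n))\<^sup>2)"
        by (rule summable_comparison_test'[OF summable_sq_add(1)[OF x y, of K], of 0]) (use le in simp)
      have "(\<Sum>n. (cmod (d n))\<^sup>2) \<le> 2 * K\<^sup>2 * (?U\<^sup>2 + ?V\<^sup>2)"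
        unfolding U V by (rule order_trans[OF suminf_le[OF le s summable_sq_add(1)[OF x y]] summable_sq_add(2)[OF x y]])
      \<comment> \<open>The generous factor 2 makes the bound a perfect square; hence the constant
        \<open>2 * K\<close>.\<close>
      also have "\<dots> \<le> 2 * K\<^sup>2 * (2 * (?U + ?V)\<^sup>2)"
        using UV by (intro mult_left_mono) (auto simp: power2_eq_square algebra_simps intro!: add_nonneg_nonneg mult_nonneg_nonneg)
      also have "\<dots> = (2 * K * (?U + ?V))\<^sup>2" by (simp add: power_mult_distrib)
      finally show ?thesis using s by simp
    qed
    have K': "cmod (ff n T) + cmod (gg n T) + cmod (f' n T) \<le> (K * lam n) * cmod (WW n)" for n by (rule K)
    have "cmod (a n) \<le> K * (?x n + ?y n)" "cmod (b n) \<le> K * (?x n + ?y n)" for n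
      using wronskian_bound[OF u[of n] v[of n] WW_def WW_nonzero K'] by (simp_all add: algebra_simps)
    then show "summable (\<lambda>n. (cmod (a n))\<^sup>2) \<and> summable (\<lambda>n. (cmod (b n))\<^sup>2) \<and>
         (\<Sum>n. (cmod (a n))\<^sup>2) \<le> (2 * K * (?U + ?V))\<^sup>2 \<and> (\<Sum>n. (cmod (b n))\<^sup>2) \<le> (2 * K * (?U + ?V))\<^sup>2"
      using conc[of a] conc[of b] by blast
  qed
qed

lemma backward_existence:
  assumes uT: "uT \<in> Hs lam phi 1" and vT: "vT \<in> Hs lam phi 1"
  obtains u0 u1 where
    "\<And>u. weak_solution A lam phi \<alpha> T u0 (dual_embed lam phi (1 / \<alpha>) u1) u \<Longrightarrow>
       u T = uT \<and> dt lam phi (1 / \<alpha>) T u T = dual_embed lam phi (1 / \<alpha>) vT"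
proof -
  let ?u = "\<lambda>n. cinner uT (phi n)" and ?v = "\<lambda>n. cinner vT (phi n)"
  define a where "a n = (ff n T * ?u n - gg n T * ?v n) / WW n" for n
  define b where "b n = (ff n T * ?v n - f' n T * ?u n) / WW n" for n
  have u: "?u n = a n * ff n T + b n * gg n T" and v: "?v n = a n * f' n T + b n * ff n T" for n
    unfolding a_def b_def wronskian_solve[OF WW_nonzero WW_def] by (rule refl)+
  have s: "summable (\<lambda>n. (cmod (a n))\<^sup>2)" "summable (\<lambda>n. (cmod (b n))\<^sup>2)"
    by (rule terminal_data_estimate, use uT vT u v in blast)+
  have Tm: "T \<in> {0..T}" using T by simp
  show thesis
  proof (rule that[of "synth a" "synth b"])
    fix w assume w: "weak_solution A lam phi \<alpha> T (synth a) (dual_embed lam phi (1 / \<alpha>) (synth b)) w"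
    have "w T = uT"
      by (rule coeff_eqI) (simp only: weak_solution_coeff(1)[OF w Tm] cinner_synth[OF s(1)] cinner_synth[OF s(2)] u[symmetric])
    moreover have "tderiv T (\<lambda>r. cinner (w r) (phi n)) T = ?v n" for n
      by (simp only: weak_solution_coeff(2)[OF w Tm] cinner_synth[OF s(1)] cinner_synth[OF s(2)] v[symmetric])
    ultimately show "w T = uT \<and> dt lam phi (1 / \<alpha>) T w T = dual_embed lam phi (1 / \<alpha>) vT"
      by (simp add: dt_def dual_series_coeff)
  qed
qed

lemma backward_estimate:
  obtains C where "0 < C"
    "\<And>uT vT u0 u1 u. \<lbrakk>uT \<in> Hs lam phi 1; vT \<in> Hs lam phi 1;
        weak_solution A lam phi \<alpha> T u0 (dual_embed lam phi (1 / \<alpha>) u1) u; u T = uT;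
        dt lam phi (1 / \<alpha>) T u T = dual_embed lam phi (1 / \<alpha>) vT\<rbrakk>
      \<Longrightarrow> norm u0 + norm u1 \<le> C * (Hs_norm lam phi 1 uT + Hs_norm lam phi 1 vT)"
proof -
  obtain K where K0: "0 < K" and K: "\<And>a b uT vT. \<lbrakk>uT \<in> Hs lam phi 1; vT \<in> Hs lam phi 1;
        \<And>n. cinner uT (phi n) = a n * ff n T + b n * gg n T; \<And>n. cinner vT (phi n) = a n * f' n T + b n * ff n T\<rbrakk>
      \<Longrightarrow> summable (\<lambda>n. (cmod (a n))\<^sup>2) \<and> summable (\<lambda>n. (cmod (b n))\<^sup>2) \<and>
         (\<Sum>n. (cmod (a n))\<^sup>2) \<le> (K * (Hs_norm lam phi 1 uT + Hs_norm lam phi 1 vT))\<^sup>2 \<and>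
         (\<Sum>n. (cmod (b n))\<^sup>2) \<le> (K * (Hs_norm lam phi 1 uT + Hs_norm lam phi 1 vT))\<^sup>2"
    by (rule terminal_data_estimate) blast
  show thesis
  proof (rule that[of "2 * K"])
    show "0 < 2 * K" using K0 by simp
    fix uT vT u0 u1 u
    assume uT: "uT \<in> Hs lam phi 1" and vT: "vT \<in> Hs lam phi 1"
      and w: "weak_solution A lam phi \<alpha> T u0 (dual_embed lam phi (1 / \<alpha>) u1) u"
      and uu: "u T = uT" and vv: "dt lam phi (1 / \<alpha>) T u T = dual_embed lam phi (1 / \<alpha>) vT"
    have Tm: "T \<in> {0..T}" using T by simp
    let ?H = "Hs_norm lam phi 1 uT + Hs_norm lam phi 1 vT"
    have u: "cinner uT (phi n) = cinner u0 (phi n) * ff n T + cinner u1 (phi n) * gg n T" for n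
      using weak_solution_coeff(1)[OF w Tm, of n] uu by simp
    have v: "cinner vT (phi n) = cinner u0 (phi n) * f' n T + cinner u1 (phi n) * ff n T" for n
    proof -
      \<comment> \<open>Evaluating the identity of functionals at \<open>phi n\<close> recovers the
        single velocity coefficient.\<close>
      have "dt lam phi (1 / \<alpha>) T u T (phi n) = cinner vT (phi n)" unfolding vv by (simp add: dual_embed_def phi_Hs)
      then show ?thesis using weak_solution_coeff(2)[OF w Tm, of n] by (simp add: dt_def dual_series_phi)
    qed
    have H: "(norm u0)\<^sup>2 \<le> (K * ?H)\<^sup>2" "(norm u1)\<^sup>2 \<le> (K * ?H)\<^sup>2"
      using K[OF uT vT u v] by (simp_all only: parseval)
    have "0 \<le> ?H" unfolding norm_J[OF uT, symmetric] norm_J[OF vT, symmetric] by simp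
    then have "0 \<le> K * ?H" using K0 by simp
    then have "norm u0 \<le> K * ?H" "norm u1 \<le> K * ?H" using H by (auto intro: power2_le_imp_le)
    then show "norm u0 + norm u1 \<le> 2 * K * ?H" by simp
  qed
qed

end

text \<open>The velocity at time \<open>T\<close> is a priori an element of the dual space of order
  \<open>1 / \<alpha>\<close>, so it is compared with the image of \<open>vT\<close> there.
  Existence of a weak solution is asserted beside the claim on all of them.\<close>

theorem theorem4p13:
  fixes D :: "'h::complex_hilbert set" and A :: "'h \<Rightarrow> 'h"
    and lam :: "nat \<Rightarrow> real" and phi :: "nat \<Rightarrow> 'h"
    and \<alpha> T :: real
  assumes "self_adjoint D A" and "negative_definite D A" and "compact_resolvent D A"
    and "eigenbasis D A lam phi"
    and "1 < \<alpha>" and "\<alpha> < 2" and "0 < T"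
    and "T \<notin> Lambda_set lam \<alpha>"
  shows
    "(\<forall>uT\<in>Hs lam phi 1. \<forall>vT\<in>Hs lam phi 1. \<exists>u0 u1.
        (\<exists>u. weak_solution A lam phi \<alpha> T u0 (dual_embed lam phi (1 / \<alpha>) u1) u) \<and>
        (\<forall>u. weak_solution A lam phi \<alpha> T u0 (dual_embed lam phi (1 / \<alpha>) u1) u \<longrightarrow>
           u T = uT \<and> dt lam phi (1 / \<alpha>) T u T = dual_embed lam phi (1 / \<alpha>) vT)) \<and>
     (\<exists>C>0. \<forall>uT\<in>Hs lam phi 1. \<forall>vT\<in>Hs lam phi 1. \<forall>u0 u1 u.
        weak_solution A lam phi \<alpha> T u0 (dual_embed lam phi (1 / \<alpha>) u1) u \<and>
        u T = uT \<and> dt lam phi (1 / \<alpha>) T u T = dual_embed lam phi (1 / \<alpha>) vT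
        \<longrightarrow> norm u0 + norm u1 \<le> C * (Hs_norm lam phi 1 uT + Hs_norm lam phi 1 vT))"
proof -
  have e: "\<And>n. 0 < lam n" "mono lam" "filterlim lam at_top sequentially" "\<And>n. phi n \<in> D"
    "\<And>n. - A (phi n) = lam n *\<^sub>R phi n" "\<And>m n. cinner (phi m) (phi n) = (if m = n then 1 else 0)"
    "closure (csubspace hull range phi) = UNIV"
    using \<open>eigenbasis D A lam phi\<close> unfolding eigenbasis_def by blast+
  have A_phi: "A (phi n) = - (lam n *\<^sub>R phi n)" for n using e(5)[of n] by (metis minus_minus)
  interpret evolution where phi = phi and D = D and A = A and lam = lam and \<alpha> = \<alpha> and T = T
    by unfold_locales (use e A_phi assms in auto)
  show ?thesis
  proof (intro conjI ballI)
    fix uT vT assume uT: "uT \<in> Hs lam phi 1" and vT: "vT \<in> Hs lam phi 1"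
    show "\<exists>u0 u1. (\<exists>u. weak_solution A lam phi \<alpha> T u0 (dual_embed lam phi (1 / \<alpha>) u1) u) \<and>
        (\<forall>u. weak_solution A lam phi \<alpha> T u0 (dual_embed lam phi (1 / \<alpha>) u1) u \<longrightarrow>
           u T = uT \<and> dt lam phi (1 / \<alpha>) T u T = dual_embed lam phi (1 / \<alpha>) vT)"
      by (rule backward_existence[OF uT vT]) (use sol_weak_solution in blast)
  next
    obtain C where C: "0 < C"
      "\<And>uT vT u0 u1 u. \<lbrakk>uT \<in> Hs lam phi 1; vT \<in> Hs lam phi 1;
        weak_solution A lam phi \<alpha> T u0 (dual_embed lam phi (1 / \<alpha>) u1) u; u T = uT;
        dt lam phi (1 / \<alpha>) T u T = dual_embed lam phi (1 / \<alpha>) vT\<rbrakk>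
      \<Longrightarrow> norm u0 + norm u1 \<le> C * (Hs_norm lam phi 1 uT + Hs_norm lam phi 1 vT)"
      by (rule backward_estimate) blast
    show "\<exists>C>0. \<forall>uT\<in>Hs lam phi 1. \<forall>vT\<in>Hs lam phi 1. \<forall>u0 u1 u.
        weak_solution A lam phi \<alpha> T u0 (dual_embed lam phi (1 / \<alpha>) u1) u \<and>
        u T = uT \<and> dt lam phi (1 / \<alpha>) T u T = dual_embed lam phi (1 / \<alpha>) vT
        \<longrightarrow> norm u0 + norm u1 \<le> C * (Hs_norm lam phi 1 uT + Hs_norm lam phi 1 vT)"
    proof (intro exI[of _ C] conjI ballI allI impI)
      fix uT vT u0 u1 u
      assume "uT \<in> Hs lam phi 1" "vT \<in> Hs lam phi 1"
        and h: "weak_solution A lam phi \<alpha> T u0 (dual_embed lam phi (1 / \<alpha>) u1) u \<and>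
        u T = uT \<and> dt lam phi (1 / \<alpha>) T u T = dual_embed lam phi (1 / \<alpha>) vT"
      then show "norm u0 + norm u1 \<le> C * (Hs_norm lam phi 1 uT + Hs_norm lam phi 1 vT)"
        by (elim conjE) (rule C(2))
    qed (rule C(1))
  qed
qed

end
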